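(* Consider the high-dimensional linear model with latent factor design, the Lasso, the IPAD procedure with the LCD (Lasso coefficient difference) knockoff statistics, and Conditions 1--5 and 7--8, all as described in the context, with $\gamma\in(0,1]$ the constant of Condition 7. Fix an arbitrary constant $\nu>0$. Suppose that Conditions 1--5 and 7--8 hold and that $(s,k,n,p)$ satisfies $2s\le k\le n\wedge p$, $c_{np}\le c/(r^2M^2C(\nu+2))^{1/2}$, and $sk^{1/2}\tilde c_{np}\to0$ as $n\wedge p\to\infty$, where $c,C$ are the positive constants specified in the context. Then both the Lasso procedure based on $(\mathbf X,\mathbf y)$ and the IPAD procedure have power bounded from below by $\gamma-o(1)$ as $n\wedge p\to\infty$; that is, $\mathbb E[|\widehat{\mathcal S}\cap\mathcal S^0|/s]\ge\gamma-o(1)$ both when $\widehat{\mathcal S}$ is the set selected by the Lasso and when $\widehat{\mathcal S}$ is the set selected by IPAD. In particular, if $\gamma=1$, IPAD has no power loss compared to the Lasso asymptotically.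
   Context: **Asymptotics and notation.** $a\wedge b=\min(a,b)$, $a\vee b=\max(a,b)$. Asymptotics are as $n\wedge p\to\infty$; $s,k$, $\boldsymbol\beta$ and the loadings may vary with $(n,p)$; $r,m$, and the constants $M>1$ (a large enough generic constant), $C_\varepsilon,C_e,c_e$, etc. are fixed. $\|\cdot\|_1,\|\cdot\|_2$ are vector $\ell_1,\ell_2$ norms, $\|\cdot\|_{\max}$ is the largest absolute entry of a vector or matrix, and $\|\cdot\|_2$ of a matrix is the spectral norm. $X\sim\mathrm{subG}(C_x^2)$ means $\mathbb E X=0$ and $\mathbb P(|X|>u)\le 2\exp(-u^2/C_x^2)$ for all $u\ge 0$. Put $c_{np}=(p^{-1}\log n)^{1/2}+(n^{-1}\log p)^{1/2}$ and $\tilde c_{np}=p^{-1/2}\log n+n^{-1/2}\log p$. For a set $\mathcal A$, $\boldsymbol\beta_{\mathcal A}$ is the subvector of $\boldsymbol\beta$ indexed by $\mathcal A$. **Model.** $\mathbf y=\mathbf X\boldsymbol\beta+\boldsymbol\varepsilon$ with $\mathbf y,\boldsymbol\varepsilon\in\mathbb R^n$, $\mathbf X\in\mathbb R^{n\times p}$ random, $\boldsymbol\beta\in\mathbb R^p$ deterministic; and $\mathbf X=\mathbf F^0{\boldsymbol\Lambda^0}'+\mathbf E=\mathbf C^0+\mathbf E$, with $\mathbf F^0\in\mathbb R^{n\times r}$ random with rows $\mathbf f_i^0$ and entries $f^0_{ik}$, $\boldsymbol\Lambda^0\in\mathbb R^{p\times r}$ deterministic with rows $\boldsymbol\lambda_j^0$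 and entries $\lambda^0_{jk}$, and $\mathbf E=(e_{ij})\in\mathbb R^{n\times p}$ with i.i.d. entries with distribution function $G(\cdot;\boldsymbol\eta^0)$, $\boldsymbol\eta^0\in\mathbb R^m$. The number of factors $r$ is fixed and treated as known. There is no endogeneity: $\boldsymbol\varepsilon$, $\mathbf F^0$, $\mathbf E$ are mutually independent. $\mathcal S^0=\{j:\beta_j\ne0\}$, $\mathcal S^1=\{1,\dots,p\}\setminus\mathcal S^0$, $s=|\mathcal S^0|=o(n)$. **Condition 1.** $\boldsymbol\varepsilon$ has i.i.d. components from $\mathrm{subG}(C_\varepsilon^2)$. **Condition 2.** The rows $\mathbf f_i^0$ are mean zero i.i.d. with $\|\mathbf F^0\|_{\max}\le M$ a.s. and $\|\boldsymbol\Sigma_f\|_2+\|\boldsymbol\Sigma_f^{-1}\|_2\le M$, where $\boldsymbol\Sigma_f=\mathbb E[\mathbf f_i^0{\mathbf f_i^0}']$. **Condition 3.** $\|\boldsymbol\Lambda^0\|_{\max}\le M$ and $\|p^{-1}{\boldsymbol\Lambda^0}'\boldsymbol\Lambda^0\|_2+\|(p^{-1}{\boldsymbol\Lambda^0}'\boldsymbol\Lambda^0)^{-1}\|_2\le M$. **Condition 4.** The entries of $\mathbf E_{\boldsymbol\eta^0}$ (and of $\mathbf E$) are i.i.d. copies of $e_{\boldsymbol\eta^0}\sim\mathrm{subG}(C_e^2)$ with continuous distribution function $G(\cdot;\boldsymbol\eta^0)$. For $1\le\ell\le m$, $\eta^0_\ell=h_\ell(\mathbb E[e_{\boldsymbol\eta^0}],\dots,\mathbb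 E[e_{\boldsymbol\eta^0}^m])$ with $h_\ell:\mathbb R^m\to\mathbb R$ such that $|h_\ell(t_1,\dots,t_m)-h_\ell(\mathbb E[e_{\boldsymbol\eta^0}],\dots,\mathbb E[e_{\boldsymbol\eta^0}^m])|\le M\max_{1\le k\le m}|t_k-\mathbb E[e^k_{\boldsymbol\eta^0}]|$ whenever $|t_k-\mathbb E[e^k_{\boldsymbol\eta^0}]|\le Mc_{np}$ for all $1\le k\le m$. There is a stochastic process $(e_{\boldsymbol\eta})_{\boldsymbol\eta}$ such that (i) for each $\boldsymbol\eta$ with $\|\boldsymbol\eta-\boldsymbol\eta^0\|_{\max}\le Mc_{np}$ the entries of $\mathbf E_{\boldsymbol\eta}$ are distributed as $e_{\boldsymbol\eta}$ (which has distribution $G(\cdot;\boldsymbol\eta)$), and (ii) for some $Z\sim\mathrm{subG}(c_e^2)$, $\sup_{\|\boldsymbol\eta-\boldsymbol\eta^0\|_{\max}\le Mc_{np}}|e_{\boldsymbol\eta}-e_{\boldsymbol\eta^0}|\le M^{1/2}c_{np}^{1/2}|Z|$. The entries of the matrix process $(\mathbf E_{\boldsymbol\eta})_{\boldsymbol\eta}$ are i.i.d. copies of $(e_{\boldsymbol\eta})_{\boldsymbol\eta}$, independent of $(\mathbf X,\mathbf y)$ (and of $\mathbf F^0,\mathbf E,\boldsymbol\varepsilon$). **Condition 5.** The $r$ eigenvalues of $p^{-1}{\boldsymbol\Lambda^0}'\boldsymbol\Lambda^0\boldsymbol\Sigma_f$ are distinct for all $p$. **Condition 7 (signal strength I).**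 For some $\gamma\in(0,1]$ and some positive sequence $b_{np}\to\infty$: every subset $\mathcal A\subset\mathcal S^0$ with $|\mathcal A|/s>1-\gamma$ satisfies $\|\boldsymbol\beta_{\mathcal A}\|_1>b_{np}\,s\,n^{-1/2}\log p$. **Condition 8 (signal strength II).** There is a constant $C_2\in(2(qs)^{-1},1)$ such that $|\mathcal S_2|\ge C_2s$, where $\mathcal S_2=\{j:|\beta_j|\gg(s/n)^{1/2}\log p\}$ ($a\gg b$ means $a/b\to\infty$). Here $q\in(0,1)$ is the target FDR level. **Knockoffs.** For $\boldsymbol\theta=(\mathbf C,\boldsymbol\eta)$ let $\widetilde{\mathbf X}(\boldsymbol\theta)=\mathbf C+\mathbf E_{\boldsymbol\eta}$; $\boldsymbol\theta^0=(\mathbf C^0,\boldsymbol\eta^0)$. **Estimator $\hat{\boldsymbol\theta}=(\widehat{\mathbf C},\hat{\boldsymbol\eta})$.** With the singular value decomposition $\mathbf X=\mathbf U\mathbf D\mathbf V'$, $\widehat{\mathbf C}=\mathbf U\mathbf D_r\mathbf V'$ where $\mathbf D_r$ keeps the $r$ largest singular values and sets the others to zero; $\widehat{\mathbf E}=(\hat e_{ij})=\mathbf X-\widehat{\mathbf C}$; $\hat\eta_\ell=h_\ell(\mathbb E_{np}\hat e,\dots,\mathbb E_{np}\hat e^m)$ with $\mathbb E_{np}\hat e^k=(np)^{-1}\sum_{i,j}\hat e_{ij}^k$. **Lasso and IPAD.** Fix $\lambda=C_0n^{-1/2}\log p$ with $C_0$ some large enough constant, used for all Lasso procedures. The Lasso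 based on $(\mathbf X,\mathbf y)$ is $\hat{\boldsymbol\beta}\in\arg\min_{\mathbf b\in\mathbb R^p}\{n^{-1}\|\mathbf y-\mathbf X\mathbf b\|_2^2+\lambda\|\mathbf b\|_1\}$ and it selects $\{j:\hat\beta_j\ne0\}$. Let $\hat{\boldsymbol\beta}^{\mathsf{aug}}(\boldsymbol\theta)\in\arg\min_{\mathbf b\in\mathbb R^{2p}}\{n^{-1}\|\mathbf y-[\mathbf X,\widetilde{\mathbf X}(\boldsymbol\theta)]\mathbf b\|_2^2+\lambda\|\mathbf b\|_1\}$ and $W_j(\boldsymbol\theta)=|\hat\beta_j^{\mathsf{aug}}(\boldsymbol\theta)|-|\hat\beta_{p+j}^{\mathsf{aug}}(\boldsymbol\theta)|$, $1\le j\le p$. IPAD selects $\{j:W_j\ge T\}$ with $W_j=W_j(\hat{\boldsymbol\theta})$ and $T$ either of the thresholds $T_1,T_2$: $T_a$ is the smallest $t\in\{|W_1|,\dots,|W_p|\}\setminus\{0\}$ with $\frac{(a-1)+|\{j:W_j\le-t\}|}{|\{j:W_j\ge t\}|\vee1}\le q$, $a\in\{1,2\}$ (and $T_a=+\infty$ if none). Throughout, with $\mathcal A^{\mathsf{aug}}(\boldsymbol\theta)=\mathrm{supp}(\hat{\boldsymbol\beta}^{\mathsf{aug}}(\boldsymbol\theta))$, it is assumed that $|\mathcal A^{\mathsf{aug}}(\boldsymbol\theta)|\le k/2$ for some positive integer $k$ which may diverge, for the $\boldsymbol\theta$ under consideration. **Power.** The power of a selection $\widehat{\mathcal S}$ is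 $\mathbb E[|\widehat{\mathcal S}\cap\mathcal S^0|/s]$. **Constants $c,C$.** $c,C>0$ are constants (existing under Conditions 2--4) such that: for $0\le u\le c$ and all indices, $\mathbb P(|p^{-1}\sum_{j=1}^p(e_{\ell j}e_{ij}-\mathbb E[e_{\ell j}e_{ij}])|>u)\le2e^{-pu^2/C}$, $\mathbb P(|n^{-1}\sum_{i=1}^nf^0_{ik}e_{ij}|>u)\le2e^{-nu^2/C}$, $\mathbb P(|n^{-1}\sum_{i=1}^n(f^0_{ik}f^0_{i\ell}-\mathbb E[f^0_{ik}f^0_{i\ell}])|>u)\le2e^{-nu^2/C}$; and for $u\ge0$, $\mathbb P(|p^{-1}\sum_{j=1}^p\lambda^0_{jk}e_{ij}|>u)\le2e^{-pu^2/C}$. *)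

theory Defs
  imports "HOL-Probability.Probability"
begin

section \<open>Rates, norms, sub-Gaussian variables\<close>

definition c_rate :: "nat \<Rightarrow> nat \<Rightarrow> real" where
  "c_rate n p = sqrt (ln (real n) / real p) + sqrt (ln (real p) / real n)"

definition c_rate_log :: "nat \<Rightarrow> nat \<Rightarrow> real" where
  "c_rate_log n p = ln (real n) / sqrt (real p) + ln (real p) / sqrt (real n)"

text \<open>The second argument is the variance proxy, i.e. the square \<open>C\<^sub>x\<^sup>2\<close> in \<open>subG(C\<^sub>x\<^sup>2)\<close>.\<close>

definition subG :: "'a measure \<Rightarrow> real \<Rightarrow> ('a \<Rightarrow> real) \<Rightarrow> bool" where
  "subG P v X \<longleftrightarrow>
     X \<in> borel_measurable P \<and> integrable P X \<and> (\<integral>\<omega>. X \<omega> \<partial>P) = 0 \<and>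
     (\<forall>u\<ge>0. measure P {\<omega> \<in> space P. \<bar>X \<omega>\<bar> > u} \<le> 2 * exp (- u\<^sup>2 / v))"

definition spectral_norm :: "real^'r^'r \<Rightarrow> real" where
  "spectral_norm A = onorm (\<lambda>x. A *v x)"

text \<open>All characteristic roots, taken in the complex numbers.\<close>

definition eigenvalues :: "real^'r^'r \<Rightarrow> complex set" where
  "eigenvalues A = {z. det ((\<chi> a b. complex_of_real (A $ a $ b)) - mat z) = 0}"

text \<open>The space \<open>\<real>\<^sup>m\<close> of parameters and of moment vectors is \<open>{1..m} \<rightarrow>\<^sub>E UNIV\<close>.\<close>

abbreviation Rvec :: "nat \<Rightarrow> (nat \<Rightarrow> real) set" where
  "Rvec m \<equiv> {1..m} \<rightarrow>\<^sub>E (UNIV :: real set)"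

section \<open>The linear model with latent factor design\<close>

text \<open>
  One record describes the model for one pair \<open>(n, p)\<close>; sample indices run through \<open>{1..n}\<close> and
  variable indices through \<open>{1..p}\<close>.  The field \<open>seed\<close> carries the randomness of the knockoff
  errors: for a process \<open>e \<eta> :: 'b \<Rightarrow> real\<close> on a probability space \<open>Q\<close>, the entry \<open>(i, j)\<close> of
  \<open>E\<^sub>\<eta>\<close> is \<open>e \<eta> (seed i j \<omega>)\<close>.
\<close>

record ('w, 'b, 'r) factor_model =
  Pr :: "'w measure"
  nobs :: nat
  nvar :: nat
  coef :: "nat \<Rightarrow> real"
  loading :: "nat \<Rightarrow> real^'r::finite"
  factor :: "nat \<Rightarrow> 'w \<Rightarrow> real^'r::finite"
  error :: "nat \<Rightarrow> nat \<Rightarrow> 'w \<Rightarrow> real"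
  noise :: "nat \<Rightarrow> 'w \<Rightarrow> real"
  seed :: "nat \<Rightarrow> nat \<Rightarrow> 'w \<Rightarrow> 'b"

definition entries :: "('w, 'b, 'r::finite) factor_model \<Rightarrow> (nat \<times> nat) set" where
  "entries D = {1..nobs D} \<times> {1..nvar D}"

definition signals :: "('w, 'b, 'r::finite) factor_model \<Rightarrow> nat set" where
  "signals D = {j \<in> {1..nvar D}. coef D j \<noteq> 0}"

definition sparsity :: "('w, 'b, 'r::finite) factor_model \<Rightarrow> nat" where
  "sparsity D = card (signals D)"

definition cnp :: "('w, 'b, 'r::finite) factor_model \<Rightarrow> real" where
  "cnp D = c_rate (nobs D) (nvar D)"

definition design :: "('w, 'b, 'r::finite) factor_model \<Rightarrow> 'w \<Rightarrow> nat \<Rightarrow> nat \<Rightarrow> real" where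
  "design D \<omega> i j = factor D i \<omega> \<bullet> loading D j + error D i j \<omega>"

definition response :: "('w, 'b, 'r::finite) factor_model \<Rightarrow> 'w \<Rightarrow> nat \<Rightarrow> real" where
  "response D \<omega> i = (\<Sum>j=1..nvar D. design D \<omega> i j * coef D j) + noise D i \<omega>"

definition factor_cov :: "('w, 'b, 'r::finite) factor_model \<Rightarrow> nat \<Rightarrow> real^'r^'r" where
  "factor_cov D i = (\<chi> a b. \<integral>\<omega>. factor D i \<omega> $ a * factor D i \<omega> $ b \<partial>Pr D)"

definition loading_gram :: "('w, 'b, 'r::finite) factor_model \<Rightarrow> real^'r^'r" where
  "loading_gram D = (\<chi> a b. (\<Sum>j=1..nvar D. loading D j $ a * loading D j $ b) / real (nvar D))"

text \<open>The sigma-algebra on the sample space generated by a family of random elements of \<open>N\<close>.\<close>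

definition generated :: "'w measure \<Rightarrow> 'c measure \<Rightarrow> 'i set \<Rightarrow> ('i \<Rightarrow> 'w \<Rightarrow> 'c) \<Rightarrow> 'w set set" where
  "generated P N I X =
     sets (vimage_algebra (space P) (\<lambda>\<omega>. \<lambda>i\<in>I. X i \<omega>) (Pi\<^sub>M I (\<lambda>_. N)))"

text \<open>
  Mutual independence of the noise, the factors, the idiosyncratic errors and the knockoff
  randomness.  \<open>indep_sets\<close> is used because the four random elements have different types.
\<close>

definition independent_sources ::
  "'b measure \<Rightarrow> ('w, 'b, 'r::finite) factor_model \<Rightarrow> bool" where
  "independent_sources Q D \<longleftrightarrow>
     prob_space.indep_sets (Pr D)
       (\<lambda>l. [generated (Pr D) borel {1..nobs D} (noise D),
             generated (Pr D) borel {1..nobs D} (factor D),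
             generated (Pr D) borel (entries D) (\<lambda>(i, j). error D i j),
             generated (Pr D) Q (entries D) (\<lambda>(i, j). seed D i j)] ! l)
       {..<4::nat}"

definition iid :: "'w measure \<Rightarrow> 'c measure \<Rightarrow> 'i set \<Rightarrow> ('i \<Rightarrow> 'w \<Rightarrow> 'c) \<Rightarrow> bool" where
  "iid P N I X \<longleftrightarrow>
     prob_space.indep_vars P (\<lambda>_. N) X I \<and> (\<forall>i\<in>I. \<forall>j\<in>I. distr P N (X i) = distr P N (X j))"

section \<open>Regularity conditions\<close>

definition noise_condition :: "real \<Rightarrow> ('w, 'b, 'r::finite) factor_model \<Rightarrow> bool" where
  "noise_condition C\<epsilon> D \<longleftrightarrow>
     iid (Pr D) borel {1..nobs D} (noise D) \<and> (\<forall>i\<in>{1..nobs D}. subG (Pr D) (C\<epsilon>\<^sup>2) (noise D i))"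

definition factor_condition :: "real \<Rightarrow> ('w, 'b, 'r::finite) factor_model \<Rightarrow> bool" where
  "factor_condition M D \<longleftrightarrow>
     iid (Pr D) borel {1..nobs D} (factor D) \<and>
     (AE \<omega> in Pr D. \<forall>i\<in>{1..nobs D}. \<forall>a. \<bar>factor D i \<omega> $ a\<bar> \<le> M) \<and>
     (\<forall>i\<in>{1..nobs D}. (\<forall>a. (\<integral>\<omega>. factor D i \<omega> $ a \<partial>Pr D) = 0) \<and>
        invertible (factor_cov D i) \<and>
        spectral_norm (factor_cov D i) + spectral_norm (matrix_inv (factor_cov D i)) \<le> M)"

definition loading_condition :: "real \<Rightarrow> ('w, 'b, 'r::finite) factor_model \<Rightarrow> bool" where
  "loading_condition M D \<longleftrightarrow>
     (\<forall>j\<in>{1..nvar D}. \<forall>a. \<bar>loading D j $ a\<bar> \<le> M) \<and>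
     invertible (loading_gram D) \<and>
     spectral_norm (loading_gram D) + spectral_norm (matrix_inv (loading_gram D)) \<le> M"

definition eigenvalue_condition :: "('w, 'b, 'r::finite) factor_model \<Rightarrow> bool" where
  "eigenvalue_condition D \<longleftrightarrow>
     (\<forall>i\<in>{1..nobs D}. card (eigenvalues (loading_gram D ** factor_cov D i)) = CARD('r))"

definition moments :: "nat \<Rightarrow> 'b measure \<Rightarrow> ('b \<Rightarrow> real) \<Rightarrow> nat \<Rightarrow> real" where
  "moments m Q X = (\<lambda>k\<in>{1..m}. \<integral>b. X b ^ k \<partial>Q)"

definition eta_ball :: "nat \<Rightarrow> (nat \<Rightarrow> real) \<Rightarrow> real \<Rightarrow> (nat \<Rightarrow> real) set" where
  "eta_ball m \<eta>0 R = {\<eta> \<in> Rvec m. \<forall>l\<in>{1..m}. \<bar>\<eta> l - \<eta>0 l\<bar> \<le> R}"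

text \<open>
  \<open>G \<eta>\<close> is the distribution function of \<open>e \<eta>\<close>.  Joint measurability of the process and
  measurability of \<open>h\<close> make the process evaluated at the estimated parameter a random variable.
\<close>

definition error_family ::
  "real \<Rightarrow> nat \<Rightarrow> ((nat \<Rightarrow> real) \<Rightarrow> real \<Rightarrow> real) \<Rightarrow> (nat \<Rightarrow> real) \<Rightarrow>
   (nat \<Rightarrow> (nat \<Rightarrow> real) \<Rightarrow> real) \<Rightarrow> 'b measure \<Rightarrow> ((nat \<Rightarrow> real) \<Rightarrow> 'b \<Rightarrow> real) \<Rightarrow> bool" where
  "error_family Ce m G \<eta>0 h Q e \<longleftrightarrow>
     prob_space Q \<and>
     (\<lambda>(\<eta>, b). e \<eta> b) \<in> borel_measurable (Pi\<^sub>M {1..m} (\<lambda>_. borel) \<Otimes>\<^sub>M Q) \<and>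
     (\<forall>l\<in>{1..m}. h l \<in> borel_measurable (Pi\<^sub>M {1..m} (\<lambda>_. borel))) \<and>
     \<eta>0 \<in> Rvec m \<and>
     subG Q (Ce\<^sup>2) (e \<eta>0) \<and>
     continuous_on UNIV (G \<eta>0) \<and>
     (\<forall>l\<in>{1..m}. \<eta>0 l = h l (moments m Q (e \<eta>0)))"

text \<open>
  The copies \<open>(e \<eta> (seed i j \<omega>))\<^sub>\<eta>\<close> of the process are i.i.d. because the seeds are i.i.d. with
  law \<open>Q\<close>; in this form the pathwise envelope \<open>Z\<close> is copied along with the process.
\<close>

definition error_condition ::
  "real \<Rightarrow> real \<Rightarrow> nat \<Rightarrow> ((nat \<Rightarrow> real) \<Rightarrow> real \<Rightarrow> real) \<Rightarrow> (nat \<Rightarrow> real) \<Rightarrow>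
   (nat \<Rightarrow> (nat \<Rightarrow> real) \<Rightarrow> real) \<Rightarrow> 'b measure \<Rightarrow> ((nat \<Rightarrow> real) \<Rightarrow> 'b \<Rightarrow> real) \<Rightarrow>
   ('w, 'b, 'r::finite) factor_model \<Rightarrow> bool" where
  "error_condition M ce m G \<eta>0 h Q e D \<longleftrightarrow>
     iid (Pr D) borel (entries D) (\<lambda>(i, j). error D i j) \<and>
     (\<forall>(i, j)\<in>entries D. cdf (distr (Pr D) borel (error D i j)) = G \<eta>0) \<and>
     iid (Pr D) Q (entries D) (\<lambda>(i, j). seed D i j) \<and>
     (\<forall>(i, j)\<in>entries D. distr (Pr D) Q (seed D i j) = Q) \<and>
     (\<forall>l\<in>{1..m}. \<forall>\<tau>\<in>eta_ball m (moments m Q (e \<eta>0)) (M * cnp D).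
        \<bar>h l \<tau> - h l (moments m Q (e \<eta>0))\<bar>
          \<le> M * Max ((\<lambda>k. \<bar>\<tau> k - moments m Q (e \<eta>0) k\<bar>) ` {1..m})) \<and>
     (\<forall>\<eta>\<in>eta_ball m \<eta>0 (M * cnp D). cdf (distr Q borel (e \<eta>)) = G \<eta>) \<and>
     (\<exists>Z. subG Q (ce\<^sup>2) Z \<and>
        (AE b in Q. \<forall>\<eta>\<in>eta_ball m \<eta>0 (M * cnp D).
           \<bar>e \<eta> b - e \<eta>0 b\<bar> \<le> sqrt M * sqrt (cnp D) * \<bar>Z b\<bar>))"

definition tail_constants :: "real \<Rightarrow> real \<Rightarrow> ('w, 'b, 'r::finite) factor_model \<Rightarrow> bool" where
  "tail_constants c C D \<longleftrightarrow>
     (let P = Pr D; n = nobs D; p = nvar D; e = error D; f = factor D in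
      (\<forall>u\<in>{0..c}. \<forall>l\<in>{1..n}. \<forall>i\<in>{1..n}.
         measure P {\<omega> \<in> space P.
           \<bar>(\<Sum>j=1..p. e l j \<omega> * e i j \<omega> - (\<integral>w. e l j w * e i j w \<partial>P)) / real p\<bar> > u}
         \<le> 2 * exp (- (real p * u\<^sup>2 / C))) \<and>
      (\<forall>u\<in>{0..c}. \<forall>a. \<forall>j\<in>{1..p}.
         measure P {\<omega> \<in> space P. \<bar>(\<Sum>i=1..n. f i \<omega> $ a * e i j \<omega>) / real n\<bar> > u}
         \<le> 2 * exp (- (real n * u\<^sup>2 / C))) \<and>
      (\<forall>u\<in>{0..c}. \<forall>a a'.
         measure P {\<omega> \<in> space P.
           \<bar>(\<Sum>i=1..n. f i \<omega> $ a * f i \<omega> $ a' - (\<integral>w. f i w $ a * f i w $ a' \<partial>P)) / real n\<bar> > u}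
         \<le> 2 * exp (- (real n * u\<^sup>2 / C))) \<and>
      (\<forall>u\<ge>0. \<forall>a. \<forall>i\<in>{1..n}.
         measure P {\<omega> \<in> space P. \<bar>(\<Sum>j=1..p. loading D j $ a * e i j \<omega>) / real p\<bar> > u}
         \<le> 2 * exp (- (real p * u\<^sup>2 / C))))"

definition signal_strength_I ::
  "real \<Rightarrow> (nat \<Rightarrow> ('w, 'b, 'r::finite) factor_model) \<Rightarrow> bool" where
  "signal_strength_I \<gamma> D \<longleftrightarrow>
     (\<exists>b :: nat \<Rightarrow> real. (\<forall>t. b t > 0) \<and> filterlim b at_top sequentially \<and>
        (\<forall>t. \<forall>A \<subseteq> signals (D t). real (card A) / real (sparsity (D t)) > 1 - \<gamma> \<longrightarrow>
           (\<Sum>j\<in>A. \<bar>coef (D t) j\<bar>)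
             > b t * real (sparsity (D t)) * ln (real (nvar (D t))) / sqrt (real (nobs (D t)))))"

text \<open>
  Membership \<open>\<bar>\<beta>\<^sub>j\<bar> \<gg> (s/n)\<^sup>1\<^sup>/\<^sup>2 log p\<close> is uniform over the members \<open>j\<close>: it is witnessed by one
  divergent sequence \<open>a\<close>.
\<close>

definition signal_strength_II ::
  "real \<Rightarrow> real \<Rightarrow> (nat \<Rightarrow> ('w, 'b, 'r::finite) factor_model) \<Rightarrow> bool" where
  "signal_strength_II q C2 D \<longleftrightarrow>
     (\<forall>t. sparsity (D t) > 0 \<and> 2 / (q * real (sparsity (D t))) < C2) \<and> C2 < 1 \<and>
     (\<exists>a :: nat \<Rightarrow> real. filterlim a at_top sequentially \<and>
        (\<forall>t. real (card {j \<in> {1..nvar (D t)}. \<bar>coef (D t) j\<bar>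
                \<ge> a t * (sqrt (real (sparsity (D t)) / real (nobs (D t))) * ln (real (nvar (D t))))})
              \<ge> C2 * real (sparsity (D t))))"

section \<open>Estimator, Lasso and IPAD\<close>

text \<open>Thin singular value decomposition \<open>X = U diag(d) V'\<close> of an \<open>n \<times> p\<close> matrix.\<close>

definition svd ::
  "nat \<Rightarrow> nat \<Rightarrow> (nat \<Rightarrow> nat \<Rightarrow> real) \<Rightarrow>
   (nat \<Rightarrow> nat \<Rightarrow> real) \<Rightarrow> (nat \<Rightarrow> real) \<Rightarrow> (nat \<Rightarrow> nat \<Rightarrow> real) \<Rightarrow> bool" where
  "svd n p X U d V \<longleftrightarrow>
     (\<forall>i\<in>{1..n}. \<forall>j\<in>{1..p}. X i j = (\<Sum>k=1..min n p. U i k * d k * V j k)) \<and>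
     (\<forall>k\<in>{1..min n p}. \<forall>l\<in>{1..min n p}.
        (\<Sum>i=1..n. U i k * U i l) = (if k = l then 1 else 0) \<and>
        (\<Sum>j=1..p. V j k * V j l) = (if k = l then 1 else 0)) \<and>
     (\<forall>k\<in>{1..min n p}. d k \<ge> 0) \<and>
     (\<forall>k\<in>{1..min n p}. \<forall>l\<in>{1..min n p}. k \<le> l \<longrightarrow> d l \<le> d k)"

definition svd_truncation ::
  "nat \<Rightarrow> nat \<Rightarrow> nat \<Rightarrow> (nat \<Rightarrow> nat \<Rightarrow> real) \<Rightarrow> (nat \<Rightarrow> nat \<Rightarrow> real) \<Rightarrow> bool" where
  "svd_truncation r n p X C \<longleftrightarrow>
     (\<exists>U d V. svd n p X U d V \<and>
        (\<forall>i\<in>{1..n}. \<forall>j\<in>{1..p}. C i j = (\<Sum>k=1..min r (min n p). U i k * d k * V j k)))"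

definition eta_hat ::
  "nat \<Rightarrow> (nat \<Rightarrow> (nat \<Rightarrow> real) \<Rightarrow> real) \<Rightarrow> nat \<Rightarrow> nat \<Rightarrow>
   (nat \<Rightarrow> nat \<Rightarrow> real) \<Rightarrow> (nat \<Rightarrow> nat \<Rightarrow> real) \<Rightarrow> nat \<Rightarrow> real" where
  "eta_hat m h n p X C =
     (\<lambda>l\<in>{1..m}. h l (\<lambda>k\<in>{1..m}. (\<Sum>i=1..n. \<Sum>j=1..p. (X i j - C i j) ^ k) / (real n * real p)))"

definition knockoff ::
  "((nat \<Rightarrow> real) \<Rightarrow> 'b \<Rightarrow> real) \<Rightarrow> ('w, 'b, 'r::finite) factor_model \<Rightarrow>
   (nat \<Rightarrow> nat \<Rightarrow> real) \<times> (nat \<Rightarrow> real) \<Rightarrow> 'w \<Rightarrow> nat \<Rightarrow> nat \<Rightarrow> real" where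
  "knockoff e D \<theta> \<omega> i j = fst \<theta> i j + e (snd \<theta>) (seed D i j \<omega>)"

definition lasso_obj ::
  "nat \<Rightarrow> nat \<Rightarrow> real \<Rightarrow> (nat \<Rightarrow> real) \<Rightarrow> (nat \<Rightarrow> nat \<Rightarrow> real) \<Rightarrow> (nat \<Rightarrow> real) \<Rightarrow> real" where
  "lasso_obj n d lam y A b =
     (\<Sum>i=1..n. (y i - (\<Sum>j=1..d. A i j * b j))\<^sup>2) / real n + lam * (\<Sum>j=1..d. \<bar>b j\<bar>)"

definition is_lasso ::
  "nat \<Rightarrow> nat \<Rightarrow> real \<Rightarrow> (nat \<Rightarrow> real) \<Rightarrow> (nat \<Rightarrow> nat \<Rightarrow> real) \<Rightarrow> (nat \<Rightarrow> real) \<Rightarrow> bool" where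
  "is_lasso n d lam y A b \<longleftrightarrow> is_arg_min (lasso_obj n d lam y A) (\<lambda>_. True) b"

definition lasso_lambda :: "real \<Rightarrow> ('w, 'b, 'r::finite) factor_model \<Rightarrow> real" where
  "lasso_lambda C0 D = C0 * ln (real (nvar D)) / sqrt (real (nobs D))"

definition augment ::
  "nat \<Rightarrow> (nat \<Rightarrow> nat \<Rightarrow> real) \<Rightarrow> (nat \<Rightarrow> nat \<Rightarrow> real) \<Rightarrow> nat \<Rightarrow> nat \<Rightarrow> real" where
  "augment p X X' i j = (if j \<le> p then X i j else X' i (j - p))"

definition support :: "nat \<Rightarrow> (nat \<Rightarrow> real) \<Rightarrow> nat set" where
  "support d b = {j \<in> {1..d}. b j \<noteq> 0}"

definition lcd :: "nat \<Rightarrow> (nat \<Rightarrow> real) \<Rightarrow> nat \<Rightarrow> real" where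
  "lcd p b j = \<bar>b j\<bar> - \<bar>b (p + j)\<bar>"

definition threshold_candidates :: "nat \<Rightarrow> real \<Rightarrow> nat \<Rightarrow> (nat \<Rightarrow> real) \<Rightarrow> real set" where
  "threshold_candidates a q p W =
     {t \<in> (\<lambda>j. \<bar>W j\<bar>) ` {1..p} - {0}.
        (real a - 1 + real (card {j \<in> {1..p}. W j \<le> - t}))
          / max (real (card {j \<in> {1..p}. W j \<ge> t})) 1 \<le> q}"

definition threshold :: "nat \<Rightarrow> real \<Rightarrow> nat \<Rightarrow> (nat \<Rightarrow> real) \<Rightarrow> ereal" where
  "threshold a q p W =
     (if threshold_candidates a q p W = {} then \<infinity> else ereal (Min (threshold_candidates a q p W)))"

definition knockoff_select :: "nat \<Rightarrow> real \<Rightarrow> nat \<Rightarrow> (nat \<Rightarrow> real) \<Rightarrow> nat set" where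
  "knockoff_select a q p W = {j \<in> {1..p}. ereal (W j) \<ge> threshold a q p W}"

definition lasso_fit ::
  "real \<Rightarrow> ('w, 'b, 'r::finite) factor_model \<Rightarrow> ('w \<Rightarrow> nat \<Rightarrow> real) \<Rightarrow> bool" where
  "lasso_fit C0 D bhat \<longleftrightarrow>
     (\<forall>j\<in>{1..nvar D}. (\<lambda>\<omega>. bhat \<omega> j) \<in> borel_measurable (Pr D)) \<and>
     (\<forall>\<omega>\<in>space (Pr D).
        is_lasso (nobs D) (nvar D) (lasso_lambda C0 D) (response D \<omega>) (design D \<omega>) (bhat \<omega>))"

definition c_hat_fit ::
  "('w, 'b, 'r::finite) factor_model \<Rightarrow> ('w \<Rightarrow> nat \<Rightarrow> nat \<Rightarrow> real) \<Rightarrow> bool" where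
  "c_hat_fit D Chat \<longleftrightarrow>
     (\<forall>(i, j)\<in>entries D. (\<lambda>\<omega>. Chat \<omega> i j) \<in> borel_measurable (Pr D)) \<and>
     (\<forall>\<omega>\<in>space (Pr D). svd_truncation CARD('r) (nobs D) (nvar D) (design D \<omega>) (Chat \<omega>))"

definition theta_hat ::
  "nat \<Rightarrow> (nat \<Rightarrow> (nat \<Rightarrow> real) \<Rightarrow> real) \<Rightarrow> ('w, 'b, 'r::finite) factor_model \<Rightarrow>
   ('w \<Rightarrow> nat \<Rightarrow> nat \<Rightarrow> real) \<Rightarrow> 'w \<Rightarrow> (nat \<Rightarrow> nat \<Rightarrow> real) \<times> (nat \<Rightarrow> real)" where
  "theta_hat m h D Chat \<omega> =
     (Chat \<omega>, eta_hat m h (nobs D) (nvar D) (design D \<omega>) (Chat \<omega>))"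

definition aug_fit ::
  "real \<Rightarrow> ((nat \<Rightarrow> real) \<Rightarrow> 'b \<Rightarrow> real) \<Rightarrow> ('w, 'b, 'r::finite) factor_model \<Rightarrow>
   ('w \<Rightarrow> (nat \<Rightarrow> nat \<Rightarrow> real) \<times> (nat \<Rightarrow> real)) \<Rightarrow> ('w \<Rightarrow> nat \<Rightarrow> real) \<Rightarrow> bool" where
  "aug_fit C0 e D \<theta> baug \<longleftrightarrow>
     (\<forall>j\<in>{1..2 * nvar D}. (\<lambda>\<omega>. baug \<omega> j) \<in> borel_measurable (Pr D)) \<and>
     (\<forall>\<omega>\<in>space (Pr D).
        is_lasso (nobs D) (2 * nvar D) (lasso_lambda C0 D) (response D \<omega>)
          (augment (nvar D) (design D \<omega>) (knockoff e D (\<theta> \<omega>) \<omega>)) (baug \<omega>))"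

definition sel_power :: "('w, 'b, 'r::finite) factor_model \<Rightarrow> ('w \<Rightarrow> nat set) \<Rightarrow> real" where
  "sel_power D S = (\<integral>\<omega>. real (card (S \<omega> \<inter> signals D)) / real (sparsity D) \<partial>Pr D)"

definition lasso_power ::
  "('w, 'b, 'r::finite) factor_model \<Rightarrow> ('w \<Rightarrow> nat \<Rightarrow> real) \<Rightarrow> real" where
  "lasso_power D bhat = sel_power D (\<lambda>\<omega>. support (nvar D) (bhat \<omega>))"

definition ipad_power ::
  "nat \<Rightarrow> real \<Rightarrow> ('w, 'b, 'r::finite) factor_model \<Rightarrow> ('w \<Rightarrow> nat \<Rightarrow> real) \<Rightarrow> real" where
  "ipad_power a q D baug =
     sel_power D (\<lambda>\<omega>. knockoff_select a q (nvar D) (lcd (nvar D) (baug \<omega>)))"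

end

theory Submission imports Defs
begin

text \<open>
  Both procedures are controlled by the \<open>l\<^sub>1\<close> oracle inequality of the Lasso, so that a missed
  signal of mass \<open>b s n\<^sup>-\<^sup>1\<^sup>/\<^sup>2 log p\<close>, \<open>b \<rightarrow> \<infinity>\<close>, is impossible.  For the knockoffs, every \<open>W\<^sub>j\<close> of a strong
  signal exceeds \<open>t = K n\<^sup>-\<^sup>1\<^sup>/\<^sup>2 log p\<close>, while at most \<open>q C\<^sub>2 s / 2\<close> of the \<open>W\<^sub>j\<close> lie below \<open>- t\<close>; hence the
  data-driven threshold does not remove any \<open>W\<^sub>j \<ge> t\<close>, and the signals that are missed have mass
  \<open>O(s t)\<close>.

  A column of the augmented design is a factor part plus an independent error column plus a
  remainder \<open>Chat - C\<^sup>0\<close> and \<open>e(etahat) - e(\<eta>0)\<close> of small norm.  The error columns are nearly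
  orthonormal up to scale and nearly orthogonal to the factor part, which gives the restricted
  eigenvalue.  The remainder of \<open>Chat\<close> is bounded by an elementary perturbation argument for the
  leading left singular vectors.

  The knockoffs depend on the noise only through the choice of \<open>Chat\<close> where the truncation is not
  unique.  On the event that the singular values have a gap, \<open>Chat\<close> is a limit of polynomials in
  \<open>X\<close>, and this limit is independent of the noise.
\<close>

text \<open>The lower bound on C0 must be fixed before the sequence of models, so every constant is
  built from the shared parameters alone, never from \<open>D t\<close>. Two kinds of deviation are
  kept apart. Entrywise ones hold up to a level x = (6 / \<alpha>) ln p; as \<lambda> is itself of
  order ln p / sqrt n, this level is affordable, and plain exponential moments then beat a union
  bound over p^2 pairs. Totals over whole matrices come from Markov's inequality: they fail with a
  fixed probability \<delta>, but cost only a constant H of order 1 / \<delta> and no logarithm. The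
  moments of the residuals need the second kind: their error must stay within c_np, which exceeds
  sqrt (1/n + 1/p) only by roots of logarithms, whereas a uniform column bound of order ln p / sqrt
  n would be too large. Since \<delta> is arbitrary, the deficit of the power tends to 0, without a
  rate. An entrywise error \<kappa> changes a quadratic form by at most \<kappa> times the squared
  l1 norm, on the Lasso cone 16 s \<kappa> times the squared l2 norm; this is why s ln p / sqrt n
  has to vanish.\<close>

declare One_nat_def [simp del]

section \<open>The Lasso and knockoff selection\<close>

lemma sum_mult_sum_swap:
  fixes P Q :: "nat \<Rightarrow> nat \<Rightarrow> real"
  shows "(\<Sum>i\<in>I. (\<Sum>j\<in>J. P i j * x j) * (\<Sum>l\<in>L. Q i l * y l))
    = (\<Sum>j\<in>J. \<Sum>l\<in>L. x j * y l * (\<Sum>i\<in>I. P i j * Q i l))"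
proof -
  have "(\<Sum>i\<in>I. (\<Sum>j\<in>J. P i j * x j) * (\<Sum>l\<in>L. Q i l * y l))
      = (\<Sum>i\<in>I. \<Sum>j\<in>J. \<Sum>l\<in>L. x j * y l * (P i j * Q i l))"
    by (simp add: sum_product mult_ac)
  also have "\<dots> = (\<Sum>j\<in>J. \<Sum>l\<in>L. \<Sum>i\<in>I. x j * y l * (P i j * Q i l))"
    by (subst sum.swap, subst (2) sum.swap) simp
  finally show ?thesis by (simp add: sum_distrib_left)
qed

text \<open>Entrywise concentration enters quadratic forms in this way: where the squared l1 norm is
  at most 16 s times the squared l2 norm, an entrywise error that is small compared with 1/s is
  harmless.\<close>

lemma bilinear_bound:
  fixes P :: "'k \<Rightarrow> 'k \<Rightarrow> real"
  assumes "\<And>j l. j \<in> J \<Longrightarrow> l \<in> J \<Longrightarrow> \<bar>P j l\<bar> \<le> c"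
  shows "\<bar>\<Sum>j\<in>J. \<Sum>l\<in>J. x j * x l * P j l\<bar> \<le> c * (\<Sum>j\<in>J. \<bar>x j\<bar>)\<^sup>2"
proof -
  have "\<bar>\<Sum>j\<in>J. \<Sum>l\<in>J. x j * x l * P j l\<bar> \<le> (\<Sum>j\<in>J. \<Sum>l\<in>J. \<bar>x j\<bar> * \<bar>x l\<bar> * c)"
    by (intro order.trans[OF sum_abs] sum_mono)
      (auto simp: abs_mult intro!: mult_left_mono assms)
  also have "\<dots> = c * (\<Sum>j\<in>J. \<bar>x j\<bar>)\<^sup>2"
    by (simp add: power2_eq_square sum_product sum_distrib_left mult_ac)
  finally show ?thesis .
qed

text \<open>Splitting off sqrt \<bar>x j\<bar> leaves the squares of \<open>R\<close> averaged with
  the weights \<bar>x j\<bar>. Summed over the rows of a matrix, only its column norms remain, and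
  these are what is small for the estimation remainder.\<close>

lemma weighted_Cauchy_Schwarz:
  fixes R :: "nat \<Rightarrow> real"
  shows "(\<Sum>j\<in>J. R j * x j)\<^sup>2 \<le> (\<Sum>j\<in>J. \<bar>x j\<bar>) * (\<Sum>j\<in>J. \<bar>x j\<bar> * (R j)\<^sup>2)"
proof -
  have "(\<Sum>j\<in>J. R j * x j)\<^sup>2 \<le> (\<Sum>j\<in>J. \<bar>R j * x j\<bar>)\<^sup>2"
    by (subst (1) power2_abs[symmetric]) (intro power_mono sum_abs abs_ge_zero)
  also have "(\<Sum>j\<in>J. \<bar>R j * x j\<bar>) = (\<Sum>j\<in>J. sqrt \<bar>x j\<bar> * (sqrt \<bar>x j\<bar> * \<bar>R j\<bar>))"
    by (intro sum.cong refl) (auto simp: abs_mult simp flip: mult.assoc intro: mult.commute)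
  also have "\<dots>\<^sup>2 \<le> (\<Sum>j\<in>J. (sqrt \<bar>x j\<bar>)\<^sup>2) * (\<Sum>j\<in>J. (sqrt \<bar>x j\<bar> * \<bar>R j\<bar>)\<^sup>2)"
    by (rule Cauchy_Schwarz_ineq_sum)
  finally show ?thesis by (simp add: power_mult_distrib)
qed

text \<open>The signal part \<open>B\<close> gets no lower bound: its square is dropped, and it only
  matters that it is nearly orthogonal to \<open>E\<close>, whose Gram matrix is close to a multiple
  of the identity. On the cone the Gram and cross errors cost 24 s k1 \<le> s2/4 and the remainder
  16 s r2 \<le> s2/8; with the half kept from the error part this leaves s2/8.\<close>

lemma restricted_eigenvalue:
  fixes n d :: nat and A B E R :: "nat \<Rightarrow> nat \<Rightarrow> real" and x :: "nat \<Rightarrow> real"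
  assumes n: "n > 0"
    and A: "\<And>i j. i \<in> {1..n} \<Longrightarrow> j \<in> {1..d} \<Longrightarrow> A i j = B i j + E i j + R i j"
    and BE: "\<And>j l. j \<in> {1..d} \<Longrightarrow> l \<in> {1..d} \<Longrightarrow> \<bar>\<Sum>i=1..n. B i j * E i l\<bar> \<le> real n * k1"
    and EE: "\<And>j l. j \<in> {1..d} \<Longrightarrow> l \<in> {1..d} \<Longrightarrow>
      \<bar>(\<Sum>i=1..n. E i j * E i l) - (if j = l then real n * s2 else 0)\<bar> \<le> real n * k1"
    and R: "\<And>j. j \<in> {1..d} \<Longrightarrow> (\<Sum>i=1..n. (R i j)\<^sup>2) \<le> real n * r2"
    and k1: "96 * s * k1 \<le> s2" "k1 \<ge> 0" and r2: "128 * s * r2 \<le> s2" "r2 \<ge> 0"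
    and cone: "(\<Sum>j=1..d. \<bar>x j\<bar>)\<^sup>2 \<le> 16 * s * (\<Sum>j=1..d. (x j)\<^sup>2)"
  shows "s2 / 8 * (\<Sum>j=1..d. (x j)\<^sup>2) \<le> (\<Sum>i=1..n. (\<Sum>j=1..d. A i j * x j)\<^sup>2) / real n"
proof -
  define X2 where "X2 = (\<Sum>j=1..d. (x j)\<^sup>2)"
  define L where "L = (\<Sum>j=1..d. \<bar>x j\<bar>)"
  have X2: "X2 \<ge> 0" and L0: "L \<ge> 0" unfolding X2_def L_def by (auto intro: sum_nonneg)
  define b where "b i = (\<Sum>j=1..d. B i j * x j)" for i
  define f where "f i = (\<Sum>j=1..d. E i j * x j)" for i
  define g where "g i = (\<Sum>j=1..d. R i j * x j)" for i
  have Ax: "(\<Sum>j=1..d. A i j * x j) = b i + f i + g i" if "i \<in> {1..n}" for i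
    unfolding b_def f_def g_def sum.distrib[symmetric]
    by (intro sum.cong refl) (simp add: A[OF that] algebra_simps)
  have bf: "\<bar>\<Sum>i=1..n. b i * f i\<bar> \<le> real n * k1 * L\<^sup>2"
    unfolding b_def f_def sum_mult_sum_swap L_def by (rule bilinear_bound) (rule BE)
  have "(\<Sum>i=1..n. (f i)\<^sup>2) = (\<Sum>j=1..d. \<Sum>l=1..d. x j * x l * (\<Sum>i=1..n. E i j * E i l))"
    unfolding f_def power2_eq_square sum_mult_sum_swap ..
  also have "\<dots> = (\<Sum>j=1..d. \<Sum>l=1..d. x j * x l * ((\<Sum>i=1..n. E i j * E i l) - (if j = l then real n * s2 else 0)))
      + (\<Sum>j=1..d. \<Sum>l=1..d. x j * x l * (if j = l then real n * s2 else 0))"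
    unfolding sum.distrib[symmetric] by (intro sum.cong refl) (simp add: algebra_simps)
  also have "(\<Sum>j=1..d. \<Sum>l=1..d. x j * x l * (if j = l then real n * s2 else 0)) = real n * s2 * X2"
    unfolding X2_def sum_distrib_left
    by (intro sum.cong refl) (simp add: if_distrib[of "\<lambda>y. _ * y"] power2_eq_square mult_ac cong: if_cong)
  finally have sum_f: "(\<Sum>i=1..n. (f i)\<^sup>2) = (\<Sum>j=1..d. \<Sum>l=1..d. x j * x l * ((\<Sum>i=1..n. E i j * E i l) - (if j = l then real n * s2 else 0)))
      + real n * s2 * X2" .
  have ff: "(\<Sum>i=1..n. (f i)\<^sup>2) \<ge> real n * s2 * X2 - real n * k1 * L\<^sup>2"
  proof -
    have "\<bar>\<Sum>j=1..d. \<Sum>l=1..d. x j * x l * ((\<Sum>i=1..n. E i j * E i l) - (if j = l then real n * s2 else 0))\<bar>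
        \<le> real n * k1 * L\<^sup>2"
      unfolding L_def by (rule bilinear_bound) (rule EE)
    then show ?thesis using sum_f by linarith
  qed
  have "(\<Sum>i=1..n. (g i)\<^sup>2) \<le> (\<Sum>i=1..n. L * (\<Sum>j=1..d. \<bar>x j\<bar> * (R i j)\<^sup>2))"
    unfolding g_def L_def by (intro sum_mono weighted_Cauchy_Schwarz)
  also have "\<dots> = L * (\<Sum>j=1..d. \<bar>x j\<bar> * (\<Sum>i=1..n. (R i j)\<^sup>2))"
    by (simp add: sum_distrib_left) (rule sum.swap)
  also have "\<dots> \<le> L * (\<Sum>j=1..d. \<bar>x j\<bar> * (real n * r2))"
    by (intro mult_left_mono sum_mono R L0) auto
  also have "(\<Sum>j=1..d. \<bar>x j\<bar> * (real n * r2)) = L * (real n * r2)"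
    by (simp add: L_def flip: sum_distrib_right)
  finally have gg: "(\<Sum>i=1..n. (g i)\<^sup>2) \<le> real n * r2 * L\<^sup>2"
    by (simp add: power2_eq_square mult_ac)
  \<comment> \<open>Half of the square of \<open>f\<close> is given up to pay for the unsigned
    remainder \<open>g\<close>: the difference of the two sides is then a sum of two
    squares.\<close>
  have "(b i + f i + g i)\<^sup>2 \<ge> b i * f i + (f i)\<^sup>2 / 2 - (g i)\<^sup>2" for i
  proof -
    have "(b i + f i + g i)\<^sup>2 - (b i * f i + (f i)\<^sup>2 / 2 - (g i)\<^sup>2)
        = (b i + f i + 2 * g i)\<^sup>2 / 2 + (b i)\<^sup>2 / 2"
      by (simp add: power2_eq_square field_simps)
    moreover have "\<dots> \<ge> 0" by simp
    ultimately show ?thesis by linarith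
  qed
  then have "(\<Sum>i=1..n. (b i + f i + g i)\<^sup>2) \<ge> (\<Sum>i=1..n. b i * f i + (f i)\<^sup>2 / 2 - (g i)\<^sup>2)"
    by (rule sum_mono)
  also have "(\<Sum>i=1..n. b i * f i + (f i)\<^sup>2 / 2 - (g i)\<^sup>2)
      = (\<Sum>i=1..n. b i * f i) + (\<Sum>i=1..n. (f i)\<^sup>2) / 2 - (\<Sum>i=1..n. (g i)\<^sup>2)"
    by (simp add: sum.distrib sum_subtractf sum_divide_distrib)
  finally have "(\<Sum>i=1..n. (b i + f i + g i)\<^sup>2)
      \<ge> real n * (s2 * X2 / 2 - 3 / 2 * k1 * L\<^sup>2 - r2 * L\<^sup>2)"
    using bf ff gg by (simp add: algebra_simps)
  moreover have "s2 * X2 / 2 - 3 / 2 * k1 * L\<^sup>2 - r2 * L\<^sup>2 \<ge> s2 / 8 * X2"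
  proof -
    have "k1 * L\<^sup>2 \<le> k1 * (16 * s * X2)" "r2 * L\<^sup>2 \<le> r2 * (16 * s * X2)"
      using cone k1 r2 by (auto simp: L_def X2_def intro!: mult_left_mono)
    moreover have "96 * s * k1 * X2 \<le> s2 * X2" "128 * s * r2 * X2 \<le> s2 * X2"
      using k1 r2 X2 by (auto intro!: mult_right_mono)
    ultimately show ?thesis by (simp add: algebra_simps)
  qed
  ultimately have "(\<Sum>i=1..n. (b i + f i + g i)\<^sup>2) \<ge> real n * (s2 / 8 * X2)"
    by (meson mult_left_mono of_nat_0_le_iff order.trans)
  then show ?thesis
    using n Ax by (simp add: X2_def field_simps)
qed

text \<open>Comparing the objective at \<open>b\<close> and at \<beta>, a noise level of lam/4 puts
  the error in the cone c \<le> 3 a, so its squared l1 norm is at most 16 a^2, hence at most 16 card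
  S times its squared l2 norm; this is the origin of the 16. The eigenvalue hypothesis is phrased
  through the norms, so that it involves \<open>S\<close> only through its cardinality.\<close>

lemma lasso_error_bound:
  fixes n d :: nat and A :: "nat \<Rightarrow> nat \<Rightarrow> real"
  assumes n: "n > 0" and lam: "lam > 0" and \<kappa>: "\<kappa> > 0" and S: "S \<subseteq> {1..d}"
    and lasso: "is_lasso n d lam y A b"
    and y: "\<And>i. i \<in> {1..n} \<Longrightarrow> y i = (\<Sum>j=1..d. A i j * \<beta> j) + \<epsilon> i"
    and \<beta>: "\<And>j. j \<in> {1..d} - S \<Longrightarrow> \<beta> j = 0"
    and noise: "\<And>j. j \<in> {1..d} \<Longrightarrow> \<bar>\<Sum>i=1..n. A i j * \<epsilon> i\<bar> \<le> real n * (lam / 4)"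
    and RE: "\<And>x. (\<Sum>j=1..d. \<bar>x j\<bar>)\<^sup>2 \<le> 16 * real (card S) * (\<Sum>j=1..d. (x j)\<^sup>2) \<Longrightarrow>
      \<kappa> * (\<Sum>j=1..d. (x j)\<^sup>2) \<le> (\<Sum>i=1..n. (\<Sum>j=1..d. A i j * x j)\<^sup>2) / real n"
  shows "(\<Sum>j=1..d. (b j - \<beta> j)\<^sup>2) \<le> (3 * lam / (2 * \<kappa>))\<^sup>2 * real (card S)"
    and "(\<Sum>j=1..d. \<bar>b j - \<beta> j\<bar>) \<le> 6 * lam * real (card S) / \<kappa>"
proof -
  define D where "D j = b j - \<beta> j" for j
  define AD where "AD i = (\<Sum>j=1..d. A i j * D j)" for i
  define s where "s = real (card S)"
  define D2 where "D2 = (\<Sum>j=1..d. (D j)\<^sup>2)"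
  define a where "a = (\<Sum>j\<in>S. \<bar>D j\<bar>)"
  define c where "c = (\<Sum>j\<in>{1..d}-S. \<bar>D j\<bar>)"
  have a0: "a \<ge> 0" and c0: "c \<ge> 0" and D20: "D2 \<ge> 0" and s0: "s \<ge> 0"
    by (auto simp: a_def c_def D2_def s_def intro: sum_nonneg)
  have split: "sum f {1..d} = sum f S + sum f ({1..d} - S)" for f :: "nat \<Rightarrow> real"
    using sum.subset_diff[OF S, of f] by simp
  have l1: "(\<Sum>j=1..d. \<bar>D j\<bar>) = a + c" unfolding a_def c_def by (rule split)
  have "lasso_obj n d lam y A b \<le> lasso_obj n d lam y A \<beta>"
    using lasso by (auto simp: is_lasso_def is_arg_min_def not_less)
  moreover have "(y i - (\<Sum>j=1..d. A i j * b j))\<^sup>2 = (\<epsilon> i)\<^sup>2 - 2 * (\<epsilon> i * AD i) + (AD i)\<^sup>2"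
    "(y i - (\<Sum>j=1..d. A i j * \<beta> j))\<^sup>2 = (\<epsilon> i)\<^sup>2" if "i \<in> {1..n}" for i
  proof -
    have "(\<Sum>j=1..d. A i j * b j) = (\<Sum>j=1..d. A i j * \<beta> j) + AD i"
      unfolding AD_def D_def sum.distrib[symmetric] by (intro sum.cong refl) (simp add: algebra_simps)
    then show "(y i - (\<Sum>j=1..d. A i j * b j))\<^sup>2 = (\<epsilon> i)\<^sup>2 - 2 * (\<epsilon> i * AD i) + (AD i)\<^sup>2"
      using y[OF that] by (simp add: power2_eq_square algebra_simps)
    show "(y i - (\<Sum>j=1..d. A i j * \<beta> j))\<^sup>2 = (\<epsilon> i)\<^sup>2" using y[OF that] by simp
  qed
  ultimately have "(\<Sum>i=1..n. (\<epsilon> i)\<^sup>2 - 2 * (\<epsilon> i * AD i) + (AD i)\<^sup>2) / real n + lam * (\<Sum>j=1..d. \<bar>b j\<bar>)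
      \<le> (\<Sum>i=1..n. (\<epsilon> i)\<^sup>2) / real n + lam * (\<Sum>j=1..d. \<bar>\<beta> j\<bar>)"
    by (simp add: lasso_obj_def)
  then have 1: "(\<Sum>i=1..n. (AD i)\<^sup>2) / real n
      \<le> 2 * (\<Sum>i=1..n. \<epsilon> i * AD i) / real n + lam * ((\<Sum>j=1..d. \<bar>\<beta> j\<bar>) - (\<Sum>j=1..d. \<bar>b j\<bar>))"
  proof -
    have "(\<Sum>i=1..n. (\<epsilon> i)\<^sup>2 - 2 * (\<epsilon> i * AD i) + (AD i)\<^sup>2)
        = (\<Sum>i=1..n. (\<epsilon> i)\<^sup>2) - 2 * (\<Sum>i=1..n. \<epsilon> i * AD i) + (\<Sum>i=1..n. (AD i)\<^sup>2)"
      unfolding sum.distrib sum_subtractf sum_distrib_left ..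
    moreover have "Q / N \<le> 2 * T / N + lam * (b1 - b2)"
      if "(S - 2 * T + Q) / N + lam * b2 \<le> S / N + lam * b1" for S T Q N b1 b2 :: real
      using that by (simp add: add_divide_distrib diff_divide_distrib right_diff_distrib)
    ultimately show ?thesis
      using \<open>(\<Sum>i=1..n. (\<epsilon> i)\<^sup>2 - 2 * (\<epsilon> i * AD i) + (AD i)\<^sup>2) / real n + lam * (\<Sum>j=1..d. \<bar>b j\<bar>) \<le> _\<close>
      by presburger
  qed
  have "(\<Sum>i=1..n. \<epsilon> i * AD i) = (\<Sum>j=1..d. D j * (\<Sum>i=1..n. A i j * \<epsilon> i))"
    unfolding AD_def sum_distrib_left
    by (subst sum.swap, rule sum.cong[OF refl], rule sum.cong[OF refl]) simp
  also have "\<dots> \<le> (\<Sum>j=1..d. \<bar>D j\<bar> * (real n * (lam / 4)))"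
  proof (rule sum_mono)
    fix j assume "j \<in> {1..d}"
    then have "\<bar>D j\<bar> * \<bar>\<Sum>i=1..n. A i j * \<epsilon> i\<bar> \<le> \<bar>D j\<bar> * (real n * (lam / 4))"
      by (intro mult_left_mono noise) auto
    then show "D j * (\<Sum>i=1..n. A i j * \<epsilon> i) \<le> \<bar>D j\<bar> * (real n * (lam / 4))"
      unfolding abs_mult[symmetric] by (rule order.trans[OF abs_ge_self])
  qed
  also have "\<dots> = (a + c) * (real n * (lam / 4))"
    by (simp only: l1 flip: sum_distrib_right)
  finally have 2: "2 * (\<Sum>i=1..n. \<epsilon> i * AD i) / real n \<le> (a + c) * lam / 2"
    using n by (simp add: field_simps)
  have "(\<Sum>j=1..d. \<bar>\<beta> j\<bar>) - (\<Sum>j=1..d. \<bar>b j\<bar>) = (\<Sum>j=1..d. \<bar>\<beta> j\<bar> - \<bar>b j\<bar>)"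
    by (simp add: sum_subtractf)
  also have "\<dots> \<le> a - c"
  proof -
    have "(\<Sum>j\<in>S. \<bar>\<beta> j\<bar> - \<bar>b j\<bar>) \<le> a"
      unfolding a_def by (rule sum_mono) (auto simp: D_def)
    moreover have "(\<Sum>j\<in>{1..d} - S. \<bar>\<beta> j\<bar> - \<bar>b j\<bar>) = - c"
      unfolding c_def sum_negf[symmetric] by (rule sum.cong) (auto simp: D_def \<beta>)
    ultimately show ?thesis unfolding split[of "\<lambda>j. \<bar>\<beta> j\<bar> - \<bar>b j\<bar>"] by linarith
  qed
  finally have "lam * ((\<Sum>j=1..d. \<bar>\<beta> j\<bar>) - (\<Sum>j=1..d. \<bar>b j\<bar>)) \<le> lam * (a - c)"
    using lam by simp
  with 1 2 have 3: "(\<Sum>i=1..n. (AD i)\<^sup>2) / real n \<le> lam * (3 / 2 * a - c / 2)"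
    by (simp add: field_simps)
  moreover have "(\<Sum>i=1..n. (AD i)\<^sup>2) / real n \<ge> 0" by (simp add: sum_nonneg)
  ultimately have "lam * (3 / 2 * a - c / 2) \<ge> 0" by linarith
  then have ca: "c \<le> 3 * a" using lam by (simp add: zero_le_mult_iff)
  have "a\<^sup>2 \<le> (\<Sum>j\<in>S. 1\<^sup>2) * (\<Sum>j\<in>S. \<bar>D j\<bar>\<^sup>2)"
    unfolding a_def using Cauchy_Schwarz_ineq_sum[of "\<lambda>_. 1" "\<lambda>j. \<bar>D j\<bar>" S] by simp
  also have "\<dots> \<le> s * D2"
    unfolding s_def D2_def using S by (auto intro!: mult_left_mono sum_mono2)
  finally have a2: "a\<^sup>2 \<le> s * D2" .
  have "(a + c)\<^sup>2 \<le> (4 * a)\<^sup>2" using ca a0 c0 by (intro power_mono) auto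
  then have "(\<Sum>j=1..d. \<bar>D j\<bar>)\<^sup>2 \<le> 16 * s * D2" using a2 by (simp add: l1 power_mult_distrib)
  then have "\<kappa> * D2 \<le> (\<Sum>i=1..n. (AD i)\<^sup>2) / real n"
    unfolding AD_def D2_def s_def by (intro RE) simp
  also have "\<dots> \<le> lam * (3 / 2 * a - c / 2)" by (rule 3)
  also have "\<dots> \<le> 3 / 2 * lam * a" using lam c0 by (simp add: algebra_simps)
  finally have "\<kappa> * D2 \<le> 3 / 2 * lam * a" .
  then have D2a: "D2 \<le> 3 * lam / (2 * \<kappa>) * a" using \<kappa> by (simp add: field_simps)
  define w where "w = 3 * lam / (2 * \<kappa>)"
  have w: "w > 0" using lam \<kappa> by (simp add: w_def)
  have "a\<^sup>2 \<le> s * (w * a)" using a2 mult_left_mono[OF D2a s0] by (simp add: w_def)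
  then have "a * a \<le> (s * w) * a" by (simp add: power2_eq_square)
  then have aw: "a \<le> s * w"
    by (cases "a = 0") (use a0 s0 w in \<open>auto simp: mult_le_cancel_right\<close>)
  have "D2 \<le> w * a" using D2a by (simp add: w_def)
  also have "\<dots> \<le> w * (s * w)" using aw w by simp
  finally show "(\<Sum>j=1..d. (b j - \<beta> j)\<^sup>2) \<le> (3 * lam / (2 * \<kappa>))\<^sup>2 * real (card S)"
    by (simp add: D2_def D_def s_def w_def power2_eq_square mult_ac)
  have "(\<Sum>j=1..d. \<bar>D j\<bar>) \<le> 4 * (s * w)" using l1 ca aw by linarith
  then show "(\<Sum>j=1..d. \<bar>b j - \<beta> j\<bar>) \<le> 6 * lam * real (card S) / \<kappa>"
    by (simp add: D_def s_def w_def mult_ac)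
qed

text \<open>Contrapositive of the first strength condition, applied to the set of missed
  signals.\<close>

lemma selected_fraction_ge:
  fixes \<beta> :: "nat \<Rightarrow> real"
  assumes "finite S" "card S > 0"
    and strength: "\<And>A. A \<subseteq> S \<Longrightarrow> real (card A) / real (card S) > 1 - \<gamma> \<Longrightarrow> (\<Sum>j\<in>A. \<bar>\<beta> j\<bar>) > \<tau>"
    and missed: "(\<Sum>j\<in>S - T. \<bar>\<beta> j\<bar>) \<le> \<tau>"
  shows "\<gamma> \<le> real (card (T \<inter> S)) / real (card S)"
proof -
  have "real (card (S - T)) / real (card S) \<le> 1 - \<gamma>"
    using strength[of "S - T"] missed by fastforce
  moreover have "card S = card (T \<inter> S) + card (S - T)"
    using card_Int_Diff[OF \<open>finite S\<close>, of T] by (simp add: Int_commute)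
  then have "real (card S) / real (card S)
      = real (card (T \<inter> S)) / real (card S) + real (card (S - T)) / real (card S)"
    by (metis add_divide_distrib of_nat_add)
  ultimately show ?thesis using assms(2) by simp
qed

text \<open>A signal outside the support has \<open>b j = 0\<close>, so its whole mass is estimation
  error.\<close>

lemma lasso_missed_le:
  fixes \<beta> b :: "nat \<Rightarrow> real"
  assumes "S \<subseteq> {1..p}" "(\<Sum>j=1..p. \<bar>b j - \<beta> j\<bar>) \<le> e1"
  shows "(\<Sum>j\<in>S - support p b. \<bar>\<beta> j\<bar>) \<le> e1"
proof -
  have "(\<Sum>j\<in>S - support p b. \<bar>\<beta> j\<bar>) \<le> (\<Sum>j\<in>S - support p b. \<bar>b j - \<beta> j\<bar>)"
    using assms(1) by (intro sum_mono) (auto simp: support_def)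
  also have "\<dots> \<le> (\<Sum>j=1..p. \<bar>b j - \<beta> j\<bar>)"
    using assms(1) by (intro sum_mono2) auto
  finally show ?thesis using assms(2) by simp
qed

text \<open>The threshold is a minimum, possibly infinite; the existential form removes both
  features and serves the counting argument as well as measurability.\<close>

lemma knockoff_select_iff:
  "j \<in> knockoff_select a q p W \<longleftrightarrow>
    j \<in> {1..p} \<and> (\<exists>t\<in>threshold_candidates a q p W. t \<le> W j)"
proof -
  have fin: "finite (threshold_candidates a q p W)"
    unfolding threshold_candidates_def
    by (rule finite_subset[of _ "(\<lambda>j. \<bar>W j\<bar>) ` {1..p}"]) auto
  show ?thesis
    by (cases "threshold_candidates a q p W = {}")
      (use fin in \<open>auto simp: knockoff_select_def threshold_def Min_le_iff\<close>)
qed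

text \<open>The smallest \<open>\<bar>W\<^sub>i\<bar> \<ge> t0\<close> need not be near \<open>t0\<close>, but no \<open>\<bar>W\<^sub>i\<bar>\<close> lies in between,
  so both counts in the ratio agree with those at \<open>t0\<close>.\<close>

lemma knockoff_selects_above:
  fixes W :: "nat \<Rightarrow> real"
  assumes t0: "t0 > 0" and q: "q > 0"
    and ratio: "real a - 1 + real (card {j \<in> {1..p}. W j \<le> - t0})
      \<le> q * real (card {j \<in> {1..p}. W j \<ge> t0})"
    and pos: "card {j \<in> {1..p}. W j \<ge> t0} > 0"
    and j: "j \<in> {1..p}" "W j \<ge> t0"
  shows "j \<in> knockoff_select a q p W"
proof -
  define V where "V = {v \<in> (\<lambda>j. \<bar>W j\<bar>) ` {1..p}. v \<ge> t0}"
  have finV: "finite V" by (simp add: V_def)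
  have jV: "\<bar>W j\<bar> \<in> V" using j t0 unfolding V_def by force
  then have V: "Min V \<in> V" using finV by (intro Min_in) auto
  have low: "Min V \<le> \<bar>W l\<bar>" if "l \<in> {1..p}" "\<bar>W l\<bar> \<ge> t0" for l
    using that finV by (intro Min_le) (auto simp: V_def)
  have ge: "Min V \<ge> t0" using V by (simp add: V_def)
  have iff: "W l \<le> - Min V \<longleftrightarrow> W l \<le> - t0" "W l \<ge> Min V \<longleftrightarrow> W l \<ge> t0" if "l \<in> {1..p}" for l
    using low[OF that] ge t0 by (cases "\<bar>W l\<bar> \<ge> t0"; linarith)+
  have eq1: "{l \<in> {1..p}. W l \<le> - Min V} = {l \<in> {1..p}. W l \<le> - t0}"
    by (intro Collect_cong conj_cong refl iff(1))
  have eq2: "{l \<in> {1..p}. W l \<ge> Min V} = {l \<in> {1..p}. W l \<ge> t0}"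
    by (intro Collect_cong conj_cong refl iff(2))
  have "(real a - 1 + real (card {l \<in> {1..p}. W l \<le> - Min V})) / max (real (card {l \<in> {1..p}. W l \<ge> Min V})) 1 \<le> q"
    unfolding eq1 eq2 using ratio pos by (subst max_absorb1) (auto simp: divide_le_eq mult.commute)
  moreover have "Min V \<in> (\<lambda>j. \<bar>W j\<bar>) ` {1..p} - {0}" using V t0 by (simp add: V_def)
  ultimately have "Min V \<in> threshold_candidates a q p W" unfolding threshold_candidates_def by blast
  moreover have "Min V \<le> W j" using low[OF j(1)] j t0 by simp
  ultimately show ?thesis using j(1) by (auto simp: knockoff_select_iff)
qed

text \<open>The ratio test at \<open>t0\<close> has a budget of q C2 s, since all strong signals
  have W j \<ge> t0 (they exceed \<open>t0\<close> by two coordinate errors of at most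
  \<open>e2\<close>). Half of the budget pays for the very negative W j, half for the offset a - 1.
  A missed signal then has W j < t0, which bounds its mass by its own errors plus
  \<open>t0\<close>.\<close>

lemma knockoff_missed_le:
  fixes \<beta> b :: "nat \<Rightarrow> real"
  assumes S: "S \<subseteq> {1..p}"
    and e1: "(\<Sum>j=1..2*p. \<bar>b j - (if j \<le> p then \<beta> j else 0)\<bar>) \<le> e1"
    and e2: "(\<Sum>j=1..2*p. (b j - (if j \<le> p then \<beta> j else 0))\<^sup>2) \<le> e2\<^sup>2" "e2 \<ge> 0"
    and a: "a \<in> {1,2}" and q: "q > 0" and t0: "t0 > 0"
    and S2: "S2 \<subseteq> {1..p}" "\<And>j. j \<in> S2 \<Longrightarrow> \<bar>\<beta> j\<bar> \<ge> t0 + 2 * e2"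
    and card: "real (card S2) \<ge> C2 * s" "s > 0" "2 / (q * s) < C2"
    and few: "e1 / t0 \<le> q * C2 * s / 2"
  shows "(\<Sum>j\<in>S - knockoff_select a q p (lcd p b). \<bar>\<beta> j\<bar>) \<le> e1 + real (card S) * t0"
proof -
  define W where "W = lcd p b"
  have shift: "(\<Sum>j=1..2*p. f j) = (\<Sum>j=1..p. f j) + (\<Sum>j=1..p. f (p + j))" for f :: "nat \<Rightarrow> real"
  proof -
    have "{1..2*p} = {1..p} \<union> {p+1..p+p}" by auto
    then have "(\<Sum>j=1..2*p. f j) = (\<Sum>j=1..p. f j) + (\<Sum>j=p+1..p+p. f j)"
      by (simp add: sum.union_disjoint)
    also have "(\<Sum>j=p+1..p+p. f j) = (\<Sum>j=1..p. f (p + j))"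
      using sum.shift_bounds_cl_nat_ivl[of f 1 p p] by (simp add: add.commute)
    finally show ?thesis .
  qed
  have e1': "(\<Sum>j=1..p. \<bar>b j - \<beta> j\<bar>) + (\<Sum>j=1..p. \<bar>b (p + j)\<bar>) \<le> e1"
  proof -
    have "(\<Sum>j=1..p. \<bar>b (p + j) - (if p + j \<le> p then \<beta> (p + j) else 0)\<bar>) = (\<Sum>j=1..p. \<bar>b (p + j)\<bar>)"
      by (intro sum.cong) auto
    moreover have "(\<Sum>j=1..p. \<bar>b j - (if j \<le> p then \<beta> j else 0)\<bar>) = (\<Sum>j=1..p. \<bar>b j - \<beta> j\<bar>)"
      by (intro sum.cong) auto
    ultimately show ?thesis using e1 unfolding shift by linarith
  qed
  define D where "D j = b j - (if j \<le> p then \<beta> j else 0)" for j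
  have e2': "\<bar>D j\<bar> \<le> e2" if "j \<in> {1..2*p}" for j
  proof -
    have "(D j)\<^sup>2 \<le> (\<Sum>j=1..2*p. (D j)\<^sup>2)" by (rule member_le_sum) (use that in auto)
    also have "\<dots> \<le> e2\<^sup>2" using e2(1) by (simp only: D_def)
    finally show ?thesis using e2(2) by (simp add: abs_le_square_iff[of "D j" e2, symmetric])
  qed
  have big: "W j \<ge> t0" if "j \<in> S2" for j
  proof -
    have "j \<in> {1..p}" using that S2 by auto
    then have "\<bar>b j - \<beta> j\<bar> \<le> e2" "\<bar>b (p + j)\<bar> \<le> e2"
      using e2'[of j] e2'[of "p + j"] by (auto simp: D_def)
    then show ?thesis using S2(2)[OF that] by (simp add: W_def lcd_def)
  qed
  have many: "real (card S2) \<le> real (card {j \<in> {1..p}. W j \<ge> t0})"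
  proof -
    have "S2 \<subseteq> {j \<in> {1..p}. W j \<ge> t0}" using big S2(1) by blast
    then show ?thesis by (simp add: card_mono)
  qed
  \<comment> \<open>Here the lower bound 2/(q s) on \<open>C2\<close> enters: half of the budget
    exceeds 1, the offset of the second threshold.\<close>
  have C2s: "q * (C2 * s) > 2" using card(2,3) q by (simp add: field_simps)
  \<comment> \<open>W j \<le> - t0 forces \<bar>b (p + j)\<bar> \<ge> t0, and the true knockoff
    coefficients are 0, so the number of such j is at most the l1 error divided by
    \<open>t0\<close>.\<close>
  have "real (card {j \<in> {1..p}. W j \<le> - t0}) * t0 = (\<Sum>j\<in>{j \<in> {1..p}. W j \<le> - t0}. t0)" by simp
  also have "\<dots> \<le> (\<Sum>j\<in>{j \<in> {1..p}. W j \<le> - t0}. \<bar>b (p + j)\<bar>)"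
    by (intro sum_mono) (auto simp: W_def lcd_def)
  also have "\<dots> \<le> (\<Sum>j=1..p. \<bar>b (p + j)\<bar>)" by (intro sum_mono2) auto
  also have "\<dots> \<le> e1"
  proof -
    have "0 \<le> (\<Sum>j=1..p. \<bar>b j - \<beta> j\<bar>)" by (simp add: sum_nonneg)
    then show ?thesis using e1' by linarith
  qed
  finally have "real (card {j \<in> {1..p}. W j \<le> - t0}) \<le> e1 / t0" using t0 by (simp add: field_simps)
  also have "\<dots> \<le> q * (C2 * s) / 2" using few by (simp only: mult.assoc)
  finally have 1: "real (card {j \<in> {1..p}. W j \<le> - t0}) \<le> q * (C2 * s) / 2" .
  have "real a - 1 \<le> q * (C2 * s) / 2"
  proof -
    have "real a \<le> 2" using a by auto
    then show ?thesis using C2s by linarith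
  qed
  with 1 have "real a - 1 + real (card {j \<in> {1..p}. W j \<le> - t0}) \<le> q * (C2 * s)" by linarith
  also have "\<dots> \<le> q * real (card {j \<in> {1..p}. W j \<ge> t0})"
    using card(1) many q by (intro mult_left_mono) auto
  finally have ratio: "real a - 1 + real (card {j \<in> {1..p}. W j \<le> - t0})
      \<le> q * real (card {j \<in> {1..p}. W j \<ge> t0})" .
  have "C2 * s > 0" using C2s q by (smt (verit) mult_nonneg_nonpos)
  then have "real (card {j \<in> {1..p}. W j \<ge> t0}) > 0" using many card(1) by linarith
  then have pos: "card {j \<in> {1..p}. W j \<ge> t0} > 0" by simp
  have sub: "W j < t0" if "j \<in> S - knockoff_select a q p W" for j
  proof (rule ccontr)
    assume "\<not> W j < t0"
    moreover have "j \<in> {1..p}" using that S by blast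
    ultimately have "j \<in> knockoff_select a q p W"
      using knockoff_selects_above[OF t0 q ratio pos, of j] by simp
    then show False using that by simp
  qed
  have "(\<Sum>j\<in>S - knockoff_select a q p W. \<bar>\<beta> j\<bar>)
      \<le> (\<Sum>j\<in>S - knockoff_select a q p W. (\<bar>b j - \<beta> j\<bar> + \<bar>b (p + j)\<bar>) + t0)"
  proof (rule sum_mono)
    fix j assume "j \<in> S - knockoff_select a q p W"
    then have "\<bar>b j\<bar> - \<bar>b (p + j)\<bar> < t0" using sub by (simp add: W_def lcd_def)
    moreover have "\<bar>\<beta> j\<bar> \<le> \<bar>b j - \<beta> j\<bar> + \<bar>b j\<bar>" by linarith
    moreover have "z \<le> (w + y) + t" if "x - y < t" "z \<le> w + x" for w x y z t :: real
      using that by linarith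
    ultimately show "\<bar>\<beta> j\<bar> \<le> (\<bar>b j - \<beta> j\<bar> + \<bar>b (p + j)\<bar>) + t0" by blast
  qed
  also have "\<dots> \<le> (\<Sum>j\<in>S. (\<bar>b j - \<beta> j\<bar> + \<bar>b (p + j)\<bar>) + t0)"
    using S t0 finite_subset[OF S] by (intro sum_mono2) auto
  also have "\<dots> = (\<Sum>j\<in>S. \<bar>b j - \<beta> j\<bar> + \<bar>b (p + j)\<bar>) + real (card S) * t0"
    by (simp add: sum.distrib)
  finally have f1: "(\<Sum>j\<in>S - knockoff_select a q p W. \<bar>\<beta> j\<bar>)
      \<le> (\<Sum>j\<in>S. \<bar>b j - \<beta> j\<bar> + \<bar>b (p + j)\<bar>) + real (card S) * t0" .
  have f2: "(\<Sum>j\<in>S. \<bar>b j - \<beta> j\<bar> + \<bar>b (p + j)\<bar>) \<le> (\<Sum>j=1..p. \<bar>b j - \<beta> j\<bar> + \<bar>b (p + j)\<bar>)"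
    using S by (intro sum_mono2) auto
  have f3: "(\<Sum>j=1..p. \<bar>b j - \<beta> j\<bar> + \<bar>b (p + j)\<bar>) \<le> e1"
    using e1' by (simp only: sum.distrib)
  from order.trans[OF f1 add_right_mono[OF order.trans[OF f2 f3]]] show ?thesis unfolding W_def .
qed

section \<open>Truncated singular value decomposition\<close>

text \<open>The entries \<open>y i\<close> may be vectors: with real values this is Pythagoras for
  one column, with values in \<open>real^'r\<close> it treats all columns of the factor matrix at
  once.\<close>

lemma orthonormal_projection:
  fixes u :: "'i \<Rightarrow> 'k \<Rightarrow> real" and y :: "'i \<Rightarrow> 'a::real_inner"
  assumes "finite K"
    and on: "\<And>k l. k \<in> K \<Longrightarrow> l \<in> K \<Longrightarrow> (\<Sum>i\<in>I. u i k * u i l) = (if k = l then 1 else 0)"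
    and c: "\<And>k. k \<in> K \<Longrightarrow> c k = (\<Sum>i\<in>I. u i k *\<^sub>R y i)"
  shows "(\<Sum>i\<in>I. (norm (y i - (\<Sum>k\<in>K. u i k *\<^sub>R c k)))\<^sup>2) = (\<Sum>i\<in>I. (norm (y i))\<^sup>2) - (\<Sum>k\<in>K. (norm (c k))\<^sup>2)"
    and "(\<Sum>i\<in>I. (norm (\<Sum>k\<in>K. u i k *\<^sub>R b k))\<^sup>2) = (\<Sum>k\<in>K. (norm (b k :: 'a))\<^sup>2)"
proof -
  have par: "(\<Sum>i\<in>I. (norm (\<Sum>k\<in>K. u i k *\<^sub>R b k))\<^sup>2) = (\<Sum>k\<in>K. (norm (b k :: 'a))\<^sup>2)" for b
  proof -
    have "(\<Sum>i\<in>I. (norm (\<Sum>k\<in>K. u i k *\<^sub>R b k))\<^sup>2)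
        = (\<Sum>i\<in>I. \<Sum>k\<in>K. \<Sum>l\<in>K. (u i k * u i l) * (b k \<bullet> b l))"
      unfolding power2_norm_eq_inner inner_sum_left inner_sum_right by (simp add: mult_ac inner_commute)
    also have "\<dots> = (\<Sum>k\<in>K. \<Sum>l\<in>K. \<Sum>i\<in>I. (u i k * u i l) * (b k \<bullet> b l))"
      by (subst sum.swap, rule sum.cong[OF refl], rule sum.swap)
    also have "\<dots> = (\<Sum>k\<in>K. \<Sum>l\<in>K. (if k = l then 1 else 0) * (b k \<bullet> b l))"
      unfolding sum_distrib_right[symmetric] using on by (intro sum.cong refl) simp
    also have "\<dots> = (\<Sum>k\<in>K. b k \<bullet> b k)"
      using assms(1) by (intro sum.cong refl) (simp add: if_distrib[of "\<lambda>z. z * _"] cong: if_cong)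
    finally show ?thesis by (simp add: power2_norm_eq_inner)
  qed
  then show "(\<Sum>i\<in>I. (norm (\<Sum>k\<in>K. u i k *\<^sub>R b k))\<^sup>2) = (\<Sum>k\<in>K. (norm (b k :: 'a))\<^sup>2)" .
  have "(\<Sum>i\<in>I. y i \<bullet> (\<Sum>k\<in>K. u i k *\<^sub>R c k)) = (\<Sum>i\<in>I. \<Sum>k\<in>K. (u i k *\<^sub>R y i) \<bullet> c k)"
    by (simp add: inner_sum_right)
  also have "\<dots> = (\<Sum>k\<in>K. \<Sum>i\<in>I. (u i k *\<^sub>R y i) \<bullet> c k)" by (rule sum.swap)
  also have "\<dots> = (\<Sum>k\<in>K. c k \<bullet> c k)"
    by (intro sum.cong refl) (simp add: c inner_sum_left)
  finally have cross: "(\<Sum>i\<in>I. y i \<bullet> (\<Sum>k\<in>K. u i k *\<^sub>R c k)) = (\<Sum>k\<in>K. (norm (c k))\<^sup>2)"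
    by (simp add: power2_norm_eq_inner)
  have "(norm (y i - (\<Sum>k\<in>K. u i k *\<^sub>R c k)))\<^sup>2
      = (norm (y i))\<^sup>2 - 2 * (y i \<bullet> (\<Sum>k\<in>K. u i k *\<^sub>R c k)) + (norm (\<Sum>k\<in>K. u i k *\<^sub>R c k))\<^sup>2" for i
    by (simp add: power2_norm_eq_inner inner_diff_left inner_diff_right inner_commute)
  then have "(\<Sum>i\<in>I. (norm (y i - (\<Sum>k\<in>K. u i k *\<^sub>R c k)))\<^sup>2)
      = (\<Sum>i\<in>I. (norm (y i))\<^sup>2) - 2 * (\<Sum>i\<in>I. y i \<bullet> (\<Sum>k\<in>K. u i k *\<^sub>R c k)) + (\<Sum>i\<in>I. (norm (\<Sum>k\<in>K. u i k *\<^sub>R c k))\<^sup>2)"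
    by (simp add: sum.distrib sum_subtractf sum_distrib_left)
  then show "(\<Sum>i\<in>I. (norm (y i - (\<Sum>k\<in>K. u i k *\<^sub>R c k)))\<^sup>2) = (\<Sum>i\<in>I. (norm (y i))\<^sup>2) - (\<Sum>k\<in>K. (norm (c k))\<^sup>2)"
    unfolding cross par by simp
qed

lemma Bessel:
  fixes u :: "'i \<Rightarrow> 'k \<Rightarrow> real" and y :: "'i \<Rightarrow> 'a::real_inner"
  assumes "finite K"
    and "\<And>k l. k \<in> K \<Longrightarrow> l \<in> K \<Longrightarrow> (\<Sum>i\<in>I. u i k * u i l) = (if k = l then 1 else 0)"
  shows "(\<Sum>k\<in>K. (norm (\<Sum>i\<in>I. u i k *\<^sub>R y i))\<^sup>2) \<le> (\<Sum>i\<in>I. (norm (y i))\<^sup>2)"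
proof -
  define c where "c k = (\<Sum>i\<in>I. u i k *\<^sub>R y i)" for k
  have "0 \<le> (\<Sum>i\<in>I. (norm (y i - (\<Sum>k\<in>K. u i k *\<^sub>R c k)))\<^sup>2)" by (simp add: sum_nonneg)
  also have "\<dots> = (\<Sum>i\<in>I. (norm (y i))\<^sup>2) - (\<Sum>k\<in>K. (norm (c k))\<^sup>2)"
    by (rule orthonormal_projection(1)) (use assms in \<open>auto simp: c_def\<close>)
  finally show ?thesis by (simp add: c_def)
qed

text \<open>Used to combine r + 1 right singular vectors into one that annihilates the loadings.
  Linear dependence is a property of the image set, so a repeated value of \<open>w\<close> is
  treated separately, with coefficients 1 and -1 at the two equal values.\<close>

lemma nontrivial_relation:
  fixes w :: "nat \<Rightarrow> 'a::euclidean_space"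
  assumes K: "finite K" "card K > DIM('a)"
  shows "\<exists>b. (\<exists>k\<in>K. b k \<noteq> 0) \<and> (\<Sum>k\<in>K. b k *\<^sub>R w k) = 0"
proof (cases "inj_on w K")
  case True
  then have "dependent (w ` K)"
    using K by (intro dependent_biggerset) (simp add: card_image)
  then obtain u where u: "\<exists>v\<in>w ` K. u v \<noteq> 0" "(\<Sum>v\<in>w ` K. u v *\<^sub>R v) = 0"
    using dependent_finite[of "w ` K"] K(1) by auto
  then show ?thesis
    using True by (intro exI[of _ "u \<circ> w"]) (auto simp: sum.reindex)
next
  case False
  then obtain k l where kl: "k \<in> K" "l \<in> K" "k \<noteq> l" "w k = w l" by (auto simp: inj_on_def)
  define b where "b i = (if i = k then 1 else 0) - (if i = l then 1 else (0::real))" for i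
  have "(\<Sum>i\<in>K. b i *\<^sub>R w i) = (\<Sum>i\<in>K. if i = k then w i else 0) - (\<Sum>i\<in>K. if i = l then w i else 0)"
    unfolding sum_subtractf[symmetric] by (intro sum.cong) (auto simp: b_def)
  also have "\<dots> = 0" using kl K by simp
  finally show ?thesis using kl by (intro exI[of _ b]) (auto simp: b_def)
qed

text \<open>Provides the test vector in the lower bound for the r-th singular value: the r - 1
  earlier directions cannot exhaust an r-dimensional space.\<close>

lemma nonzero_orthogonal:
  fixes w :: "nat \<Rightarrow> 'a::euclidean_space"
  assumes K: "finite K" "card K < DIM('a)"
  shows "\<exists>c. c \<noteq> 0 \<and> (\<forall>k\<in>K. w k \<bullet> c = 0)"
proof -
  have "dim (w ` K) \<le> card (w ` K)" using K by (intro dim_le_card') auto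
  also have "\<dots> \<le> card K" using K by (intro card_image_le)
  finally have "dim (w ` K) < DIM('a)" using K by simp
  then obtain c where "c \<noteq> 0" "\<And>y. y \<in> span (w ` K) \<Longrightarrow> orthogonal c y"
    using orthogonal_to_subspace_exists by blast
  then have "w k \<bullet> c = 0" if "k \<in> K" for k
    using that by (metis imageI inner_commute orthogonal_def span_base)
  with \<open>c \<noteq> 0\<close> show ?thesis by blast
qed

lemma power2_sum_le: "(a + b)\<^sup>2 \<le> 2 * a\<^sup>2 + 2 * (b::real)\<^sup>2"
  using zero_le_power2[of "a - b"] by (simp add: power2_eq_square algebra_simps)

lemma L2_set_diff_le: "L2_set (\<lambda>i. f i - g i) A \<le> L2_set f A + L2_set g A"
  using L2_set_triangle_ineq[of f "\<lambda>i. - g i" A] by (simp add: L2_set_def)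

section \<open>Norms and truncation of a thin singular value decomposition\<close>

locale thin_svd =
  fixes n p :: nat and X U :: "nat \<Rightarrow> nat \<Rightarrow> real" and d :: "nat \<Rightarrow> real" and V :: "nat \<Rightarrow> nat \<Rightarrow> real"
  assumes svd: "svd n p X U d V"
begin

abbreviation "mn \<equiv> min n p"

lemma X_eq: "i \<in> {1..n} \<Longrightarrow> j \<in> {1..p} \<Longrightarrow> X i j = (\<Sum>k=1..mn. U i k * d k * V j k)"
  and U_on: "k \<in> {1..mn} \<Longrightarrow> l \<in> {1..mn} \<Longrightarrow> (\<Sum>i=1..n. U i k * U i l) = (if k = l then 1 else 0)"
  and V_on: "k \<in> {1..mn} \<Longrightarrow> l \<in> {1..mn} \<Longrightarrow> (\<Sum>j=1..p. V j k * V j l) = (if k = l then 1 else 0)"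
  and d_nonneg: "k \<in> {1..mn} \<Longrightarrow> d k \<ge> 0"
  and d_mono: "k \<in> {1..mn} \<Longrightarrow> l \<in> {1..mn} \<Longrightarrow> k \<le> l \<Longrightarrow> d l \<le> d k"
  using svd unfolding svd_def by blast+

lemma X_V:
  assumes "i \<in> {1..n}" "k \<in> {1..mn}"
  shows "(\<Sum>j=1..p. X i j * V j k) = d k * U i k"
proof -
  have "(\<Sum>j=1..p. X i j * V j k) = (\<Sum>j=1..p. \<Sum>l=1..mn. (U i l * d l) * (V j l * V j k))"
    using assms by (intro sum.cong refl) (simp add: X_eq sum_distrib_left sum_distrib_right mult_ac)
  also have "\<dots> = (\<Sum>l=1..mn. (U i l * d l) * (\<Sum>j=1..p. V j l * V j k))"
    unfolding sum_distrib_left by (rule sum.swap)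
  also have "\<dots> = (\<Sum>l=1..mn. if l = k then U i l * d l else 0)"
    by (rule sum.cong[OF refl]) (use assms V_on in auto)
  also have "\<dots> = d k * U i k" using assms by simp
  finally show ?thesis .
qed

lemma U_X:
  assumes "j \<in> {1..p}" "k \<in> {1..mn}"
  shows "(\<Sum>i=1..n. U i k * X i j) = d k * V j k"
proof -
  have "(\<Sum>i=1..n. U i k * X i j) = (\<Sum>i=1..n. \<Sum>l=1..mn. (d l * V j l) * (U i k * U i l))"
    using assms by (intro sum.cong refl) (simp add: X_eq sum_distrib_left mult_ac)
  also have "\<dots> = (\<Sum>l=1..mn. (d l * V j l) * (\<Sum>i=1..n. U i k * U i l))"
    unfolding sum_distrib_left by (rule sum.swap)
  also have "\<dots> = (\<Sum>l=1..mn. if l = k then d l * V j l else 0)"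
    by (rule sum.cong[OF refl]) (use assms U_on in auto)
  also have "\<dots> = d k * V j k" using assms by simp
  finally show ?thesis .
qed

lemma norm_X_mult:
  "(\<Sum>i=1..n. (\<Sum>j=1..p. X i j * z j)\<^sup>2) = (\<Sum>k=1..mn. (d k)\<^sup>2 * (\<Sum>j=1..p. V j k * z j)\<^sup>2)"
proof -
  have "(\<Sum>j=1..p. X i j * z j) = (\<Sum>k=1..mn. U i k *\<^sub>R (d k * (\<Sum>j=1..p. V j k * z j)))" if "i \<in> {1..n}" for i
  proof -
    have "(\<Sum>j=1..p. X i j * z j) = (\<Sum>j=1..p. \<Sum>k=1..mn. U i k * (d k * (V j k * z j)))"
      using that by (intro sum.cong refl) (simp add: X_eq sum_distrib_left sum_distrib_right mult_ac)
    also have "\<dots> = (\<Sum>k=1..mn. \<Sum>j=1..p. U i k * (d k * (V j k * z j)))" by (rule sum.swap)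
    finally show ?thesis by (simp add: sum_distrib_left)
  qed
  then have "(\<Sum>i=1..n. (\<Sum>j=1..p. X i j * z j)\<^sup>2)
      = (\<Sum>i=1..n. (norm (\<Sum>k=1..mn. U i k *\<^sub>R (d k * (\<Sum>j=1..p. V j k * z j))))\<^sup>2)"
    by (intro sum.cong) auto
  also have "\<dots> = (\<Sum>k=1..mn. (norm (d k * (\<Sum>j=1..p. V j k * z j)))\<^sup>2)"
    by (rule orthonormal_projection(2)) (use U_on in auto)
  finally show ?thesis by (simp add: power_mult_distrib)
qed

lemma singular_value_square_le:
  assumes "k \<in> {1..mn}"
  shows "(d k)\<^sup>2 \<le> (\<Sum>i=1..n. \<Sum>j=1..p. (X i j)\<^sup>2)"
proof -
  have "(d k)\<^sup>2 = (d k)\<^sup>2 * (\<Sum>i=1..n. U i k * U i k)" using U_on[OF assms assms] by simp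
  also have "\<dots> = (\<Sum>i=1..n. (\<Sum>j=1..p. X i j * V j k)\<^sup>2)"
    unfolding sum_distrib_left using assms by (intro sum.cong refl, subst X_V) (auto simp: power2_eq_square)
  also have "\<dots> \<le> (\<Sum>i=1..n. (\<Sum>j=1..p. (X i j)\<^sup>2) * (\<Sum>j=1..p. (V j k)\<^sup>2))"
    by (intro sum_mono Cauchy_Schwarz_ineq_sum)
  also have "(\<Sum>j=1..p. (V j k)\<^sup>2) = 1" using V_on[OF assms assms] by (simp add: power2_eq_square)
  finally show ?thesis by simp
qed

lemma scaled_left_le:
  assumes "i \<in> {1..n}" "k \<in> {1..mn}"
  shows "(d k * U i k)\<^sup>2 \<le> (\<Sum>j=1..p. (X i j)\<^sup>2)"
proof -
  have "(d k * U i k)\<^sup>2 \<le> (\<Sum>j=1..p. (X i j)\<^sup>2) * (\<Sum>j=1..p. (V j k)\<^sup>2)"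
    unfolding X_V[OF assms, symmetric] by (rule Cauchy_Schwarz_ineq_sum)
  also have "(\<Sum>j=1..p. (V j k)\<^sup>2) = 1" using V_on[OF assms(2) assms(2)] by (simp add: power2_eq_square)
  finally show ?thesis by simp
qed

lemma scaled_right_le:
  assumes "j \<in> {1..p}" "k \<in> {1..mn}"
  shows "(d k * V j k)\<^sup>2 \<le> (\<Sum>i=1..n. (X i j)\<^sup>2)"
proof -
  have "(d k * V j k)\<^sup>2 \<le> (\<Sum>i=1..n. (U i k)\<^sup>2) * (\<Sum>i=1..n. (X i j)\<^sup>2)"
    unfolding U_X[OF assms, symmetric] by (rule Cauchy_Schwarz_ineq_sum)
  also have "(\<Sum>i=1..n. (U i k)\<^sup>2) = 1" using U_on[OF assms(2) assms(2)] by (simp add: power2_eq_square)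
  finally show ?thesis by simp
qed

definition "trunc r i j = (\<Sum>k=1..r. U i k * d k * V j k)"

text \<open>Since d V = X'U, a column of the truncation is the projection of the column of
  \<open>X\<close> onto the leading left singular vectors.\<close>

lemma trunc_column_le:
  assumes "r \<le> mn" "j \<in> {1..p}"
  shows "(\<Sum>i=1..n. (trunc r i j)\<^sup>2) \<le> (\<Sum>i=1..n. (X i j)\<^sup>2)"
proof -
  have "(\<Sum>i=1..n. (trunc r i j)\<^sup>2) = (\<Sum>i=1..n. (norm (\<Sum>k=1..r. U i k *\<^sub>R (d k * V j k)))\<^sup>2)"
    by (simp add: trunc_def mult.assoc)
  also have "\<dots> = (\<Sum>k=1..r. (norm (d k * V j k))\<^sup>2)"
    by (rule orthonormal_projection(2)) (use U_on assms in auto)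
  also have "\<dots> = (\<Sum>k=1..r. (norm (\<Sum>i=1..n. U i k *\<^sub>R X i j))\<^sup>2)"
    using assms by (intro sum.cong refl) (simp add: U_X)
  also have "\<dots> \<le> (\<Sum>i=1..n. (norm (X i j))\<^sup>2)"
    by (rule Bessel) (use U_on assms in auto)
  finally show ?thesis by simp
qed

text \<open>Writing U d V as (d U)(d V) / d, the two factors are bounded by a row norm and a column
  norm of \<open>X\<close>. With these of order sqrt p and sqrt n, and d of order sqrt (n p), the
  entries of the truncation stay bounded.\<close>

lemma trunc_entry_le:
  assumes r: "r \<le> mn" and i: "i \<in> {1..n}" and j: "j \<in> {1..p}" and b: "b > 0" "\<And>k. k \<in> {1..r} \<Longrightarrow> d k \<ge> b"
    and a1: "(\<Sum>j=1..p. (X i j)\<^sup>2) \<le> a1\<^sup>2" "a1 \<ge> 0" and a2: "(\<Sum>i=1..n. (X i j)\<^sup>2) \<le> a2\<^sup>2" "a2 \<ge> 0"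
  shows "\<bar>trunc r i j\<bar> \<le> real r * (a1 * a2 / b)"
proof -
  have "\<bar>U i k * d k * V j k\<bar> \<le> a1 * a2 / b" if k: "k \<in> {1..r}" for k
  proof -
    have kmn: "k \<in> {1..mn}" using k r by auto
    have "(d k * U i k)\<^sup>2 \<le> a1\<^sup>2" using scaled_left_le[OF i kmn] a1(1) by linarith
    then have 1: "\<bar>d k * U i k\<bar> \<le> a1" using a1(2) abs_le_square_iff[of "d k * U i k" a1] by simp
    have "(d k * V j k)\<^sup>2 \<le> a2\<^sup>2" using scaled_right_le[OF j kmn] a2(1) by linarith
    then have 2: "\<bar>d k * V j k\<bar> \<le> a2" using a2(2) abs_le_square_iff[of "d k * V j k" a2] by simp
    have dk: "d k > 0" using b(1) b(2)[OF k] by linarith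
    have "\<bar>U i k * d k * V j k\<bar> = \<bar>d k * U i k\<bar> * \<bar>d k * V j k\<bar> / d k"
      using dk by (simp add: abs_mult)
    also have "\<dots> \<le> a1 * a2 / d k"
      using dk a1(2) by (intro divide_right_mono mult_mono 1 2) auto
    also have "\<dots> \<le> a1 * a2 / b"
      using b(1) b(2)[OF k] a1(2) a2(2) by (intro divide_left_mono mult_nonneg_nonneg) auto
    finally show ?thesis .
  qed
  then have "(\<Sum>k=1..r. \<bar>U i k * d k * V j k\<bar>) \<le> (\<Sum>k=1..r. a1 * a2 / b)" by (rule sum_mono)
  then show ?thesis unfolding trunc_def by (intro order.trans[OF sum_abs]) simp
qed

end

text \<open>The entries of \<open>X (X' X)\<^sup>m\<close>: they are polynomials in the entries of \<open>X\<close> and the matrices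
  share the singular vectors of \<open>X\<close>.\<close>

fun odd_power :: "nat \<Rightarrow> nat \<Rightarrow> (nat \<Rightarrow> nat \<Rightarrow> real) \<Rightarrow> nat \<Rightarrow> nat \<Rightarrow> nat \<Rightarrow> real" where
  "odd_power n p X 0 i j = X i j"
| "odd_power n p X (Suc m) i j = (\<Sum>i'=1..n. (\<Sum>j'=1..p. X i j' * X i' j') * odd_power n p X m i' j)"

context thin_svd begin

lemma gram_eq:
  assumes "i \<in> {1..n}" "i' \<in> {1..n}"
  shows "(\<Sum>j=1..p. X i j * X i' j) = (\<Sum>k=1..mn. (d k)\<^sup>2 * U i k * U i' k)"
proof -
  have "(\<Sum>j=1..p. X i j * X i' j) = (\<Sum>j=1..p. \<Sum>k=1..mn. U i' k * d k * (X i j * V j k))"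
    using assms by (intro sum.cong refl) (simp add: X_eq[of i'] sum_distrib_left mult_ac)
  also have "\<dots> = (\<Sum>k=1..mn. \<Sum>j=1..p. U i' k * d k * (X i j * V j k))" by (rule sum.swap)
  also have "\<dots> = (\<Sum>k=1..mn. (d k)\<^sup>2 * U i k * U i' k)"
    unfolding sum_distrib_left[symmetric]
    using assms by (intro sum.cong refl, subst X_V) (auto simp: power2_eq_square)
  finally show ?thesis .
qed

lemma odd_power_eq:
  "i \<in> {1..n} \<Longrightarrow> j \<in> {1..p} \<Longrightarrow> odd_power n p X m i j = (\<Sum>k=1..mn. U i k * d k * ((d k)\<^sup>2) ^ m * V j k)"
proof (induction m arbitrary: i)
  case 0 then show ?case by (simp add: X_eq)
next
  case (Suc m)
  have "odd_power n p X (Suc m) i j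
      = (\<Sum>i'=1..n. \<Sum>k=1..mn. \<Sum>l=1..mn. ((d k)\<^sup>2 * U i k * d l * ((d l)\<^sup>2) ^ m * V j l) * (U i' k * U i' l))"
    unfolding odd_power.simps using Suc
    by (intro sum.cong refl) (simp add: gram_eq sum_product mult_ac)
  also have "\<dots> = (\<Sum>k=1..mn. \<Sum>l=1..mn. \<Sum>i'=1..n. ((d k)\<^sup>2 * U i k * d l * ((d l)\<^sup>2) ^ m * V j l) * (U i' k * U i' l))"
    by (subst sum.swap, rule sum.cong[OF refl], rule sum.swap)
  also have "\<dots> = (\<Sum>k=1..mn. \<Sum>l=1..mn. if k = l then (d k)\<^sup>2 * U i k * d l * ((d l)\<^sup>2) ^ m * V j l else 0)"
    unfolding sum_distrib_left[symmetric] by (intro sum.cong refl) (use U_on in auto)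
  also have "\<dots> = (\<Sum>k=1..mn. U i k * d k * ((d k)\<^sup>2) ^ Suc m * V j k)"
    by (intro sum.cong refl) (simp add: mult_ac)
  finally show ?case .
qed

text \<open>Functional calculus by hand: an odd polynomial in \<open>X\<close> acts on the singular
  values alone. Coefficients approximating the indicator of the leading squared singular values
  therefore reproduce the truncation, whichever decomposition was chosen.\<close>

lemma spectral_polynomial_tendsto:
  assumes r: "r \<le> mn" and i: "i \<in> {1..n}" and j: "j \<in> {1..p}"
    and top: "\<And>k. k \<in> {1..r} \<Longrightarrow> (\<lambda>t. \<Sum>m\<le>N t. c t m * ((d k)\<^sup>2) ^ m) \<longlonglongrightarrow> 1"
    and bot: "\<And>k. k \<in> {r+1..mn} \<Longrightarrow> (\<lambda>t. \<Sum>m\<le>N t. c t m * ((d k)\<^sup>2) ^ m) \<longlonglongrightarrow> 0"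
  shows "(\<lambda>t. \<Sum>m\<le>N t. c t m * odd_power n p X m i j) \<longlonglongrightarrow> trunc r i j"
proof -
  have eq: "(\<Sum>m\<le>N t. c t m * odd_power n p X m i j) = (\<Sum>k=1..mn. U i k * d k * V j k * (\<Sum>m\<le>N t. c t m * ((d k)\<^sup>2) ^ m))" for t
    unfolding odd_power_eq[OF i j] sum_distrib_left
    by (subst sum.swap) (intro sum.cong refl, simp)
  have "(\<lambda>t. \<Sum>k=1..mn. U i k * d k * V j k * (\<Sum>m\<le>N t. c t m * ((d k)\<^sup>2) ^ m))
      \<longlonglongrightarrow> (\<Sum>k=1..mn. U i k * d k * V j k * (if k \<le> r then 1 else 0))"
    by (intro tendsto_sum tendsto_mult tendsto_const) (use top bot in auto)
  also have "(\<Sum>k=1..mn. U i k * d k * V j k * (if k \<le> r then 1 else 0)) = (\<Sum>k=1..r. U i k * d k * V j k)"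
    by (rule sum.mono_neutral_cong_right) (use r in auto)
  finally show ?thesis unfolding eq trunc_def .
qed

end

text \<open>Weierstrass approximation of a continuous ramp, which the gap between \<open>a\<close>
  and \<open>b\<close> makes possible. The polynomials depend on \<open>a\<close>, \<open>b\<close>,
  \<open>R\<close> only, so the same ones serve all outcomes.\<close>

lemma step_polynomials:
  fixes a b R :: real
  assumes "0 \<le> a" "a < b" "b \<le> R"
  obtains c :: "nat \<Rightarrow> nat \<Rightarrow> real" and N :: "nat \<Rightarrow> nat"
  where "\<And>x. x \<in> {b..R} \<Longrightarrow> (\<lambda>t. \<Sum>m\<le>N t. c t m * x ^ m) \<longlonglongrightarrow> 1"
    and "\<And>x. x \<in> {0..a} \<Longrightarrow> (\<lambda>t. \<Sum>m\<le>N t. c t m * x ^ m) \<longlonglongrightarrow> 0"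
proof -
  define f where "f x = max 0 (min 1 ((x - a) / (b - a)))" for x
  have cont: "continuous_on {0..R} f" unfolding f_def by (intro continuous_intros) (use assms in auto)
  have f1: "f x = 1" if "x \<ge> b" for x using that assms by (simp add: f_def field_simps max_def min_def)
  have f0: "f x = 0" if "x \<le> a" for x using that assms by (auto simp: f_def max_def min_def field_simps divide_le_0_iff)
  have "\<exists>cN. \<forall>x\<in>{0..R}. \<bar>f x - (\<Sum>m\<le>snd cN. fst cN m * x ^ m)\<bar> < 1 / real (Suc t)" for t
  proof -
    obtain g where g: "real_polynomial_function g" "\<And>x. x \<in> {0..R} \<Longrightarrow> \<bar>f x - g x\<bar> < 1 / real (Suc t)"
      using Stone_Weierstrass_real_polynomial_function[OF _ cont, of "1 / real (Suc t)"] by auto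
    then obtain c N where "g = (\<lambda>x. \<Sum>i\<le>N. c i * x ^ i)"
      by (auto simp: real_polynomial_function_iff_sum)
    then show ?thesis using g(2) by (intro exI[of _ "(c, N)"]) auto
  qed
  then obtain cN where cN: "\<And>t x. x \<in> {0..R} \<Longrightarrow> \<bar>f x - (\<Sum>m\<le>snd (cN t). fst (cN t) m * x ^ m)\<bar> < 1 / real (Suc t)"
    by metis
  have lim: "(\<lambda>t. \<Sum>m\<le>snd (cN t). fst (cN t) m * x ^ m) \<longlonglongrightarrow> f x" if "x \<in> {0..R}" for x
  proof -
    have "(\<lambda>t. f x - (\<Sum>m\<le>snd (cN t). fst (cN t) m * x ^ m)) \<longlonglongrightarrow> 0"
      by (rule tendsto_rabs_zero_cancel, rule tendsto_sandwich[OF _ _ tendsto_const LIMSEQ_inverse_real_of_nat])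
        (use cN[OF that] in \<open>auto intro!: eventuallyI less_imp_le simp: inverse_eq_divide\<close>)
    from tendsto_diff[OF tendsto_const[of "f x"] this] show ?thesis by simp
  qed
  show thesis
  proof
    show "(\<lambda>t. \<Sum>m\<le>snd (cN t). fst (cN t) m * x ^ m) \<longlonglongrightarrow> 1" if "x \<in> {b..R}" for x
      using lim[of x] f1[of x] that assms by auto
    show "(\<lambda>t. \<Sum>m\<le>snd (cN t). fst (cN t) m * x ^ m) \<longlonglongrightarrow> 0" if "x \<in> {0..a}" for x
      using lim[of x] f0[of x] that assms by auto
  qed
qed

text \<open>The rows of \<open>F\<close> and \<open>L\<close> are the factors and the loadings, so that \<open>F i \<bullet> L j\<close> is the
  entry of \<open>C\<^sup>0\<close>; \<open>w\<close> bounds the squared operator norm of the error matrix.\<close>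

locale factor_svd = thin_svd n p X U d V
  for n p :: nat and X U :: "nat \<Rightarrow> nat \<Rightarrow> real" and d :: "nat \<Rightarrow> real" and V :: "nat \<Rightarrow> nat \<Rightarrow> real" +
  fixes F L :: "nat \<Rightarrow> real^'r::finite" and E :: "nat \<Rightarrow> nat \<Rightarrow> real" and w f l :: real and r :: nat
  assumes X_decomp: "i \<in> {1..n} \<Longrightarrow> j \<in> {1..p} \<Longrightarrow> X i j = F i \<bullet> L j + E i j"
    and r_card: "r = CARD('r)" and r_le: "r \<le> min n p"
    and w: "w \<ge> 0" and E_op: "\<And>z. (\<Sum>i=1..n. (\<Sum>j=1..p. E i j * z j)\<^sup>2) \<le> w * (\<Sum>j=1..p. (z j)\<^sup>2)"
    and f: "f > 0" and F_lower: "\<And>y. f * (norm y)\<^sup>2 \<le> (\<Sum>i=1..n. (F i \<bullet> y)\<^sup>2)"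
    and l: "l > 0" and L_lower: "\<And>c. l * norm c \<le> norm (\<Sum>j=1..p. (L j \<bullet> c) *\<^sub>R L j)"
begin

text \<open>A min-max argument with an explicit test vector: z = L c lies in the range of the
  loadings and is orthogonal to the first r - 1 right singular vectors, so that \<bar>X z\<bar>
  \<le> d_r \<bar>z\<bar>. The signal part of X z has norm at least sqrt (f l) \<bar>z\<bar>, and
  the error part removes at most sqrt w \<bar>z\<bar>.\<close>

lemma singular_value_lower: "d r \<ge> sqrt (f * l) - sqrt w"
proof -
  have r0: "r > 0" by (simp add: r_card)
  obtain c :: "real^'r" where c: "c \<noteq> 0" "\<And>k. k \<in> {1..<r} \<Longrightarrow> (\<Sum>j=1..p. V j k *\<^sub>R L j) \<bullet> c = 0"
    using nonzero_orthogonal[of "{1..<r}" "\<lambda>k. \<Sum>j=1..p. V j k *\<^sub>R L j"] r0 by (auto simp: r_card)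
  define z where "z j = L j \<bullet> c" for j
  define y where "y = (\<Sum>j=1..p. z j *\<^sub>R L j)"
  define Z where "Z = (\<Sum>j=1..p. (z j)\<^sup>2)"
  have Z0: "Z \<ge> 0" by (simp add: Z_def sum_nonneg)
  have ly: "l * norm c \<le> norm y" using L_lower[of c] by (simp add: y_def z_def)
  have cy: "y \<bullet> c = Z" by (simp add: y_def Z_def z_def inner_sum_left power2_eq_square)
  have y0: "norm y > 0" using ly c(1) l by (smt (verit) mult_pos_pos zero_less_norm_iff)
  \<comment> \<open>With y = L'L c and y \<bullet> c = Z, the lower bound for L'L turns into one for
    L'z by Cauchy--Schwarz, without eigenvectors.\<close>
  have "l * Z = l * (y \<bullet> c)" by (simp add: cy)
  also have "\<dots> \<le> l * (norm y * norm c)" using l norm_cauchy_schwarz[of y c] by (intro mult_left_mono) auto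
  also have "\<dots> = (l * norm c) * norm y" by simp
  also have "\<dots> \<le> norm y * norm y" using ly by (intro mult_right_mono) auto
  finally have lZ: "l * Z \<le> (norm y)\<^sup>2" by (simp add: power2_eq_square)
  have Zpos: "Z > 0"
  proof (rule ccontr)
    assume "\<not> Z > 0"
    then have "(\<Sum>j=1..p. (z j)\<^sup>2) = 0" using Z0 by (simp add: Z_def)
    then have "\<forall>j\<in>{1..p}. (z j)\<^sup>2 = 0" by (subst (asm) sum_nonneg_eq_0_iff) auto
    then have "y = 0" by (simp add: y_def)
    then show False using y0 by simp
  qed
  have Vz: "(\<Sum>j=1..p. V j k * z j) = 0" if "k \<in> {1..<r}" for k
    using c(2)[OF that] by (simp add: z_def inner_sum_left)
  have dr: "d r \<ge> 0" using r_le r0 by (intro d_nonneg) auto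
  have Xz: "(\<Sum>i=1..n. (\<Sum>j=1..p. X i j * z j)\<^sup>2) \<le> (d r)\<^sup>2 * Z"
  proof -
    have "(d k)\<^sup>2 * (\<Sum>j=1..p. V j k * z j)\<^sup>2 \<le> (d r)\<^sup>2 * (\<Sum>j=1..p. V j k * z j)\<^sup>2" if k: "k \<in> {1..mn}" for k
    proof (cases "k < r")
      case True then show ?thesis using Vz[of k] k by simp
    next
      case False
      then have "d k \<le> d r" using k r_le r0 by (intro d_mono) auto
      then show ?thesis using d_nonneg[OF k] by (intro mult_right_mono power_mono) auto
    qed
    then have "(\<Sum>k=1..mn. (d k)\<^sup>2 * (\<Sum>j=1..p. V j k * z j)\<^sup>2) \<le> (\<Sum>k=1..mn. (d r)\<^sup>2 * (\<Sum>j=1..p. V j k * z j)\<^sup>2)"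
      by (rule sum_mono)
    also have "\<dots> = (d r)\<^sup>2 * (\<Sum>k=1..mn. (norm (\<Sum>j=1..p. V j k *\<^sub>R z j))\<^sup>2)" by (simp add: sum_distrib_left)
    also have "\<dots> \<le> (d r)\<^sup>2 * (\<Sum>j=1..p. (norm (z j))\<^sup>2)"
      by (intro mult_left_mono Bessel) (use V_on in auto)
    finally show ?thesis by (simp add: norm_X_mult Z_def)
  qed
  have Fy: "f * l * Z \<le> (\<Sum>i=1..n. (F i \<bullet> y)\<^sup>2)"
  proof -
    have "f * (l * Z) \<le> f * (norm y)\<^sup>2" using lZ f by (intro mult_left_mono) auto
    then show ?thesis using F_lower[of y] by (simp add: mult.assoc)
  qed
  have dec: "F i \<bullet> y = (\<Sum>j=1..p. X i j * z j) - (\<Sum>j=1..p. E i j * z j)" if "i \<in> {1..n}" for i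
  proof -
    have "(\<Sum>j=1..p. X i j * z j) = (\<Sum>j=1..p. z j * (F i \<bullet> L j) + E i j * z j)"
      using that by (intro sum.cong refl) (simp add: X_decomp algebra_simps)
    then show ?thesis by (simp add: sum.distrib y_def inner_sum_right)
  qed
  have "sqrt (f * l * Z) \<le> sqrt (\<Sum>i=1..n. (F i \<bullet> y)\<^sup>2)" using Fy by (rule real_sqrt_le_mono)
  also have "\<dots> = L2_set (\<lambda>i. (\<Sum>j=1..p. X i j * z j) - (\<Sum>j=1..p. E i j * z j)) {1..n}"
    unfolding L2_set_def by (intro arg_cong[of _ _ sqrt] sum.cong refl) (simp add: dec)
  also have "\<dots> \<le> L2_set (\<lambda>i. \<Sum>j=1..p. X i j * z j) {1..n} + L2_set (\<lambda>i. \<Sum>j=1..p. E i j * z j) {1..n}"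
    by (rule L2_set_diff_le)
  also have "\<dots> \<le> sqrt ((d r)\<^sup>2 * Z) + sqrt (w * Z)"
    unfolding L2_set_def using Xz E_op[of z] by (intro add_mono real_sqrt_le_mono) (auto simp: Z_def)
  also have "\<dots> = (d r + sqrt w) * sqrt Z" using dr by (simp add: real_sqrt_mult algebra_simps)
  finally have "sqrt (f * l) * sqrt Z \<le> (d r + sqrt w) * sqrt Z" by (simp add: real_sqrt_mult)
  then have "sqrt (f * l) \<le> d r + sqrt w" using Zpos by (simp add: mult_le_cancel_right)
  then show ?thesis by simp
qed

text \<open>The dual min-max argument: some nonzero combination v of the first r + 1 right singular
  vectors satisfies L'v = 0. Hence X v = E v, while \<bar>X v\<bar> is at least d_(r+1)
  \<bar>v\<bar> and so at least d_k \<bar>v\<bar>.\<close>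

lemma singular_value_upper:
  assumes k: "k \<in> {r + 1..mn}"
  shows "(d k)\<^sup>2 \<le> w"
proof -
  have r1: "r + 1 \<in> {1..mn}" using k by auto
  obtain b where b: "\<exists>k\<in>{1..r+1}. b k \<noteq> 0" "(\<Sum>k=1..r+1. b k *\<^sub>R (\<Sum>j=1..p. V j k *\<^sub>R L j)) = 0"
    using nontrivial_relation[of "{1..r+1}" "\<lambda>k. \<Sum>j=1..p. V j k *\<^sub>R L j"] by (auto simp: r_card)
  define v where "v j = (\<Sum>k=1..r+1. V j k * b k)" for j
  define S where "S = (\<Sum>k=1..r+1. (b k)\<^sup>2)"
  obtain k0 where k0: "k0 \<in> {1..r+1}" "b k0 \<noteq> 0" using b(1) by blast
  have "0 < (b k0)\<^sup>2" using k0 by simp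
  also have "\<dots> \<le> S" unfolding S_def by (rule member_le_sum) (use k0 in auto)
  finally have S: "S > 0" .
  have vL: "(\<Sum>j=1..p. v j *\<^sub>R L j) = 0"
  proof -
    have "(\<Sum>j=1..p. v j *\<^sub>R L j) = (\<Sum>j=1..p. \<Sum>k=1..r+1. b k *\<^sub>R (V j k *\<^sub>R L j))"
      by (simp add: v_def scaleR_sum_left mult.commute del: sum.cl_ivl_Suc)
    also have "\<dots> = (\<Sum>k=1..r+1. b k *\<^sub>R (\<Sum>j=1..p. V j k *\<^sub>R L j))"
      unfolding scaleR_sum_right by (rule sum.swap)
    finally show ?thesis using b(2) by simp
  qed
  have vv: "(\<Sum>j=1..p. (v j)\<^sup>2) = S"
  proof -
    have "(\<Sum>j=1..p. (norm (\<Sum>k=1..r+1. V j k *\<^sub>R b k))\<^sup>2) = (\<Sum>k=1..r+1. (norm (b k))\<^sup>2)"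
      by (rule orthonormal_projection(2)) (use V_on r1 in auto)
    then show ?thesis by (simp add: v_def S_def del: sum.cl_ivl_Suc)
  qed
  have Vv: "(\<Sum>j=1..p. V j k * v j) = b k" if "k \<in> {1..r+1}" for k
  proof -
    have kmn: "k \<in> {1..mn}" using that r1 by auto
    have "(\<Sum>j=1..p. V j k * v j) = (\<Sum>j=1..p. \<Sum>l=1..r+1. b l * (V j k * V j l))"
      unfolding v_def sum_distrib_left by (intro sum.cong refl) simp
    also have "\<dots> = (\<Sum>l=1..r+1. b l * (\<Sum>j=1..p. V j k * V j l))"
      unfolding sum_distrib_left by (rule sum.swap)
    also have "\<dots> = (\<Sum>l=1..r+1. if k = l then b l else 0)"
      by (intro sum.cong refl) (use V_on[OF kmn] r1 in \<open>auto simp del: sum.cl_ivl_Suc\<close>)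
    also have "\<dots> = b k" using that by (simp del: sum.cl_ivl_Suc)
    finally show ?thesis .
  qed
  have "(d k)\<^sup>2 * S = (\<Sum>l=1..r+1. (d k)\<^sup>2 * (b l)\<^sup>2)" by (simp add: S_def sum_distrib_left)
  also have "\<dots> \<le> (\<Sum>l=1..r+1. (d l)\<^sup>2 * (\<Sum>j=1..p. V j l * v j)\<^sup>2)"
  proof (rule sum_mono)
    fix l assume l: "l \<in> {1..r+1}"
    have "d k \<le> d l" using l k r1 by (intro d_mono) auto
    moreover have "0 \<le> d k" using k by (intro d_nonneg) auto
    ultimately have "(d k)\<^sup>2 \<le> (d l)\<^sup>2" by (intro power_mono) auto
    then show "(d k)\<^sup>2 * (b l)\<^sup>2 \<le> (d l)\<^sup>2 * (\<Sum>j=1..p. V j l * v j)\<^sup>2"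
      unfolding Vv[OF l] by (intro mult_right_mono) auto
  qed
  also have "\<dots> \<le> (\<Sum>l=1..mn. (d l)\<^sup>2 * (\<Sum>j=1..p. V j l * v j)\<^sup>2)"
    using r1 by (intro sum_mono2) auto
  also have "\<dots> = (\<Sum>i=1..n. (\<Sum>j=1..p. X i j * v j)\<^sup>2)" by (rule norm_X_mult[symmetric])
  also have "\<dots> = (\<Sum>i=1..n. (\<Sum>j=1..p. E i j * v j)\<^sup>2)"
  proof (intro sum.cong refl)
    fix i assume i: "i \<in> {1..n}"
    have "(\<Sum>j=1..p. X i j * v j) = (\<Sum>j=1..p. F i \<bullet> (v j *\<^sub>R L j) + E i j * v j)"
      using i by (intro sum.cong refl) (simp add: X_decomp algebra_simps)
    also have "\<dots> = F i \<bullet> (\<Sum>j=1..p. v j *\<^sub>R L j) + (\<Sum>j=1..p. E i j * v j)"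
      by (simp only: sum.distrib inner_sum_right)
    finally show "(\<Sum>j=1..p. X i j * v j)\<^sup>2 = (\<Sum>j=1..p. E i j * v j)\<^sup>2" by (simp add: vL)
  qed
  also have "\<dots> \<le> w * S" using E_op[of v] by (simp add: vv)
  finally show ?thesis using S by simp
qed

text \<open>\<open>g\<close> collects the rows of U'F, and \<open>R\<close> those of (I - P) F, with
  P the projection onto the leading left singular vectors: the part of the factors that the
  truncation misses.\<close>

definition "g k = (\<Sum>i=1..n. U i k *\<^sub>R F i)"
definition "R i = F i - (\<Sum>k=1..r. U i k *\<^sub>R g k)"

text \<open>The truncation is P X for the projection P onto the leading left singular vectors, so
  its error splits as P E - (I - P) C: projected error and missed signal.\<close>

lemma trunc_diff:
  assumes i: "i \<in> {1..n}" and j: "j \<in> {1..p}"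
  shows "trunc r i j - F i \<bullet> L j = (\<Sum>k=1..r. U i k * (\<Sum>i'=1..n. U i' k * E i' j)) - R i \<bullet> L j"
proof -
  have "trunc r i j = (\<Sum>k=1..r. U i k * (\<Sum>i'=1..n. U i' k * X i' j))"
    unfolding trunc_def using r_le j by (intro sum.cong refl) (simp add: U_X)
  also have "\<dots> = (\<Sum>k=1..r. U i k * (g k \<bullet> L j) + U i k * (\<Sum>i'=1..n. U i' k * E i' j))"
  proof (intro sum.cong refl)
    fix k
    have "(\<Sum>i'=1..n. U i' k * X i' j) = (\<Sum>i'=1..n. U i' k * (F i' \<bullet> L j) + U i' k * E i' j)"
      using j by (intro sum.cong refl) (simp add: X_decomp distrib_left)
    also have "\<dots> = g k \<bullet> L j + (\<Sum>i'=1..n. U i' k * E i' j)"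
      by (simp add: sum.distrib g_def inner_sum_left)
    finally show "U i k * (\<Sum>i'=1..n. U i' k * X i' j) = U i k * (g k \<bullet> L j) + U i k * (\<Sum>i'=1..n. U i' k * E i' j)"
      by (simp add: distrib_left)
  qed
  also have "\<dots> = (\<Sum>k=1..r. U i k * (g k \<bullet> L j)) + (\<Sum>k=1..r. U i k * (\<Sum>i'=1..n. U i' k * E i' j))"
    by (rule sum.distrib)
  finally show ?thesis by (simp add: R_def inner_diff_left inner_sum_left)
qed

text \<open>From X v = d u, the product d u'E equals v'X'E, which trades the left singular vector
  for inner products of columns. In the second bound the diagonal of X'E is centred at
  \<open>q\<close>; as v is a unit vector, this centring costs only a multiple of q^2 after summing
  over all columns.\<close>

lemma left_vector_error_le:
  assumes k: "k \<in> {1..mn}"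
  shows "(d k)\<^sup>2 * (\<Sum>i=1..n. U i k * E i j)\<^sup>2 \<le> (\<Sum>j'=1..p. (\<Sum>i=1..n. X i j' * E i j)\<^sup>2)"
    and "(d k)\<^sup>2 * (\<Sum>j=1..p. (\<Sum>i=1..n. U i k * E i j)\<^sup>2)
      \<le> 2 * (\<Sum>j=1..p. \<Sum>j'=1..p. ((\<Sum>i=1..n. X i j' * E i j) - (if j = j' then q else 0))\<^sup>2) + 2 * q\<^sup>2"
proof -
  have V1: "(\<Sum>j=1..p. (V j k)\<^sup>2) = 1" using V_on[OF k k] by (simp add: power2_eq_square)
  have eq: "d k * (\<Sum>i=1..n. U i k * E i j) = (\<Sum>j'=1..p. V j' k * (\<Sum>i=1..n. X i j' * E i j))" for j
  proof -
    have "d k * (\<Sum>i=1..n. U i k * E i j) = (\<Sum>i=1..n. (\<Sum>j'=1..p. X i j' * V j' k) * E i j)"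
      unfolding sum_distrib_left using k by (intro sum.cong refl) (simp add: X_V)
    also have "\<dots> = (\<Sum>i=1..n. \<Sum>j'=1..p. V j' k * (X i j' * E i j))"
      unfolding sum_distrib_right by (intro sum.cong refl) simp
    also have "\<dots> = (\<Sum>j'=1..p. V j' k * (\<Sum>i=1..n. X i j' * E i j))"
      unfolding sum_distrib_left by (rule sum.swap)
    finally show ?thesis .
  qed
  have CS: "(\<Sum>j'=1..p. V j' k * y j')\<^sup>2 \<le> (\<Sum>j'=1..p. (y j')\<^sup>2)" for y
    using Cauchy_Schwarz_ineq_sum[of "\<lambda>j. V j k" y "{1..p}"] V1 by simp
  show "(d k)\<^sup>2 * (\<Sum>i=1..n. U i k * E i j)\<^sup>2 \<le> (\<Sum>j'=1..p. (\<Sum>i=1..n. X i j' * E i j)\<^sup>2)"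
    unfolding power_mult_distrib[symmetric] eq by (rule CS)
  have "(d k * (\<Sum>i=1..n. U i k * E i j))\<^sup>2
      \<le> 2 * (\<Sum>j'=1..p. ((\<Sum>i=1..n. X i j' * E i j) - (if j = j' then q else 0))\<^sup>2) + 2 * (V j k * q)\<^sup>2"
    if j: "j \<in> {1..p}" for j
  proof -
    have "(\<Sum>j'=1..p. V j' k * (\<Sum>i=1..n. X i j' * E i j))
        = (\<Sum>j'=1..p. V j' k * ((\<Sum>i=1..n. X i j' * E i j) - (if j = j' then q else 0)))
          + (\<Sum>j'=1..p. if j = j' then V j' k * q else 0)"
      unfolding sum.distrib[symmetric] by (intro sum.cong refl) (simp add: algebra_simps)
    also have "(\<Sum>j'=1..p. if j = j' then V j' k * q else 0) = V j k * q" using j by simp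
    finally have "(d k * (\<Sum>i=1..n. U i k * E i j))\<^sup>2
        = ((\<Sum>j'=1..p. V j' k * ((\<Sum>i=1..n. X i j' * E i j) - (if j = j' then q else 0))) + V j k * q)\<^sup>2"
      unfolding eq by simp
    also have "\<dots> \<le> 2 * (\<Sum>j'=1..p. V j' k * ((\<Sum>i=1..n. X i j' * E i j) - (if j = j' then q else 0)))\<^sup>2 + 2 * (V j k * q)\<^sup>2"
      by (rule power2_sum_le)
    finally show ?thesis using CS[of "\<lambda>j'. (\<Sum>i=1..n. X i j' * E i j) - (if j = j' then q else 0)"] by linarith
  qed
  then have "(\<Sum>j=1..p. (d k * (\<Sum>i=1..n. U i k * E i j))\<^sup>2)
      \<le> (\<Sum>j=1..p. 2 * (\<Sum>j'=1..p. ((\<Sum>i=1..n. X i j' * E i j) - (if j = j' then q else 0))\<^sup>2) + 2 * (V j k * q)\<^sup>2)"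
    by (rule sum_mono)
  also have "\<dots> = 2 * (\<Sum>j=1..p. \<Sum>j'=1..p. ((\<Sum>i=1..n. X i j' * E i j) - (if j = j' then q else 0))\<^sup>2)
      + 2 * q\<^sup>2 * (\<Sum>j=1..p. (V j k)\<^sup>2)"
    by (simp add: sum.distrib power_mult_distrib sum_distrib_left mult_ac)
  finally show "(d k)\<^sup>2 * (\<Sum>j=1..p. (\<Sum>i=1..n. U i k * E i j)\<^sup>2)
      \<le> 2 * (\<Sum>j=1..p. \<Sum>j'=1..p. ((\<Sum>i=1..n. X i j' * E i j) - (if j = j' then q else 0))\<^sup>2) + 2 * q\<^sup>2"
    unfolding V1 by (simp only: power_mult_distrib sum_distrib_left[of "(d k)\<^sup>2"] mult_1_right)
qed

text \<open>In matrix form \<open>T\<close> is (F'F)(L'L). Multiplying F by C C', where C = F L',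
  amounts to applying \<open>T\<close> to every row, so the n-dimensional problem reduces to an
  r-dimensional one.\<close>

definition "T c = (\<Sum>i=1..n. (F i \<bullet> (\<Sum>j=1..p. (L j \<bullet> c) *\<^sub>R L j)) *\<^sub>R F i)"

lemma linear_T: "linear T"
  unfolding T_def
  by (intro linear_compose_sum ballI linearI)
    (simp_all add: inner_add_right scaleR_add_left sum.distrib scaleR_sum_right[symmetric] inner_sum_right sum_distrib_left mult.assoc)

text \<open>Testing T c against y = L'L c gives the quadratic form of F'F at y. The matrix of
  \<open>T\<close> is in general not symmetric, hence a bound through norms rather than
  eigenvalues.\<close>

lemma T_lower: "f * l * norm c \<le> norm (T c)"
proof -
  define y where "y = (\<Sum>j=1..p. (L j \<bullet> c) *\<^sub>R L j)"
  have "f * (norm y)\<^sup>2 \<le> (\<Sum>i=1..n. (F i \<bullet> y)\<^sup>2)" by (rule F_lower)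
  also have "\<dots> = T c \<bullet> y" by (simp add: T_def y_def[symmetric] inner_sum_left power2_eq_square)
  also have "\<dots> \<le> norm (T c) * norm y" by (rule norm_cauchy_schwarz)
  finally have "f * norm y * norm y \<le> norm (T c) * norm y" by (simp add: power2_eq_square mult.assoc)
  then have "f * norm y \<le> norm (T c)"
    by (cases "norm y = 0") (auto simp: mult_le_cancel_right)
  moreover have "f * (l * norm c) \<le> f * norm y"
    using L_lower[of c] f by (intro mult_left_mono) (auto simp: y_def)
  ultimately show ?thesis by (simp add: mult.assoc)
qed

text \<open>The part of the factors missed by the leading left singular vectors (a bound of the
  Davis--Kahan type): \<open>Q = I - \<Sum> u\<^sub>k u\<^sub>k'\<close> commutes with \<open>X X'\<close>, so that
  \<open>Q X X' F = X X' Q F\<close> is small compared with \<open>T (Q F)\<close>.\<close>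

lemma missed_factor_le:
  fixes q :: real
  defines "H i \<equiv> (\<Sum>i'=1..n. ((\<Sum>j=1..p. X i j * X i' j) - (\<Sum>j=1..p. (F i \<bullet> L j) * (F i' \<bullet> L j))
      - (if i = i' then q else 0)) *\<^sub>R F i')"
  assumes q: "q \<ge> 0"
  shows "(f * l - w - q) * L2_set (\<lambda>i. norm (R i)) {1..n} \<le> L2_set (\<lambda>i. norm (H i)) {1..n}"
proof -
  define Y where "Y i = (\<Sum>i'=1..n. (\<Sum>j=1..p. X i j * X i' j) *\<^sub>R F i')" for i
  define Q where "Q y i = y i - (\<Sum>k=1..r. U i k *\<^sub>R (\<Sum>i'=1..n. U i' k *\<^sub>R y i'))" for y :: "nat \<Rightarrow> real^'r" and i
  have rk: "k \<in> {1..mn}" if "k \<in> {1..r}" for k using that r_le by auto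
  \<comment> \<open>X X' is split into C C', the multiple \<open>q\<close> of the identity around
    which E E' concentrates, and a remainder. The multiple of the identity commutes with
    \<open>Q\<close>, so it only narrows the gap.\<close>
  have Y1: "Y i = T (F i) + q *\<^sub>R F i + H i" if i: "i \<in> {1..n}" for i
  proof -
    have "T (F i) = (\<Sum>i'=1..n. (\<Sum>j=1..p. (F i \<bullet> L j) * (F i' \<bullet> L j)) *\<^sub>R F i')"
      unfolding T_def by (intro sum.cong refl) (simp add: inner_sum_right inner_commute)
    moreover have "q *\<^sub>R F i = (\<Sum>i'=1..n. (if i = i' then q else 0) *\<^sub>R F i')"
      using i by (simp add: if_distrib[of "\<lambda>z. z *\<^sub>R _"] cong: if_cong)
    ultimately show ?thesis
      unfolding Y_def H_def sum.distrib[symmetric] by (simp add: algebra_simps flip: sum.distrib)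
  qed
  have Y2: "Y i = (\<Sum>k=1..mn. U i k *\<^sub>R ((d k)\<^sup>2 *\<^sub>R g k))" if i: "i \<in> {1..n}" for i
  proof -
    have "Y i = (\<Sum>i'=1..n. \<Sum>k=1..mn. ((d k)\<^sup>2 * U i k * U i' k) *\<^sub>R F i')"
      unfolding Y_def using i by (intro sum.cong refl) (simp add: gram_eq scaleR_sum_left)
    also have "\<dots> = (\<Sum>k=1..mn. \<Sum>i'=1..n. ((d k)\<^sup>2 * U i k * U i' k) *\<^sub>R F i')" by (rule sum.swap)
    finally show ?thesis by (simp add: g_def scaleR_sum_right mult_ac)
  qed
  have UY: "(\<Sum>i=1..n. U i k *\<^sub>R Y i) = (d k)\<^sup>2 *\<^sub>R g k" if k: "k \<in> {1..mn}" for k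
  proof -
    have "(\<Sum>i=1..n. U i k *\<^sub>R Y i) = (\<Sum>i=1..n. \<Sum>l=1..mn. (U i k * U i l) *\<^sub>R ((d l)\<^sup>2 *\<^sub>R g l))"
      by (intro sum.cong refl) (simp add: Y2 scaleR_sum_right mult.assoc)
    also have "\<dots> = (\<Sum>l=1..mn. (\<Sum>i=1..n. U i k * U i l) *\<^sub>R ((d l)\<^sup>2 *\<^sub>R g l))"
      unfolding scaleR_sum_left by (rule sum.swap)
    also have "\<dots> = (\<Sum>l=1..mn. if k = l then (d l)\<^sup>2 *\<^sub>R g l else 0)"
      by (intro sum.cong refl) (use U_on[OF k] in auto)
    finally show ?thesis using k by simp
  qed
  have QY: "Q Y i = (\<Sum>k=r+1..mn. U i k *\<^sub>R ((d k)\<^sup>2 *\<^sub>R g k))" if i: "i \<in> {1..n}" for i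
  proof -
    have "{1..mn} = {1..r} \<union> {r+1..mn}" using r_le by auto
    then have "Y i = (\<Sum>k=1..r. U i k *\<^sub>R ((d k)\<^sup>2 *\<^sub>R g k)) + (\<Sum>k=r+1..mn. U i k *\<^sub>R ((d k)\<^sup>2 *\<^sub>R g k))"
      unfolding Y2[OF i] by (simp add: sum.union_disjoint)
    moreover have "(\<Sum>k=1..r. U i k *\<^sub>R (\<Sum>i'=1..n. U i' k *\<^sub>R Y i')) = (\<Sum>k=1..r. U i k *\<^sub>R ((d k)\<^sup>2 *\<^sub>R g k))"
      by (intro sum.cong refl) (simp only: UY[OF rk])
    ultimately show ?thesis by (simp add: Q_def)
  qed
  have gR: "g k = (\<Sum>i=1..n. U i k *\<^sub>R R i)" if k: "k \<in> {r+1..mn}" for k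
  proof -
    have kmn: "k \<in> {1..mn}" using k by auto
    have "(\<Sum>i=1..n. U i k *\<^sub>R (\<Sum>l=1..r. U i l *\<^sub>R g l)) = (\<Sum>i=1..n. \<Sum>l=1..r. (U i k * U i l) *\<^sub>R g l)"
      by (simp add: scaleR_sum_right)
    also have "\<dots> = (\<Sum>l=1..r. (\<Sum>i=1..n. U i k * U i l) *\<^sub>R g l)"
      unfolding scaleR_sum_left by (rule sum.swap)
    also have "\<dots> = 0" by (rule sum.neutral) (use U_on[OF kmn] k rk in auto)
    finally show ?thesis by (simp add: R_def scaleR_diff_right sum_subtractf g_def)
  qed
  have RQ: "R i = Q F i" for i by (simp add: R_def Q_def g_def)
  have QT: "Q (\<lambda>i. T (F i)) i = T (R i)" for i
    unfolding RQ Q_def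
    by (simp add: linear_diff[OF linear_T] linear_sum[OF linear_T] linear_cmul[OF linear_T] o_def)
  have Qlin: "Q Y i = T (R i) + q *\<^sub>R R i + Q H i" if i: "i \<in> {1..n}" for i
  proof -
    have "(\<Sum>i'=1..n. U i' k *\<^sub>R Y i') = (\<Sum>i'=1..n. U i' k *\<^sub>R T (F i')) + q *\<^sub>R (\<Sum>i'=1..n. U i' k *\<^sub>R F i')
        + (\<Sum>i'=1..n. U i' k *\<^sub>R H i')" for k
    proof -
      have "(\<Sum>i'=1..n. U i' k *\<^sub>R Y i') = (\<Sum>i'=1..n. U i' k *\<^sub>R T (F i') + q *\<^sub>R (U i' k *\<^sub>R F i') + U i' k *\<^sub>R H i')"
        by (intro sum.cong refl) (simp add: Y1 scaleR_add_right)
      then show ?thesis by (simp only: sum.distrib scaleR_sum_right)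
    qed
    then have "Q Y i = Q (\<lambda>i. T (F i)) i + q *\<^sub>R Q F i + Q H i"
      unfolding Q_def Y1[OF i]
      by (simp add: scaleR_add_right sum.distrib scaleR_diff_right scaleR_sum_right mult_ac)
    then show ?thesis unfolding QT RQ[symmetric] .
  qed
  let ?N = "\<lambda>y. L2_set (\<lambda>i. norm (y i)) {1..n}"
  have QH: "?N (Q H) \<le> ?N H"
  proof -
    have "(\<Sum>i=1..n. (norm (Q H i))\<^sup>2) = (\<Sum>i=1..n. (norm (H i))\<^sup>2) - (\<Sum>k=1..r. (norm (\<Sum>i'=1..n. U i' k *\<^sub>R H i'))\<^sup>2)"
      unfolding Q_def by (rule orthonormal_projection(1)) (use U_on r_le in auto)
    then show ?thesis unfolding L2_set_def by (intro real_sqrt_le_mono) (simp add: sum_nonneg)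
  qed
  \<comment> \<open>Q Y has trailing singular components only; there the squared singular values are
    at most \<open>w\<close>, and the coefficients \<open>g k\<close> are those of
    \<open>R\<close>.\<close>
  have QYle: "?N (Q Y) \<le> w * ?N R"
  proof -
    have "(\<Sum>i=1..n. (norm (Q Y i))\<^sup>2) = (\<Sum>i=1..n. (norm (\<Sum>k=r+1..mn. U i k *\<^sub>R ((d k)\<^sup>2 *\<^sub>R g k)))\<^sup>2)"
      using QY by (intro sum.cong refl) simp
    also have "\<dots> = (\<Sum>k=r+1..mn. (norm ((d k)\<^sup>2 *\<^sub>R g k))\<^sup>2)"
      by (rule orthonormal_projection(2)) (use U_on in auto)
    also have "\<dots> \<le> (\<Sum>k=r+1..mn. w\<^sup>2 * (norm (g k))\<^sup>2)"
    proof (rule sum_mono)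
      fix k assume "k \<in> {r+1..mn}"
      then have "((d k)\<^sup>2)\<^sup>2 \<le> w\<^sup>2" by (intro power_mono singular_value_upper) auto
      then show "(norm ((d k)\<^sup>2 *\<^sub>R g k))\<^sup>2 \<le> w\<^sup>2 * (norm (g k))\<^sup>2"
        unfolding norm_scaleR power_mult_distrib power2_abs by (rule mult_right_mono) simp
    qed
    also have "\<dots> = w\<^sup>2 * (\<Sum>k=r+1..mn. (norm (\<Sum>i=1..n. U i k *\<^sub>R R i))\<^sup>2)"
      using gR by (simp add: sum_distrib_left)
    also have "\<dots> \<le> w\<^sup>2 * (\<Sum>i=1..n. (norm (R i))\<^sup>2)"
      by (intro mult_left_mono Bessel) (use U_on in auto)
    finally have "?N (Q Y) \<le> sqrt (w\<^sup>2 * (\<Sum>i=1..n. (norm (R i))\<^sup>2))"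
      unfolding L2_set_def by (rule real_sqrt_le_mono)
    then show ?thesis using w by (simp add: L2_set_def real_sqrt_mult)
  qed
  \<comment> \<open>T R = Q Y - q R - Q H row by row; the first two terms are at most (w + q) times
    the norm of \<open>R\<close> and are absorbed on the left.\<close>
  have "f * l * ?N R = L2_set (\<lambda>i. f * l * norm (R i)) {1..n}"
    using f l by (simp add: L2_set_right_distrib)
  also have "\<dots> \<le> L2_set (\<lambda>i. norm (T (R i))) {1..n}"
    using f l by (intro L2_set_mono T_lower) auto
  also have "\<dots> \<le> L2_set (\<lambda>i. norm (Q Y i) + (q * norm (R i) + norm (Q H i))) {1..n}"
  proof (rule L2_set_mono)
    fix i assume i: "i \<in> {1..n}"
    have "T (R i) = Q Y i - (q *\<^sub>R R i + Q H i)" using Qlin[OF i] by (simp add: algebra_simps)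
    then have "norm (T (R i)) \<le> norm (Q Y i) + norm (q *\<^sub>R R i + Q H i)"
      by (simp only: norm_triangle_ineq4)
    also have "norm (q *\<^sub>R R i + Q H i) \<le> q * norm (R i) + norm (Q H i)"
      using norm_triangle_ineq[of "q *\<^sub>R R i" "Q H i"] q by simp
    finally show "norm (T (R i)) \<le> norm (Q Y i) + (q * norm (R i) + norm (Q H i))" by simp
  qed simp
  also have "\<dots> \<le> ?N (Q Y) + L2_set (\<lambda>i. q * norm (R i) + norm (Q H i)) {1..n}" by (rule L2_set_triangle_ineq)
  also have "L2_set (\<lambda>i. q * norm (R i) + norm (Q H i)) {1..n} \<le> L2_set (\<lambda>i. q * norm (R i)) {1..n} + ?N (Q H)"
    by (rule L2_set_triangle_ineq)
  also have "L2_set (\<lambda>i. q * norm (R i)) {1..n} = q * ?N R" using q by (simp add: L2_set_right_distrib)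
  finally show ?thesis using QH QYle by (simp add: algebra_simps)
qed

end

text \<open>What is needed of one outcome, in deterministic form. \<open>H\<close> bounds sums over
  whole matrices, \<open>t\<close> bounds single inner products of columns; in the application the
  first is constant and the second grows like a logarithm.\<close>

locale factor_sample = thin_svd n p X U d V
  for n p :: nat and X U :: "nat \<Rightarrow> nat \<Rightarrow> real" and d :: "nat \<Rightarrow> real" and V :: "nat \<Rightarrow> nat \<Rightarrow> real" +
  fixes F L :: "nat \<Rightarrow> real^'r::finite" and E :: "nat \<Rightarrow> nat \<Rightarrow> real" and r :: nat
    and b f0 l0 \<beta> \<sigma>2 H t :: real
  assumes X_decomp: "i \<in> {1..n} \<Longrightarrow> j \<in> {1..p} \<Longrightarrow> X i j = F i \<bullet> L j + E i j"
    and r_card: "r = CARD('r)" and r_le: "r \<le> min n p"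
    and F_bound: "i \<in> {1..n} \<Longrightarrow> (norm (F i))\<^sup>2 \<le> b" and L_bound: "j \<in> {1..p} \<Longrightarrow> (norm (L j))\<^sup>2 \<le> b"
    and F_lower: "\<And>y. f0 * real n * (norm y)\<^sup>2 \<le> (\<Sum>i=1..n. (F i \<bullet> y)\<^sup>2)"
    and L_lower: "\<And>c. l0 * real p * norm c \<le> norm (\<Sum>j=1..p. (L j \<bullet> c) *\<^sub>R L j)"
    and f0: "f0 > 0" and l0: "l0 > 0" and \<beta>: "\<beta> = f0 * l0"
    and E_gram: "(\<Sum>j=1..p. \<Sum>l=1..p. ((\<Sum>i=1..n. E i j * E i l) - (if j = l then real n * \<sigma>2 else 0))\<^sup>2)
      \<le> H * real n * (real p)\<^sup>2"
    and E_gram': "(\<Sum>i=1..n. \<Sum>l=1..n. ((\<Sum>j=1..p. E i j * E l j) - (if i = l then real p * \<sigma>2 else 0))\<^sup>2)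
      \<le> H * real p * (real n)\<^sup>2"
    and E_L: "(\<Sum>i=1..n. (norm (\<Sum>j=1..p. E i j *\<^sub>R L j))\<^sup>2) \<le> H * real n * real p"
    and E_F: "(\<Sum>j=1..p. (norm (\<Sum>i=1..n. E i j *\<^sub>R F i))\<^sup>2) \<le> H * real n * real p"
    and E_col: "j \<in> {1..p} \<Longrightarrow> l \<in> {1..p} \<Longrightarrow>
      \<bar>(\<Sum>i=1..n. E i j * E i l) - (if j = l then real n * \<sigma>2 else 0)\<bar> \<le> t * sqrt (real n)"
    and C_col: "j \<in> {1..p} \<Longrightarrow> l \<in> {1..p} \<Longrightarrow> \<bar>\<Sum>i=1..n. (F i \<bullet> L j) * E i l\<bar> \<le> t * sqrt (real n)"
    and E_row: "i \<in> {1..n} \<Longrightarrow> (\<Sum>j=1..p. (E i j)\<^sup>2) \<le> real p * (\<sigma>2 + 1)"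
    and \<sigma>2: "\<sigma>2 > 0" and H: "H \<ge> 1" and t: "0 \<le> t" "t \<le> sqrt (real n)"
    and small: "2 * (H / real n + \<sigma>2\<^sup>2 / real p) \<le> (\<beta> / 16)\<^sup>2" "\<sigma>2 / real n \<le> \<beta> / 16"
begin

lemma n_pos: "n > 0" and p_pos: "p > 0"
proof -
  have "r > 0" by (simp add: r_card)
  then show "n > 0" "p > 0" using r_le by auto
qed

lemma \<beta>_pos: "\<beta> > 0"
  using f0 l0 by (simp add: \<beta>)

lemma b_nonneg: "b \<ge> 0"
proof -
  have "0 \<le> (norm (F 1))\<^sup>2" by simp
  also have "\<dots> \<le> b" by (rule F_bound) (use n_pos in auto)
  finally show ?thesis .
qed

text \<open>A fixed fraction of n p is affordable: sqrt w is a quarter of sqrt (n p \<beta>), so the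
  leading squared singular values stay above 9/16, hence above 1/2, of n p \<beta>, and the others
  below 1/16 of it.\<close>

definition "w = real n * real p * (\<beta> / 16)"

lemma w_nonneg: "w \<ge> 0"
  using \<beta>_pos by (simp add: w_def)

text \<open>The operator norm is controlled by the Frobenius norm of the Gram matrix E'E, for which
  second moments suffice: its square is at most (n p)^2 times a multiple of 1/n + 1/p.\<close>

lemma E_operator_bound: "(\<Sum>i=1..n. (\<Sum>j=1..p. E i j * z j)\<^sup>2) \<le> w * (\<Sum>j=1..p. (z j)\<^sup>2)"
proof -
  define A where "A j l = (\<Sum>i=1..n. E i j * E i l)" for j l
  define Z where "Z = (\<Sum>j=1..p. (z j)\<^sup>2)"
  define Y where "Y = (\<Sum>i=1..n. (\<Sum>j=1..p. E i j * z j)\<^sup>2)"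
  have Z0: "Z \<ge> 0" and Y0: "Y \<ge> 0" by (simp_all add: Z_def Y_def sum_nonneg)
  have frob: "(\<Sum>j=1..p. \<Sum>l=1..p. (A j l)\<^sup>2) \<le> w\<^sup>2"
  proof -
    have "(\<Sum>j=1..p. \<Sum>l=1..p. (A j l)\<^sup>2)
        \<le> (\<Sum>j=1..p. \<Sum>l=1..p. 2 * (A j l - (if j = l then real n * \<sigma>2 else 0))\<^sup>2 + 2 * (if j = l then real n * \<sigma>2 else 0)\<^sup>2)"
    proof (intro sum_mono)
      fix j l
      show "(A j l)\<^sup>2 \<le> 2 * (A j l - (if j = l then real n * \<sigma>2 else 0))\<^sup>2 + 2 * (if j = l then real n * \<sigma>2 else 0)\<^sup>2"
        using power2_sum_le[of "A j l - (if j = l then real n * \<sigma>2 else 0)" "if j = l then real n * \<sigma>2 else 0"] by simp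
    qed
    also have "\<dots> = 2 * (\<Sum>j=1..p. \<Sum>l=1..p. (A j l - (if j = l then real n * \<sigma>2 else 0))\<^sup>2)
        + (\<Sum>j=1..p. \<Sum>l=1..p. if j = l then 2 * (real n * \<sigma>2)\<^sup>2 else 0)"
      by (simp add: sum.distrib sum_distrib_left if_distrib[of "\<lambda>z. 2 * z\<^sup>2"] cong: if_cong)
    also have "(\<Sum>j=1..p. \<Sum>l=1..p. if j = l then 2 * (real n * \<sigma>2)\<^sup>2 else 0) = 2 * real p * (real n * \<sigma>2)\<^sup>2"
      by simp
    also have "2 * (\<Sum>j=1..p. \<Sum>l=1..p. (A j l - (if j = l then real n * \<sigma>2 else 0))\<^sup>2) + 2 * real p * (real n * \<sigma>2)\<^sup>2
        \<le> 2 * (H * real n * (real p)\<^sup>2) + 2 * real p * (real n * \<sigma>2)\<^sup>2"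
      using E_gram unfolding A_def by simp
    also have "\<dots> = (real n * real p)\<^sup>2 * (2 * (H / real n + \<sigma>2\<^sup>2 / real p))"
      using n_pos p_pos by (simp add: power2_eq_square field_simps)
    also have "\<dots> \<le> (real n * real p)\<^sup>2 * (\<beta> / 16)\<^sup>2"
      by (intro mult_left_mono small) simp
    also have "\<dots> = w\<^sup>2" by (simp add: w_def power_mult_distrib power_divide)
    finally show ?thesis .
  qed
  have "Y = (\<Sum>j=1..p. z j * (\<Sum>l=1..p. A j l * z l))"
  proof -
    have "Y = (\<Sum>j=1..p. \<Sum>l=1..p. z j * z l * A j l)"
      unfolding Y_def power2_eq_square sum_mult_sum_swap A_def ..
    also have "\<dots> = (\<Sum>j=1..p. z j * (\<Sum>l=1..p. A j l * z l))"
      unfolding sum_distrib_left by (intro sum.cong refl) simp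
    finally show ?thesis .
  qed
  then have "Y\<^sup>2 \<le> Z * (\<Sum>j=1..p. (\<Sum>l=1..p. A j l * z l)\<^sup>2)"
    unfolding Z_def by (simp only: Cauchy_Schwarz_ineq_sum)
  also have "\<dots> \<le> Z * (\<Sum>j=1..p. (\<Sum>l=1..p. (A j l)\<^sup>2) * Z)"
    unfolding Z_def by (intro mult_left_mono sum_mono Cauchy_Schwarz_ineq_sum) (simp add: sum_nonneg)
  also have "\<dots> = (\<Sum>j=1..p. \<Sum>l=1..p. (A j l)\<^sup>2) * Z\<^sup>2"
    by (simp add: power2_eq_square flip: sum_distrib_right)
  also have "\<dots> \<le> w\<^sup>2 * Z\<^sup>2" by (intro mult_right_mono frob) simp
  finally have "Y\<^sup>2 \<le> (w * Z)\<^sup>2" by (simp add: power_mult_distrib)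
  then have "Y \<le> w * Z" by (rule power2_le_imp_le) (use Z0 w_nonneg in simp)
  then show ?thesis by (simp add: Y_def Z_def)
qed

sublocale factor_svd n p X U d V F L E w "f0 * real n" "l0 * real p" r
  by unfold_locales
    (use X_decomp r_card r_le w_nonneg E_operator_bound f0 l0 n_pos p_pos F_lower L_lower in auto)

lemma spectral_gap:
  "k \<in> {1..r} \<Longrightarrow> (d k)\<^sup>2 \<ge> real n * real p * (\<beta> / 2)"
  "k \<in> {r + 1..min n p} \<Longrightarrow> (d k)\<^sup>2 \<le> real n * real p * (\<beta> / 16)"
proof -
  show "k \<in> {r + 1..min n p} \<Longrightarrow> (d k)\<^sup>2 \<le> real n * real p * (\<beta> / 16)"
    using singular_value_upper by (simp add: w_def)
  assume k: "k \<in> {1..r}"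
  define D where "D = real n * real p"
  have D: "D > 0" using n_pos p_pos by (simp add: D_def)
  have "sqrt (f0 * real n * (l0 * real p)) - sqrt w = sqrt (D * \<beta>) - sqrt (D * \<beta> / 16)"
  proof -
    have "f0 * real n * (l0 * real p) = D * \<beta>" by (simp add: \<beta> D_def)
    moreover have "w = D * \<beta> / 16" by (simp add: w_def D_def)
    ultimately show ?thesis by simp
  qed
  also have "sqrt (D * \<beta> / 16) = sqrt (D * \<beta>) / 4"
    by (simp add: real_sqrt_divide)
  finally have "d r \<ge> 3 / 4 * sqrt (D * \<beta>)" using singular_value_lower by simp
  moreover have "d k \<ge> d r" by (rule d_mono) (use k r_le in auto)
  ultimately have "d k \<ge> 3 / 4 * sqrt (D * \<beta>)" by linarith
  then have "(3 / 4 * sqrt (D * \<beta>))\<^sup>2 \<le> (d k)\<^sup>2"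
    by (intro power_mono) (use D \<beta>_pos in auto)
  moreover have "(3 / 4 * sqrt (D * \<beta>))\<^sup>2 = 9 / 16 * (D * \<beta>)"
    using D \<beta>_pos by (simp add: power_mult_distrib power2_eq_square)
  moreover have "D * \<beta> / 2 \<le> 9 / 16 * (D * \<beta>)" using D \<beta>_pos by simp
  moreover have "real n * real p * (\<beta> / 2) = D * \<beta> / 2" by (simp add: D_def)
  ultimately show "(d k)\<^sup>2 \<ge> real n * real p * (\<beta> / 2)" by linarith
qed

lemma C_entry: 
  assumes "i \<in> {1..n}" "j \<in> {1..p}"
  shows "\<bar>F i \<bullet> L j\<bar> \<le> b" "(F i \<bullet> L j)\<^sup>2 \<le> b\<^sup>2"
proof -
  have "(F i \<bullet> L j)\<^sup>2 \<le> (norm (F i))\<^sup>2 * (norm (L j))\<^sup>2"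
    using Cauchy_Schwarz_ineq[of "F i" "L j"] by (simp add: power2_norm_eq_inner)
  also have "\<dots> \<le> b * b" using F_bound[OF assms(1)] L_bound[OF assms(2)] b_nonneg by (intro mult_mono) auto
  finally show "(F i \<bullet> L j)\<^sup>2 \<le> b\<^sup>2" by (simp add: power2_eq_square)
  then show "\<bar>F i \<bullet> L j\<bar> \<le> b" using b_nonneg abs_le_square_iff[of "F i \<bullet> L j" b] by simp
qed

definition "v = 2 * b\<^sup>2 + 2 * (\<sigma>2 + 1)"

lemma v_pos: "v > 0" using \<sigma>2 by (simp add: v_def add_nonneg_pos)

lemma t_sqrt: "t * sqrt (real n) \<le> real n"
  using mult_right_mono[OF t(2), of "sqrt (real n)"] by simp

lemma E_column_le: "j \<in> {1..p} \<Longrightarrow> (\<Sum>i=1..n. (E i j)\<^sup>2) \<le> real n * (\<sigma>2 + 1)"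
  using E_col[of j j] t_sqrt by (simp add: power2_eq_square abs_le_iff algebra_simps)

lemma X_row_le:
  assumes "i \<in> {1..n}"
  shows "(\<Sum>j=1..p. (X i j)\<^sup>2) \<le> real p * v"
proof -
  have "(\<Sum>j=1..p. (X i j)\<^sup>2) \<le> (\<Sum>j=1..p. 2 * b\<^sup>2 + 2 * (E i j)\<^sup>2)"
  proof (rule sum_mono)
    fix j assume j: "j \<in> {1..p}"
    show "(X i j)\<^sup>2 \<le> 2 * b\<^sup>2 + 2 * (E i j)\<^sup>2"
      using power2_sum_le[of "F i \<bullet> L j" "E i j"] C_entry(2)[OF assms j] X_decomp[OF assms j] by simp
  qed
  also have "\<dots> = 2 * b\<^sup>2 * real p + 2 * (\<Sum>j=1..p. (E i j)\<^sup>2)" by (simp add: sum.distrib sum_distrib_left)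
  also have "\<dots> \<le> 2 * b\<^sup>2 * real p + 2 * (real p * (\<sigma>2 + 1))" using E_row[OF assms] by simp
  finally show ?thesis by (simp add: v_def algebra_simps)
qed

lemma X_column_le:
  assumes "j \<in> {1..p}"
  shows "(\<Sum>i=1..n. (X i j)\<^sup>2) \<le> real n * v"
proof -
  have "(\<Sum>i=1..n. (X i j)\<^sup>2) \<le> (\<Sum>i=1..n. 2 * b\<^sup>2 + 2 * (E i j)\<^sup>2)"
  proof (rule sum_mono)
    fix i assume i: "i \<in> {1..n}"
    show "(X i j)\<^sup>2 \<le> 2 * b\<^sup>2 + 2 * (E i j)\<^sup>2"
      using power2_sum_le[of "F i \<bullet> L j" "E i j"] C_entry(2)[OF i assms] X_decomp[OF i assms] by simp
  qed
  also have "\<dots> = 2 * b\<^sup>2 * real n + 2 * (\<Sum>i=1..n. (E i j)\<^sup>2)" by (simp add: sum.distrib sum_distrib_left)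
  also have "\<dots> \<le> 2 * b\<^sup>2 * real n + 2 * (real n * (\<sigma>2 + 1))" using E_column_le[OF assms] by simp
  finally show ?thesis by (simp add: v_def algebra_simps)
qed

lemma singular_value_square_bound: "k \<in> {1..min n p} \<Longrightarrow> (d k)\<^sup>2 \<le> real n * real p * v"
proof -
  assume k: "k \<in> {1..min n p}"
  have "(d k)\<^sup>2 \<le> (\<Sum>i=1..n. \<Sum>j=1..p. (X i j)\<^sup>2)" by (rule singular_value_square_le[OF k])
  also have "\<dots> \<le> (\<Sum>i=1..n. real p * v)" by (intro sum_mono X_row_le)
  finally show ?thesis by simp
qed

text \<open>A constant bound is enough here: it reduces the higher powers of the estimation error,
  which occur in the empirical moments of the residuals, to the first power.\<close>

lemma trunc_bounded:
  assumes "i \<in> {1..n}" "j \<in> {1..p}"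
  shows "\<bar>trunc r i j\<bar> \<le> real r * (v / sqrt (\<beta> / 2))"
proof -
  have "\<bar>trunc r i j\<bar> \<le> real r * (sqrt (real p * v) * sqrt (real n * v) / sqrt (real n * real p * (\<beta> / 2)))"
  proof (rule trunc_entry_le[OF r_le assms])
    show "sqrt (real n * real p * (\<beta> / 2)) > 0" using n_pos p_pos \<beta>_pos by simp
    show "sqrt (real n * real p * (\<beta> / 2)) \<le> d k" if "k \<in> {1..r}" for k
      using real_sqrt_le_mono[OF spectral_gap(1)[OF that]] d_nonneg[of k] that r_le by simp
  qed (use X_row_le[OF assms(1)] X_column_le[OF assms(2)] v_pos in auto)
  also have "sqrt (real p * v) * sqrt (real n * v) / sqrt (real n * real p * (\<beta> / 2)) = v / sqrt (\<beta> / 2)"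
    using n_pos p_pos v_pos \<beta>_pos by (simp add: real_sqrt_mult real_sqrt_divide field_simps)
  finally show ?thesis .
qed

definition "KR = 12 * (2 * b + 1) * b / \<beta>\<^sup>2"

lemma KR_nonneg: "KR \<ge> 0" using b_nonneg by (simp add: KR_def)

text \<open>The perturbation N of C C' + q I has squared Frobenius norm of order p n^2. Applied to
  the n bounded factor rows it gains a factor n, and dividing by the squared gap (n p \<beta> / 2)^2
  leaves n / p.\<close>

lemma missed_factor_bound: "(\<Sum>i=1..n. (norm (R i))\<^sup>2) \<le> KR * H * real n / real p"
proof -
  define q where "q = real p * \<sigma>2"
  define N where "N i i' = (\<Sum>j=1..p. X i j * X i' j) - (\<Sum>j=1..p. (F i \<bullet> L j) * (F i' \<bullet> L j)) - (if i = i' then q else 0)" for i i'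
  define G where "G i = (\<Sum>j=1..p. E i j *\<^sub>R L j)" for i
  define W where "W i i' = (\<Sum>j=1..p. E i j * E i' j) - (if i = i' then q else 0)" for i i'
  have Neq: "N i i' = F i \<bullet> G i' + F i' \<bullet> G i + W i i'" if "i \<in> {1..n}" "i' \<in> {1..n}" for i i'
  proof -
    have "(\<Sum>j=1..p. X i j * X i' j) = (\<Sum>j=1..p. (F i \<bullet> L j) * (F i' \<bullet> L j) + (F i \<bullet> (E i' j *\<^sub>R L j)
        + F i' \<bullet> (E i j *\<^sub>R L j) + E i j * E i' j))"
      using that by (intro sum.cong refl) (simp add: X_decomp algebra_simps)
    also have "\<dots> = (\<Sum>j=1..p. (F i \<bullet> L j) * (F i' \<bullet> L j)) + (F i \<bullet> G i' + F i' \<bullet> G i + (\<Sum>j=1..p. E i j * E i' j))"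
      by (simp only: sum.distrib G_def inner_sum_right)
    finally show ?thesis by (simp add: N_def W_def)
  qed
  have FG: "(F i \<bullet> G i')\<^sup>2 \<le> b * (norm (G i'))\<^sup>2" if "i \<in> {1..n}" for i i'
  proof -
    have "(F i \<bullet> G i')\<^sup>2 \<le> (norm (F i))\<^sup>2 * (norm (G i'))\<^sup>2"
      using Cauchy_Schwarz_ineq[of "F i" "G i'"] by (simp add: power2_norm_eq_inner)
    also have "\<dots> \<le> b * (norm (G i'))\<^sup>2" by (intro mult_right_mono F_bound that) simp
    finally show ?thesis .
  qed
  have three: "(x + y + z)\<^sup>2 \<le> 3 * x\<^sup>2 + 3 * y\<^sup>2 + 3 * z\<^sup>2" for x y z :: real
  proof -
    have "3 * x\<^sup>2 + 3 * y\<^sup>2 + 3 * z\<^sup>2 - (x + y + z)\<^sup>2 = (x - y)\<^sup>2 + (y - z)\<^sup>2 + (x - z)\<^sup>2"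
      by (simp add: power2_eq_square algebra_simps)
    then show ?thesis by (smt (verit) zero_le_power2)
  qed
  have "(\<Sum>i=1..n. \<Sum>i'=1..n. (N i i')\<^sup>2)
      \<le> (\<Sum>i=1..n. \<Sum>i'=1..n. 3 * (b * (norm (G i'))\<^sup>2) + 3 * (b * (norm (G i))\<^sup>2) + 3 * (W i i')\<^sup>2)"
  proof (intro sum_mono)
    fix i i' assume ii: "i \<in> {1..n}" "i' \<in> {1..n}"
    show "(N i i')\<^sup>2 \<le> 3 * (b * (norm (G i'))\<^sup>2) + 3 * (b * (norm (G i))\<^sup>2) + 3 * (W i i')\<^sup>2"
      using three[of "F i \<bullet> G i'" "F i' \<bullet> G i" "W i i'"] FG[OF ii(1), of i'] FG[OF ii(2), of i] Neq[OF ii] by simp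
  qed
  also have "\<dots> = 6 * b * real n * (\<Sum>i=1..n. (norm (G i))\<^sup>2) + 3 * (\<Sum>i=1..n. \<Sum>i'=1..n. (W i i')\<^sup>2)"
    by (simp add: sum.distrib flip: sum_distrib_left)
  also have "\<dots> \<le> 6 * b * real n * (H * real n * real p) + 3 * (H * real p * (real n)\<^sup>2)"
    using E_L E_gram' b_nonneg unfolding G_def W_def q_def by (intro add_mono mult_left_mono) auto
  finally have NN: "(\<Sum>i=1..n. \<Sum>i'=1..n. (N i i')\<^sup>2) \<le> 3 * (2 * b + 1) * H * real p * (real n)\<^sup>2"
    by (simp add: power2_eq_square algebra_simps)
  define Hv where "Hv i = (\<Sum>i'=1..n. N i i' *\<^sub>R F i')" for i
  have "(norm (Hv i))\<^sup>2 \<le> (\<Sum>i'=1..n. (N i i')\<^sup>2) * (real n * b)" for i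
  proof -
    have "norm (Hv i) \<le> (\<Sum>i'=1..n. \<bar>N i i'\<bar> * norm (F i'))"
      unfolding Hv_def by (intro order.trans[OF norm_sum]) simp
    then have "(norm (Hv i))\<^sup>2 \<le> (\<Sum>i'=1..n. \<bar>N i i'\<bar> * norm (F i'))\<^sup>2" by (intro power_mono) auto
    also have "\<dots> \<le> (\<Sum>i'=1..n. \<bar>N i i'\<bar>\<^sup>2) * (\<Sum>i'=1..n. (norm (F i'))\<^sup>2)" by (rule Cauchy_Schwarz_ineq_sum)
    also have "\<dots> \<le> (\<Sum>i'=1..n. (N i i')\<^sup>2) * (\<Sum>i'=1..n. b)"
      unfolding power2_abs by (intro mult_left_mono sum_mono F_bound) (auto simp: sum_nonneg)
    finally show ?thesis by simp
  qed
  then have "(\<Sum>i=1..n. (norm (Hv i))\<^sup>2) \<le> (\<Sum>i=1..n. (\<Sum>i'=1..n. (N i i')\<^sup>2) * (real n * b))" by (rule sum_mono)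
  also have "\<dots> \<le> (3 * (2 * b + 1) * H * real p * (real n)\<^sup>2) * (real n * b)"
    unfolding sum_distrib_right[symmetric] using NN b_nonneg by (intro mult_right_mono) auto
  finally have Hvle: "(\<Sum>i=1..n. (norm (Hv i))\<^sup>2) \<le> (3 * (2 * b + 1) * H * real p * (real n)\<^sup>2) * (real n * b)" .
  define S where "S = L2_set (\<lambda>i. norm (R i)) {1..n}"
  have S0: "S \<ge> 0" by (simp add: S_def)
  have q0: "q \<ge> 0" using \<sigma>2 by (simp add: q_def)
  have main: "(f0 * real n * (l0 * real p) - w - q) * S \<le> L2_set (\<lambda>i. norm (Hv i)) {1..n}"
    unfolding S_def Hv_def N_def by (rule missed_factor_le[OF q0])
  have "q \<le> real n * real p * (\<beta> / 16)"
    using small(2) n_pos p_pos by (simp add: q_def field_simps)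
  \<comment> \<open>\<open>w\<close> and \<open>q\<close> each take at most a sixteenth of the gap
    \<beta>, so more than half of it is left.\<close>
  then have "real n * real p * \<beta> / 2 \<le> f0 * real n * (l0 * real p) - w - q"
  proof -
    define x where "x = real n * real p * \<beta>"
    have "x \<ge> 0" "f0 * real n * (l0 * real p) = x" using \<beta>_pos by (simp_all add: x_def) (simp add: \<beta>)
    moreover have "w = x / 16" by (simp add: w_def x_def)
    moreover have "q \<le> x / 16" using \<open>q \<le> real n * real p * (\<beta> / 16)\<close> by (simp add: x_def)
    ultimately show ?thesis unfolding x_def[symmetric] by linarith
  qed
  from mult_right_mono[OF this S0] main have "real n * real p * \<beta> / 2 * S \<le> L2_set (\<lambda>i. norm (Hv i)) {1..n}" by linarith
  then have "(real n * real p * \<beta> / 2 * S)\<^sup>2 \<le> (L2_set (\<lambda>i. norm (Hv i)) {1..n})\<^sup>2"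
    using S0 \<beta>_pos by (intro power_mono) auto
  also have "\<dots> = (\<Sum>i=1..n. (norm (Hv i))\<^sup>2)" by (simp add: L2_set_def sum_nonneg)
  also note Hvle
  also have "(3 * (2 * b + 1) * H * real p * (real n)\<^sup>2) * (real n * b) = (real n * real p)\<^sup>2 * (3 * (2 * b + 1) * H * b * real n / real p)"
    using p_pos by (simp add: power2_eq_square field_simps)
  also have "(real n * real p * \<beta> / 2 * S)\<^sup>2 = (real n * real p)\<^sup>2 * (\<beta>\<^sup>2 / 4) * S\<^sup>2"
    by (simp add: power_mult_distrib power_divide)
  finally have "(real n * real p)\<^sup>2 * (\<beta>\<^sup>2 / 4) * S\<^sup>2 \<le> (real n * real p)\<^sup>2 * (3 * (2 * b + 1) * H * b * real n / real p)" .
  then have "(\<beta>\<^sup>2 / 4) * S\<^sup>2 \<le> 3 * (2 * b + 1) * H * b * real n / real p"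
    unfolding mult.assoc[of "(real n * real p)\<^sup>2"] by (rule mult_left_le_imp_le) (use n_pos p_pos in simp)
  then have "S\<^sup>2 \<le> 4 * (3 * (2 * b + 1) * H * b * real n / real p) / \<beta>\<^sup>2"
    using \<beta>_pos by (subst pos_le_divide_eq) (auto simp: mult.commute)
  also have "\<dots> = KR * H * real n / real p" by (simp add: KR_def field_simps)
  finally have "S\<^sup>2 \<le> KR * H * real n / real p" .
  then show ?thesis by (simp add: S_def L2_set_def sum_nonneg)
qed

lemma trunc_column_error:
  assumes j: "j \<in> {1..p}"
  shows "(\<Sum>i=1..n. (trunc r i j - F i \<bullet> L j)\<^sup>2) \<le> 2 * (\<Sum>k=1..r. (\<Sum>i=1..n. U i k * E i j)\<^sup>2) + 2 * b * (KR * H * real n / real p)"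
proof -
  define a where "a i = (\<Sum>k=1..r. U i k * (\<Sum>i'=1..n. U i' k * E i' j))" for i
  have "(\<Sum>i=1..n. (trunc r i j - F i \<bullet> L j)\<^sup>2) \<le> (\<Sum>i=1..n. 2 * (a i)\<^sup>2 + 2 * (b * (norm (R i))\<^sup>2))"
  proof (rule sum_mono)
    fix i assume i: "i \<in> {1..n}"
    have "(R i \<bullet> L j)\<^sup>2 \<le> (norm (L j))\<^sup>2 * (norm (R i))\<^sup>2"
      using Cauchy_Schwarz_ineq[of "R i" "L j"] by (simp add: power2_norm_eq_inner mult.commute)
    also have "\<dots> \<le> b * (norm (R i))\<^sup>2" by (intro mult_right_mono L_bound j) simp
    finally show "(trunc r i j - F i \<bullet> L j)\<^sup>2 \<le> 2 * (a i)\<^sup>2 + 2 * (b * (norm (R i))\<^sup>2)"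
      using power2_sum_le[of "a i" "- (R i \<bullet> L j)"] trunc_diff[OF i j] by (simp add: a_def)
  qed
  also have "\<dots> = 2 * (\<Sum>i=1..n. (a i)\<^sup>2) + 2 * b * (\<Sum>i=1..n. (norm (R i))\<^sup>2)"
    by (simp add: sum.distrib sum_distrib_left mult.assoc)
  also have "(\<Sum>i=1..n. (a i)\<^sup>2) = (\<Sum>k=1..r. (\<Sum>i=1..n. U i k * E i j)\<^sup>2)"
  proof -
    have "(\<Sum>i=1..n. (norm (\<Sum>k=1..r. U i k *\<^sub>R (\<Sum>i'=1..n. U i' k * E i' j)))\<^sup>2) = (\<Sum>k=1..r. (norm (\<Sum>i'=1..n. U i' k * E i' j))\<^sup>2)"
      by (rule orthonormal_projection(2)) (use U_on r_le in auto)
    then show ?thesis by (simp add: a_def)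
  qed
  also have "2 * b * (\<Sum>i=1..n. (norm (R i))\<^sup>2) \<le> 2 * b * (KR * H * real n / real p)"
    using b_nonneg by (intro mult_left_mono missed_factor_bound) auto
  finally show ?thesis by simp
qed

definition "KC = 16 * real r / \<beta> * (1 + (\<sigma>2 + 2)\<^sup>2) + 2 * b * KR"

lemma KC_nonneg: "KC \<ge> 0"
  using \<beta>_pos b_nonneg KR_nonneg by (simp add: KC_def)

text \<open>For a single column the off-diagonal entries of X'E are at most 2 t sqrt n and the
  diagonal one is of order n. Dividing p n t^2 + n^2 by a squared singular value of order n p gives
  t^2 + n / p, uniformly in the column, as the restricted eigenvalue requires.\<close>

lemma trunc_column_error_bound:
  assumes j: "j \<in> {1..p}"
  shows "(\<Sum>i=1..n. (trunc r i j - F i \<bullet> L j)\<^sup>2) \<le> real n * (KC * (t\<^sup>2 / real n + H / real p))"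
proof -
  have XE: "(\<Sum>i=1..n. X i l * E i j) = (\<Sum>i=1..n. (F i \<bullet> L l) * E i j) + (\<Sum>i=1..n. E i j * E i l)" if "l \<in> {1..p}" for l
    unfolding sum.distrib[symmetric] using that by (intro sum.cong refl) (simp add: X_decomp algebra_simps)
  have off: "(\<Sum>i=1..n. X i l * E i j)\<^sup>2 \<le> 4 * (t\<^sup>2 * real n) + (if j = l then ((\<sigma>2 + 2) * real n)\<^sup>2 else 0)" if l: "l \<in> {1..p}" for l
  proof (cases "j = l")
    case True
    have "\<bar>\<Sum>i=1..n. X i l * E i j\<bar> \<le> (\<sigma>2 + 2) * real n"
    proof -
      have "\<bar>a + e\<bar> \<le> (\<sigma>2 + 2) * real n" if "\<bar>a\<bar> \<le> T" "\<bar>e - real n * \<sigma>2\<bar> \<le> T" "T \<le> real n" for a e T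
      proof -
        have "0 \<le> real n * \<sigma>2" "(\<sigma>2 + 2) * real n = real n * \<sigma>2 + 2 * real n"
          using \<sigma>2 by (simp_all add: algebra_simps)
        then show ?thesis using that by linarith
      qed
      then show ?thesis using C_col[OF l j] E_col[OF j l] XE[OF l] t_sqrt True by simp
    qed
    moreover have "0 \<le> (\<sigma>2 + 2) * real n" using \<sigma>2 by simp
    ultimately have "(\<Sum>i=1..n. X i l * E i j)\<^sup>2 \<le> ((\<sigma>2 + 2) * real n)\<^sup>2"
      using abs_le_square_iff[of "\<Sum>i=1..n. X i l * E i j" "(\<sigma>2 + 2) * real n"] by simp
    then show ?thesis using True by (simp add: add_increasing)
  next
    case False
    have "\<bar>\<Sum>i=1..n. X i l * E i j\<bar> \<le> 2 * (t * sqrt (real n))"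
      using C_col[OF l j] E_col[OF j l] XE[OF l] False by (auto simp: abs_le_iff)
    moreover have "0 \<le> 2 * (t * sqrt (real n))" using t by simp
    ultimately have "(\<Sum>i=1..n. X i l * E i j)\<^sup>2 \<le> (2 * (t * sqrt (real n)))\<^sup>2"
      using abs_le_square_iff[of "\<Sum>i=1..n. X i l * E i j" "2 * (t * sqrt (real n))"] by simp
    then show ?thesis using False by (simp add: power_mult_distrib)
  qed
  have "(\<Sum>l=1..p. (\<Sum>i=1..n. X i l * E i j)\<^sup>2) \<le> (\<Sum>l=1..p. 4 * (t\<^sup>2 * real n) + (if j = l then ((\<sigma>2 + 2) * real n)\<^sup>2 else 0))"
    by (intro sum_mono off)
  also have "\<dots> = 4 * real p * (t\<^sup>2 * real n) + ((\<sigma>2 + 2) * real n)\<^sup>2" using j by (simp add: sum.distrib)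
  finally have XEs: "(\<Sum>l=1..p. (\<Sum>i=1..n. X i l * E i j)\<^sup>2) \<le> 4 * real p * (t\<^sup>2 * real n) + ((\<sigma>2 + 2) * real n)\<^sup>2" .
  define c where "c = 8 / \<beta> * (1 + (\<sigma>2 + 2)\<^sup>2)"
  have c0: "c \<ge> 0" using \<beta>_pos by (simp add: c_def)
  define y where "y = c * (t\<^sup>2 + real n / real p)"
  have one: "(\<Sum>i=1..n. U i k * E i j)\<^sup>2 \<le> y" if k: "k \<in> {1..r}" for k
  proof -
    have "real n * real p * (\<beta> / 2) * (\<Sum>i=1..n. U i k * E i j)\<^sup>2 \<le> (d k)\<^sup>2 * (\<Sum>i=1..n. U i k * E i j)\<^sup>2"
      by (intro mult_right_mono spectral_gap(1) k) simp
    also have "\<dots> \<le> 4 * real p * (t\<^sup>2 * real n) + ((\<sigma>2 + 2) * real n)\<^sup>2"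
      using left_vector_error_le(1)[of k j] k r_le XEs by auto
    also have "\<dots> = real n * real p * (4 * t\<^sup>2 + (\<sigma>2 + 2)\<^sup>2 * (real n / real p))"
      using p_pos by (simp add: power2_eq_square field_simps)
    finally have "(\<beta> / 2) * (\<Sum>i=1..n. U i k * E i j)\<^sup>2 \<le> 4 * t\<^sup>2 + (\<sigma>2 + 2)\<^sup>2 * (real n / real p)"
      unfolding mult.assoc[of "real n * real p"] by (rule mult_left_le_imp_le) (use n_pos p_pos in simp)
    also have "\<dots> \<le> 4 * (1 + (\<sigma>2 + 2)\<^sup>2) * (t\<^sup>2 + real n / real p)"
    proof -
      have "0 \<le> (\<sigma>2 + 2)\<^sup>2 * t\<^sup>2" "0 \<le> real n / real p" "0 \<le> (\<sigma>2 + 2)\<^sup>2 * (real n / real p)" by simp_all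
      then show ?thesis unfolding distrib_left distrib_right by linarith
    qed
    finally have "(\<Sum>i=1..n. U i k * E i j)\<^sup>2 \<le> 4 * (1 + (\<sigma>2 + 2)\<^sup>2) * (t\<^sup>2 + real n / real p) / (\<beta> / 2)"
      using \<beta>_pos by (subst pos_le_divide_eq) (auto simp: mult.commute)
    also have "\<dots> = y" by (simp add: y_def c_def)
    finally show ?thesis .
  qed
  have "(\<Sum>k=1..r. (\<Sum>i=1..n. U i k * E i j)\<^sup>2) \<le> (\<Sum>k=1..r. y)" by (intro sum_mono one)
  then have "(\<Sum>i=1..n. (trunc r i j - F i \<bullet> L j)\<^sup>2) \<le> 2 * (real r * y) + 2 * b * (KR * H * real n / real p)"
    using trunc_column_error[OF j] by simp
  also have "2 * (real r * y) \<le> 16 * real r / \<beta> * (1 + (\<sigma>2 + 2)\<^sup>2) * (t\<^sup>2 + H * (real n / real p))"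
  proof -
    have "real n / real p \<le> H * (real n / real p)"
      using mult_right_mono[OF H, of "real n / real p"] by simp
    then have "y \<le> c * (t\<^sup>2 + H * (real n / real p))"
      unfolding y_def by (intro mult_left_mono c0) simp
    then have "2 * (real r * y) \<le> 2 * (real r * (c * (t\<^sup>2 + H * (real n / real p))))"
      by (intro mult_left_mono) auto
    also have "\<dots> = 16 * real r / \<beta> * (1 + (\<sigma>2 + 2)\<^sup>2) * (t\<^sup>2 + H * (real n / real p))"
      by (simp add: c_def)
    finally show ?thesis .
  qed
  also have "2 * b * (KR * H * real n / real p) \<le> 2 * b * KR * (t\<^sup>2 + H * (real n / real p))"
    using b_nonneg KR_nonneg by (simp add: algebra_simps)
  finally have "(\<Sum>i=1..n. (trunc r i j - F i \<bullet> L j)\<^sup>2) \<le> KC * (t\<^sup>2 + H * (real n / real p))"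
    by (simp add: KC_def distrib_right)
  also have "\<dots> = real n * (KC * (t\<^sup>2 / real n + H / real p))" using n_pos p_pos by (simp add: field_simps)
  finally show ?thesis .
qed

definition "KA = 2 * real r * (4 / \<beta>) * (2 * b + 2 + \<sigma>2\<^sup>2) + 2 * b * KR"

text \<open>Averaging over the columns uses the Frobenius bounds in \<open>H\<close> in place of the
  uniform level \<open>t\<close>. The result carries no logarithm, as it must: its square root is
  compared with c_np when the moments of the residuals are estimated.\<close>

lemma trunc_total_error_bound:
  "(\<Sum>i=1..n. \<Sum>j=1..p. (trunc r i j - F i \<bullet> L j)\<^sup>2) \<le> real n * real p * (KA * H * (1 / real n + 1 / real p))"
proof -
  define q where "q = real n * \<sigma>2"
  have W: "(\<Sum>j=1..p. \<Sum>l=1..p. ((\<Sum>i=1..n. X i l * E i j) - (if j = l then q else 0))\<^sup>2)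
      \<le> (2 * b + 2) * (H * real n * (real p)\<^sup>2)"
  proof -
    have "(\<Sum>j=1..p. \<Sum>l=1..p. ((\<Sum>i=1..n. X i l * E i j) - (if j = l then q else 0))\<^sup>2)
        \<le> (\<Sum>j=1..p. \<Sum>l=1..p. 2 * (b * (norm (\<Sum>i=1..n. E i j *\<^sub>R F i))\<^sup>2)
          + 2 * ((\<Sum>i=1..n. E i j * E i l) - (if j = l then q else 0))\<^sup>2)"
    proof (intro sum_mono)
      fix j l assume j: "j \<in> {1..p}" and l: "l \<in> {1..p}"
      have "(\<Sum>i=1..n. X i l * E i j) = (\<Sum>i=1..n. L l \<bullet> (E i j *\<^sub>R F i) + E i j * E i l)"
        using l by (intro sum.cong refl) (simp add: X_decomp algebra_simps inner_commute)
      also have "\<dots> = L l \<bullet> (\<Sum>i=1..n. E i j *\<^sub>R F i) + (\<Sum>i=1..n. E i j * E i l)"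
        by (simp only: sum.distrib inner_sum_right)
      finally have eq: "(\<Sum>i=1..n. X i l * E i j) - (if j = l then q else 0)
          = L l \<bullet> (\<Sum>i=1..n. E i j *\<^sub>R F i) + ((\<Sum>i=1..n. E i j * E i l) - (if j = l then q else 0))" by simp
      have "(L l \<bullet> (\<Sum>i=1..n. E i j *\<^sub>R F i))\<^sup>2 \<le> (norm (L l))\<^sup>2 * (norm (\<Sum>i=1..n. E i j *\<^sub>R F i))\<^sup>2"
        using Cauchy_Schwarz_ineq[of "L l" "\<Sum>i=1..n. E i j *\<^sub>R F i"] by (simp add: power2_norm_eq_inner)
      also have "\<dots> \<le> b * (norm (\<Sum>i=1..n. E i j *\<^sub>R F i))\<^sup>2" by (intro mult_right_mono L_bound l) simp
      finally show "((\<Sum>i=1..n. X i l * E i j) - (if j = l then q else 0))\<^sup>2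
          \<le> 2 * (b * (norm (\<Sum>i=1..n. E i j *\<^sub>R F i))\<^sup>2) + 2 * ((\<Sum>i=1..n. E i j * E i l) - (if j = l then q else 0))\<^sup>2"
        unfolding eq
        using power2_sum_le[of "L l \<bullet> (\<Sum>i=1..n. E i j *\<^sub>R F i)" "(\<Sum>i=1..n. E i j * E i l) - (if j = l then q else 0)"] by linarith
    qed
    also have "\<dots> = 2 * b * real p * (\<Sum>j=1..p. (norm (\<Sum>i=1..n. E i j *\<^sub>R F i))\<^sup>2)
        + 2 * (\<Sum>j=1..p. \<Sum>l=1..p. ((\<Sum>i=1..n. E i j * E i l) - (if j = l then q else 0))\<^sup>2)"
      by (simp add: sum.distrib flip: sum_distrib_left)
    also have "\<dots> \<le> 2 * b * real p * (H * real n * real p) + 2 * (H * real n * (real p)\<^sup>2)"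
      using E_F E_gram b_nonneg unfolding q_def by (intro add_mono mult_left_mono) auto
    finally show ?thesis by (simp add: power2_eq_square algebra_simps)
  qed
  have one: "(\<Sum>j=1..p. (\<Sum>i=1..n. U i k * E i j)\<^sup>2) \<le> 4 / \<beta> * (2 * b + 2 + \<sigma>2\<^sup>2) * H * (real p + real n / real p)" if k: "k \<in> {1..r}" for k
  proof -
    have "real n * real p * (\<beta> / 2) * (\<Sum>j=1..p. (\<Sum>i=1..n. U i k * E i j)\<^sup>2) \<le> (d k)\<^sup>2 * (\<Sum>j=1..p. (\<Sum>i=1..n. U i k * E i j)\<^sup>2)"
      by (intro mult_right_mono spectral_gap(1) k) (simp add: sum_nonneg)
    also have "\<dots> \<le> 2 * ((2 * b + 2) * (H * real n * (real p)\<^sup>2)) + 2 * q\<^sup>2"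
      using left_vector_error_le(2)[of k q] k r_le W by auto
    also have "\<dots> = real n * real p * (2 * (2 * b + 2) * H * real p + 2 * \<sigma>2\<^sup>2 * (real n / real p))"
      using p_pos by (simp add: q_def power2_eq_square field_simps)
    finally have "(\<beta> / 2) * (\<Sum>j=1..p. (\<Sum>i=1..n. U i k * E i j)\<^sup>2) \<le> 2 * (2 * b + 2) * H * real p + 2 * \<sigma>2\<^sup>2 * (real n / real p)"
      unfolding mult.assoc[of "real n * real p"] by (rule mult_left_le_imp_le) (use n_pos p_pos in simp)
    also have "\<dots> \<le> 2 * (2 * b + 2 + \<sigma>2\<^sup>2) * H * (real p + real n / real p)"
    proof -
      define u where "u = real n / real p"
      have u: "u \<ge> 0" by (simp add: u_def)
      have "0 \<le> \<sigma>2\<^sup>2 * H * real p" "0 \<le> (2 * b + 2) * H * u" using H b_nonneg u by simp_all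
      moreover have "\<sigma>2\<^sup>2 * u \<le> \<sigma>2\<^sup>2 * u * H" using mult_left_mono[OF H, of "\<sigma>2\<^sup>2 * u"] u by simp
      moreover have "2 * (2 * b + 2 + \<sigma>2\<^sup>2) * H * (real p + u)
          = 2 * (2 * b + 2) * H * real p + 2 * (\<sigma>2\<^sup>2 * H * real p) + 2 * ((2 * b + 2) * H * u) + 2 * (\<sigma>2\<^sup>2 * u * H)"
        by (simp add: algebra_simps)
      ultimately show ?thesis unfolding u_def[symmetric] by linarith
    qed
    finally show ?thesis using \<beta>_pos by (simp add: field_simps)
  qed
  have "(\<Sum>i=1..n. \<Sum>j=1..p. (trunc r i j - F i \<bullet> L j)\<^sup>2) = (\<Sum>j=1..p. \<Sum>i=1..n. (trunc r i j - F i \<bullet> L j)\<^sup>2)"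
    by (rule sum.swap)
  also have "\<dots> \<le> (\<Sum>j=1..p. 2 * (\<Sum>k=1..r. (\<Sum>i=1..n. U i k * E i j)\<^sup>2) + 2 * b * (KR * H * real n / real p))"
    by (intro sum_mono trunc_column_error)
  also have "\<dots> = 2 * (\<Sum>j=1..p. \<Sum>k=1..r. (\<Sum>i=1..n. U i k * E i j)\<^sup>2) + real p * (2 * b * (KR * H * real n / real p))"
    by (simp add: sum.distrib sum_distrib_left)
  also have "(\<Sum>j=1..p. \<Sum>k=1..r. (\<Sum>i=1..n. U i k * E i j)\<^sup>2) = (\<Sum>k=1..r. \<Sum>j=1..p. (\<Sum>i=1..n. U i k * E i j)\<^sup>2)"
    by (rule sum.swap)
  also have "2 * \<dots> + real p * (2 * b * (KR * H * real n / real p))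
      \<le> 2 * (\<Sum>k=1..r. 4 / \<beta> * (2 * b + 2 + \<sigma>2\<^sup>2) * H * (real p + real n / real p)) + real p * (2 * b * (KR * H * real n / real p))"
    by (intro add_right_mono mult_left_mono sum_mono one) auto
  also have "\<dots> = 2 * real r * (4 / \<beta>) * (2 * b + 2 + \<sigma>2\<^sup>2) * (H * (real p + real n / real p)) + 2 * b * KR * (H * real n)"
    using p_pos by (simp add: field_simps)
  also have "\<dots> \<le> 2 * real r * (4 / \<beta>) * (2 * b + 2 + \<sigma>2\<^sup>2) * (H * (real p + real n)) + 2 * b * KR * (H * (real p + real n))"
  proof -
    have "real n / real p \<le> real n" using p_pos by (simp add: divide_le_eq mult_le_cancel_left1)
    then show ?thesis using H b_nonneg KR_nonneg \<beta>_pos by (intro add_mono mult_left_mono) auto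
  qed
  also have "\<dots> = KA * H * (real p + real n)" by (simp add: KA_def algebra_simps)
  also have "\<dots> = real n * real p * (KA * H * (1 / real n + 1 / real p))" using n_pos p_pos by (simp add: field_simps)
  finally show ?thesis .
qed

end

section \<open>Empirical moments of perturbed errors\<close>

lemma power_perturbation_le:
  fixes x \<delta> K :: real
  assumes "\<bar>\<delta>\<bar> \<le> K"
  shows "\<bar>(x - \<delta>) ^ k - x ^ k\<bar> \<le> real k * 2 ^ k * \<bar>\<delta>\<bar> * (\<bar>x\<bar> ^ (k - 1) + K ^ (k - 1))"
proof (cases k)
  case (Suc l)
  define mx where "mx = max \<bar>x\<bar> K"
  have K: "K \<ge> 0" using assms by linarith
  have mx: "mx \<ge> 0" "\<bar>x\<bar> \<le> mx" "K \<le> mx" by (auto simp: mx_def le_max_iff_disj)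
  have b: "\<bar>x - \<delta>\<bar> \<le> 2 * mx" "\<bar>x\<bar> \<le> 2 * mx" using assms mx by linarith+
  have bnd: "\<bar>(x - \<delta>) ^ p * x ^ (l - p)\<bar> \<le> (2 * mx) ^ l" if "p < Suc l" for p
  proof -
    have "\<bar>(x - \<delta>) ^ p * x ^ (l - p)\<bar> = \<bar>x - \<delta>\<bar> ^ p * \<bar>x\<bar> ^ (l - p)" by (simp add: abs_mult power_abs)
    also have "\<dots> \<le> (2 * mx) ^ p * (2 * mx) ^ (l - p)"
      using b mx by (intro mult_mono power_mono) auto
    also have "\<dots> = (2 * mx) ^ l" using that by (simp only: power_add[symmetric]) simp
    finally show ?thesis .
  qed
  have "\<bar>(x - \<delta>) ^ k - x ^ k\<bar> = \<bar>- \<delta> * (\<Sum>p<Suc l. (x - \<delta>) ^ p * x ^ (l - p))\<bar>"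
    unfolding Suc power_diff_sumr2[of "x - \<delta>" "Suc l" x] by (simp add: algebra_simps)
  also have "\<dots> = \<bar>\<delta>\<bar> * \<bar>\<Sum>p<Suc l. (x - \<delta>) ^ p * x ^ (l - p)\<bar>" by (simp only: abs_mult abs_minus_cancel)
  also have "\<dots> \<le> \<bar>\<delta>\<bar> * (\<Sum>p<Suc l. (2 * mx) ^ l)"
  proof (rule mult_left_mono)
    show "\<bar>\<Sum>p<Suc l. (x - \<delta>) ^ p * x ^ (l - p)\<bar> \<le> (\<Sum>p<Suc l. (2 * mx) ^ l)"
      by (rule order.trans[OF sum_abs], rule sum_mono) (use bnd in auto)
  qed simp
  also have "\<dots> = real k * 2 ^ l * \<bar>\<delta>\<bar> * mx ^ l" by (simp add: Suc power_mult_distrib)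
  also have "\<dots> \<le> real k * 2 ^ l * \<bar>\<delta>\<bar> * (\<bar>x\<bar> ^ l + K ^ l)"
  proof (rule mult_left_mono)
    show "mx ^ l \<le> \<bar>x\<bar> ^ l + K ^ l" using K by (auto simp: mx_def max_def)
  qed simp
  also have "\<dots> \<le> real k * 2 ^ k * \<bar>\<delta>\<bar> * (\<bar>x\<bar> ^ l + K ^ l)"
    using K by (intro mult_right_mono mult_left_mono) (auto simp: Suc)
  finally show ?thesis by (simp add: Suc)
qed simp

text \<open>The error is of first order in \<delta>: \<open>K\<close> caps the higher powers, and
  Cauchy--Schwarz pairs \<delta> with x^(k-1), so that only the mean square of \<delta> and the
  moment of x of order 2 (k - 1) enter.\<close>

lemma empirical_moment_error:
  fixes x \<delta> :: "'i \<Rightarrow> real"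
  assumes A: "finite A" "card A > 0" and k: "k \<ge> 1"
    and \<delta>: "\<And>z. z \<in> A \<Longrightarrow> \<bar>\<delta> z\<bar> \<le> K" "(\<Sum>z\<in>A. (\<delta> z)\<^sup>2) \<le> real (card A) * a"
    and mean: "(\<Sum>z\<in>A. x z ^ k - \<mu>)\<^sup>2 \<le> H * real (card A)"
    and pow: "(\<Sum>z\<in>A. (x z ^ (k - 1))\<^sup>2) \<le> H * real (card A)"
  shows "\<bar>(\<Sum>z\<in>A. (x z - \<delta> z) ^ k) / real (card A) - \<mu>\<bar>
    \<le> sqrt (H / real (card A)) + real k * 2 ^ k * (sqrt H + K ^ (k - 1)) * sqrt a"
proof -
  define N where "N = real (card A)"
  have N: "N > 0" using A by (simp add: N_def)
  obtain z0 where "z0 \<in> A" using A by (metis card.empty equals0I less_irrefl)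
  then have K: "K \<ge> 0" using \<delta>(1) by fastforce
  define S where "S = (\<Sum>z\<in>A. \<bar>\<delta> z\<bar>)"
  define T where "T = (\<Sum>z\<in>A. \<bar>\<delta> z\<bar> * \<bar>x z\<bar> ^ (k - 1))"
  have "0 \<le> (\<Sum>z\<in>A. (\<delta> z)\<^sup>2)" by (simp add: sum_nonneg)
  then have "0 \<le> N * a" using \<delta>(2) by (simp add: N_def)
  then have a: "a \<ge> 0" using N by (simp add: zero_le_mult_iff)
  have "0 \<le> (\<Sum>z\<in>A. (x z ^ (k - 1))\<^sup>2)" by (simp add: sum_nonneg)
  then have "0 \<le> H * N" using pow by (simp add: N_def)
  then have H: "H \<ge> 0" using N by (simp add: zero_le_mult_iff)
  have "S\<^sup>2 \<le> (\<Sum>z\<in>A. (1::real)\<^sup>2) * (\<Sum>z\<in>A. \<bar>\<delta> z\<bar>\<^sup>2)"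
    using Cauchy_Schwarz_ineq_sum[of "\<lambda>_. 1" "\<lambda>z. \<bar>\<delta> z\<bar>" A] by (simp add: S_def)
  also have "\<dots> = N * (\<Sum>z\<in>A. (\<delta> z)\<^sup>2)" by (simp add: N_def)
  also have "\<dots> \<le> N * (N * a)" using \<delta>(2) N by (intro mult_left_mono) (auto simp: N_def)
  also have "\<dots> = (N * sqrt a)\<^sup>2" using a by (simp add: power2_eq_square)
  finally have S: "S \<le> N * sqrt a" by (rule power2_le_imp_le) (use N a in simp)
  have "T\<^sup>2 \<le> (\<Sum>z\<in>A. \<bar>\<delta> z\<bar>\<^sup>2) * (\<Sum>z\<in>A. (\<bar>x z\<bar> ^ (k - 1))\<^sup>2)"
    unfolding T_def by (rule Cauchy_Schwarz_ineq_sum)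
  also have "\<dots> = (\<Sum>z\<in>A. (\<delta> z)\<^sup>2) * (\<Sum>z\<in>A. (x z ^ (k - 1))\<^sup>2)" by (simp add: power_abs[symmetric])
  also have "\<dots> \<le> (N * a) * (H * N)"
    using \<delta>(2) pow N a by (intro mult_mono) (auto simp: N_def sum_nonneg)
  also have "\<dots> = (N * (sqrt H * sqrt a))\<^sup>2" using a H by (simp add: power_mult_distrib real_sqrt_pow2) (simp add: power2_eq_square)
  finally have T: "T \<le> N * (sqrt H * sqrt a)" by (rule power2_le_imp_le) (use N a H in simp)
  have "\<bar>\<Sum>z\<in>A. (x z - \<delta> z) ^ k - x z ^ k\<bar> \<le> (\<Sum>z\<in>A. real k * 2 ^ k * \<bar>\<delta> z\<bar> * (\<bar>x z\<bar> ^ (k - 1) + K ^ (k - 1)))"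
    by (rule order.trans[OF sum_abs], rule sum_mono, rule power_perturbation_le) (rule \<delta>(1))
  also have "\<dots> = real k * 2 ^ k * (T + K ^ (k - 1) * S)"
    by (simp add: T_def S_def algebra_simps sum.distrib sum_distrib_left)
  also have "\<dots> \<le> real k * 2 ^ k * (N * (sqrt H * sqrt a) + K ^ (k - 1) * (N * sqrt a))"
    using S T K by (intro mult_left_mono add_mono) auto
  also have "\<dots> = N * (real k * 2 ^ k * (sqrt H + K ^ (k - 1)) * sqrt a)" by (simp add: algebra_simps)
  finally have 1: "\<bar>\<Sum>z\<in>A. (x z - \<delta> z) ^ k - x z ^ k\<bar> \<le> N * (real k * 2 ^ k * (sqrt H + K ^ (k - 1)) * sqrt a)" .
  have "(\<Sum>z\<in>A. x z ^ k - \<mu>)\<^sup>2 \<le> (sqrt (H * N))\<^sup>2" using mean H N by (simp add: N_def)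
  then have 2: "\<bar>\<Sum>z\<in>A. x z ^ k - \<mu>\<bar> \<le> sqrt (H * N)"
    using H N abs_le_square_iff[of "\<Sum>z\<in>A. x z ^ k - \<mu>" "sqrt (H * N)"] by simp
  have "sqrt (H * N) = N * sqrt (H / N)"
    using N by (simp add: real_sqrt_mult real_sqrt_divide field_simps)
  moreover have "(\<Sum>z\<in>A. (x z - \<delta> z) ^ k) / N - \<mu> = ((\<Sum>z\<in>A. (x z - \<delta> z) ^ k - x z ^ k) + (\<Sum>z\<in>A. x z ^ k - \<mu>)) / N"
    using N by (simp add: sum_subtractf N_def field_simps)
  ultimately have "\<bar>(\<Sum>z\<in>A. (x z - \<delta> z) ^ k) / N - \<mu>\<bar>
      \<le> (N * (real k * 2 ^ k * (sqrt H + K ^ (k - 1)) * sqrt a) + N * sqrt (H / N)) / N"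
    using 1 2 N by (simp add: abs_divide divide_right_mono)
  also have "\<dots> = sqrt (H / N) + real k * 2 ^ k * (sqrt H + K ^ (k - 1)) * sqrt a"
    using N by (simp add: add_divide_distrib)
  finally show ?thesis by (simp add: N_def)
qed

section \<open>Exponential moments and tail bounds\<close>

text \<open>Only the exceptional set has to be measurable: the properties used later quantify over
  all vectors y or over a ball of parameters \<eta>, and measurability of such sets is not
  evident.\<close>

definition holds_except :: "'a measure \<Rightarrow> real \<Rightarrow> ('a \<Rightarrow> bool) \<Rightarrow> bool" where
  "holds_except P \<delta> \<phi> \<longleftrightarrow> (\<exists>N\<in>sets P. measure P N \<le> \<delta> \<and> (\<forall>\<omega>\<in>space P - N. \<phi> \<omega>))"

lemma holds_except_mono:
  assumes "holds_except P \<delta> \<phi>" "\<delta> \<le> \<delta>'" "\<And>\<omega>. \<omega> \<in> space P \<Longrightarrow> \<phi> \<omega> \<Longrightarrow> \<psi> \<omega>"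
  shows "holds_except P \<delta>' \<psi>"
proof -
  from assms(1) obtain N where "N \<in> sets P" "measure P N \<le> \<delta>" "\<forall>\<omega>\<in>space P - N. \<phi> \<omega>"
    unfolding holds_except_def by blast
  then show ?thesis unfolding holds_except_def using assms(2,3) by (intro bexI[of _ N]) auto
qed

context prob_space begin

lemma holds_except_conj:
  assumes "holds_except M \<delta> \<phi>" "holds_except M \<epsilon> \<psi>"
  shows "holds_except M (\<delta> + \<epsilon>) (\<lambda>\<omega>. \<phi> \<omega> \<and> \<psi> \<omega>)"
proof -
  from assms(1) obtain N where N: "N \<in> sets M" "prob N \<le> \<delta>" "\<forall>\<omega>\<in>space M - N. \<phi> \<omega>"
    unfolding holds_except_def by blast
  from assms(2) obtain N' where N': "N' \<in> sets M" "prob N' \<le> \<epsilon>" "\<forall>\<omega>\<in>space M - N'. \<psi> \<omega>"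
    unfolding holds_except_def by blast
  have "prob (N \<union> N') \<le> \<delta> + \<epsilon>"
    using measure_Un_le[OF N(1) N'(1)] N(2) N'(2) by linarith
  then show ?thesis
    unfolding holds_except_def using N(1,3) N'(1,3) by (intro bexI[of _ "N \<union> N'"]) auto
qed

lemma holds_except_ball:
  assumes "finite I" "\<And>i. i \<in> I \<Longrightarrow> holds_except M \<delta> (\<phi> i)"
  shows "holds_except M (real (card I) * \<delta>) (\<lambda>\<omega>. \<forall>i\<in>I. \<phi> i \<omega>)"
  using assms
proof (induction I rule: finite_induct)
  case empty
  show ?case unfolding holds_except_def by (intro bexI[of _ "{}"]) auto
next
  case (insert i I)
  have "holds_except M (\<delta> + real (card I) * \<delta>) (\<lambda>\<omega>. \<phi> i \<omega> \<and> (\<forall>i\<in>I. \<phi> i \<omega>))"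
    by (intro holds_except_conj insert) auto
  then show ?case by (rule holds_except_mono) (use insert.hyps in \<open>auto simp: algebra_simps\<close>)
qed

lemma holds_except_AE:
  assumes "AE \<omega> in M. \<phi> \<omega>"
  shows "holds_except M 0 \<phi>"
proof -
  from AE_E[OF assms] obtain N where "{x \<in> space M. \<not> \<phi> x} \<subseteq> N" "emeasure M N = 0" "N \<in> sets M"
    by metis
  then show ?thesis unfolding holds_except_def
    by (intro bexI[of _ N]) (auto simp: measure_def)
qed

lemma holds_except_Markov:
  assumes X: "X \<in> borel_measurable M" and X0: "\<And>\<omega>. X \<omega> \<ge> 0"
    and int: "(\<integral>\<^sup>+\<omega>. ennreal (X \<omega>) \<partial>M) \<le> ennreal K" and K: "K \<ge> 0" and \<delta>: "\<delta> > 0" and u: "u > 0" "K \<le> \<delta> * u"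
  shows "holds_except M \<delta> (\<lambda>\<omega>. X \<omega> \<le> u)"
proof -
  define N where "N = {\<omega> \<in> space M. X \<omega> > u}"
  have N: "N \<in> sets M" using X unfolding N_def by measurable
  have "ennreal u * emeasure M N = (\<integral>\<^sup>+\<omega>. ennreal u * indicator N \<omega> \<partial>M)"
    using N by (simp add: nn_integral_cmult_indicator)
  also have "\<dots> \<le> (\<integral>\<^sup>+\<omega>. ennreal (X \<omega>) \<partial>M)"
    by (intro nn_integral_mono) (auto simp: N_def indicator_def intro: ennreal_leI)
  also have "\<dots> \<le> ennreal K" by (rule int)
  finally have "ennreal (u * prob N) \<le> ennreal K"
    using u by (simp add: emeasure_eq_measure ennreal_mult)
  then have "u * prob N \<le> K" using K by (simp add: ennreal_le_iff)
  also have "\<dots> \<le> u * \<delta>" using u by (simp add: mult.commute)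
  finally have "prob N \<le> \<delta>" using u by simp
  then show ?thesis unfolding holds_except_def using N by (intro bexI[of _ N]) (auto simp: N_def)
qed

lemma expectation_ge_of_holds_except:
  assumes "holds_except M \<delta> (\<lambda>\<omega>. \<gamma> \<le> f \<omega>)" "f \<in> borel_measurable M"
    and f: "\<And>\<omega>. 0 \<le> f \<omega>" "\<And>\<omega>. f \<omega> \<le> 1" and \<gamma>: "0 \<le> \<gamma>" "\<gamma> \<le> 1"
  shows "expectation f \<ge> \<gamma> - \<delta>"
proof -
  from assms(1) obtain N where N: "N \<in> sets M" "prob N \<le> \<delta>" "\<forall>\<omega>\<in>space M - N. \<gamma> \<le> f \<omega>"
    unfolding holds_except_def by blast
  have int: "integrable M f"
    by (rule integrable_const_bound[of _ 1]) (use assms in auto)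
  have "\<gamma> - \<delta> \<le> \<gamma> - \<gamma> * prob N"
    using mult_right_le_one_le[of "prob N" \<gamma>] \<gamma> N(2) by (simp add: mult.commute)
  also have "\<dots> = (\<integral>\<omega>. \<gamma> - \<gamma> * indicator N \<omega> \<partial>M)"
    using N(1) by (subst Bochner_Integration.integral_diff) (auto simp: prob_space emeasure_eq_measure)
  also have "\<dots> \<le> expectation f"
  proof (rule integral_mono)
    show "integrable M (\<lambda>\<omega>. \<gamma> - \<gamma> * indicator N \<omega>)" using N(1) by (auto simp: emeasure_eq_measure)
    show "\<gamma> - \<gamma> * indicator N \<omega> \<le> f \<omega>" if "\<omega> \<in> space M" for \<omega>
      using N(3) that f by (auto simp: indicator_def)
  qed (rule int)
  finally show ?thesis .
qed

end

text \<open>The moment generating functions are kept as nonnegative integrals, so that integrability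
  need not be carried along.\<close>

lemma exp_le_quadratic:
  fixes x :: real
  shows "exp x \<le> 1 + x + x\<^sup>2 * exp \<bar>x\<bar>"
proof (cases "\<bar>x\<bar> \<le> 1")
  case True
  have "exp x \<le> 1 + x + x\<^sup>2" 
  proof (cases "x \<ge> 0")
    case True then show ?thesis using exp_bound[of x] \<open>\<bar>x\<bar> \<le> 1\<close> by simp
  next
    case False
    have "\<exists>t. \<bar>t\<bar> \<le> \<bar>x\<bar> \<and> exp x = (\<Sum>m<2. x ^ m / fact m) + exp t / fact 2 * x ^ 2"
      by (rule Maclaurin_exp_le)
    then obtain t where t: "\<bar>t\<bar> \<le> \<bar>x\<bar>" "exp x = 1 + x + exp t / 2 * x\<^sup>2"
      by (auto simp: numeral_2_eq_2)
    show ?thesis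
    proof -
      have "exp x \<le> 1 + x + x\<^sup>2 / 2" if "x \<le> 0" for x :: real
      proof -
        have "1 + x + x\<^sup>2/2 - exp x \<ge> 1 + 0 + 0\<^sup>2/2 - exp (0::real)"
          by (rule DERIV_nonpos_imp_nonincreasing[of x 0 "\<lambda>x. 1 + x + x\<^sup>2/2 - exp x"])
            (use that in \<open>auto intro!: exI derivative_eq_intros simp: exp_ge_add_one_self\<close>)
        then show ?thesis by simp
      qed
      from this[of x] False show ?thesis by (smt (verit) field_sum_of_halves zero_le_power2)
    qed
  qed
  also have "\<dots> \<le> 1 + x + x\<^sup>2 * exp \<bar>x\<bar>"
    using mult_left_mono[of 1 "exp \<bar>x\<bar>" "x\<^sup>2"] by simp
  finally show ?thesis .
next
  case False
  then have "x\<^sup>2 \<ge> 1" using abs_le_square_iff[of 1 x] by simp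
  show ?thesis
  proof (cases "x \<ge> 0")
    case True
    have "exp x \<le> x\<^sup>2 * exp x" using \<open>x\<^sup>2 \<ge> 1\<close> by (simp add: mult_le_cancel_right1)
    with True show ?thesis by (smt (verit))
  next
    case neg: False
    then have "exp x \<le> 1" by simp
    moreover have "- x \<le> x\<^sup>2 * exp \<bar>x\<bar>"
    proof -
      have "- x * 1 \<le> - x * - x" using False neg by (intro mult_left_mono) auto
      then have "- x \<le> x\<^sup>2" by (simp add: power2_eq_square)
      also have "\<dots> \<le> x\<^sup>2 * exp \<bar>x\<bar>" using mult_left_mono[of 1 "exp \<bar>x\<bar>" "x\<^sup>2"] by simp
      finally show ?thesis .
    qed
    ultimately show ?thesis by linarith
  qed
qed

lemma square_le_two_exp: "(x::real)\<^sup>2 \<le> 2 * exp \<bar>x\<bar>"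
  using exp_lower_Taylor_quadratic[of "\<bar>x\<bar>"] by simp

context prob_space begin

text \<open>Bernstein's argument for a centred variable. Half of the rate \<alpha> is spent on the
  exponential itself, the other half absorbs the quadratic factor; the linear term integrates to 0,
  which makes the exponent quadratic in \<open>b\<close>.\<close>

lemma nn_integral_exp_le:
  assumes Y: "Y \<in> borel_measurable M" "integrable M Y" "expectation Y = 0"
    and \<alpha>: "\<alpha> > 0" and B: "B \<ge> 0" "(\<integral>\<^sup>+\<omega>. ennreal (exp (\<alpha> * \<bar>Y \<omega>\<bar>)) \<partial>M) \<le> ennreal B"
    and b: "\<bar>b\<bar> \<le> 1"
  shows "(\<integral>\<^sup>+\<omega>. ennreal (exp (\<alpha> / 2 * b * Y \<omega>)) \<partial>M) \<le> ennreal (exp (2 * B * b\<^sup>2))"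
proof -
  define \<theta> where "\<theta> = \<alpha> / 2"
  have intE: "integrable M (\<lambda>\<omega>. exp (\<alpha> * \<bar>Y \<omega>\<bar>))"
  proof (rule integrableI_bounded)
    show "(\<integral>\<^sup>+\<omega>. ennreal (norm (exp (\<alpha> * \<bar>Y \<omega>\<bar>))) \<partial>M) < \<infinity>"
      using B(2) by (simp add: order.strict_trans1 ennreal_less_top)
  qed (use Y in measurable)
  have EB: "expectation (\<lambda>\<omega>. exp (\<alpha> * \<bar>Y \<omega>\<bar>)) \<le> B"
    using B by (subst integral_eq_nn_integral) (use Y in \<open>auto simp: enn2real_leI\<close>)
  have le: "exp (\<theta> * b * y) \<le> 1 + \<theta> * b * y + 2 * b\<^sup>2 * exp (\<alpha> * \<bar>y\<bar>)" for y
  proof -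
    have "(\<theta> * b * y)\<^sup>2 * exp \<bar>\<theta> * b * y\<bar> \<le> (b\<^sup>2 * (2 * exp \<bar>\<theta> * y\<bar>)) * exp \<bar>\<theta> * y\<bar>"
    proof (rule mult_mono)
      have "(\<theta> * b * y)\<^sup>2 = b\<^sup>2 * (\<theta> * y)\<^sup>2" by (simp add: power_mult_distrib)
      also have "\<dots> \<le> b\<^sup>2 * (2 * exp \<bar>\<theta> * y\<bar>)" by (intro mult_left_mono square_le_two_exp) auto
      finally show "(\<theta> * b * y)\<^sup>2 \<le> b\<^sup>2 * (2 * exp \<bar>\<theta> * y\<bar>)" .
      have "\<bar>\<theta> * b * y\<bar> = \<bar>b\<bar> * \<bar>\<theta> * y\<bar>" by (simp add: abs_mult)
      also have "\<dots> \<le> \<bar>\<theta> * y\<bar>" using b by (simp add: mult_left_le_one_le)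
      finally show "exp \<bar>\<theta> * b * y\<bar> \<le> exp \<bar>\<theta> * y\<bar>" by simp
    qed auto
    also have "\<dots> = 2 * b\<^sup>2 * exp (\<bar>\<theta> * y\<bar> + \<bar>\<theta> * y\<bar>)" unfolding exp_add by (simp only: mult_ac)
    also have "\<bar>\<theta> * y\<bar> + \<bar>\<theta> * y\<bar> = \<alpha> * \<bar>y\<bar>" using \<alpha> by (simp add: \<theta>_def abs_mult)
    finally show ?thesis using exp_le_quadratic[of "\<theta> * b * y"] by linarith
  qed
  have int2: "integrable M (\<lambda>\<omega>. 1 + \<theta> * b * Y \<omega> + 2 * b\<^sup>2 * exp (\<alpha> * \<bar>Y \<omega>\<bar>))"
    using Y intE by auto
  have nonneg: "0 \<le> 1 + \<theta> * b * y + 2 * b\<^sup>2 * exp (\<alpha> * \<bar>y\<bar>)" for y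
    by (rule order.trans[OF _ le]) simp
  have "(\<integral>\<^sup>+\<omega>. ennreal (exp (\<theta> * b * Y \<omega>)) \<partial>M)
      \<le> (\<integral>\<^sup>+\<omega>. ennreal (1 + \<theta> * b * Y \<omega> + 2 * b\<^sup>2 * exp (\<alpha> * \<bar>Y \<omega>\<bar>)) \<partial>M)"
    by (intro nn_integral_mono ennreal_leI le)
  also have "\<dots> = ennreal (expectation (\<lambda>\<omega>. 1 + \<theta> * b * Y \<omega> + 2 * b\<^sup>2 * exp (\<alpha> * \<bar>Y \<omega>\<bar>)))"
    using int2 nonneg by (intro nn_integral_eq_integral) auto
  also have "expectation (\<lambda>\<omega>. 1 + \<theta> * b * Y \<omega> + 2 * b\<^sup>2 * exp (\<alpha> * \<bar>Y \<omega>\<bar>))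
      = 1 + 2 * b\<^sup>2 * expectation (\<lambda>\<omega>. exp (\<alpha> * \<bar>Y \<omega>\<bar>))"
    using Y intE by (simp add: prob_space)
  also have "ennreal \<dots> \<le> ennreal (exp (2 * B * b\<^sup>2))"
  proof (rule ennreal_leI)
    have "1 + 2 * b\<^sup>2 * expectation (\<lambda>\<omega>. exp (\<alpha> * \<bar>Y \<omega>\<bar>)) \<le> 1 + 2 * B * b\<^sup>2"
      using mult_left_mono[OF EB, of "2 * b\<^sup>2"] by (simp add: mult_ac)
    also have "\<dots> \<le> exp (2 * B * b\<^sup>2)" by (rule exp_ge_add_one_self)
    finally show "1 + 2 * b\<^sup>2 * expectation (\<lambda>\<omega>. exp (\<alpha> * \<bar>Y \<omega>\<bar>)) \<le> exp (2 * B * b\<^sup>2)" .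
  qed
  finally show ?thesis by (simp add: \<theta>_def)
qed

text \<open>Slice X^2 / v at the integers: the slice from k to k + 1 contributes at most exp ((k +
  1) / 2) times 2 exp (- k), a geometric series of ratio exp (-1/2). The bound is free of
  \<open>v\<close>, and any larger proxy \<open>w\<close> is allowed, so one constant serves
  variables with different proxies.\<close>

lemma subG_exp_square:
  assumes "subG M v X" "v > 0" "v \<le> w"
  shows "(\<integral>\<^sup>+\<omega>. ennreal (exp (1 / (2 * w) * (X \<omega>)\<^sup>2)) \<partial>M) \<le> ennreal (1 + 2 * exp (1/2) / (1 - exp (-1/2)))"
proof -
  have X: "X \<in> borel_measurable M" and tail: "\<And>u. u \<ge> 0 \<Longrightarrow> prob {\<omega> \<in> space M. \<bar>X \<omega>\<bar> > u} \<le> 2 * exp (- u\<^sup>2 / v)"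
    using assms(1) by (auto simp: subG_def)
  define A where "A k = {\<omega> \<in> space M. \<bar>X \<omega>\<bar> > sqrt (real k * v)}" for k :: nat
  have A: "A k \<in> sets M" for k using X unfolding A_def by measurable
  have pA: "prob (A k) \<le> 2 * exp (- real k)" for k
    using tail[of "sqrt (real k * v)"] assms(2) by (simp add: A_def)
  have point: "ennreal (exp (1 / (2 * w) * (X \<omega>)\<^sup>2))
      \<le> 1 + (\<Sum>k. ennreal (exp ((real k + 1) / 2)) * indicator (A k) \<omega>)" if \<omega>: "\<omega> \<in> space M" for \<omega>
  proof (cases "X \<omega> = 0")
    case False
    define z where "z = (X \<omega>)\<^sup>2 / v"
    have z: "z > 0" using False assms(2) by (simp add: z_def)
    \<comment> \<open>The ceiling minus 1 rather than the floor: the tail event is strict, so k < z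
      is wanted for integral z too.\<close>
    define k where "k = nat (\<lceil>z\<rceil> - 1)"
    have k: "real k < z" "z \<le> real k + 1" using z unfolding k_def by linarith+
    have "real k * v < (X \<omega>)\<^sup>2" using k(1) assms(2) by (simp add: z_def field_simps)
    then have "sqrt (real k * v) < \<bar>X \<omega>\<bar>" by (metis real_sqrt_abs real_sqrt_less_iff)
    then have kA: "\<omega> \<in> A k" using \<omega> by (simp add: A_def)
    have "1 / (2 * w) * (X \<omega>)\<^sup>2 \<le> z / 2"
      using assms by (simp add: z_def field_simps mult_right_mono)
    also have "\<dots> \<le> (real k + 1) / 2" using k by simp
    finally have "ennreal (exp (1 / (2 * w) * (X \<omega>)\<^sup>2)) \<le> ennreal (exp ((real k + 1) / 2)) * indicator (A k) \<omega>"
      using kA by (simp add: ennreal_leI)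
    also have "\<dots> \<le> (\<Sum>k. ennreal (exp ((real k + 1) / 2)) * indicator (A k) \<omega>)"
    proof -
      have "sum f {k} \<le> suminf f" for f :: "nat \<Rightarrow> ennreal"
        by (rule sum_le_suminf) auto
      then show ?thesis by (metis (no_types, lifting) sum.empty sum.insert add_0_right empty_iff finite.emptyI)
    qed
    finally show ?thesis by (simp add: add_increasing)
  qed simp
  have moment: "(\<integral>\<^sup>+\<omega>. ennreal (exp ((real k + 1) / 2)) * indicator (A k) \<omega> \<partial>M)
      \<le> ennreal (2 * exp (1/2) * exp (-1/2) ^ k)" for k
  proof -
    have "(\<integral>\<^sup>+\<omega>. ennreal (exp ((real k + 1) / 2)) * indicator (A k) \<omega> \<partial>M)
        = ennreal (exp ((real k + 1) / 2) * prob (A k))"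
      using A by (simp add: nn_integral_cmult_indicator emeasure_eq_measure ennreal_mult)
    also have "\<dots> \<le> ennreal (exp ((real k + 1) / 2) * (2 * exp (- real k)))"
      by (intro ennreal_leI mult_left_mono pA) auto
    also have "exp ((real k + 1) / 2) * (2 * exp (- real k)) = 2 * (exp ((real k + 1) / 2) * exp (- real k))" by simp
    also have "exp ((real k + 1) / 2) * exp (- real k) = exp (1/2) * exp (real k * (-1/2))"
      by (simp add: field_simps flip: exp_add)
    also have "exp (real k * (-1/2)) = exp (-1/2) ^ k" by (rule exp_of_nat_mult)
    finally show ?thesis by (simp add: mult.assoc)
  qed
  have sm: "(\<lambda>k. 2 * exp (1/2) * exp (-1/2) ^ k) sums (2 * exp (1/2) * (1 / (1 - exp (-1/2::real))))"
    by (intro sums_mult geometric_sums) simp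
  have "(\<integral>\<^sup>+\<omega>. ennreal (exp (1 / (2 * w) * (X \<omega>)\<^sup>2)) \<partial>M)
      \<le> (\<integral>\<^sup>+\<omega>. 1 + (\<Sum>k. ennreal (exp ((real k + 1) / 2)) * indicator (A k) \<omega>) \<partial>M)"
    by (intro nn_integral_mono point)
  also have "\<dots> = 1 + (\<Sum>k. (\<integral>\<^sup>+\<omega>. ennreal (exp ((real k + 1) / 2)) * indicator (A k) \<omega> \<partial>M))"
    using A by (subst nn_integral_add) (auto simp: nn_integral_suminf emeasure_space_1)
  also have "\<dots> \<le> 1 + (\<Sum>k. ennreal (2 * exp (1/2) * exp (-1/2) ^ k))"
    by (intro add_left_mono suminf_le moment) auto
  also have "(\<Sum>k. ennreal (2 * exp (1/2) * exp (-1/2) ^ k)) = ennreal (2 * exp (1/2) * (1 / (1 - exp (-1/2))))"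
    using sm by (intro suminf_ennreal_eq) auto
  also have "1 + ennreal (2 * exp (1/2) * (1 / (1 - exp (-1/2)))) = ennreal (1 + 2 * exp (1/2) / (1 - exp (-1/2)))"
    by (subst ennreal_plus) auto
  finally show ?thesis .
qed


section \<open>Weighted sums of independent variables\<close>

lemma indep_vars_reindex:
  assumes f: "inj_on f J" and X: "indep_vars N X (f ` J)"
  shows "indep_vars (\<lambda>j. N (f j)) (\<lambda>j. X (f j)) J"
  unfolding indep_vars_def2
proof (intro conjI ballI indep_setsI)
  show "random_variable (N (f j)) (X (f j))" if "j \<in> J" for j
    using X that by (auto simp: indep_vars_def2)
  then show "{X (f j) -` A \<inter> space M |A. A \<in> sets (N (f j))} \<subseteq> events" if "j \<in> J" for j
    using that by (auto intro: measurable_sets)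
  fix A K assume K: "K \<noteq> {}" "K \<subseteq> J" "finite K"
    and A: "\<forall>j\<in>K. A j \<in> {X (f j) -` A \<inter> space M |A. A \<in> sets (N (f j))}"
  have inj: "inj_on f K" using f K by (auto intro: inj_on_subset)
  have eq: "A (the_inv_into K f (f j)) = A j" if "j \<in> K" for j
    using the_inv_into_f_f[OF inj that] by simp
  have "prob (\<Inter>i\<in>f ` K. A (the_inv_into K f i)) = (\<Prod>i\<in>f ` K. prob (A (the_inv_into K f i)))"
    by (rule indep_setsD[of "\<lambda>i. {X i -` A \<inter> space M |A. A \<in> sets (N i)}" "f ` J"])
      (use X K A eq in \<open>auto simp: indep_vars_def2\<close>)
  then show "prob (\<Inter>j\<in>K. A j) = (\<Prod>j\<in>K. prob (A j))"
    using eq by (simp add: prod.reindex[OF inj])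
qed

text \<open>Turns bounds for random weights into bounds for fixed ones, such as the plain
  sum.\<close>

lemma indep_var_const:
  assumes c: "c \<in> space S" and Y: "random_variable T Y"
  shows "indep_var S (\<lambda>_. c) T Y"
proof -
  have "prob (A \<inter> B) = prob A * prob B" if "A = {} \<or> A = space M" "B \<in> events" for A B
    using that sets.sets_into_space[OF that(2)] by (auto simp: prob_space Int_absorb1)
  then have "indep_set {(\<lambda>_. c) -` A \<inter> space M |A. A \<in> sets S} {Y -` A \<inter> space M |A. A \<in> sets T}"
    using Y by (intro indep_setI) (auto intro: measurable_sets)
  moreover have "Int_stable {(\<lambda>_::'a. c) -` A \<inter> space M |A. A \<in> sets S}"
  proof (rule Int_stableI, clarify)
    fix A B assume "A \<in> sets S" "B \<in> sets S"
    then show "\<exists>C. (\<lambda>_. c) -` A \<inter> space M \<inter> ((\<lambda>_. c) -` B \<inter> space M) = (\<lambda>_. c) -` C \<inter> space M \<and> C \<in> sets S"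
      by (intro exI[of _ "A \<inter> B"]) auto
  qed
  moreover have "Int_stable {Y -` A \<inter> space M |A. A \<in> sets T}"
  proof (rule Int_stableI, clarify)
    fix A B assume "A \<in> sets T" "B \<in> sets T"
    then show "\<exists>C. Y -` A \<inter> space M \<inter> (Y -` B \<inter> space M) = Y -` C \<inter> space M \<and> C \<in> sets T"
      by (intro exI[of _ "A \<inter> B"]) auto
  qed
  ultimately show ?thesis
    unfolding indep_var_eq using c Y by (intro conjI indep_set_sigma_sets) simp_all
qed

text \<open>Fubini in place of conditional expectation: it suffices to bound the integral with the
  first component frozen.\<close>

lemma nn_integral_indep_le:
  assumes ind: "indep_var S X T Y" and g: "g \<in> borel_measurable (S \<Otimes>\<^sub>M T)"
    and c: "c \<in> borel_measurable S"
    and le: "\<And>x. x \<in> space S \<Longrightarrow> (\<integral>\<^sup>+\<omega>. g (x, Y \<omega>) \<partial>M) \<le> c x"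
  shows "(\<integral>\<^sup>+\<omega>. g (X \<omega>, Y \<omega>) \<partial>M) \<le> (\<integral>\<^sup>+\<omega>. c (X \<omega>) \<partial>M)"
proof -
  have X: "random_variable S X" and Y: "random_variable T Y"
    using ind by (auto dest: indep_var_rv1 indep_var_rv2)
  interpret X: prob_space "distr M S X" by (rule prob_space_distr[OF X])
  interpret Y: prob_space "distr M T Y" by (rule prob_space_distr[OF Y])
  have g': "g \<in> borel_measurable (distr M S X \<Otimes>\<^sub>M distr M T Y)" using g by simp
  have "(\<integral>\<^sup>+\<omega>. g (X \<omega>, Y \<omega>) \<partial>M) = (\<integral>\<^sup>+z. g z \<partial>distr M (S \<Otimes>\<^sub>M T) (\<lambda>x. (X x, Y x)))"
    using X Y g by (subst nn_integral_distr) auto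
  also have "distr M (S \<Otimes>\<^sub>M T) (\<lambda>x. (X x, Y x)) = distr M S X \<Otimes>\<^sub>M distr M T Y"
    using ind by (simp add: indep_var_distribution_eq)
  also have "(\<integral>\<^sup>+z. g z \<partial>(distr M S X \<Otimes>\<^sub>M distr M T Y)) = (\<integral>\<^sup>+x. \<integral>\<^sup>+y. g (x, y) \<partial>distr M T Y \<partial>distr M S X)"
    by (rule Y.nn_integral_fst[symmetric]) (rule g')
  also have "\<dots> \<le> (\<integral>\<^sup>+x. c x \<partial>distr M S X)"
  proof (rule nn_integral_mono)
    fix x assume "x \<in> space (distr M S X)"
    then have x: "x \<in> space S" by simp
    then have "(\<integral>\<^sup>+y. g (x, y) \<partial>distr M T Y) = (\<integral>\<^sup>+\<omega>. g (x, Y \<omega>) \<partial>M)"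
      using Y g by (subst nn_integral_distr) auto
    then show "(\<integral>\<^sup>+y. g (x, y) \<partial>distr M T Y) \<le> c x" using le[OF x] by simp
  qed
  also have "\<dots> = (\<integral>\<^sup>+\<omega>. c (X \<omega>) \<partial>M)" using X c by (subst nn_integral_distr) auto
  finally show ?thesis .
qed

definition subexp :: "real \<Rightarrow> real \<Rightarrow> ('a \<Rightarrow> real) \<Rightarrow> bool" where
  "subexp \<alpha> B Y \<longleftrightarrow> Y \<in> borel_measurable M \<and> integrable M Y \<and> expectation Y = 0 \<and>
     (\<integral>\<^sup>+\<omega>. ennreal (exp (\<alpha> * \<bar>Y \<omega>\<bar>)) \<partial>M) \<le> ennreal B"

text \<open>Normalisation makes each weight at most 1 in absolute value, as the bound for a single
  variable requires, while the exponents 2 B (b i)^2 add up to at most 2 B whatever the number of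
  terms.\<close>

lemma subexp_mgf_weighted_sum:
  assumes I: "finite I" "indep_vars (\<lambda>_. borel) Y I"
    and Y: "\<And>i. i \<in> I \<Longrightarrow> subexp \<alpha> B (Y i)" and \<alpha>: "\<alpha> > 0" and B: "B \<ge> 0"
    and b: "(\<Sum>i\<in>I. (b i)\<^sup>2) \<le> 1"
  shows "(\<integral>\<^sup>+\<omega>. ennreal (exp (\<alpha> / 2 * (\<Sum>i\<in>I. b i * Y i \<omega>))) \<partial>M) \<le> ennreal (exp (2 * B))"
proof -
  have b1: "\<bar>b i\<bar> \<le> 1" if "i \<in> I" for i
  proof -
    have "(b i)\<^sup>2 \<le> 1" using member_le_sum[of i I "\<lambda>i. (b i)\<^sup>2"] that I(1) b by auto
    then show ?thesis by (simp add: abs_square_le_1)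
  qed
  have "(\<integral>\<^sup>+\<omega>. ennreal (exp (\<alpha> / 2 * (\<Sum>i\<in>I. b i * Y i \<omega>))) \<partial>M)
      = (\<integral>\<^sup>+\<omega>. (\<Prod>i\<in>I. ennreal (exp (\<alpha> / 2 * b i * Y i \<omega>))) \<partial>M)"
    by (simp add: prod_ennreal exp_sum I(1) sum_distrib_left mult.assoc)
  also have "\<dots> = (\<Prod>i\<in>I. \<integral>\<^sup>+\<omega>. ennreal (exp (\<alpha> / 2 * b i * Y i \<omega>)) \<partial>M)"
    by (intro indep_vars_nn_integral I indep_vars_compose2[OF I(2)]) auto
  also have "\<dots> \<le> (\<Prod>i\<in>I. ennreal (exp (2 * B * (b i)\<^sup>2)))"
    by (intro prod_mono_ennreal nn_integral_exp_le) (use Y b1 \<alpha> B in \<open>auto simp: subexp_def\<close>)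
  also have "\<dots> = ennreal (exp (2 * B * (\<Sum>i\<in>I. (b i)\<^sup>2)))"
    by (simp add: prod_ennreal exp_sum I(1) sum_distrib_left)
  also have "\<dots> \<le> ennreal (exp (2 * B))"
    using mult_left_mono[OF b, of "2 * B"] B by (intro ennreal_leI) simp
  finally show ?thesis .
qed

text \<open>Truncating at \<open>x \<cdot> sqrt V\<close> rather than at a Gaussian rate is enough here: all deviations are
  allowed to be of the order of a logarithm.\<close>

lemma subexp_weighted_sum_tail:
  assumes I: "finite I" "indep_vars (\<lambda>_. borel) Y I"
    and Y: "\<And>i. i \<in> I \<Longrightarrow> subexp \<alpha> B (Y i)" and \<alpha>: "\<alpha> > 0" and B: "B \<ge> 0"
    and ind: "indep_var (Pi\<^sub>M I (\<lambda>_. borel)) (\<lambda>\<omega>. \<lambda>i\<in>I. a i \<omega>) (Pi\<^sub>M I (\<lambda>_. borel)) (\<lambda>\<omega>. \<lambda>i\<in>I. Y i \<omega>)"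
    and V: "V > 0"
  shows "holds_except M (2 * exp (2 * B) * exp (- (\<alpha> / 2 * x)))
    (\<lambda>\<omega>. (\<Sum>i\<in>I. (a i \<omega>)\<^sup>2) \<le> V \<longrightarrow> \<bar>\<Sum>i\<in>I. a i \<omega> * Y i \<omega>\<bar> \<le> x * sqrt V)"
proof -
  let ?P = "Pi\<^sub>M I (\<lambda>_. borel :: real measure)"
  have one: "holds_except M (exp (2 * B) * exp (- (\<alpha> / 2 * x)))
    (\<lambda>\<omega>. (\<Sum>i\<in>I. (a i \<omega>)\<^sup>2) \<le> V \<longrightarrow> s * (\<Sum>i\<in>I. a i \<omega> * Y i \<omega>) \<le> x * sqrt V)"
    if s: "s = 1 \<or> s = - 1" for s :: real
  proof -
    \<comment> \<open>The exponential is replaced by 0 where the weights are too large. This keeps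
      the integral bounded for arbitrary random weights; the conclusion carries the size condition
      as a premise.\<close>
    define g where "g = (\<lambda>(u, y). if (\<Sum>i\<in>I. (u i)\<^sup>2) \<le> V
      then exp (\<alpha> / 2 * (\<Sum>i\<in>I. (s * u i / sqrt V) * y i)) else (0::real))"
    have g: "g \<in> borel_measurable (?P \<Otimes>\<^sub>M ?P)"
      unfolding g_def by measurable
    have inner: "(\<integral>\<^sup>+\<omega>. ennreal (g (u, \<lambda>i\<in>I. Y i \<omega>)) \<partial>M) \<le> ennreal (exp (2 * B))" for u
    proof (cases "(\<Sum>i\<in>I. (u i)\<^sup>2) \<le> V")
      case True
      have s2: "s\<^sup>2 = 1" using s by auto
      have "(\<Sum>i\<in>I. (s * u i / sqrt V)\<^sup>2) = (\<Sum>i\<in>I. (u i)\<^sup>2) / V"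
        using V s2 by (simp add: power_divide power_mult_distrib sum_divide_distrib)
      also have "\<dots> \<le> 1" using True V by simp
      finally have "(\<integral>\<^sup>+\<omega>. ennreal (exp (\<alpha> / 2 * (\<Sum>i\<in>I. (s * u i / sqrt V) * Y i \<omega>))) \<partial>M) \<le> ennreal (exp (2 * B))"
        by (intro subexp_mgf_weighted_sum[OF I Y \<alpha> B])
      then show ?thesis using True by (simp add: g_def)
    qed (simp add: g_def)
    have "(\<integral>\<^sup>+\<omega>. ennreal (g (\<lambda>i\<in>I. a i \<omega>, \<lambda>i\<in>I. Y i \<omega>)) \<partial>M) \<le> (\<integral>\<^sup>+\<omega>. ennreal (exp (2 * B)) \<partial>M)"
      by (rule nn_integral_indep_le[OF ind, of "\<lambda>z. ennreal (g z)" "\<lambda>_. ennreal (exp (2 * B))"])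
        (use g inner in auto)
    also have "\<dots> = ennreal (exp (2 * B))" by (simp add: emeasure_space_1)
    finally have K: "(\<integral>\<^sup>+\<omega>. ennreal (g (\<lambda>i\<in>I. a i \<omega>, \<lambda>i\<in>I. Y i \<omega>)) \<partial>M) \<le> ennreal (exp (2 * B))" .
    have aY: "random_variable ?P (\<lambda>\<omega>. \<lambda>i\<in>I. a i \<omega>)" "random_variable ?P (\<lambda>\<omega>. \<lambda>i\<in>I. Y i \<omega>)"
      using ind by (auto dest: indep_var_rv1 indep_var_rv2)
    have meas: "(\<lambda>\<omega>. g (\<lambda>i\<in>I. a i \<omega>, \<lambda>i\<in>I. Y i \<omega>)) \<in> borel_measurable M"
      by (rule measurable_compose[OF measurable_Pair[OF aY] g])
    have "holds_except M (exp (2 * B) * exp (- (\<alpha> / 2 * x)))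
        (\<lambda>\<omega>. g (\<lambda>i\<in>I. a i \<omega>, \<lambda>i\<in>I. Y i \<omega>) \<le> exp (\<alpha> / 2 * x))"
      by (rule holds_except_Markov[OF meas _ K]) (auto simp: g_def simp flip: exp_add)
    then show ?thesis
    proof (rule holds_except_mono)
      fix \<omega> assume le: "g (\<lambda>i\<in>I. a i \<omega>, \<lambda>i\<in>I. Y i \<omega>) \<le> exp (\<alpha> / 2 * x)"
      show "(\<Sum>i\<in>I. (a i \<omega>)\<^sup>2) \<le> V \<longrightarrow> s * (\<Sum>i\<in>I. a i \<omega> * Y i \<omega>) \<le> x * sqrt V"
      proof
        assume "(\<Sum>i\<in>I. (a i \<omega>)\<^sup>2) \<le> V"
        then have "(\<Sum>i\<in>I. (s * a i \<omega> / sqrt V) * Y i \<omega>) \<le> x"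
          using le \<alpha> by (simp add: g_def)
        moreover have "(\<Sum>i\<in>I. (s * a i \<omega> / sqrt V) * Y i \<omega>) = s * (\<Sum>i\<in>I. a i \<omega> * Y i \<omega>) / sqrt V"
          by (simp add: sum_divide_distrib sum_distrib_left mult.assoc)
        ultimately show "s * (\<Sum>i\<in>I. a i \<omega> * Y i \<omega>) \<le> x * sqrt V"
          using V by (simp add: divide_le_eq)
      qed
    qed simp
  qed
  show ?thesis
    by (rule holds_except_mono[OF holds_except_conj[OF one[of 1] one[of "-1"]]]) (auto simp: abs_le_iff)
qed

lemma subexp_sum_tail:
  assumes I: "finite I" "indep_vars (\<lambda>_. borel) Y I"
    and Y: "\<And>i. i \<in> I \<Longrightarrow> subexp \<alpha> B (Y i)" and \<alpha>: "\<alpha> > 0" and B: "B \<ge> 0" and I0: "card I > 0"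
  shows "holds_except M (2 * exp (2 * B) * exp (- (\<alpha> / 2 * x)))
    (\<lambda>\<omega>. \<bar>\<Sum>i\<in>I. Y i \<omega>\<bar> \<le> x * sqrt (real (card I)))"
proof -
  have rv: "random_variable (Pi\<^sub>M I (\<lambda>_. borel)) (\<lambda>\<omega>. \<lambda>i\<in>I. Y i \<omega>)"
    using I(2) by (intro measurable_restrict) (auto simp: indep_vars_def2)
  have "holds_except M (2 * exp (2 * B) * exp (- (\<alpha> / 2 * x)))
    (\<lambda>\<omega>. (\<Sum>i\<in>I. (1::real)\<^sup>2) \<le> real (card I) \<longrightarrow> \<bar>\<Sum>i\<in>I. 1 * Y i \<omega>\<bar> \<le> x * sqrt (real (card I)))"
    by (rule subexp_weighted_sum_tail[OF I Y \<alpha> B indep_var_const[OF _ rv]])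
      (use I0 in \<open>auto simp: space_PiM PiE_def extensional_def\<close>)
  then show ?thesis by simp
qed

lemma integrable_squareI:
  assumes "Y \<in> borel_measurable M" "(\<integral>\<^sup>+\<omega>. ennreal ((Y \<omega>)\<^sup>2) \<partial>M) \<le> ennreal v"
  shows "integrable M (\<lambda>\<omega>. (Y \<omega>)\<^sup>2)" "v \<ge> 0 \<Longrightarrow> expectation (\<lambda>\<omega>. (Y \<omega>)\<^sup>2) \<le> v"
proof -
  show "integrable M (\<lambda>\<omega>. (Y \<omega>)\<^sup>2)"
  proof (rule integrableI_bounded)
    have "(\<integral>\<^sup>+\<omega>. ennreal (norm ((Y \<omega>)\<^sup>2)) \<partial>M) \<le> ennreal v" using assms(2) by simp
    also have "\<dots> < \<infinity>" by simp
    finally show "(\<integral>\<^sup>+\<omega>. ennreal (norm ((Y \<omega>)\<^sup>2)) \<partial>M) < \<infinity>" .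
  qed (use assms in measurable)
  then have "ennreal (expectation (\<lambda>\<omega>. (Y \<omega>)\<^sup>2)) = (\<integral>\<^sup>+\<omega>. ennreal ((Y \<omega>)\<^sup>2) \<partial>M)"
    by (intro nn_integral_eq_integral[symmetric]) auto
  with assms(2) show "expectation (\<lambda>\<omega>. (Y \<omega>)\<^sup>2) \<le> v" if "v \<ge> 0"
    using that by (metis ennreal_le_iff)
qed

lemma second_moment_sum_const:
  assumes I: "finite I" "indep_vars (\<lambda>_. borel) Y I"
    and Y: "\<And>i. i \<in> I \<Longrightarrow> integrable M (Y i)" "\<And>i. i \<in> I \<Longrightarrow> expectation (Y i) = 0"
    and v: "\<And>i. i \<in> I \<Longrightarrow> (\<integral>\<^sup>+\<omega>. ennreal ((Y i \<omega>)\<^sup>2) \<partial>M) \<le> ennreal v" "v \<ge> 0"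
  shows "(\<integral>\<^sup>+\<omega>. ennreal ((\<Sum>i\<in>I. b i * Y i \<omega>)\<^sup>2) \<partial>M) \<le> ennreal (v * (\<Sum>i\<in>I. (b i)\<^sup>2))"
proof -
  have meas: "Y i \<in> borel_measurable M" if "i \<in> I" for i using Y(1) that by auto
  have YY: "integrable M (\<lambda>\<omega>. Y i \<omega> * Y j \<omega>) \<and> expectation (\<lambda>\<omega>. Y i \<omega> * Y j \<omega>) = 0"
    if "i \<in> I" "j \<in> I" "i \<noteq> j" for i j
  proof -
    have ij: "indep_vars (\<lambda>_. borel) Y {i, j}" by (rule indep_vars_subset[OF I(2)]) (use that in auto)
    show ?thesis
      using indep_vars_integrable[OF _ ij] indep_vars_lebesgue_integral[OF _ ij] that Y by auto
  qed
  have Y2: "integrable M (\<lambda>\<omega>. Y i \<omega> * Y i \<omega>)" "expectation (\<lambda>\<omega>. Y i \<omega> * Y i \<omega>) \<le> v" if "i \<in> I" for i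
    using integrable_squareI[OF meas[OF that] v(1)[OF that]] v(2) by (auto simp: power2_eq_square)
  have int: "integrable M (\<lambda>\<omega>. Y i \<omega> * Y j \<omega>)" if "i \<in> I" "j \<in> I" for i j
    using YY[of i j] Y2[of i] that by (cases "i = j") auto
  have eq: "(\<Sum>i\<in>I. b i * Y i \<omega>)\<^sup>2 = (\<Sum>i\<in>I. \<Sum>j\<in>I. (b i * b j) * (Y i \<omega> * Y j \<omega>))" for \<omega>
    unfolding power2_eq_square sum_product by (intro sum.cong refl) simp
  have "(\<integral>\<^sup>+\<omega>. ennreal ((\<Sum>i\<in>I. b i * Y i \<omega>)\<^sup>2) \<partial>M) = ennreal (expectation (\<lambda>\<omega>. (\<Sum>i\<in>I. b i * Y i \<omega>)\<^sup>2))"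
  proof (rule nn_integral_eq_integral)
    show "integrable M (\<lambda>\<omega>. (\<Sum>i\<in>I. b i * Y i \<omega>)\<^sup>2)" unfolding eq using int by auto
  qed simp
  also have "expectation (\<lambda>\<omega>. (\<Sum>i\<in>I. b i * Y i \<omega>)\<^sup>2)
      = (\<Sum>i\<in>I. \<Sum>j\<in>I. (b i * b j) * expectation (\<lambda>\<omega>. Y i \<omega> * Y j \<omega>))"
    unfolding eq using int by (simp add: Bochner_Integration.integral_sum)
  also have "\<dots> = (\<Sum>i\<in>I. \<Sum>j\<in>I. if i = j then (b i * b j) * expectation (\<lambda>\<omega>. Y i \<omega> * Y j \<omega>) else 0)"
    using YY by (intro sum.cong) auto
  also have "\<dots> = (\<Sum>i\<in>I. (b i)\<^sup>2 * expectation (\<lambda>\<omega>. Y i \<omega> * Y i \<omega>))"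
    using I(1) by (simp add: power2_eq_square)
  also have "ennreal \<dots> \<le> ennreal (\<Sum>i\<in>I. (b i)\<^sup>2 * v)"
    using Y2 by (intro ennreal_leI sum_mono mult_left_mono) auto
  also have "(\<Sum>i\<in>I. (b i)\<^sup>2 * v) = v * (\<Sum>i\<in>I. (b i)\<^sup>2)"
    by (simp add: sum_distrib_left mult.commute)
  finally show ?thesis .
qed

text \<open>Given the weights this is the variance of an independent sum; the weights may depend on
  one another.\<close>

lemma second_moment_sum_indep:
  assumes I: "finite I" "indep_vars (\<lambda>_. borel) Y I"
    and Y: "\<And>i. i \<in> I \<Longrightarrow> integrable M (Y i)" "\<And>i. i \<in> I \<Longrightarrow> expectation (Y i) = 0"
    and v: "\<And>i. i \<in> I \<Longrightarrow> (\<integral>\<^sup>+\<omega>. ennreal ((Y i \<omega>)\<^sup>2) \<partial>M) \<le> ennreal v" "v \<ge> 0"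
    and ind: "indep_var (Pi\<^sub>M I (\<lambda>_. borel)) (\<lambda>\<omega>. \<lambda>i\<in>I. a i \<omega>) (Pi\<^sub>M I (\<lambda>_. borel)) (\<lambda>\<omega>. \<lambda>i\<in>I. Y i \<omega>)"
    and w: "\<And>i. i \<in> I \<Longrightarrow> (\<integral>\<^sup>+\<omega>. ennreal ((a i \<omega>)\<^sup>2) \<partial>M) \<le> ennreal w" "w \<ge> 0"
  shows "(\<integral>\<^sup>+\<omega>. ennreal ((\<Sum>i\<in>I. a i \<omega> * Y i \<omega>)\<^sup>2) \<partial>M) \<le> ennreal (v * w * real (card I))"
proof -
  let ?P = "Pi\<^sub>M I (\<lambda>_. borel :: real measure)"
  have arv: "random_variable ?P (\<lambda>\<omega>. \<lambda>i\<in>I. a i \<omega>)" using ind by (auto dest: indep_var_rv1)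
  have am: "a i \<in> borel_measurable M" if "i \<in> I" for i
    using measurable_compose[OF arv measurable_component_singleton[OF that]] that by simp
  define g where "g = (\<lambda>(u, y). ennreal ((\<Sum>i\<in>I. u i * y i)\<^sup>2))"
  define c where "c u = ennreal (v * (\<Sum>i\<in>I. (u i)\<^sup>2))" for u
  have "(\<integral>\<^sup>+\<omega>. ennreal ((\<Sum>i\<in>I. a i \<omega> * Y i \<omega>)\<^sup>2) \<partial>M) = (\<integral>\<^sup>+\<omega>. g (\<lambda>i\<in>I. a i \<omega>, \<lambda>i\<in>I. Y i \<omega>) \<partial>M)"
    by (simp add: g_def)
  also have "\<dots> \<le> (\<integral>\<^sup>+\<omega>. c (\<lambda>i\<in>I. a i \<omega>) \<partial>M)"
  proof (rule nn_integral_indep_le[OF ind])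
    show "g \<in> borel_measurable (?P \<Otimes>\<^sub>M ?P)" unfolding g_def by measurable
    show "c \<in> borel_measurable ?P" unfolding c_def by measurable
    show "(\<integral>\<^sup>+\<omega>. g (u, \<lambda>i\<in>I. Y i \<omega>) \<partial>M) \<le> c u" for u
      using second_moment_sum_const[OF I Y v, of u] by (simp add: g_def c_def)
  qed
  also have "\<dots> = (\<integral>\<^sup>+\<omega>. ennreal (v * (\<Sum>i\<in>I. (a i \<omega>)\<^sup>2)) \<partial>M)" by (simp add: c_def)
  also have "\<dots> = (\<integral>\<^sup>+\<omega>. ennreal v * (\<Sum>i\<in>I. ennreal ((a i \<omega>)\<^sup>2)) \<partial>M)"
    using v(2) by (intro nn_integral_cong) (simp add: ennreal_mult sum_nonneg flip: sum_ennreal)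
  also have "\<dots> = ennreal v * (\<Sum>i\<in>I. \<integral>\<^sup>+\<omega>. ennreal ((a i \<omega>)\<^sup>2) \<partial>M)"
    using am by (subst nn_integral_cmult) (auto simp: nn_integral_sum simp del: sum_ennreal)
  also have "\<dots> \<le> ennreal v * (\<Sum>i\<in>I. ennreal w)"
    by (intro mult_left_mono sum_mono w) auto
  also have "\<dots> = ennreal (v * w * real (card I))"
    using v(2) w(2) by (simp add: ennreal_mult ennreal_of_nat_eq_real_of_nat mult_ac)
  finally show ?thesis .
qed

lemma second_moment_of_exp:
  assumes Y: "Y \<in> borel_measurable M" "(\<integral>\<^sup>+\<omega>. ennreal (exp (\<alpha> * \<bar>Y \<omega>\<bar>)) \<partial>M) \<le> ennreal B" and \<alpha>: "\<alpha> > 0" and B: "B \<ge> 0"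
  shows "(\<integral>\<^sup>+\<omega>. ennreal ((Y \<omega>)\<^sup>2) \<partial>M) \<le> ennreal (2 / \<alpha>\<^sup>2 * B)"
proof -
  have "ennreal ((Y \<omega>)\<^sup>2) \<le> ennreal (2 / \<alpha>\<^sup>2) * ennreal (exp (\<alpha> * \<bar>Y \<omega>\<bar>))" for \<omega>
  proof -
    have "(\<alpha> * Y \<omega>)\<^sup>2 \<le> 2 * exp \<bar>\<alpha> * Y \<omega>\<bar>" by (rule square_le_two_exp)
    then have "(Y \<omega>)\<^sup>2 \<le> 2 / \<alpha>\<^sup>2 * exp (\<alpha> * \<bar>Y \<omega>\<bar>)"
      using \<alpha> by (simp add: abs_mult power_mult_distrib field_simps)
    then show ?thesis by (simp add: ennreal_leI flip: ennreal_mult)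
  qed
  then have "(\<integral>\<^sup>+\<omega>. ennreal ((Y \<omega>)\<^sup>2) \<partial>M) \<le> (\<integral>\<^sup>+\<omega>. ennreal (2 / \<alpha>\<^sup>2) * ennreal (exp (\<alpha> * \<bar>Y \<omega>\<bar>)) \<partial>M)"
    by (rule nn_integral_mono)
  also have "\<dots> = ennreal (2 / \<alpha>\<^sup>2) * (\<integral>\<^sup>+\<omega>. ennreal (exp (\<alpha> * \<bar>Y \<omega>\<bar>)) \<partial>M)"
    using Y(1) by (intro nn_integral_cmult) measurable
  also have "\<dots> \<le> ennreal (2 / \<alpha>\<^sup>2) * ennreal B" by (intro mult_left_mono Y) auto
  also have "\<dots> = ennreal (2 / \<alpha>\<^sup>2 * B)" using B by (subst ennreal_mult) auto
  finally show ?thesis .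
qed

end

lemma power_le_fact_exp:
  fixes x :: real
  assumes "x \<ge> 0"
  shows "x ^ k \<le> fact k * exp x"
proof -
  have "x ^ k / fact k = (\<Sum>i\<in>{k}. x ^ i /\<^sub>R fact i)" by (simp add: divide_inverse mult.commute)
  also have "\<dots> \<le> (\<Sum>i. x ^ i /\<^sub>R fact i)"
    by (rule sum_le_suminf) (use assms summable_exp_generic[of x] in auto)
  also have "\<dots> = exp x" by (simp add: exp_def)
  finally show ?thesis by (simp add: field_simps)
qed

text \<open>A common interface for the design errors, the ideal knockoff errors, the envelope
  variables and, with a single column, the noise. Exponential moments of squares are assumed because
  Gram diagonals are sums of squares; generic index types allow rows and columns to be
  exchanged.\<close>

locale noise_array = prob_space M for M :: "'a measure" +
  fixes x :: "'i \<Rightarrow> 'j \<Rightarrow> 'a \<Rightarrow> real" and I :: "'i set" and J :: "'j set" and \<alpha> B s2 :: real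
  assumes finite_I: "finite I" and finite_J: "finite J" and \<alpha>: "\<alpha> > 0" and B0: "B \<ge> 0"
    and indep: "indep_vars (\<lambda>_. borel) (\<lambda>(i, j). x i j) (I \<times> J)"
    and int: "i \<in> I \<Longrightarrow> j \<in> J \<Longrightarrow> integrable M (x i j)"
    and mean: "i \<in> I \<Longrightarrow> j \<in> J \<Longrightarrow> expectation (x i j) = 0"
    and expsq: "i \<in> I \<Longrightarrow> j \<in> J \<Longrightarrow> (\<integral>\<^sup>+\<omega>. ennreal (exp (\<alpha> * (x i j \<omega>)\<^sup>2)) \<partial>M) \<le> ennreal B"
    and var: "i \<in> I \<Longrightarrow> j \<in> J \<Longrightarrow> expectation (\<lambda>\<omega>. (x i j \<omega>)\<^sup>2) = s2"
begin

lemma rv: "i \<in> I \<Longrightarrow> j \<in> J \<Longrightarrow> x i j \<in> borel_measurable M"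
  using int by blast

lemma transposed: "noise_array M (\<lambda>j i. x i j) J I \<alpha> B s2"
proof
  show "indep_vars (\<lambda>_. borel) (\<lambda>(j, i). x i j) (J \<times> I)"
  proof -
    have "indep_vars (\<lambda>_. borel) (\<lambda>ji. (\<lambda>(i, j). x i j) (prod.swap ji)) (J \<times> I)"
      by (rule indep_vars_reindex) (use indep in \<open>simp_all add: product_swap inj_on_def\<close>)
    then show ?thesis by (simp add: case_prod_unfold prod.swap_def)
  qed
qed (use finite_I finite_J \<alpha> B0 int mean expsq var in auto)

lemma indep_column: "j \<in> J \<Longrightarrow> indep_vars (\<lambda>_. borel) (\<lambda>i. x i j) I"
  using indep_vars_reindex[of "\<lambda>i. (i, j)" I "\<lambda>_. borel" "\<lambda>(i, j). x i j"]
    indep_vars_subset[OF indep, of "(\<lambda>i. (i, j)) ` I"]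
  by (auto simp: inj_on_def)

lemma indep_columns:
  assumes "j \<in> J" "l \<in> J" "j \<noteq> l"
  shows "indep_var (Pi\<^sub>M I (\<lambda>_. borel)) (\<lambda>\<omega>. \<lambda>i\<in>I. x i j \<omega>) (Pi\<^sub>M I (\<lambda>_. borel)) (\<lambda>\<omega>. \<lambda>i\<in>I. x i l \<omega>)"
proof -
  define col where "col j u = (\<lambda>i\<in>I. u (i, j))" for j :: 'j and u :: "'i \<times> 'j \<Rightarrow> real"
  have col: "col j \<in> measurable (Pi\<^sub>M (I \<times> {j}) (\<lambda>_. borel)) (Pi\<^sub>M I (\<lambda>_. borel))" for j
    unfolding col_def by (intro measurable_restrict measurable_component_singleton) auto
  have "indep_var (Pi\<^sub>M I (\<lambda>_. borel)) (col j \<circ> (\<lambda>\<omega>. \<lambda>ij\<in>I \<times> {j}. (\<lambda>(i, j). x i j) ij \<omega>))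
      (Pi\<^sub>M I (\<lambda>_. borel)) (col l \<circ> (\<lambda>\<omega>. \<lambda>ij\<in>I \<times> {l}. (\<lambda>(i, j). x i j) ij \<omega>))"
    by (intro indep_var_compose[OF indep_var_restrict[OF indep]] col) (use assms in auto)
  also have "col j \<circ> (\<lambda>\<omega>. \<lambda>ij\<in>I \<times> {j}. (\<lambda>(i, j). x i j) ij \<omega>) = (\<lambda>\<omega>. \<lambda>i\<in>I. x i j \<omega>)"
    by (auto simp: col_def fun_eq_iff)
  also have "col l \<circ> (\<lambda>\<omega>. \<lambda>ij\<in>I \<times> {l}. (\<lambda>(i, j). x i j) ij \<omega>) = (\<lambda>\<omega>. \<lambda>i\<in>I. x i l \<omega>)"
    by (auto simp: col_def fun_eq_iff)
  finally show ?thesis .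
qed

lemma moment_bound:
  assumes "i \<in> I" "j \<in> J"
  shows "(\<integral>\<^sup>+\<omega>. ennreal ((x i j \<omega> ^ k)\<^sup>2) \<partial>M) \<le> ennreal (fact k / \<alpha> ^ k * B)"
proof -
  have le: "(y ^ k)\<^sup>2 \<le> fact k / \<alpha> ^ k * exp (\<alpha> * y\<^sup>2)" for y :: real
  proof -
    have "(\<alpha> * y\<^sup>2) ^ k \<le> fact k * exp (\<alpha> * y\<^sup>2)" using \<alpha> by (intro power_le_fact_exp) auto
    then have "\<alpha> ^ k * (y ^ k)\<^sup>2 \<le> fact k * exp (\<alpha> * y\<^sup>2)"
      by (simp add: power_mult_distrib mult.commute flip: power_mult)
    then show ?thesis using \<alpha> by (simp add: field_simps)
  qed
  have "(\<integral>\<^sup>+\<omega>. ennreal ((x i j \<omega> ^ k)\<^sup>2) \<partial>M) \<le> (\<integral>\<^sup>+\<omega>. ennreal (fact k / \<alpha> ^ k) * ennreal (exp (\<alpha> * (x i j \<omega>)\<^sup>2)) \<partial>M)"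
  proof (rule nn_integral_mono)
    fix \<omega>
    show "ennreal ((x i j \<omega> ^ k)\<^sup>2) \<le> ennreal (fact k / \<alpha> ^ k) * ennreal (exp (\<alpha> * (x i j \<omega>)\<^sup>2))"
      using ennreal_leI[OF le[of "x i j \<omega>"]] \<alpha> by (subst ennreal_mult[symmetric]) auto
  qed
  also have "\<dots> = ennreal (fact k / \<alpha> ^ k) * (\<integral>\<^sup>+\<omega>. ennreal (exp (\<alpha> * (x i j \<omega>)\<^sup>2)) \<partial>M)"
    using rv[OF assms] by (intro nn_integral_cmult) measurable
  also have "\<dots> \<le> ennreal (fact k / \<alpha> ^ k) * ennreal B" by (intro mult_left_mono expsq assms) auto
  also have "\<dots> = ennreal (fact k / \<alpha> ^ k * B)" using \<alpha> B0 by (subst ennreal_mult) auto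
  finally show ?thesis .
qed

lemma square_integrable: "i \<in> I \<Longrightarrow> j \<in> J \<Longrightarrow> integrable M (\<lambda>\<omega>. (x i j \<omega>)\<^sup>2)"
  using integrable_squareI(1)[OF rv, of i j] moment_bound[of i j 1] by simp

lemma nn_var:
  assumes "i \<in> I" "j \<in> J"
  shows "(\<integral>\<^sup>+\<omega>. ennreal ((x i j \<omega>)\<^sup>2) \<partial>M) = ennreal s2"
  using nn_integral_eq_integral[OF square_integrable[OF assms]] var[OF assms] by simp

lemma s2_bounds:
  assumes "i \<in> I" "j \<in> J"
  shows "s2 \<ge> 0" "\<alpha> * s2 \<le> B"
proof -
  show s2: "s2 \<ge> 0" unfolding var[OF assms, symmetric] by simp
  have "ennreal (\<alpha> * s2) = ennreal \<alpha> * (\<integral>\<^sup>+\<omega>. ennreal ((x i j \<omega>)\<^sup>2) \<partial>M)"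
    unfolding nn_var[OF assms] using \<alpha> s2 by (simp add: ennreal_mult)
  also have "\<dots> = (\<integral>\<^sup>+\<omega>. ennreal (\<alpha> * (x i j \<omega>)\<^sup>2) \<partial>M)"
    using \<alpha> rv[OF assms] by (subst nn_integral_cmult[symmetric]) (auto simp: ennreal_mult)
  also have "\<dots> \<le> (\<integral>\<^sup>+\<omega>. ennreal (exp (\<alpha> * (x i j \<omega>)\<^sup>2)) \<partial>M)"
  proof (intro nn_integral_mono ennreal_leI)
    fix \<omega>
    show "\<alpha> * (x i j \<omega>)\<^sup>2 \<le> exp (\<alpha> * (x i j \<omega>)\<^sup>2)"
      using exp_ge_add_one_self[of "\<alpha> * (x i j \<omega>)\<^sup>2"] by linarith
  qed
  also have "\<dots> \<le> ennreal B" by (rule expsq[OF assms])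
  finally show "\<alpha> * s2 \<le> B" using B0 by (simp add: ennreal_le_iff)
qed

text \<open>One constant for two families: \<alpha> \<bar>y\<bar> \<le> \<alpha> + \<alpha> y^2 for
  the entries, and \<alpha> \<bar>y^2 - s2\<bar> \<le> \<alpha> s2 + \<alpha> y^2 with \<alpha> s2
  \<le> B for the centred squares.\<close>

definition "D = exp (\<alpha> + B) * B"

lemma D0: "D \<ge> 0" using B0 by (simp add: D_def)

lemma expsq_shift:
  assumes "i \<in> I" "j \<in> J" "c \<le> \<alpha> + B"
  shows "(\<integral>\<^sup>+\<omega>. ennreal (exp (c + \<alpha> * (x i j \<omega>)\<^sup>2)) \<partial>M) \<le> ennreal D"
proof -
  have "(\<integral>\<^sup>+\<omega>. ennreal (exp (c + \<alpha> * (x i j \<omega>)\<^sup>2)) \<partial>M)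
      \<le> (\<integral>\<^sup>+\<omega>. ennreal (exp (\<alpha> + B)) * ennreal (exp (\<alpha> * (x i j \<omega>)\<^sup>2)) \<partial>M)"
    using assms(3) by (intro nn_integral_mono, subst ennreal_mult[symmetric]) (auto simp flip: exp_add intro!: ennreal_leI)
  also have "\<dots> = ennreal (exp (\<alpha> + B)) * (\<integral>\<^sup>+\<omega>. ennreal (exp (\<alpha> * (x i j \<omega>)\<^sup>2)) \<partial>M)"
    using rv[OF assms(1,2)] by (intro nn_integral_cmult) measurable
  also have "\<dots> \<le> ennreal (exp (\<alpha> + B)) * ennreal B" by (intro mult_left_mono expsq assms) auto
  also have "\<dots> = ennreal D" using B0 unfolding D_def by (subst ennreal_mult) auto
  finally show ?thesis .
qed

lemma subexp_entry:
  assumes "i \<in> I" "j \<in> J"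
  shows "subexp \<alpha> D (x i j)"
proof -
  have "\<alpha> * \<bar>y\<bar> \<le> \<alpha> + \<alpha> * y\<^sup>2" for y
  proof -
    have "\<bar>y\<bar> \<le> 1 + y\<^sup>2"
    proof (cases "\<bar>y\<bar> \<le> 1")
      case False
      then have "\<bar>y\<bar> * 1 \<le> \<bar>y\<bar> * \<bar>y\<bar>" by (intro mult_left_mono) auto
      then show ?thesis by (simp add: power2_eq_square)
    qed (simp add: add_increasing2)
    then have "\<alpha> * \<bar>y\<bar> \<le> \<alpha> * (1 + y\<^sup>2)" using \<alpha> by (intro mult_left_mono) auto
    then show ?thesis by (simp add: algebra_simps)
  qed
  then have "(\<integral>\<^sup>+\<omega>. ennreal (exp (\<alpha> * \<bar>x i j \<omega>\<bar>)) \<partial>M) \<le> (\<integral>\<^sup>+\<omega>. ennreal (exp (\<alpha> + \<alpha> * (x i j \<omega>)\<^sup>2)) \<partial>M)"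
    by (intro nn_integral_mono ennreal_leI) simp
  also have "\<dots> \<le> ennreal D" by (rule expsq_shift[OF assms]) (use B0 in simp)
  finally show ?thesis using assms by (simp add: subexp_def rv int mean)
qed

lemma subexp_square:
  assumes "i \<in> I" "j \<in> J"
  shows "subexp \<alpha> D (\<lambda>\<omega>. (x i j \<omega>)\<^sup>2 - s2)"
proof -
  have "\<alpha> * \<bar>y\<^sup>2 - s2\<bar> \<le> \<alpha> * s2 + \<alpha> * y\<^sup>2" for y
  proof -
    have "\<bar>y\<^sup>2 - s2\<bar> \<le> s2 + y\<^sup>2" using s2_bounds(1)[OF assms] by (simp add: abs_le_iff)
    then have "\<alpha> * \<bar>y\<^sup>2 - s2\<bar> \<le> \<alpha> * (s2 + y\<^sup>2)" using \<alpha> by (intro mult_left_mono) auto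
    then show ?thesis by (simp add: algebra_simps)
  qed
  then have "(\<integral>\<^sup>+\<omega>. ennreal (exp (\<alpha> * \<bar>(x i j \<omega>)\<^sup>2 - s2\<bar>)) \<partial>M) \<le> (\<integral>\<^sup>+\<omega>. ennreal (exp (\<alpha> * s2 + \<alpha> * (x i j \<omega>)\<^sup>2)) \<partial>M)"
    by (intro nn_integral_mono ennreal_leI) simp
  also have "\<dots> \<le> ennreal D"
    by (rule expsq_shift[OF assms]) (use s2_bounds(2)[OF assms] \<alpha> in linarith)
  finally show ?thesis
    using assms square_integrable[OF assms] by (simp add: subexp_def rv var prob_space)
qed

lemma column_square_tail:
  assumes "j \<in> J" "I \<noteq> {}"
  shows "holds_except M (2 * exp (2 * D) * exp (- (\<alpha> / 2 * t)))
    (\<lambda>\<omega>. \<bar>(\<Sum>i\<in>I. (x i j \<omega>)\<^sup>2) - real (card I) * s2\<bar> \<le> t * sqrt (real (card I)))"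
proof -
  have "indep_vars (\<lambda>_. borel) (\<lambda>i \<omega>. (x i j \<omega>)\<^sup>2 - s2) I"
    by (rule indep_vars_compose2[OF indep_column[OF assms(1)], of "\<lambda>_ y. y\<^sup>2 - s2"]) measurable
  then have "holds_except M (2 * exp (2 * D) * exp (- (\<alpha> / 2 * t)))
      (\<lambda>\<omega>. \<bar>\<Sum>i\<in>I. (x i j \<omega>)\<^sup>2 - s2\<bar> \<le> t * sqrt (real (card I)))"
    by (rule subexp_sum_tail[OF finite_I _ subexp_square \<alpha> D0]) (use assms finite_I in \<open>auto simp: card_gt_0_iff\<close>)
  then show ?thesis by (simp add: sum_subtractf)
qed

lemma weighted_column_tail:
  assumes "j \<in> J" "V > 0"
    and "indep_var (Pi\<^sub>M I (\<lambda>_. borel)) (\<lambda>\<omega>. \<lambda>i\<in>I. a i \<omega>) (Pi\<^sub>M I (\<lambda>_. borel)) (\<lambda>\<omega>. \<lambda>i\<in>I. x i j \<omega>)"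
  shows "holds_except M (2 * exp (2 * D) * exp (- (\<alpha> / 2 * t)))
    (\<lambda>\<omega>. (\<Sum>i\<in>I. (a i \<omega>)\<^sup>2) \<le> V \<longrightarrow> \<bar>\<Sum>i\<in>I. a i \<omega> * x i j \<omega>\<bar> \<le> t * sqrt V)"
  by (rule subexp_weighted_sum_tail[OF finite_I indep_column subexp_entry \<alpha> D0]) (use assms in auto)

lemma weighted_column_second_moment:
  assumes "j \<in> J"
    and "indep_var (Pi\<^sub>M I (\<lambda>_. borel)) (\<lambda>\<omega>. \<lambda>i\<in>I. a i \<omega>) (Pi\<^sub>M I (\<lambda>_. borel)) (\<lambda>\<omega>. \<lambda>i\<in>I. x i j \<omega>)"
    and "\<And>i. i \<in> I \<Longrightarrow> (\<integral>\<^sup>+\<omega>. ennreal ((a i \<omega>)\<^sup>2) \<partial>M) \<le> ennreal w" "w \<ge> 0"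
  shows "(\<integral>\<^sup>+\<omega>. ennreal ((\<Sum>i\<in>I. a i \<omega> * x i j \<omega>)\<^sup>2) \<partial>M) \<le> ennreal (\<bar>s2\<bar> * w * real (card I))"
  by (rule second_moment_sum_indep[OF finite_I indep_column])
    (use assms int mean nn_var in \<open>auto intro!: ennreal_leI\<close>)

lemma fixed_weights_second_moment:
  assumes "j \<in> J"
  shows "(\<integral>\<^sup>+\<omega>. ennreal ((\<Sum>i\<in>I. b i * x i j \<omega>)\<^sup>2) \<partial>M) \<le> ennreal (\<bar>s2\<bar> * (\<Sum>i\<in>I. (b i)\<^sup>2))"
  by (rule second_moment_sum_const[OF finite_I indep_column])
    (use assms int mean nn_var in \<open>auto intro!: ennreal_leI\<close>)

text \<open>The first summand covers the off-diagonal Gram entries (two independent columns), the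
  second the diagonal ones (centred squares).\<close>

definition "K = s2\<^sup>2 + 2 / \<alpha>\<^sup>2 * D"

lemma K0: "K \<ge> 0" using D0 by (simp add: K_def)

lemma gram_entry_second_moment:
  assumes "j \<in> J" "l \<in> J"
  shows "(\<integral>\<^sup>+\<omega>. ennreal (((\<Sum>i\<in>I. x i j \<omega> * x i l \<omega>) - (if j = l then real (card I) * s2 else 0))\<^sup>2) \<partial>M)
    \<le> ennreal (K * real (card I))"
proof (cases "j = l")
  case True
  have ind: "indep_vars (\<lambda>_. borel) (\<lambda>i \<omega>. (x i j \<omega>)\<^sup>2 - s2) I"
    by (rule indep_vars_compose2[OF indep_column[OF assms(1)], of "\<lambda>_ y. y\<^sup>2 - s2"]) measurable
  have "(\<integral>\<^sup>+\<omega>. ennreal ((\<Sum>i\<in>I. 1 * ((x i j \<omega>)\<^sup>2 - s2))\<^sup>2) \<partial>M) \<le> ennreal (2 / \<alpha>\<^sup>2 * D * (\<Sum>i\<in>I. 1\<^sup>2))"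
  proof (rule second_moment_sum_const[OF finite_I ind])
    fix i assume "i \<in> I"
    then have "subexp \<alpha> D (\<lambda>\<omega>. (x i j \<omega>)\<^sup>2 - s2)" using subexp_square assms by blast
    then show "integrable M (\<lambda>\<omega>. (x i j \<omega>)\<^sup>2 - s2)" "expectation (\<lambda>\<omega>. (x i j \<omega>)\<^sup>2 - s2) = 0"
      "(\<integral>\<^sup>+\<omega>. ennreal (((x i j \<omega>)\<^sup>2 - s2)\<^sup>2) \<partial>M) \<le> ennreal (2 / \<alpha>\<^sup>2 * D)"
      using second_moment_of_exp[OF _ _ \<alpha> D0, of "\<lambda>\<omega>. (x i j \<omega>)\<^sup>2 - s2"] by (auto simp: subexp_def)
  qed (use D0 in simp)
  also have "\<dots> \<le> ennreal (K * real (card I))"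
    by (intro ennreal_leI) (simp add: K_def distrib_right)
  finally show ?thesis using True by (simp add: sum_subtractf power2_eq_square)
next
  case False
  have "(\<integral>\<^sup>+\<omega>. ennreal ((\<Sum>i\<in>I. x i j \<omega> * x i l \<omega>)\<^sup>2) \<partial>M) \<le> ennreal (\<bar>s2\<bar> * \<bar>s2\<bar> * real (card I))"
    by (rule weighted_column_second_moment[OF assms(2) indep_columns[OF assms False]])
      (use assms nn_var in \<open>auto intro!: ennreal_leI\<close>)
  also have "\<dots> \<le> ennreal (K * real (card I))"
    using D0 by (intro ennreal_leI mult_right_mono) (auto simp: K_def power2_eq_square)
  finally show ?thesis using False by simp
qed

lemma gram_second_moment:
  "(\<integral>\<^sup>+\<omega>. ennreal (\<Sum>j\<in>J. \<Sum>l\<in>J. ((\<Sum>i\<in>I. x i j \<omega> * x i l \<omega>) - (if j = l then real (card I) * s2 else 0))\<^sup>2) \<partial>M)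
    \<le> ennreal (K * real (card I) * (real (card J))\<^sup>2)" (is "?L \<le> _")
proof -
  have "?L = (\<integral>\<^sup>+\<omega>. (\<Sum>j\<in>J. \<Sum>l\<in>J. ennreal (((\<Sum>i\<in>I. x i j \<omega> * x i l \<omega>) - (if j = l then real (card I) * s2 else 0))\<^sup>2)) \<partial>M)"
    by (simp add: sum_nonneg)
  also have "\<dots> = (\<Sum>j\<in>J. \<Sum>l\<in>J. \<integral>\<^sup>+\<omega>. ennreal (((\<Sum>i\<in>I. x i j \<omega> * x i l \<omega>) - (if j = l then real (card I) * s2 else 0))\<^sup>2) \<partial>M)"
    using rv by (subst nn_integral_sum; (intro sum.cong refl nn_integral_sum)?) (auto simp del: sum_ennreal)
  also have "\<dots> \<le> (\<Sum>j\<in>J. \<Sum>l\<in>J. ennreal (K * real (card I)))"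
    by (intro sum_mono gram_entry_second_moment)
  also have "\<dots> = ennreal (K * real (card I) * (real (card J))\<^sup>2)"
    using K0 by (simp add: power2_eq_square ennreal_of_nat_eq_real_of_nat mult_ac flip: ennreal_mult)
  finally show ?thesis .
qed

lemma power_sum_second_moment:
  assumes m: "\<And>i j. i \<in> I \<Longrightarrow> j \<in> J \<Longrightarrow> expectation (\<lambda>\<omega>. x i j \<omega> ^ k) = m"
  shows "(\<integral>\<^sup>+\<omega>. ennreal ((\<Sum>i\<in>I. \<Sum>j\<in>J. x i j \<omega> ^ k - m)\<^sup>2) \<partial>M)
    \<le> ennreal (fact k / \<alpha> ^ k * B * (real (card I) * real (card J)))"
proof -
  define Y where "Y = (\<lambda>(i, j) \<omega>. x i j \<omega> ^ k - m)"
  have ind: "indep_vars (\<lambda>_. borel) Y (I \<times> J)"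
    unfolding Y_def case_prod_unfold
    using indep_vars_compose2[OF indep, of "\<lambda>_ y. y ^ k - m" "\<lambda>_. borel"] by (simp add: case_prod_unfold)
  have "(\<integral>\<^sup>+\<omega>. ennreal ((\<Sum>ij\<in>I \<times> J. 1 * Y ij \<omega>)\<^sup>2) \<partial>M) \<le> ennreal (fact k / \<alpha> ^ k * B * (\<Sum>ij\<in>I \<times> J. 1\<^sup>2))"
  proof (rule second_moment_sum_const[OF _ ind])
    fix ij assume "ij \<in> I \<times> J"
    then obtain i j where ij: "ij = (i, j)" "i \<in> I" "j \<in> J" by auto
    have meas: "(\<lambda>\<omega>. x i j \<omega> ^ k) \<in> borel_measurable M" using rv[OF ij(2,3)] by measurable
    have sq: "integrable M (\<lambda>\<omega>. (x i j \<omega> ^ k)\<^sup>2)" "expectation (\<lambda>\<omega>. (x i j \<omega> ^ k)\<^sup>2) \<le> fact k / \<alpha> ^ k * B"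
      using integrable_squareI[OF meas moment_bound[OF ij(2,3)]] \<alpha> B0 by auto
    have i1: "integrable M (\<lambda>\<omega>. x i j \<omega> ^ k)"
      by (rule square_integrable_imp_integrable[OF meas sq(1)])
    show "integrable M (Y ij)" using i1 by (simp add: Y_def ij)
    show "expectation (Y ij) = 0" using i1 m[OF ij(2,3)] by (simp add: Y_def ij prob_space)
    have eq: "(x i j \<omega> ^ k - m)\<^sup>2 = (x i j \<omega> ^ k)\<^sup>2 - 2 * m * x i j \<omega> ^ k + m\<^sup>2" for \<omega>
      by (simp add: power2_eq_square algebra_simps)
    have "integrable M (\<lambda>\<omega>. (x i j \<omega> ^ k - m)\<^sup>2)" unfolding eq using sq i1 by auto
    then have "(\<integral>\<^sup>+\<omega>. ennreal ((x i j \<omega> ^ k - m)\<^sup>2) \<partial>M) = ennreal (expectation (\<lambda>\<omega>. (x i j \<omega> ^ k - m)\<^sup>2))"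
      by (intro nn_integral_eq_integral) auto
    also have "expectation (\<lambda>\<omega>. (x i j \<omega> ^ k - m)\<^sup>2) = expectation (\<lambda>\<omega>. (x i j \<omega> ^ k)\<^sup>2) - m\<^sup>2"
      unfolding eq using sq i1 m[OF ij(2,3)] by (simp add: prob_space power2_eq_square)
    also have "ennreal \<dots> \<le> ennreal (fact k / \<alpha> ^ k * B)"
      using sq(2) by (intro ennreal_leI) (smt (verit) zero_le_power2)
    finally show "(\<integral>\<^sup>+\<omega>. ennreal ((Y ij \<omega>)\<^sup>2) \<partial>M) \<le> ennreal (fact k / \<alpha> ^ k * B)"
      by (simp add: Y_def ij)
  qed (use finite_I finite_J \<alpha> B0 in auto)
  also have "(\<Sum>ij\<in>I \<times> J. 1\<^sup>2) = real (card I) * real (card J)" by (simp add: card_cartesian_product)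
  finally show ?thesis by (simp add: Y_def sum.cartesian_product case_prod_unfold)
qed

lemma even_power_sum_moment:
  "(\<integral>\<^sup>+\<omega>. ennreal (\<Sum>i\<in>I. \<Sum>j\<in>J. (x i j \<omega> ^ k)\<^sup>2) \<partial>M)
    \<le> ennreal (fact k / \<alpha> ^ k * B * (real (card I) * real (card J)))" (is "?L \<le> _")
proof -
  have "?L = (\<integral>\<^sup>+\<omega>. (\<Sum>i\<in>I. \<Sum>j\<in>J. ennreal ((x i j \<omega> ^ k)\<^sup>2)) \<partial>M)"
    by (simp add: sum_nonneg)
  also have "\<dots> = (\<Sum>i\<in>I. \<Sum>j\<in>J. \<integral>\<^sup>+\<omega>. ennreal ((x i j \<omega> ^ k)\<^sup>2) \<partial>M)"
    using rv by (subst nn_integral_sum; (intro sum.cong refl nn_integral_sum)?) (auto simp del: sum_ennreal)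
  also have "\<dots> \<le> (\<Sum>i\<in>I. \<Sum>j\<in>J. ennreal (fact k / \<alpha> ^ k * B))"
    by (intro sum_mono moment_bound)
  also have "\<dots> = ennreal (fact k / \<alpha> ^ k * B * (real (card I) * real (card J)))"
    using \<alpha> B0 by (simp add: ennreal_of_nat_eq_real_of_nat mult_ac flip: ennreal_mult)
  finally show ?thesis .
qed

end

section \<open>Independence in the latent factor model\<close>

lemma Int_stable_sets: "Int_stable (sets N)"
  by (auto simp: Int_stable_def)

lemma (in prob_space) real_distributionI: "X \<in> borel_measurable M \<Longrightarrow> real_distribution (distr M borel X)"
  by (auto simp: real_distribution_def real_distribution_axioms_def prob_space_distr)

text \<open>The moments are those of the common law \<open>N\<close>, because the errors are
  specified through their distribution function; this also gives the design errors and the ideal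
  knockoff errors one variance.\<close>

lemma noise_arrayI_distr:
  assumes P: "prob_space P" and fin: "finite I" "finite J" and \<alpha>: "\<alpha> > 0" and B: "B \<ge> 0"
    and indep: "prob_space.indep_vars P (\<lambda>_. borel) (\<lambda>(i, j). x i j) (I \<times> J)"
    and N: "\<And>i j. i \<in> I \<Longrightarrow> j \<in> J \<Longrightarrow> distr P borel (x i j) = N"
    and int: "integrable N (\<lambda>y. y)" and mean: "(\<integral>y. y \<partial>N) = 0"
    and expsq: "(\<integral>\<^sup>+y. ennreal (exp (\<alpha> * y\<^sup>2)) \<partial>N) \<le> ennreal B"
  shows "noise_array P x I J \<alpha> B (\<integral>y. y\<^sup>2 \<partial>N)"
proof -
  interpret prob_space P by fact
  have rv: "x i j \<in> borel_measurable P" if "i \<in> I" "j \<in> J" for i j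
    using indep that by (auto simp: indep_vars_def2)
  show ?thesis
  proof
    fix i j assume ij: "i \<in> I" "j \<in> J"
    show "integrable P (x i j)"
      using int unfolding N[OF ij, symmetric] by (subst (asm) integrable_distr_eq) (use rv[OF ij] in auto)
    show "expectation (x i j) = 0"
      using mean unfolding N[OF ij, symmetric] by (subst (asm) integral_distr) (use rv[OF ij] in auto)
    show "(\<integral>\<^sup>+\<omega>. ennreal (exp (\<alpha> * (x i j \<omega>)\<^sup>2)) \<partial>P) \<le> ennreal B"
      using expsq unfolding N[OF ij, symmetric]
      by (subst (asm) nn_integral_distr) (use rv[OF ij] in auto)
    show "expectation (\<lambda>\<omega>. (x i j \<omega>)\<^sup>2) = (\<integral>y. y\<^sup>2 \<partial>N)"
      unfolding N[OF ij, symmetric] by (subst integral_distr) (use rv[OF ij] in auto)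
  qed (use assms in auto)
qed

text \<open>The rate is small enough for the noise, the errors and the envelope at the same time.\<close>

definition exp_rate :: "real \<Rightarrow> real \<Rightarrow> real \<Rightarrow> real" where
  "exp_rate C\<epsilon> Ce ce = 1 / (2 * max (C\<epsilon>\<^sup>2) (max (Ce\<^sup>2) (ce\<^sup>2)))"

definition exp_bound :: real where
  "exp_bound = 1 + 2 * exp (1/2) / (1 - exp (-1/2))"

lemma exp_bound_ge: "exp_bound \<ge> 1"
  by (simp add: exp_bound_def)

lemma subG_distr:
  assumes "prob_space P" "subG P (c\<^sup>2) X" "c > 0" "c = C\<epsilon> \<or> c = Ce \<or> c = ce"
  shows "integrable (distr P borel X) (\<lambda>y. y)" "(\<integral>y. y \<partial>distr P borel X) = 0"
    "(\<integral>\<^sup>+y. ennreal (exp (exp_rate C\<epsilon> Ce ce * y\<^sup>2)) \<partial>distr P borel X) \<le> ennreal exp_bound"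
proof -
  interpret prob_space P by fact
  have X: "X \<in> borel_measurable P" "integrable P X" "(\<integral>\<omega>. X \<omega> \<partial>P) = 0" using assms(2) by (auto simp: subG_def)
  show "integrable (distr P borel X) (\<lambda>y. y)" "(\<integral>y. y \<partial>distr P borel X) = 0"
    using X by (auto simp: integrable_distr_eq integral_distr)
  have "(\<integral>\<^sup>+\<omega>. ennreal (exp (exp_rate C\<epsilon> Ce ce * (X \<omega>)\<^sup>2)) \<partial>P) \<le> ennreal exp_bound"
    unfolding exp_rate_def exp_bound_def
    by (rule subG_exp_square[OF assms(2)]) (use assms(3,4) in auto)
  then show "(\<integral>\<^sup>+y. ennreal (exp (exp_rate C\<epsilon> Ce ce * y\<^sup>2)) \<partial>distr P borel X) \<le> ennreal exp_bound"
    using X by (subst nn_integral_distr) auto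
qed

text \<open>The numerical constants introduced below (\<alpha>, \<sigma>2, \<open>bd\<close>,
  \<open>KM\<close>, \<open>vA\<close> and the like) mention only the parameters common to all
  models and never \<open>D\<close>, so they agree for all members of a sequence.\<close>

locale latent_model =
  fixes M C\<epsilon> Ce ce :: real and m :: nat
    and G :: "(nat \<Rightarrow> real) \<Rightarrow> real \<Rightarrow> real" and \<eta>0 :: "nat \<Rightarrow> real"
    and h :: "nat \<Rightarrow> (nat \<Rightarrow> real) \<Rightarrow> real"
    and Q :: "'b measure" and e :: "(nat \<Rightarrow> real) \<Rightarrow> 'b \<Rightarrow> real"
    and D :: "('w, 'b, 'r::finite) factor_model"
  assumes M1: "M > 1" and C_pos: "C\<epsilon> > 0" "Ce > 0" "ce > 0" and m1: "m \<ge> 1"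
    and family: "error_family Ce m G \<eta>0 h Q e"
    and prob_P: "prob_space (Pr D)" and sources: "independent_sources Q D"
    and noise_cond: "noise_condition C\<epsilon> D" and factor_cond: "factor_condition M D"
    and loading_cond: "loading_condition M D" and error_cond: "error_condition M ce m G \<eta>0 h Q e D"
begin

abbreviation "n \<equiv> nobs D"
abbreviation "p \<equiv> nvar D"

sublocale prob_space "Pr D" by (rule prob_P)

sublocale Q: prob_space Q using family by (simp add: error_family_def)

definition "\<alpha> = exp_rate C\<epsilon> Ce ce"

lemma \<alpha>_pos: "\<alpha> > 0"
  using C_pos by (simp add: \<alpha>_def exp_rate_def less_max_iff_disj)

definition "\<sigma>2 = (\<integral>b. (e \<eta>0 b)\<^sup>2 \<partial>Q)"

definition src :: "nat \<Rightarrow> 'w set set" where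
  "src l = [generated (Pr D) borel {1..n} (noise D),
            generated (Pr D) borel {1..n} (factor D),
            generated (Pr D) borel (entries D) (\<lambda>(i, j). error D i j),
            generated (Pr D) Q (entries D) (\<lambda>(i, j). seed D i j)] ! l"

lemma indep_src: "indep_sets src {..<4}"
  using sources unfolding independent_sources_def src_def by simp

lemma src_events: "l < 4 \<Longrightarrow> src l \<subseteq> events"
  using indep_src by (auto simp: indep_sets_def)

text \<open>The sigma-algebra generated by the sources with index in \<open>A\<close> (0 noise, 1
  factors, 2 errors, 3 seeds). Measurability with respect to it records what a quantity depends
  on.\<close>

definition info :: "nat set \<Rightarrow> 'w measure" where
  "info A = sigma (space (Pr D)) (\<Union>l\<in>A. src l)"

lemma
  assumes "A \<subseteq> {..<4}"
  shows space_info: "space (info A) = space (Pr D)"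
    and sets_info: "sets (info A) = sigma_sets (space (Pr D)) (\<Union>l\<in>A. src l)"
    and sets_info_events: "sets (info A) \<subseteq> events"
proof -
  have sub: "(\<Union>l\<in>A. src l) \<subseteq> events" using src_events assms by blast
  then have "(\<Union>l\<in>A. src l) \<subseteq> Pow (space (Pr D))" using sets.sets_into_space by blast
  then show "space (info A) = space (Pr D)" "sets (info A) = sigma_sets (space (Pr D)) (\<Union>l\<in>A. src l)"
    by (auto simp: info_def)
  then show "sets (info A) \<subseteq> events" using sub by (simp add: sets.sigma_sets_subset)
qed

lemma info_measurable:
  assumes "A \<subseteq> {..<4}" "X \<in> measurable (info A) S"
  shows "X \<in> measurable (Pr D) S"
  using assms(2) sets_info_events[OF assms(1)] space_info[OF assms(1)] unfolding measurable_def by auto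

lemma Int_stable_src: "l < 4 \<Longrightarrow> Int_stable (src l)"
  unfolding src_def generated_def
  by (auto simp: less_Suc_eq numeral_eq_Suc Int_stable_sets)

text \<open>Independence becomes a matter of disjoint index sets, by grouping independent
  \<pi>-systems into generated sigma-algebras.\<close>

lemma indep_info:
  assumes AB: "A \<subseteq> {..<4}" "B \<subseteq> {..<4}" "A \<inter> B = {}"
    and X: "X \<in> measurable (info A) S" and Y: "Y \<in> measurable (info B) T"
  shows "indep_var S X T Y"
proof -
  have "indep_sets (\<lambda>b. sigma_sets (space (Pr D)) (\<Union>l\<in>case_bool A B b. src l)) UNIV"
  proof (rule indep_sets_collect_sigma)
    show "indep_sets src (\<Union>b\<in>UNIV. case_bool A B b)"
      by (rule indep_sets_mono_index[OF _ indep_src]) (use AB in \<open>auto simp: UNIV_bool\<close>)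
    show "Int_stable (src l)" if "l \<in> case_bool A B b" for l b
      using that AB by (intro Int_stable_src) (auto split: bool.splits)
    show "disjoint_family_on (case_bool A B) UNIV"
      using AB by (auto simp: disjoint_family_on_def split: bool.split)
  qed
  moreover have "(\<lambda>b. sigma_sets (space (Pr D)) (\<Union>l\<in>case_bool A B b. src l)) = case_bool (sets (info A)) (sets (info B))"
    using AB by (auto simp: sets_info fun_eq_iff split: bool.split)
  ultimately have ind: "indep_set (sets (info A)) (sets (info B))"
    by (simp add: indep_set_def)
  have gen: "sigma_sets (space (Pr D)) {X -` C \<inter> space (Pr D) |C. C \<in> sets S} \<subseteq> sets (info A)"
    if A: "A \<subseteq> {..<4}" and X: "X \<in> measurable (info A) S" for A and X :: "'w \<Rightarrow> 'c" and S
  proof -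
    have "{X -` C \<inter> space (Pr D) |C. C \<in> sets S} \<subseteq> sets (info A)"
      using measurable_sets[OF X] by (auto simp: space_info[OF A])
    then show ?thesis
      using sets.sigma_sets_subset[of _ "info A"] by (simp add: space_info[OF A])
  qed
  show ?thesis
    unfolding indep_var_eq
  proof (intro conjI)
    show "indep_set (sigma_sets (space (Pr D)) {X -` C \<inter> space (Pr D) |C. C \<in> sets S})
        (sigma_sets (space (Pr D)) {Y -` C \<inter> space (Pr D) |C. C \<in> sets T})"
      using ind gen[OF AB(1) X] gen[OF AB(2) Y] unfolding indep_sets2_eq by blast
  qed (use info_measurable AB X Y in auto)
qed

lemma measurable_generated:
  assumes l: "l \<in> A" "A \<subseteq> {..<4}" and src: "src l = generated (Pr D) N I X"
    and X: "\<And>i \<omega>. i \<in> I \<Longrightarrow> \<omega> \<in> space (Pr D) \<Longrightarrow> X i \<omega> \<in> space N" and i: "i \<in> I"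
  shows "X i \<in> measurable (info A) N"
proof -
  let ?V = "vimage_algebra (space (Pr D)) (\<lambda>\<omega>. \<lambda>i\<in>I. X i \<omega>) (Pi\<^sub>M I (\<lambda>_. N))"
  have 1: "(\<lambda>\<omega>. \<lambda>i\<in>I. X i \<omega>) \<in> measurable ?V (Pi\<^sub>M I (\<lambda>_. N))"
    by (rule measurable_vimage_algebra1) (use X in \<open>auto simp: space_PiM\<close>)
  have "(\<lambda>\<omega>. (\<lambda>i\<in>I. X i \<omega>) i) \<in> measurable ?V N"
    by (rule measurable_compose[OF 1 measurable_component_singleton[OF i]])
  then have 2: "X i \<in> measurable ?V N" using i by simp
  have "sets ?V \<subseteq> sets (info A)"
    using l src by (auto simp: sets_info generated_def)
  then show ?thesis using 2 space_info[OF l(2)] unfolding measurable_def by auto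
qed

lemma noise_info: "0 \<in> A \<Longrightarrow> A \<subseteq> {..<4} \<Longrightarrow> i \<in> {1..n} \<Longrightarrow> noise D i \<in> borel_measurable (info A)"
  by (rule measurable_generated[where l = 0 and I = "{1..n}"]) (auto simp: src_def)

lemma factor_info: "1 \<in> A \<Longrightarrow> A \<subseteq> {..<4} \<Longrightarrow> i \<in> {1..n} \<Longrightarrow> factor D i \<in> borel_measurable (info A)"
  by (rule measurable_generated[where l = 1 and I = "{1..n}"]) (auto simp: src_def)

lemma error_info:
  assumes "2 \<in> A" "A \<subseteq> {..<4}" "i \<in> {1..n}" "j \<in> {1..p}"
  shows "error D i j \<in> borel_measurable (info A)"
proof -
  have "(\<lambda>(i, j). error D i j) (i, j) \<in> borel_measurable (info A)"
    by (rule measurable_generated[where l = 2 and I = "entries D"]) (use assms in \<open>auto simp: src_def entries_def\<close>)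
  then show ?thesis by simp
qed

lemma seed_rv: "i \<in> {1..n} \<Longrightarrow> j \<in> {1..p} \<Longrightarrow> random_variable Q (seed D i j)"
  using error_cond by (force simp: error_condition_def iid_def indep_vars_def2 entries_def)

lemma seed_info:
  assumes "3 \<in> A" "A \<subseteq> {..<4}" "i \<in> {1..n}" "j \<in> {1..p}"
  shows "seed D i j \<in> measurable (info A) Q"
proof -
  have "(\<lambda>(i, j). seed D i j) (i, j) \<in> measurable (info A) Q"
    by (rule measurable_generated[where l = 3 and I = "entries D"])
      (use assms measurable_space[OF seed_rv] in \<open>auto simp: src_def entries_def\<close>)
  then show ?thesis by simp
qed

lemma e_measurable: "\<eta> \<in> Rvec m \<Longrightarrow> e \<eta> \<in> borel_measurable Q"
  using family measurable_compose[OF measurable_Pair1' [of \<eta> "Pi\<^sub>M {1..m} (\<lambda>_. borel)" Q], of "\<lambda>(\<eta>, b). e \<eta> b" borel]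
  by (simp add: error_family_def space_PiM)

lemma \<eta>0: "\<eta>0 \<in> Rvec m" and subG_e: "subG Q (Ce\<^sup>2) (e \<eta>0)"
  using family by (auto simp: error_family_def)

lemma cnp_nonneg: "cnp D \<ge> 0"
proof -
  have "ln (real k) \<ge> 0" for k :: nat by (cases k) auto
  then show ?thesis by (simp add: cnp_def c_rate_def)
qed

lemma \<eta>0_ball: "\<eta>0 \<in> eta_ball m \<eta>0 (M * cnp D)"
  using \<eta>0 M1 cnp_nonneg by (auto simp: eta_ball_def)

lemma cdf_G: "cdf (distr Q borel (e \<eta>0)) = G \<eta>0"
  using error_cond \<eta>0_ball by (simp add: error_condition_def)

text \<open>Links the errors, known through their distribution function, with the process at \<eta>0
  on \<open>Q\<close>: \<eta>0 lies in its own ball, so \<open>G \<eta>0\<close> is the distribution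
  function of both.\<close>

lemma error_distr:
  assumes "i \<in> {1..n}" "j \<in> {1..p}"
  shows "distr (Pr D) borel (error D i j) = distr Q borel (e \<eta>0)"
proof (rule cdf_unique)
  have "random_variable borel (error D i j)"
    using error_cond assms by (force simp: error_condition_def iid_def indep_vars_def2 entries_def)
  then show "real_distribution (distr (Pr D) borel (error D i j))" by (rule real_distributionI)
  show "real_distribution (distr Q borel (e \<eta>0))" by (rule Q.real_distributionI[OF e_measurable[OF \<eta>0]])
  show "cdf (distr (Pr D) borel (error D i j)) = cdf (distr Q borel (e \<eta>0))"
    using error_cond assms cdf_G by (auto simp: error_condition_def entries_def)
qed

lemma seed_distr: "i \<in> {1..n} \<Longrightarrow> j \<in> {1..p} \<Longrightarrow> distr (Pr D) Q (seed D i j) = Q"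
  using error_cond by (auto simp: error_condition_def entries_def)

lemma \<sigma>2_distr: "(\<integral>y. y\<^sup>2 \<partial>distr Q borel (e \<eta>0)) = \<sigma>2"
  unfolding \<sigma>2_def using e_measurable[OF \<eta>0] by (subst integral_distr) auto

lemma error_array: "noise_array (Pr D) (error D) {1..n} {1..p} \<alpha> exp_bound \<sigma>2"
  unfolding \<sigma>2_distr[symmetric]
proof (rule noise_arrayI_distr)
  show "indep_vars (\<lambda>_. borel) (\<lambda>(i, j). error D i j) ({1..n} \<times> {1..p})"
    using error_cond by (simp add: error_condition_def iid_def entries_def)
qed (use prob_P \<alpha>_pos exp_bound_ge error_distr subG_distr[OF Q.prob_space_axioms subG_e C_pos(2), of C\<epsilon> Ce ce] in \<open>auto simp: \<alpha>_def\<close>)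

lemma seed_array:
  assumes "c > 0" "subG Q (c\<^sup>2) g" "c = Ce \<or> c = ce"
  shows "noise_array (Pr D) (\<lambda>i j \<omega>. g (seed D i j \<omega>)) {1..n} {1..p} \<alpha> exp_bound (\<integral>b. (g b)\<^sup>2 \<partial>Q)"
proof -
  have g: "g \<in> borel_measurable Q" using assms(2) by (simp add: subG_def)
  have eq: "(\<integral>b. (g b)\<^sup>2 \<partial>Q) = (\<integral>y. y\<^sup>2 \<partial>distr Q borel g)" using g by (subst integral_distr) auto
  show ?thesis
    unfolding eq
  proof (rule noise_arrayI_distr)
    have "indep_vars (\<lambda>_. borel) (\<lambda>ij \<omega>. g ((\<lambda>(i, j). seed D i j) ij \<omega>)) ({1..n} \<times> {1..p})"
      by (rule indep_vars_compose2[where M' = "\<lambda>_. Q"])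
        (use error_cond g in \<open>auto simp: error_condition_def iid_def entries_def\<close>)
    then show "indep_vars (\<lambda>_. borel) (\<lambda>(i, j) \<omega>. g (seed D i j \<omega>)) ({1..n} \<times> {1..p})"
      by (simp add: case_prod_unfold)
    fix i j assume "i \<in> {1..n}" "j \<in> {1..p}"
    then show "distr (Pr D) borel (\<lambda>\<omega>. g (seed D i j \<omega>)) = distr Q borel g"
      using distr_distr[OF g seed_rv, of i j] by (simp add: seed_distr o_def)
  qed (use prob_P \<alpha>_pos exp_bound_ge assms subG_distr[OF Q.prob_space_axioms assms(2,1), of C\<epsilon> Ce ce] in \<open>auto simp: \<alpha>_def\<close>)
qed

lemma knockoff_array: "noise_array (Pr D) (\<lambda>i j \<omega>. e \<eta>0 (seed D i j \<omega>)) {1..n} {1..p} \<alpha> exp_bound \<sigma>2"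
  unfolding \<sigma>2_def by (rule seed_array[OF C_pos(2) subG_e]) simp

text \<open>The noise vector becomes an array with one column, so that the column tail bounds apply
  to it.\<close>

lemma noise_row:
  assumes "n > 0"
  shows "\<exists>v. noise_array (Pr D) (\<lambda>i j. noise D i) {1..n} {0::nat} \<alpha> exp_bound v"
proof -
  have "noise_array (Pr D) (\<lambda>i j. noise D i) {1..n} {0::nat} \<alpha> exp_bound (\<integral>y. y\<^sup>2 \<partial>distr (Pr D) borel (noise D 1))"
  proof (rule noise_arrayI_distr)
  have sub: "subG (Pr D) (C\<epsilon>\<^sup>2) (noise D 1)" using noise_cond assms by (auto simp: noise_condition_def)
  show "integrable (distr (Pr D) borel (noise D 1)) (\<lambda>y. y)" "(\<integral>y. y \<partial>distr (Pr D) borel (noise D 1)) = 0"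
    "(\<integral>\<^sup>+y. ennreal (exp (\<alpha> * y\<^sup>2)) \<partial>distr (Pr D) borel (noise D 1)) \<le> ennreal exp_bound"
    using subG_distr[OF prob_P sub C_pos(1), of C\<epsilon> Ce ce] by (auto simp: \<alpha>_def)
  have "indep_vars (\<lambda>_. borel) (\<lambda>ij. noise D (fst ij)) ({1..n} \<times> {0::nat})"
    by (rule indep_vars_reindex[of fst "{1..n} \<times> {0::nat}" "\<lambda>_. borel" "noise D"])
      (use noise_cond in \<open>auto simp: noise_condition_def iid_def inj_on_def fst_image_times\<close>)
  then show "indep_vars (\<lambda>_. borel) (\<lambda>(i, j). noise D i) ({1..n} \<times> {0::nat})"
    by (simp add: case_prod_unfold)
  show "distr (Pr D) borel (noise D i) = distr (Pr D) borel (noise D 1)" if "i \<in> {1..n}" for i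
  proof -
    have "\<forall>i\<in>{1..n}. \<forall>j\<in>{1..n}. distr (Pr D) borel (noise D i) = distr (Pr D) borel (noise D j)"
      using noise_cond unfolding noise_condition_def iid_def by (elim conjE)
    from bspec[OF bspec[OF this that]] show ?thesis using assms by simp
  qed
  qed (use prob_P \<alpha>_pos exp_bound_ge in auto)
  then show ?thesis by blast
qed

text \<open>With zero variance \<open>e \<eta>0\<close> would have an atom at 0, against the
  continuity of \<open>G \<eta>0\<close>. The restricted eigenvalue rests on this
  positivity.\<close>

lemma \<sigma>2_pos: "\<sigma>2 > 0"
proof (rule ccontr)
  assume "\<not> \<sigma>2 > 0"
  moreover have "\<sigma>2 \<ge> 0" by (simp add: \<sigma>2_def)
  ultimately have 0: "\<sigma>2 = 0" by simp
  have meas: "e \<eta>0 \<in> borel_measurable Q" by (rule e_measurable[OF \<eta>0])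
  interpret R: real_distribution "distr Q borel (e \<eta>0)" by (rule Q.real_distributionI[OF meas])
  have nn: "(\<integral>\<^sup>+b. ennreal ((e \<eta>0 b)\<^sup>2) \<partial>Q) \<le> ennreal (2 / \<alpha>\<^sup>2 * (exp \<alpha> * exp_bound))"
  proof (rule Q.second_moment_of_exp[OF meas _ \<alpha>_pos])
    have le: "\<alpha> * \<bar>y\<bar> \<le> \<alpha> + \<alpha> * y\<^sup>2" for y :: real
    proof -
      have "\<bar>y\<bar> \<le> 1 + y\<^sup>2" using zero_le_power2[of "\<bar>y\<bar> - 1"] zero_le_power2[of y] by (simp add: power2_eq_square algebra_simps)
      then have "\<alpha> * \<bar>y\<bar> \<le> \<alpha> * (1 + y\<^sup>2)" using \<alpha>_pos by (intro mult_left_mono) auto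
      then show ?thesis by (simp add: algebra_simps)
    qed
    have "(\<integral>\<^sup>+b. ennreal (exp (\<alpha> * \<bar>e \<eta>0 b\<bar>)) \<partial>Q) \<le> (\<integral>\<^sup>+b. ennreal (exp \<alpha>) * ennreal (exp (\<alpha> * (e \<eta>0 b)\<^sup>2)) \<partial>Q)"
      using le by (intro nn_integral_mono, subst ennreal_mult[symmetric]) (auto simp flip: exp_add intro!: ennreal_leI)
    also have "\<dots> = ennreal (exp \<alpha>) * (\<integral>\<^sup>+b. ennreal (exp (\<alpha> * (e \<eta>0 b)\<^sup>2)) \<partial>Q)"
      using meas by (intro nn_integral_cmult) measurable
    also have "(\<integral>\<^sup>+b. ennreal (exp (\<alpha> * (e \<eta>0 b)\<^sup>2)) \<partial>Q) \<le> ennreal exp_bound"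
      using subG_distr(3)[OF Q.prob_space_axioms subG_e C_pos(2), of C\<epsilon> Ce ce] meas
      by (simp add: nn_integral_distr \<alpha>_def)
    finally show "(\<integral>\<^sup>+b. ennreal (exp (\<alpha> * \<bar>e \<eta>0 b\<bar>)) \<partial>Q) \<le> ennreal (exp \<alpha> * exp_bound)"
      using exp_bound_ge by (simp add: ennreal_mult mult_left_mono)
  qed (use exp_bound_ge in simp)
  have int: "integrable Q (\<lambda>b. (e \<eta>0 b)\<^sup>2)" by (rule Q.integrable_squareI(1)[OF meas nn])
  have "AE b in Q. (e \<eta>0 b)\<^sup>2 = 0"
    using 0 integral_nonneg_eq_0_iff_AE[OF int] by (simp add: \<sigma>2_def)
  then have "AE b in Q. e \<eta>0 b = 0" by simp
  then have "Q.prob {b \<in> space Q. e \<eta>0 b = 0} = 1"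
    using meas by (subst Q.prob_Collect_eq_1) auto
  then have "measure (distr Q borel (e \<eta>0)) {0} = 1"
    using meas by (subst measure_distr) (auto simp: vimage_def Int_def conj_commute)
  moreover have "isCont (cdf (distr Q borel (e \<eta>0))) 0"
    using family cdf_G by (simp add: error_family_def continuous_on_eq_continuous_at)
  ultimately show False using R.isCont_cdf[of 0] by simp
qed

end

section \<open>High-probability events\<close>

lemma norm_vec_square: "(norm (x :: real^'r::finite))\<^sup>2 = (\<Sum>a\<in>UNIV. (x $ a)\<^sup>2)"
  by (simp add: norm_vec_def L2_set_def sum_nonneg)

lemma spectral_norm_bound: "norm (A *v x) \<le> spectral_norm A * norm x"
  unfolding spectral_norm_def by (rule onorm) (simp add: matrix_vector_mul_bounded_linear)

lemma spectral_norm_nonneg: "spectral_norm A \<ge> 0"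
  unfolding spectral_norm_def by (rule onorm_pos_le) (simp add: matrix_vector_mul_bounded_linear)

lemma invertible_norm_lower:
  assumes "invertible A" "spectral_norm A + spectral_norm (matrix_inv A) \<le> M" "M > 0"
  shows "norm x \<le> M * norm (A *v x)" "norm (A *v x) \<le> M * norm x"
proof -
  have "x = matrix_inv A *v (A *v x)"
    using someI_ex[OF assms(1)[unfolded invertible_def]] by (simp add: matrix_vector_mul_assoc matrix_inv_def)
  then have "norm x \<le> spectral_norm (matrix_inv A) * norm (A *v x)" using spectral_norm_bound by metis
  also have "\<dots> \<le> M * norm (A *v x)"
    using assms(2) spectral_norm_nonneg[of A] by (intro mult_right_mono) auto
  finally show "norm x \<le> M * norm (A *v x)" .
  have "norm (A *v x) \<le> spectral_norm A * norm x" by (rule spectral_norm_bound)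
  also have "\<dots> \<le> M * norm x"
    using assms(2) spectral_norm_nonneg[of "matrix_inv A"] by (intro mult_right_mono) auto
  finally show "norm (A *v x) \<le> M * norm x" .
qed

text \<open>For a positive semidefinite form, Cauchy--Schwarz gives
  \<open>\<bar>A x\<bar>\<^sup>4 \<le> (x \<bullet> A x) (A x \<bullet> A (A x))\<close>; no diagonalization is needed.\<close>

lemma quadratic_form_lower:
  fixes A :: "real^'r^'r::finite"
  assumes sym: "\<And>x y. x \<bullet> (A *v y) = y \<bullet> (A *v x)" and psd: "\<And>x. 0 \<le> x \<bullet> (A *v x)"
    and lo: "\<And>x. norm x \<le> M * norm (A *v x)" and up: "\<And>x. norm (A *v x) \<le> M * norm x" and M: "M > 0"
  shows "(norm x)\<^sup>2 / M ^ 3 \<le> x \<bullet> (A *v x)"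
proof -
  define y where "y = A *v x"
  define q where "q = x \<bullet> (A *v x)"
  have CS: "(x \<bullet> (A *v y))\<^sup>2 \<le> q * (y \<bullet> (A *v y))"
  proof -
    have quad: "0 \<le> q + 2 * t * (x \<bullet> (A *v y)) + t\<^sup>2 * (y \<bullet> (A *v y))" for t
    proof -
      have "0 \<le> (x + t *\<^sub>R y) \<bullet> (A *v (x + t *\<^sub>R y))" by (rule psd)
      also have "\<dots> = q + 2 * t * (x \<bullet> (A *v y)) + t\<^sup>2 * (y \<bullet> (A *v y))"
        using sym[of y x] by (simp add: q_def matrix_vector_right_distrib matrix_vector_mult_scaleR
            inner_add_left inner_add_right power2_eq_square algebra_simps)
      finally show ?thesis .
    qed
    define c where "c = y \<bullet> (A *v y)"
    define bb where "bb = x \<bullet> (A *v y)"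
    show ?thesis
    proof (cases "c = 0")
      case True
      have "bb = 0"
      proof (rule ccontr)
        assume bb: "bb \<noteq> 0"
        \<comment> \<open>With c = 0 the form is affine in t, and this t gives it the value
          -1.\<close>
        have "0 \<le> q + 2 * (- (q + 1) / (2 * bb)) * bb" using quad[of "- (q + 1) / (2 * bb)"] True by (simp add: c_def bb_def)
        then show False using bb by (simp add: field_simps)
      qed
      then show ?thesis using True by (simp add: c_def bb_def)
    next
      case False
      then have c: "c > 0" using psd[of y] by (simp add: c_def)
      have "0 \<le> q + 2 * (- bb / c) * bb + (- bb / c)\<^sup>2 * c" using quad[of "- bb / c"] by (simp add: c_def bb_def)
      also have "\<dots> = q - bb\<^sup>2 / c" using c by (simp add: power2_eq_square field_simps)
      finally show ?thesis using c by (simp add: bb_def[symmetric] c_def[symmetric] field_simps)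
    qed
  qed
  have xy: "x \<bullet> (A *v y) = (norm y)\<^sup>2" using sym[of x y] by (simp add: y_def power2_norm_eq_inner)
  have "y \<bullet> (A *v y) \<le> norm y * norm (A *v y)" by (rule norm_cauchy_schwarz)
  also have "\<dots> \<le> norm y * (M * norm y)" by (intro mult_left_mono up) simp
  finally have yy: "y \<bullet> (A *v y) \<le> M * (norm y)\<^sup>2" by (simp add: power2_eq_square mult_ac)
  have q0: "q \<ge> 0" unfolding q_def by (rule psd)
  have "(norm y)\<^sup>2 * (norm y)\<^sup>2 \<le> q * (M * (norm y)\<^sup>2)"
    using CS mult_left_mono[OF yy q0] by (simp add: xy power2_eq_square)
  then have "(norm y)\<^sup>2 \<le> q * M"
  proof (cases "y = 0")
    case False
    then have "(norm y)\<^sup>2 > 0" by simp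
    moreover have "(norm y)\<^sup>2 * (norm y)\<^sup>2 \<le> (q * M) * (norm y)\<^sup>2"
      using \<open>(norm y)\<^sup>2 * (norm y)\<^sup>2 \<le> q * (M * (norm y)\<^sup>2)\<close> by (simp only: mult.assoc)
    ultimately show ?thesis by (rule mult_right_le_imp_le[rotated])
  qed (use q0 M in simp)
  \<comment> \<open>The cube of M: one factor from y \<bullet> A y \<le> M \<bar>y\<bar>^2 and two
    from \<bar>x\<bar> \<le> M \<bar>y\<bar>.\<close>
  moreover have "(norm x)\<^sup>2 \<le> M\<^sup>2 * (norm y)\<^sup>2"
    using power_mono[OF lo[of x], of 2] by (simp add: y_def power_mult_distrib)
  ultimately have "(norm x)\<^sup>2 \<le> M\<^sup>2 * (q * M)" using M by (meson mult_left_mono order.trans zero_le_power2)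
  then show ?thesis using M by (simp add: q_def power2_eq_square power3_eq_cube field_simps)
qed

lemma vec_nth_measurable: "(\<lambda>x::real^'r::finite. x $ a) \<in> borel_measurable borel"
  by (intro borel_measurable_continuous_onI continuous_intros)

context latent_model begin

definition "tail x = 2 * exp (2 * noise_array.D \<alpha> exp_bound) * exp (- (\<alpha> / 2 * x))"

lemma tail_nonneg: "tail x \<ge> 0" by (simp add: tail_def)

sublocale EA: noise_array "Pr D" "error D" "{1..n}" "{1..p}" \<alpha> exp_bound \<sigma>2 by (rule error_array)
sublocale SA: noise_array "Pr D" "\<lambda>i j \<omega>. e \<eta>0 (seed D i j \<omega>)" "{1..n}" "{1..p}" \<alpha> exp_bound \<sigma>2 by (rule knockoff_array)

definition "bd = real CARD('r) * M\<^sup>2"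

lemma factor_bounded: "AE \<omega> in Pr D. \<forall>i\<in>{1..n}. \<forall>a. \<bar>factor D i \<omega> $ a\<bar> \<le> M"
  using factor_cond by (simp add: factor_condition_def)

lemma norm_square_le_b: "(\<And>a. \<bar>(y::real^'r) $ a\<bar> \<le> M) \<Longrightarrow> (norm y)\<^sup>2 \<le> bd"
proof -
  assume le: "\<And>a. \<bar>y $ a\<bar> \<le> M"
  have "(y $ a)\<^sup>2 \<le> M\<^sup>2" for a using power_mono[OF le[of a], of 2] by simp
  then have "(\<Sum>a\<in>UNIV. (y $ a)\<^sup>2) \<le> (\<Sum>a\<in>(UNIV::'r set). M\<^sup>2)" by (intro sum_mono)
  then show ?thesis by (simp add: norm_vec_square bd_def)
qed

lemma loading_bounded: "j \<in> {1..p} \<Longrightarrow> (norm (loading D j))\<^sup>2 \<le> bd"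
  using loading_cond by (intro norm_square_le_b) (auto simp: loading_condition_def)

lemma loading_lower:
  assumes "p > 0"
  shows "1 / M * real p * norm c \<le> norm (\<Sum>j=1..p. (loading D j \<bullet> c) *\<^sub>R loading D j)"
proof -
  have "real p *\<^sub>R (loading_gram D *v c) = (\<Sum>j=1..p. (loading D j \<bullet> c) *\<^sub>R loading D j)"
  proof (rule vec_eq_iff[THEN iffD2], rule allI)
    fix a
    have "(real p *\<^sub>R (loading_gram D *v c)) $ a = (\<Sum>b\<in>UNIV. (\<Sum>j=1..p. loading D j $ a * loading D j $ b) * c $ b)"
      using assms by (simp add: matrix_vector_mult_def loading_gram_def sum_distrib_left)
    also have "\<dots> = (\<Sum>b\<in>UNIV. \<Sum>j=1..p. loading D j $ a * (loading D j $ b * c $ b))"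
      by (simp add: sum_distrib_right mult.assoc)
    also have "\<dots> = (\<Sum>j=1..p. \<Sum>b\<in>UNIV. loading D j $ a * (loading D j $ b * c $ b))" by (rule sum.swap)
    also have "\<dots> = (\<Sum>j=1..p. (loading D j \<bullet> c) *\<^sub>R loading D j) $ a"
      by (simp add: inner_vec_def sum_distrib_left mult.commute)
    finally show "(real p *\<^sub>R (loading_gram D *v c)) $ a = (\<Sum>j=1..p. (loading D j \<bullet> c) *\<^sub>R loading D j) $ a" .
  qed
  then have "norm (\<Sum>j=1..p. (loading D j \<bullet> c) *\<^sub>R loading D j) = real p * norm (loading_gram D *v c)"
    by (metis abs_of_nat norm_scaleR)
  moreover have "norm c \<le> M * norm (loading_gram D *v c)"
    using invertible_norm_lower(1)[of "loading_gram D" M c] loading_cond M1 by (simp add: loading_condition_def)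
  moreover have "1 / M * norm c \<le> norm (loading_gram D *v c)"
    using \<open>norm c \<le> M * norm (loading_gram D *v c)\<close> M1 by (simp add: field_simps)
  then have "real p * (1 / M * norm c) \<le> real p * norm (loading_gram D *v c)" by (rule mult_left_mono) simp
  ultimately show ?thesis by (simp add: mult_ac)
qed

lemma factor_rv: "i \<in> {1..n} \<Longrightarrow> factor D i \<in> borel_measurable (Pr D)"
  using factor_cond by (simp add: factor_condition_def iid_def indep_vars_def2)

lemma factor_component_rv: "i \<in> {1..n} \<Longrightarrow> (\<lambda>\<omega>. factor D i \<omega> $ a) \<in> borel_measurable (Pr D)"
  by (rule measurable_compose[OF factor_rv vec_nth_measurable])

lemma factor_product_integrable:
  assumes "i \<in> {1..n}"
  shows "integrable (Pr D) (\<lambda>\<omega>. factor D i \<omega> $ a * factor D i \<omega> $ b)"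
proof (rule integrable_const_bound)
  show "AE \<omega> in Pr D. norm (factor D i \<omega> $ a * factor D i \<omega> $ b) \<le> M * M"
    using factor_bounded
  proof eventually_elim
    case (elim \<omega>)
    then show ?case using assms M1 by (auto simp: abs_mult intro!: mult_mono)
  qed
qed (use factor_component_rv[OF assms] in measurable)

lemma factor_cov_lower:
  assumes i: "i \<in> {1..n}"
  shows "(norm y)\<^sup>2 / M ^ 3 \<le> (\<Sum>a\<in>UNIV. \<Sum>b\<in>UNIV. y $ a * y $ b * factor_cov D i $ a $ b)"
proof -
  let ?A = "factor_cov D i"
  have form: "x \<bullet> (?A *v y) = (\<Sum>a\<in>UNIV. \<Sum>b\<in>UNIV. x $ a * y $ b * ?A $ a $ b)" for x y
    by (simp add: inner_vec_def matrix_vector_mult_def sum_distrib_left mult_ac)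
  have sy: "?A $ a $ b = ?A $ b $ a" for a b by (simp add: factor_cov_def mult.commute)
  have "(norm y)\<^sup>2 / M ^ 3 \<le> y \<bullet> (?A *v y)"
  proof (rule quadratic_form_lower)
    fix x y
    show "x \<bullet> (?A *v y) = y \<bullet> (?A *v x)"
      unfolding form by (subst sum.swap) (use sy in \<open>simp add: mult_ac\<close>)
    have "x \<bullet> (?A *v x) = (\<Sum>a\<in>UNIV. \<Sum>b\<in>UNIV. x $ a * x $ b * (\<integral>\<omega>. factor D i \<omega> $ a * factor D i \<omega> $ b \<partial>Pr D))"
      unfolding form by (simp add: factor_cov_def)
    also have "\<dots> = (\<integral>\<omega>. (\<Sum>a\<in>UNIV. \<Sum>b\<in>UNIV. x $ a * x $ b * (factor D i \<omega> $ a * factor D i \<omega> $ b)) \<partial>Pr D)"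
      using factor_product_integrable[OF i] by (simp add: Bochner_Integration.integral_sum)
    also have "\<dots> = (\<integral>\<omega>. (factor D i \<omega> \<bullet> x)\<^sup>2 \<partial>Pr D)"
      by (intro Bochner_Integration.integral_cong refl) (simp add: inner_vec_def power2_eq_square sum_product mult_ac)
    also have "\<dots> \<ge> 0" by simp
    finally show "0 \<le> x \<bullet> (?A *v x)" .
    show "norm x \<le> M * norm (?A *v x)" "norm (?A *v x) \<le> M * norm x"
      using invertible_norm_lower[of ?A M x] factor_cond i M1 by (auto simp: factor_condition_def)
  qed (use M1 in simp)
  then show ?thesis by (simp add: form)
qed

text \<open>Half of the lower bound 1 / M^3 for the population form; the other half is given up to
  the sampling deviation.\<close>

definition "f0 = 1 / (2 * M ^ 3)"

text \<open>Centred products of bounded factors are at most 2 M^2, hence subexponential with rate 1.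
  A deviation x sqrt n in each of the r^2 entries changes the form by at most r x sqrt n times the
  squared norm of y.\<close>

lemma factor_gram_lower:
  assumes "n > 0" and x: "real CARD('r) * x \<le> sqrt (real n) / (2 * M ^ 3)"
  shows "holds_except (Pr D) (real CARD('r) * (real CARD('r) * (2 * exp (2 * exp (2 * M\<^sup>2)) * exp (- (1 / 2 * x)))))
    (\<lambda>\<omega>. \<forall>y. f0 * real n * (norm y)\<^sup>2 \<le> (\<Sum>i=1..n. (factor D i \<omega> \<bullet> y)\<^sup>2))"
proof -
  define Y where "Y a b i \<omega> = factor D i \<omega> $ a * factor D i \<omega> $ b - factor_cov D i $ a $ b" for a b :: 'r and i \<omega>
  have cov_le: "\<bar>factor_cov D i $ a $ b\<bar> \<le> M\<^sup>2" if i: "i \<in> {1..n}" for i a b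
  proof -
    have "\<bar>factor_cov D i $ a $ b\<bar> \<le> (\<integral>\<omega>. \<bar>factor D i \<omega> $ a * factor D i \<omega> $ b\<bar> \<partial>Pr D)"
      unfolding factor_cov_def by (simp add: integral_abs_bound)
    also have "\<dots> \<le> (\<integral>\<omega>. M\<^sup>2 \<partial>Pr D)"
    proof (rule integral_mono_AE)
      show "AE \<omega> in Pr D. \<bar>factor D i \<omega> $ a * factor D i \<omega> $ b\<bar> \<le> M\<^sup>2"
        using factor_bounded
      proof eventually_elim
        case (elim \<omega>)
        then show ?case using i M1 by (auto simp: abs_mult power2_eq_square intro!: mult_mono)
      qed
    qed (use factor_product_integrable[OF i] in auto)
    finally show ?thesis by (simp add: prob_space)
  qed
  have sub: "subexp 1 (exp (2 * M\<^sup>2)) (Y a b i)" if i: "i \<in> {1..n}" for a b i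
    unfolding subexp_def
  proof (intro conjI)
    show "Y a b i \<in> borel_measurable (Pr D)" unfolding Y_def using factor_component_rv[OF i] by measurable
    show "integrable (Pr D) (Y a b i)" unfolding Y_def using factor_product_integrable[OF i] by auto
    show "expectation (Y a b i) = 0" unfolding Y_def using factor_product_integrable[OF i] by (simp add: factor_cov_def prob_space)
    have "AE \<omega> in Pr D. ennreal (exp (1 * \<bar>Y a b i \<omega>\<bar>)) \<le> ennreal (exp (2 * M\<^sup>2))"
      using factor_bounded
    proof eventually_elim
      case (elim \<omega>)
      have "\<bar>factor D i \<omega> $ a * factor D i \<omega> $ b\<bar> \<le> M\<^sup>2"
        using elim i M1 by (auto simp: abs_mult power2_eq_square intro!: mult_mono)
      then have "\<bar>Y a b i \<omega>\<bar> \<le> 2 * M\<^sup>2" using cov_le[OF i, of a b] unfolding Y_def by linarith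
      then show ?case by (simp add: ennreal_leI)
    qed
    then have "(\<integral>\<^sup>+\<omega>. ennreal (exp (1 * \<bar>Y a b i \<omega>\<bar>)) \<partial>Pr D) \<le> (\<integral>\<^sup>+\<omega>. ennreal (exp (2 * M\<^sup>2)) \<partial>Pr D)"
      by (rule nn_integral_mono_AE)
    then show "(\<integral>\<^sup>+\<omega>. ennreal (exp (1 * \<bar>Y a b i \<omega>\<bar>)) \<partial>Pr D) \<le> ennreal (exp (2 * M\<^sup>2))"
      by (simp add: emeasure_space_1)
  qed
  have ind: "indep_vars (\<lambda>_. borel) (Y a b) {1..n}" for a b
    unfolding Y_def
    by (rule indep_vars_compose2[where Y = "\<lambda>i y. y $ a * y $ b - factor_cov D i $ a $ b" and M' = "\<lambda>_. borel"])
      (use factor_cond in \<open>auto simp: factor_condition_def iid_def\<close>)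
  have each: "holds_except (Pr D) (2 * exp (2 * exp (2 * M\<^sup>2)) * exp (- (1 / 2 * x)))
      (\<lambda>\<omega>. \<bar>\<Sum>i=1..n. Y a b i \<omega>\<bar> \<le> x * sqrt (real n))" for a b
    using subexp_sum_tail[OF _ ind sub, of x a b] assms(1) by simp
  have "holds_except (Pr D) (real CARD('r) * (real CARD('r) * (2 * exp (2 * exp (2 * M\<^sup>2)) * exp (- (1 / 2 * x)))))
      (\<lambda>\<omega>. \<forall>a\<in>UNIV. \<forall>b\<in>UNIV. \<bar>\<Sum>i=1..n. Y a b i \<omega>\<bar> \<le> x * sqrt (real n))"
    by (intro holds_except_ball each) auto
  then show ?thesis
  proof (rule holds_except_mono)
    fix \<omega> assume Y: "\<forall>a\<in>UNIV. \<forall>b\<in>UNIV. \<bar>\<Sum>i=1..n. Y a b i \<omega>\<bar> \<le> x * sqrt (real n)"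
    show "\<forall>y. f0 * real n * (norm y)\<^sup>2 \<le> (\<Sum>i=1..n. (factor D i \<omega> \<bullet> y)\<^sup>2)"
    proof
      fix y :: "real^'r"
      have gen: "d \<le> s" if "a - b \<le> s" "b \<le> c" "a - c = d" for a b c d s :: real
        using that by linarith
      define z where "z = x * sqrt (real n)"
      have "0 \<le> \<bar>\<Sum>i=1..n. Y undefined undefined i \<omega>\<bar>" by simp
      also have "\<dots> \<le> z" using Y unfolding z_def by blast
      finally have z0: "z \<ge> 0" .
      have sq: "(factor D i \<omega> \<bullet> y)\<^sup>2 = (\<Sum>a\<in>UNIV. \<Sum>b\<in>UNIV. y $ a * y $ b * factor_cov D i $ a $ b)
          + (\<Sum>a\<in>UNIV. \<Sum>b\<in>UNIV. y $ a * y $ b * Y a b i \<omega>)" for i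
      proof -
        have "(factor D i \<omega> \<bullet> y)\<^sup>2 = (\<Sum>a\<in>UNIV. \<Sum>b\<in>UNIV. y $ a * y $ b * (factor D i \<omega> $ a * factor D i \<omega> $ b))"
          by (simp add: inner_vec_def power2_eq_square sum_product mult_ac)
        then show ?thesis by (simp add: Y_def algebra_simps flip: sum.distrib)
      qed
      have "(\<Sum>i=1..n. \<Sum>a\<in>UNIV. \<Sum>b\<in>UNIV. y $ a * y $ b * Y a b i \<omega>) = (\<Sum>a\<in>UNIV. \<Sum>b\<in>UNIV. y $ a * y $ b * (\<Sum>i=1..n. Y a b i \<omega>))"
        unfolding sum_distrib_left by (subst sum.swap, rule sum.cong[OF refl], rule sum.swap)
      moreover have "\<bar>\<dots>\<bar> \<le> z * real CARD('r) * (norm y)\<^sup>2"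
      proof -
        have "\<bar>\<Sum>a\<in>UNIV. \<Sum>b\<in>UNIV. y $ a * y $ b * (\<Sum>i=1..n. Y a b i \<omega>)\<bar> \<le> z * (\<Sum>a\<in>UNIV. \<bar>y $ a\<bar>)\<^sup>2"
          by (rule bilinear_bound) (use Y in \<open>auto simp: z_def\<close>)
        also have "\<dots> \<le> z * ((\<Sum>a\<in>(UNIV::'r set). 1\<^sup>2) * (\<Sum>a\<in>UNIV. \<bar>y $ a\<bar>\<^sup>2))"
          using Cauchy_Schwarz_ineq_sum[of "\<lambda>_. 1" "\<lambda>a. \<bar>y $ a\<bar>" UNIV] z0 by (intro mult_left_mono) auto
        finally show ?thesis by (simp add: norm_vec_square)
      qed
      moreover have "(\<Sum>i=1..n. (norm y)\<^sup>2 / M ^ 3) \<le> (\<Sum>i=1..n. \<Sum>a\<in>UNIV. \<Sum>b\<in>UNIV. y $ a * y $ b * factor_cov D i $ a $ b)"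
        by (intro sum_mono factor_cov_lower)
      moreover have "(\<Sum>i=1..n. (factor D i \<omega> \<bullet> y)\<^sup>2) = (\<Sum>i=1..n. \<Sum>a\<in>UNIV. \<Sum>b\<in>UNIV. y $ a * y $ b * factor_cov D i $ a $ b)
          + (\<Sum>i=1..n. \<Sum>a\<in>UNIV. \<Sum>b\<in>UNIV. y $ a * y $ b * Y a b i \<omega>)"
        unfolding sq by (rule sum.distrib)
      ultimately have "(\<Sum>i=1..n. (factor D i \<omega> \<bullet> y)\<^sup>2) \<ge> real n * ((norm y)\<^sup>2 / M ^ 3) - z * real CARD('r) * (norm y)\<^sup>2"
        by simp
      moreover have "z * real CARD('r) * (norm y)\<^sup>2 \<le> (real n / (2 * M ^ 3)) * (norm y)\<^sup>2"
      proof (rule mult_right_mono)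
        have "z * real CARD('r) = (real CARD('r) * x) * sqrt (real n)" by (simp add: z_def)
        also have "\<dots> \<le> sqrt (real n) / (2 * M ^ 3) * sqrt (real n)" by (intro mult_right_mono x) simp
        also have "\<dots> = real n / (2 * M ^ 3)" by simp
        finally show "z * real CARD('r) \<le> real n / (2 * M ^ 3)" .
      qed simp
      moreover have "real n * ((norm y)\<^sup>2 / M ^ 3) - (real n / (2 * M ^ 3)) * (norm y)\<^sup>2 = f0 * real n * (norm y)\<^sup>2"
        using M1 by (simp add: f0_def field_simps)
      ultimately show "f0 * real n * (norm y)\<^sup>2 \<le> (\<Sum>i=1..n. (factor D i \<omega> \<bullet> y)\<^sup>2)" by (rule gen)
    qed
  qed simp
qed


text \<open>The columns \<open>1..2p\<close> collect the errors of the design and those of the ideal knockoffs.\<close>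

definition Eb :: "nat \<Rightarrow> nat \<Rightarrow> 'w \<Rightarrow> real" where
  "Eb i j \<omega> = (if j \<le> p then error D i j \<omega> else e \<eta>0 (seed D i (j - p) \<omega>))"

lemma Eb_cases:
  assumes "j \<in> {1..2*p}"
  obtains "j \<in> {1..p}" "\<And>i. Eb i j = error D i j"
    | "j - p \<in> {1..p}" "\<not> j \<le> p" "\<And>i. Eb i j = (\<lambda>\<omega>. e \<eta>0 (seed D i (j - p) \<omega>))"
proof (cases "j \<le> p")
  case True
  then show thesis using assms by (intro that(1)) (auto simp: Eb_def fun_eq_iff)
next
  case False
  moreover from this have "j - p \<in> {1..p}" using assms unfolding atLeastAtMost_iff by linarith
  ultimately show thesis by (intro that(2)) (auto simp: Eb_def fun_eq_iff)
qed

lemma error_column_info: "j \<in> {1..p} \<Longrightarrow> (\<lambda>\<omega>. \<lambda>i\<in>{1..n}. error D i j \<omega>) \<in> measurable (info {2}) (Pi\<^sub>M {1..n} (\<lambda>_. borel))"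
  by (intro measurable_restrict error_info) auto

lemma seed_column_info: "j \<in> {1..p} \<Longrightarrow> (\<lambda>\<omega>. \<lambda>i\<in>{1..n}. e \<eta>0 (seed D i j \<omega>)) \<in> measurable (info {3}) (Pi\<^sub>M {1..n} (\<lambda>_. borel))"
  by (intro measurable_restrict measurable_compose[OF seed_info e_measurable[OF \<eta>0]]) auto

lemma inner_measurable: "(\<lambda>x::real^'r. x \<bullet> y) \<in> borel_measurable borel"
  by (intro borel_measurable_continuous_onI continuous_intros)

lemma signal_column_info: "(\<lambda>\<omega>. \<lambda>i\<in>{1..n}. factor D i \<omega> \<bullet> loading D j) \<in> measurable (info {1}) (Pi\<^sub>M {1..n} (\<lambda>_. borel))"
  by (intro measurable_restrict measurable_compose[OF factor_info inner_measurable]) auto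

lemma Eb_weighted_tail:
  assumes j: "j \<in> {1..2*p}" and V: "V > 0"
    and ind: "indep_var (Pi\<^sub>M {1..n} (\<lambda>_. borel)) (\<lambda>\<omega>. \<lambda>i\<in>{1..n}. a i \<omega>) (Pi\<^sub>M {1..n} (\<lambda>_. borel)) (\<lambda>\<omega>. \<lambda>i\<in>{1..n}. Eb i j \<omega>)"
  shows "holds_except (Pr D) (tail x)
    (\<lambda>\<omega>. (\<Sum>i=1..n. (a i \<omega>)\<^sup>2) \<le> V \<longrightarrow> \<bar>\<Sum>i=1..n. a i \<omega> * Eb i j \<omega>\<bar> \<le> x * sqrt V)"
  using j
proof (cases rule: Eb_cases)
  case 1
  show ?thesis using EA.weighted_column_tail[OF 1(1) V, of a x] ind by (simp add: 1(2) tail_def)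
next
  case 2
  show ?thesis using SA.weighted_column_tail[OF 2(1) V, of a x] ind by (simp add: 2(3) tail_def)
qed

lemma Eb_square_tail:
  assumes j: "j \<in> {1..2*p}" and n: "n > 0"
  shows "holds_except (Pr D) (tail x) (\<lambda>\<omega>. \<bar>(\<Sum>i=1..n. (Eb i j \<omega>)\<^sup>2) - real n * \<sigma>2\<bar> \<le> x * sqrt (real n))"
  using j
proof (cases rule: Eb_cases)
  case 1
  show ?thesis using EA.column_square_tail[OF 1(1), of x] n by (simp add: 1(2) tail_def)
next
  case 2
  show ?thesis using SA.column_square_tail[OF 2(1), of x] n by (simp add: 2(3) tail_def)
qed

lemma Eb_indep:
  assumes "j \<in> {1..2*p}" "l \<in> {1..2*p}" "j \<noteq> l"
  shows "indep_var (Pi\<^sub>M {1..n} (\<lambda>_. borel)) (\<lambda>\<omega>. \<lambda>i\<in>{1..n}. Eb i j \<omega>) (Pi\<^sub>M {1..n} (\<lambda>_. borel)) (\<lambda>\<omega>. \<lambda>i\<in>{1..n}. Eb i l \<omega>)"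
  using assms(1)
proof (cases rule: Eb_cases)
  case j: 1
  show ?thesis
    using assms(2)
  proof (cases rule: Eb_cases)
    case l: 1
    show ?thesis unfolding j(2) l(2) by (rule EA.indep_columns[OF j(1) l(1) assms(3)])
  next
    case l: 2
    show ?thesis unfolding j(2) l(3)
      by (rule indep_info[OF _ _ _ error_column_info[OF j(1)] seed_column_info[OF l(1)]]) auto
  qed
next
  case j: 2
  show ?thesis
    using assms(2)
  proof (cases rule: Eb_cases)
    case l: 1
    show ?thesis unfolding j(3) l(2)
      by (rule indep_info[OF _ _ _ seed_column_info[OF j(1)] error_column_info[OF l(1)]]) auto
  next
    case l: 2
    have "j - p \<noteq> l - p" using j(2) l(2) assms(3) by arith
    then show ?thesis unfolding j(3) l(3) by (rule SA.indep_columns[OF j(1) l(1)])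
  qed
qed

text \<open>Off the diagonal one column supplies the random weights for the other. The weighted tail
  presupposes that the squared length of the first is at most V, which the diagonal bound provides
  on the same event.\<close>

lemma Eb_gram:
  assumes n: "n > 0" and x: "0 \<le> x" "x \<le> sqrt (real n)"
  shows "holds_except (Pr D) (real (2*p) * tail x + real (2*p) * (real (2*p) * tail x))
    (\<lambda>\<omega>. \<forall>j\<in>{1..2*p}. \<forall>l\<in>{1..2*p}.
      \<bar>(\<Sum>i=1..n. Eb i j \<omega> * Eb i l \<omega>) - (if j = l then real n * \<sigma>2 else 0)\<bar> \<le> x * (\<sigma>2 + 1) * sqrt (real n))"
proof -
  define V where "V = real n * (\<sigma>2 + 1)"
  have V: "V > 0" using n \<sigma>2_pos by (simp add: V_def)
  have "holds_except (Pr D) (real (card {1..2*p}) * tail x)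
      (\<lambda>\<omega>. \<forall>j\<in>{1..2*p}. \<bar>(\<Sum>i=1..n. (Eb i j \<omega>)\<^sup>2) - real n * \<sigma>2\<bar> \<le> x * sqrt (real n))"
    by (intro holds_except_ball Eb_square_tail n) auto
  moreover have "holds_except (Pr D) (real (card {1..2*p}) * (real (card {1..2*p}) * tail x))
      (\<lambda>\<omega>. \<forall>j\<in>{1..2*p}. \<forall>l\<in>{1..2*p}. j \<noteq> l \<longrightarrow> (\<Sum>i=1..n. (Eb i j \<omega>)\<^sup>2) \<le> V \<longrightarrow> \<bar>\<Sum>i=1..n. Eb i j \<omega> * Eb i l \<omega>\<bar> \<le> x * sqrt V)"
  proof (intro holds_except_ball)
    fix j l assume jl: "j \<in> {1..2*p}" "l \<in> {1..2*p}"
    show "holds_except (Pr D) (tail x) (\<lambda>\<omega>. j \<noteq> l \<longrightarrow> (\<Sum>i=1..n. (Eb i j \<omega>)\<^sup>2) \<le> V \<longrightarrow> \<bar>\<Sum>i=1..n. Eb i j \<omega> * Eb i l \<omega>\<bar> \<le> x * sqrt V)"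
    proof (cases "j = l")
      case True
      then show ?thesis using tail_nonneg unfolding holds_except_def by (intro bexI[of _ "{}"]) auto
    next
      case False
      show ?thesis by (rule holds_except_mono[OF Eb_weighted_tail[OF jl(2) V Eb_indep[OF jl False]]]) auto
    qed
  qed auto
  ultimately have "holds_except (Pr D) (real (card {1..2*p}) * tail x + real (card {1..2*p}) * (real (card {1..2*p}) * tail x))
      (\<lambda>\<omega>. (\<forall>j\<in>{1..2*p}. \<bar>(\<Sum>i=1..n. (Eb i j \<omega>)\<^sup>2) - real n * \<sigma>2\<bar> \<le> x * sqrt (real n)) \<and>
        (\<forall>j\<in>{1..2*p}. \<forall>l\<in>{1..2*p}. j \<noteq> l \<longrightarrow> (\<Sum>i=1..n. (Eb i j \<omega>)\<^sup>2) \<le> V \<longrightarrow> \<bar>\<Sum>i=1..n. Eb i j \<omega> * Eb i l \<omega>\<bar> \<le> x * sqrt V))"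
    by (rule holds_except_conj)
  then show ?thesis
  proof (rule holds_except_mono)
    fix \<omega>
    assume A: "(\<forall>j\<in>{1..2*p}. \<bar>(\<Sum>i=1..n. (Eb i j \<omega>)\<^sup>2) - real n * \<sigma>2\<bar> \<le> x * sqrt (real n)) \<and>
        (\<forall>j\<in>{1..2*p}. \<forall>l\<in>{1..2*p}. j \<noteq> l \<longrightarrow> (\<Sum>i=1..n. (Eb i j \<omega>)\<^sup>2) \<le> V \<longrightarrow> \<bar>\<Sum>i=1..n. Eb i j \<omega> * Eb i l \<omega>\<bar> \<le> x * sqrt V)"
    have xn: "x * sqrt (real n) \<le> real n" using mult_right_mono[OF x(2), of "sqrt (real n)"] by simp
    have s1: "sqrt (\<sigma>2 + 1) \<le> \<sigma>2 + 1" using \<sigma>2_pos by (intro real_le_lsqrt) (auto simp: power2_eq_square algebra_simps)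
    have xs: "x * sqrt (real n) \<le> x * (\<sigma>2 + 1) * sqrt (real n)"
      using x(1) \<sigma>2_pos by (intro mult_right_mono) (auto simp: algebra_simps)
    have xV: "x * sqrt V \<le> x * (\<sigma>2 + 1) * sqrt (real n)"
      using mult_left_mono[OF mult_right_mono[OF s1, of "sqrt (real n)"] x(1)] by (simp add: V_def real_sqrt_mult mult_ac)
    show "\<forall>j\<in>{1..2*p}. \<forall>l\<in>{1..2*p}.
      \<bar>(\<Sum>i=1..n. Eb i j \<omega> * Eb i l \<omega>) - (if j = l then real n * \<sigma>2 else 0)\<bar> \<le> x * (\<sigma>2 + 1) * sqrt (real n)"
    proof (intro ballI)
      fix j l assume jl: "j \<in> {1..2*p}" "l \<in> {1..2*p}"
      have sq: "\<bar>(\<Sum>i=1..n. (Eb i j \<omega>)\<^sup>2) - real n * \<sigma>2\<bar> \<le> x * sqrt (real n)" using A jl by blast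
      show "\<bar>(\<Sum>i=1..n. Eb i j \<omega> * Eb i l \<omega>) - (if j = l then real n * \<sigma>2 else 0)\<bar> \<le> x * (\<sigma>2 + 1) * sqrt (real n)"
      proof (cases "j = l")
        case True
        then show ?thesis using order.trans[OF sq xs] by (simp add: power2_eq_square)
      next
        case False
        have "(\<Sum>i=1..n. (Eb i j \<omega>)\<^sup>2) \<le> V" using sq xn unfolding V_def distrib_left by linarith
        then have "\<bar>\<Sum>i=1..n. Eb i j \<omega> * Eb i l \<omega>\<bar> \<le> x * sqrt V" using A jl False by blast
        then show ?thesis using xV False by simp
      qed
    qed
  qed simp
qed

lemma bd_pos: "bd > 0"
  using M1 by (simp add: bd_def)

lemma signal_entry_le:
  assumes "\<forall>i\<in>{1..n}. \<forall>a. \<bar>factor D i \<omega> $ a\<bar> \<le> M" "i \<in> {1..n}" "j \<in> {1..p}"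
  shows "(factor D i \<omega> \<bullet> loading D j)\<^sup>2 \<le> bd\<^sup>2"
proof -
  have "(factor D i \<omega> \<bullet> loading D j)\<^sup>2 \<le> (norm (factor D i \<omega>))\<^sup>2 * (norm (loading D j))\<^sup>2"
    using Cauchy_Schwarz_ineq[of "factor D i \<omega>" "loading D j"] by (simp add: power2_norm_eq_inner)
  also have "\<dots> \<le> bd * bd"
    using norm_square_le_b[of "factor D i \<omega>"] loading_bounded[OF assms(3)] assms(1,2) bd_pos by (intro mult_mono) auto
  finally show ?thesis by (simp add: power2_eq_square)
qed

text \<open>The signal columns are bounded almost surely and come from the factors alone, so they
  are admissible weights of squared length n bd^2 for both kinds of error columns.\<close>

lemma Eb_cross:
  assumes n: "n > 0"
  shows "holds_except (Pr D) (real p * (real (2*p) * tail x))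
    (\<lambda>\<omega>. \<forall>j\<in>{1..p}. \<forall>l\<in>{1..2*p}. \<bar>\<Sum>i=1..n. (factor D i \<omega> \<bullet> loading D j) * Eb i l \<omega>\<bar> \<le> x * bd * sqrt (real n))"
proof -
  define V where "V = real n * bd\<^sup>2"
  have V: "V > 0" using n bd_pos by (simp add: V_def)
  have "holds_except (Pr D) (real (card {1..p}) * (real (card {1..2*p}) * tail x))
    (\<lambda>\<omega>. \<forall>j\<in>{1..p}. \<forall>l\<in>{1..2*p}. (\<Sum>i=1..n. (factor D i \<omega> \<bullet> loading D j)\<^sup>2) \<le> V \<longrightarrow>
      \<bar>\<Sum>i=1..n. (factor D i \<omega> \<bullet> loading D j) * Eb i l \<omega>\<bar> \<le> x * sqrt V)"
  proof (intro holds_except_ball)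
    fix j l assume jl: "j \<in> {1..p}" "l \<in> {1..2*p}"
    have "indep_var (Pi\<^sub>M {1..n} (\<lambda>_. borel)) (\<lambda>\<omega>. \<lambda>i\<in>{1..n}. factor D i \<omega> \<bullet> loading D j) (Pi\<^sub>M {1..n} (\<lambda>_. borel)) (\<lambda>\<omega>. \<lambda>i\<in>{1..n}. Eb i l \<omega>)"
      using jl(2)
    proof (cases rule: Eb_cases)
      case l: 1
      show ?thesis unfolding l(2) by (rule indep_info[OF _ _ _ signal_column_info error_column_info[OF l(1)]]) auto
    next
      case l: 2
      show ?thesis unfolding l(3) by (rule indep_info[OF _ _ _ signal_column_info seed_column_info[OF l(1)]]) auto
    qed
    then show "holds_except (Pr D) (tail x) (\<lambda>\<omega>. (\<Sum>i=1..n. (factor D i \<omega> \<bullet> loading D j)\<^sup>2) \<le> V \<longrightarrow>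
      \<bar>\<Sum>i=1..n. (factor D i \<omega> \<bullet> loading D j) * Eb i l \<omega>\<bar> \<le> x * sqrt V)"
      by (rule Eb_weighted_tail[OF jl(2) V])
  qed auto
  from holds_except_conj[OF this holds_except_AE[OF factor_bounded]]
  show ?thesis
  proof (rule holds_except_mono)
    fix \<omega>
    assume A: "(\<forall>j\<in>{1..p}. \<forall>l\<in>{1..2*p}. (\<Sum>i=1..n. (factor D i \<omega> \<bullet> loading D j)\<^sup>2) \<le> V \<longrightarrow>
      \<bar>\<Sum>i=1..n. (factor D i \<omega> \<bullet> loading D j) * Eb i l \<omega>\<bar> \<le> x * sqrt V) \<and> (\<forall>i\<in>{1..n}. \<forall>a. \<bar>factor D i \<omega> $ a\<bar> \<le> M)"
    have sV: "sqrt V = bd * sqrt (real n)" using bd_pos by (simp add: V_def real_sqrt_mult)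
    show "\<forall>j\<in>{1..p}. \<forall>l\<in>{1..2*p}. \<bar>\<Sum>i=1..n. (factor D i \<omega> \<bullet> loading D j) * Eb i l \<omega>\<bar> \<le> x * bd * sqrt (real n)"
    proof (intro ballI)
      fix j l assume jl: "j \<in> {1..p}" "l \<in> {1..2*p}"
      have "(\<Sum>i=1..n. (factor D i \<omega> \<bullet> loading D j)\<^sup>2) \<le> (\<Sum>i=1..n. bd\<^sup>2)"
        by (intro sum_mono signal_entry_le) (use A jl in auto)
      then have "(\<Sum>i=1..n. (factor D i \<omega> \<bullet> loading D j)\<^sup>2) \<le> V" by (simp add: V_def)
      then have "\<bar>\<Sum>i=1..n. (factor D i \<omega> \<bullet> loading D j) * Eb i l \<omega>\<bar> \<le> x * sqrt V" using A jl by blast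
      then show "\<bar>\<Sum>i=1..n. (factor D i \<omega> \<bullet> loading D j) * Eb i l \<omega>\<bar> \<le> x * bd * sqrt (real n)"
        by (simp add: sV mult.assoc)
    qed
  qed simp
qed

sublocale EAt: noise_array "Pr D" "\<lambda>j i. error D i j" "{1..p}" "{1..n}" \<alpha> exp_bound \<sigma>2 by (rule EA.transposed)

text \<open>A constant factor is all that is wanted, so the deviation may be as large as p itself;
  the resulting tail in sqrt p is strong enough for a union over the n rows.\<close>

lemma error_rows:
  assumes p: "p > 0"
  shows "holds_except (Pr D) (real n * tail (sqrt (real p)))
    (\<lambda>\<omega>. \<forall>i\<in>{1..n}. (\<Sum>j=1..p. (error D i j \<omega>)\<^sup>2) \<le> real p * (\<sigma>2 + 1))"
proof -
  have "holds_except (Pr D) (real (card {1..n}) * tail (sqrt (real p)))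
    (\<lambda>\<omega>. \<forall>i\<in>{1..n}. \<bar>(\<Sum>j=1..p. (error D i j \<omega>)\<^sup>2) - real p * \<sigma>2\<bar> \<le> sqrt (real p) * sqrt (real p))"
    using EAt.column_square_tail[of _ "sqrt (real p)"] p by (intro holds_except_ball) (auto simp: tail_def)
  then show ?thesis
  proof (rule holds_except_mono)
    fix \<omega> assume A: "\<forall>i\<in>{1..n}. \<bar>(\<Sum>j=1..p. (error D i j \<omega>)\<^sup>2) - real p * \<sigma>2\<bar> \<le> sqrt (real p) * sqrt (real p)"
    show "\<forall>i\<in>{1..n}. (\<Sum>j=1..p. (error D i j \<omega>)\<^sup>2) \<le> real p * (\<sigma>2 + 1)"
    proof
      fix i assume "i \<in> {1..n}"
      then have "\<bar>(\<Sum>j=1..p. (error D i j \<omega>)\<^sup>2) - real p * \<sigma>2\<bar> \<le> real p" using A by simp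
      then show "(\<Sum>j=1..p. (error D i j \<omega>)\<^sup>2) \<le> real p * (\<sigma>2 + 1)" unfolding distrib_left by linarith
    qed
  qed simp
qed

text \<open>Dominates the second-moment constants of all the Markov bounds, so that one pair of
  \<delta> and \<open>H\<close> serves them all.\<close>

definition "KM = EA.K + \<sigma>2 * bd + (\<Sum>k\<le>m. fact k / \<alpha> ^ k * exp_bound)"

lemma KM_bounds:
  "EA.K \<le> KM" "\<sigma>2 * bd \<le> KM" "k \<le> m \<Longrightarrow> fact k / \<alpha> ^ k * exp_bound \<le> KM" "KM \<ge> 0"
proof -
  have f: "0 \<le> fact k / \<alpha> ^ k * exp_bound" for k using \<alpha>_pos exp_bound_ge by simp
  have sb: "0 \<le> \<sigma>2 * bd" using \<sigma>2_pos bd_pos by simp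
  have s: "0 \<le> (\<Sum>k\<le>m. fact k / \<alpha> ^ k * exp_bound)" by (intro sum_nonneg f)
  show "EA.K \<le> KM" "\<sigma>2 * bd \<le> KM" "KM \<ge> 0" using sb s EA.K0 by (auto simp: KM_def)
  assume k: "k \<le> m"
  have "fact k / \<alpha> ^ k * exp_bound \<le> (\<Sum>k\<le>m. fact k / \<alpha> ^ k * exp_bound)"
    by (rule member_le_sum) (use k f in auto)
  then show "fact k / \<alpha> ^ k * exp_bound \<le> KM" using sb EA.K0 by (simp add: KM_def)
qed

lemma Markov_bound:
  assumes X: "X \<in> borel_measurable (Pr D)" "\<And>\<omega>. X \<omega> \<ge> 0"
    and int: "(\<integral>\<^sup>+\<omega>. ennreal (X \<omega>) \<partial>Pr D) \<le> ennreal (K * N)" and K: "0 \<le> K" "K \<le> KM"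
    and N: "N > 0" and \<delta>: "\<delta> > 0" and H: "H > 0" "KM \<le> \<delta> * H"
  shows "holds_except (Pr D) \<delta> (\<lambda>\<omega>. X \<omega> \<le> H * N)"
proof (rule holds_except_Markov[OF X int])
  have "K * N \<le> \<delta> * H * N" using K H N by (intro mult_right_mono) auto
  then show "K * N \<le> \<delta> * (H * N)" by (simp add: mult.assoc)
qed (use K N H \<delta> in auto)

context
  fixes \<delta> H :: real
  assumes np: "n > 0" "p > 0" and \<delta>: "\<delta> > 0" and H: "H > 0" "KM \<le> \<delta> * H"
begin

lemma error_gram_Markov:
  "holds_except (Pr D) \<delta> (\<lambda>\<omega>. (\<Sum>j=1..p. \<Sum>l=1..p. ((\<Sum>i=1..n. error D i j \<omega> * error D i l \<omega>)
    - (if j = l then real n * \<sigma>2 else 0))\<^sup>2) \<le> H * (real n * (real p)\<^sup>2))"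
proof (rule Markov_bound)
  show "(\<integral>\<^sup>+\<omega>. ennreal (\<Sum>j=1..p. \<Sum>l=1..p. ((\<Sum>i=1..n. error D i j \<omega> * error D i l \<omega>)
      - (if j = l then real n * \<sigma>2 else 0))\<^sup>2) \<partial>Pr D) \<le> ennreal (EA.K * (real n * (real p)\<^sup>2))"
    using EA.gram_second_moment by (simp add: mult.assoc cong: if_cong)
qed (use np \<delta> H KM_bounds EA.K0 EA.rv in \<open>auto intro!: sum_nonneg\<close>)

lemma error_gram_Markov':
  "holds_except (Pr D) \<delta> (\<lambda>\<omega>. (\<Sum>i=1..n. \<Sum>l=1..n. ((\<Sum>j=1..p. error D i j \<omega> * error D l j \<omega>)
    - (if i = l then real p * \<sigma>2 else 0))\<^sup>2) \<le> H * (real p * (real n)\<^sup>2))"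
proof (rule Markov_bound)
  show "(\<integral>\<^sup>+\<omega>. ennreal (\<Sum>i=1..n. \<Sum>l=1..n. ((\<Sum>j=1..p. error D i j \<omega> * error D l j \<omega>)
      - (if i = l then real p * \<sigma>2 else 0))\<^sup>2) \<partial>Pr D) \<le> ennreal (EA.K * (real p * (real n)\<^sup>2))"
    using EAt.gram_second_moment by (simp add: mult.assoc cong: if_cong)
qed (use np \<delta> H KM_bounds EA.K0 EA.rv in \<open>auto intro!: sum_nonneg\<close>)

lemma error_loading_Markov:
  "holds_except (Pr D) \<delta> (\<lambda>\<omega>. (\<Sum>i=1..n. (norm (\<Sum>j=1..p. error D i j \<omega> *\<^sub>R loading D j))\<^sup>2) \<le> H * (real n * real p))"
proof (rule Markov_bound)
  have eq: "(\<Sum>i=1..n. (norm (\<Sum>j=1..p. error D i j \<omega> *\<^sub>R loading D j))\<^sup>2)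
      = (\<Sum>i=1..n. \<Sum>a\<in>UNIV. (\<Sum>j=1..p. loading D j $ a * error D i j \<omega>)\<^sup>2)" for \<omega>
    by (simp add: norm_vec_square mult.commute)
  show meas: "(\<lambda>\<omega>. \<Sum>i=1..n. (norm (\<Sum>j=1..p. error D i j \<omega> *\<^sub>R loading D j))\<^sup>2) \<in> borel_measurable (Pr D)"
    unfolding eq using EA.rv by (intro borel_measurable_sum borel_measurable_power borel_measurable_times borel_measurable_const) auto
  have "(\<integral>\<^sup>+\<omega>. ennreal (\<Sum>i=1..n. (norm (\<Sum>j=1..p. error D i j \<omega> *\<^sub>R loading D j))\<^sup>2) \<partial>Pr D)
      = (\<integral>\<^sup>+\<omega>. (\<Sum>i=1..n. \<Sum>a\<in>UNIV. ennreal ((\<Sum>j=1..p. loading D j $ a * error D i j \<omega>)\<^sup>2)) \<partial>Pr D)"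
    unfolding eq by (simp add: sum_nonneg)
  also have "\<dots> = (\<Sum>i=1..n. \<Sum>a\<in>UNIV. (\<integral>\<^sup>+\<omega>. ennreal ((\<Sum>j=1..p. loading D j $ a * error D i j \<omega>)\<^sup>2) \<partial>Pr D))"
    using EA.rv by (subst nn_integral_sum; (intro sum.cong refl nn_integral_sum)?) (auto simp del: sum_ennreal)
  also have "\<dots> \<le> (\<Sum>i=1..n. \<Sum>a\<in>(UNIV::'r set). ennreal (\<sigma>2 * (\<Sum>j=1..p. (loading D j $ a)\<^sup>2)))"
  proof (intro sum_mono)
    fix i a assume i: "i \<in> {1..n}"
    show "(\<integral>\<^sup>+\<omega>. ennreal ((\<Sum>j=1..p. loading D j $ a * error D i j \<omega>)\<^sup>2) \<partial>Pr D) \<le> ennreal (\<sigma>2 * (\<Sum>j=1..p. (loading D j $ a)\<^sup>2))"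
      using EAt.fixed_weights_second_moment[OF i, of "\<lambda>j. loading D j $ a"] \<sigma>2_pos by simp
  qed
  also have "\<dots> = ennreal (\<Sum>i=1..n. \<Sum>a\<in>(UNIV::'r set). \<sigma>2 * (\<Sum>j=1..p. (loading D j $ a)\<^sup>2))"
    using \<sigma>2_pos by (simp add: sum_nonneg ennreal_of_nat_eq_real_of_nat flip: ennreal_mult)
  also have "\<dots> \<le> ennreal (\<sigma>2 * bd * (real n * real p))"
  proof (rule ennreal_leI)
    have "(\<Sum>a\<in>(UNIV::'r set). \<Sum>j=1..p. (loading D j $ a)\<^sup>2) = (\<Sum>j=1..p. (norm (loading D j))\<^sup>2)"
      unfolding norm_vec_square by (rule sum.swap)
    also have "\<dots> \<le> (\<Sum>j=1..p. bd)" by (intro sum_mono loading_bounded)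
    finally have "\<sigma>2 * (\<Sum>a\<in>(UNIV::'r set). \<Sum>j=1..p. (loading D j $ a)\<^sup>2) \<le> \<sigma>2 * (real p * bd)"
      using \<sigma>2_pos by (intro mult_left_mono) auto
    then have "(\<Sum>i=1..n. \<sigma>2 * (\<Sum>a\<in>(UNIV::'r set). \<Sum>j=1..p. (loading D j $ a)\<^sup>2)) \<le> (\<Sum>i=1..n. \<sigma>2 * (real p * bd))"
      by (rule sum_mono)
    then show "(\<Sum>i=1..n. \<Sum>a\<in>(UNIV::'r set). \<sigma>2 * (\<Sum>j=1..p. (loading D j $ a)\<^sup>2)) \<le> \<sigma>2 * bd * (real n * real p)"
      by (simp add: sum_distrib_left mult_ac)
  qed
  finally show "(\<integral>\<^sup>+\<omega>. ennreal (\<Sum>i=1..n. (norm (\<Sum>j=1..p. error D i j \<omega> *\<^sub>R loading D j))\<^sup>2) \<partial>Pr D) \<le> ennreal (\<sigma>2 * bd * (real n * real p))" .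
qed (use np \<delta> H KM_bounds \<sigma>2_pos bd_pos in \<open>auto intro!: sum_nonneg\<close>)

lemma factor_second_moment:
  assumes i: "i \<in> {1..n}"
  shows "(\<integral>\<^sup>+\<omega>. ennreal ((factor D i \<omega> $ a)\<^sup>2) \<partial>Pr D) \<le> ennreal (M\<^sup>2)"
proof -
  have "AE \<omega> in Pr D. ennreal ((factor D i \<omega> $ a)\<^sup>2) \<le> ennreal (M\<^sup>2)"
    using factor_bounded
  proof eventually_elim
    case (elim \<omega>)
    then have "\<bar>factor D i \<omega> $ a\<bar>\<^sup>2 \<le> M\<^sup>2" using i by (intro power_mono) auto
    then show ?case by (simp add: ennreal_leI)
  qed
  then have "(\<integral>\<^sup>+\<omega>. ennreal ((factor D i \<omega> $ a)\<^sup>2) \<partial>Pr D) \<le> (\<integral>\<^sup>+\<omega>. ennreal (M\<^sup>2) \<partial>Pr D)"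
    by (rule nn_integral_mono_AE)
  then show ?thesis by (simp add: emeasure_space_1)
qed

lemma error_factor_Markov:
  "holds_except (Pr D) \<delta> (\<lambda>\<omega>. (\<Sum>j=1..p. (norm (\<Sum>i=1..n. error D i j \<omega> *\<^sub>R factor D i \<omega>))\<^sup>2) \<le> H * (real n * real p))"
proof (rule Markov_bound)
  have eq: "(\<Sum>j=1..p. (norm (\<Sum>i=1..n. error D i j \<omega> *\<^sub>R factor D i \<omega>))\<^sup>2)
      = (\<Sum>j=1..p. \<Sum>a\<in>UNIV. (\<Sum>i=1..n. factor D i \<omega> $ a * error D i j \<omega>)\<^sup>2)" for \<omega>
    by (simp add: norm_vec_square mult.commute)
  show "(\<lambda>\<omega>. \<Sum>j=1..p. (norm (\<Sum>i=1..n. error D i j \<omega> *\<^sub>R factor D i \<omega>))\<^sup>2) \<in> borel_measurable (Pr D)"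
    unfolding eq using EA.rv factor_component_rv by (intro borel_measurable_sum borel_measurable_power borel_measurable_times) auto
  have "(\<integral>\<^sup>+\<omega>. ennreal (\<Sum>j=1..p. (norm (\<Sum>i=1..n. error D i j \<omega> *\<^sub>R factor D i \<omega>))\<^sup>2) \<partial>Pr D)
      = (\<integral>\<^sup>+\<omega>. (\<Sum>j=1..p. \<Sum>a\<in>UNIV. ennreal ((\<Sum>i=1..n. factor D i \<omega> $ a * error D i j \<omega>)\<^sup>2)) \<partial>Pr D)"
    unfolding eq by (simp add: sum_nonneg)
  also have "\<dots> = (\<Sum>j=1..p. \<Sum>a\<in>UNIV. (\<integral>\<^sup>+\<omega>. ennreal ((\<Sum>i=1..n. factor D i \<omega> $ a * error D i j \<omega>)\<^sup>2) \<partial>Pr D))"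
    using EA.rv factor_component_rv
    by (subst nn_integral_sum; (intro sum.cong refl nn_integral_sum)?) (auto simp del: sum_ennreal)
  also have "\<dots> \<le> (\<Sum>j=1..p. \<Sum>a\<in>(UNIV::'r set). ennreal (\<sigma>2 * M\<^sup>2 * real n))"
  proof (intro sum_mono)
    fix j and a :: 'r assume j: "j \<in> {1..p}"
    have "(\<lambda>\<omega>. \<lambda>i\<in>{1..n}. factor D i \<omega> $ a) \<in> measurable (info {1}) (Pi\<^sub>M {1..n} (\<lambda>_. borel))"
      by (intro measurable_restrict measurable_compose[OF factor_info vec_nth_measurable]) auto
    note fm = this
    have "indep_var (Pi\<^sub>M {1..n} (\<lambda>_. borel)) (\<lambda>\<omega>. \<lambda>i\<in>{1..n}. factor D i \<omega> $ a) (Pi\<^sub>M {1..n} (\<lambda>_. borel)) (\<lambda>\<omega>. \<lambda>i\<in>{1..n}. error D i j \<omega>)"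
      by (rule indep_info[OF _ _ _ fm error_column_info[OF j]]) auto
    then show "(\<integral>\<^sup>+\<omega>. ennreal ((\<Sum>i=1..n. factor D i \<omega> $ a * error D i j \<omega>)\<^sup>2) \<partial>Pr D) \<le> ennreal (\<sigma>2 * M\<^sup>2 * real n)"
      using EA.weighted_column_second_moment[OF j _ factor_second_moment] \<sigma>2_pos by simp
  qed
  also have "\<dots> = ennreal (\<sigma>2 * bd * (real n * real p))"
    using \<sigma>2_pos by (simp add: bd_def ennreal_of_nat_eq_real_of_nat mult_ac flip: ennreal_mult)
  finally show "(\<integral>\<^sup>+\<omega>. ennreal (\<Sum>j=1..p. (norm (\<Sum>i=1..n. error D i j \<omega> *\<^sub>R factor D i \<omega>))\<^sup>2) \<partial>Pr D) \<le> ennreal (\<sigma>2 * bd * (real n * real p))" .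
qed (use np \<delta> H KM_bounds \<sigma>2_pos bd_pos in \<open>auto intro!: sum_nonneg\<close>)

lemma error_power_mean:
  assumes "i \<in> {1..n}" "j \<in> {1..p}"
  shows "expectation (\<lambda>\<omega>. error D i j \<omega> ^ k) = (\<integral>b. e \<eta>0 b ^ k \<partial>Q)"
proof -
  have "expectation (\<lambda>\<omega>. error D i j \<omega> ^ k) = (\<integral>y. y ^ k \<partial>distr (Pr D) borel (error D i j))"
    using EA.rv[OF assms] by (subst integral_distr) auto
  also have "\<dots> = (\<integral>b. e \<eta>0 b ^ k \<partial>Q)"
    unfolding error_distr[OF assms] using e_measurable[OF \<eta>0] by (subst integral_distr) auto
  finally show ?thesis .
qed

lemma error_moment_Markov:
  assumes k: "k \<in> {1..m}"
  shows "holds_except (Pr D) \<delta> (\<lambda>\<omega>. (\<Sum>i=1..n. \<Sum>j=1..p. error D i j \<omega> ^ k - moments m Q (e \<eta>0) k)\<^sup>2 \<le> H * (real n * real p))"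
proof (rule Markov_bound)
  show "(\<integral>\<^sup>+\<omega>. ennreal ((\<Sum>i=1..n. \<Sum>j=1..p. error D i j \<omega> ^ k - moments m Q (e \<eta>0) k)\<^sup>2) \<partial>Pr D)
      \<le> ennreal (fact k / \<alpha> ^ k * exp_bound * (real n * real p))"
    using EA.power_sum_second_moment[of k "moments m Q (e \<eta>0) k"] error_power_mean k by (simp add: moments_def)
qed (use np \<delta> H KM_bounds k \<alpha>_pos exp_bound_ge EA.rv in auto)

lemma error_power_Markov:
  assumes k: "k \<le> m"
  shows "holds_except (Pr D) \<delta> (\<lambda>\<omega>. (\<Sum>i=1..n. \<Sum>j=1..p. (error D i j \<omega> ^ k)\<^sup>2) \<le> H * (real n * real p))"
proof (rule Markov_bound)
  show "(\<integral>\<^sup>+\<omega>. ennreal (\<Sum>i=1..n. \<Sum>j=1..p. (error D i j \<omega> ^ k)\<^sup>2) \<partial>Pr D)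
      \<le> ennreal (fact k / \<alpha> ^ k * exp_bound * (real n * real p))"
    using EA.even_power_sum_moment[of k] by simp
qed (use np \<delta> H KM_bounds k \<alpha>_pos exp_bound_ge EA.rv in \<open>auto intro!: sum_nonneg\<close>)

end

text \<open>Uniform over the ball because the estimated parameter is random and data-dependent. A
  single envelope \<open>Z\<close> reduces the bound to the column sums of Z^2, at most n (exp_bound
  / \<alpha> + 1).\<close>

lemma knockoff_perturbation:
  assumes np: "n > 0" "p > 0" and x: "x \<le> sqrt (real n)"
  shows "holds_except (Pr D) (real p * tail x)
    (\<lambda>\<omega>. \<forall>\<eta>\<in>eta_ball m \<eta>0 (M * cnp D). \<forall>j\<in>{1..p}.
      (\<Sum>i=1..n. (e \<eta> (seed D i j \<omega>) - e \<eta>0 (seed D i j \<omega>))\<^sup>2) \<le> real n * (M * cnp D * (exp_bound / \<alpha> + 1)))"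
proof -
  obtain Z where Z: "subG Q (ce\<^sup>2) Z"
    and env: "AE b in Q. \<forall>\<eta>\<in>eta_ball m \<eta>0 (M * cnp D). \<bar>e \<eta> b - e \<eta>0 b\<bar> \<le> sqrt M * sqrt (cnp D) * \<bar>Z b\<bar>"
    using error_cond by (auto simp: error_condition_def)
  interpret ZA: noise_array "Pr D" "\<lambda>i j \<omega>. Z (seed D i j \<omega>)" "{1..n}" "{1..p}" \<alpha> exp_bound "\<integral>b. (Z b)\<^sup>2 \<partial>Q"
    by (rule seed_array[OF C_pos(3) Z]) simp
  define z2 where "z2 = (\<integral>b. (Z b)\<^sup>2 \<partial>Q)"
  have "\<alpha> * z2 \<le> exp_bound" unfolding z2_def by (rule ZA.s2_bounds(2)[of 1 1]) (use np in auto)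
  then have z2: "z2 \<le> exp_bound / \<alpha>" using \<alpha>_pos by (simp add: field_simps)
  have AEij: "AE \<omega> in Pr D. \<forall>\<eta>\<in>eta_ball m \<eta>0 (M * cnp D).
      \<bar>e \<eta> (seed D i j \<omega>) - e \<eta>0 (seed D i j \<omega>)\<bar> \<le> sqrt M * sqrt (cnp D) * \<bar>Z (seed D i j \<omega>)\<bar>"
    if "i \<in> {1..n}" "j \<in> {1..p}" for i j
  proof (rule AE_distrD[OF seed_rv[OF that]])
    show "AE b in distr (Pr D) Q (seed D i j). \<forall>\<eta>\<in>eta_ball m \<eta>0 (M * cnp D). \<bar>e \<eta> b - e \<eta>0 b\<bar> \<le> sqrt M * sqrt (cnp D) * \<bar>Z b\<bar>"
      unfolding seed_distr[OF that] by (rule env)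
  qed
  have "AE \<omega> in Pr D. \<forall>i\<in>{1..n}. \<forall>j\<in>{1..p}. \<forall>\<eta>\<in>eta_ball m \<eta>0 (M * cnp D).
      \<bar>e \<eta> (seed D i j \<omega>) - e \<eta>0 (seed D i j \<omega>)\<bar> \<le> sqrt M * sqrt (cnp D) * \<bar>Z (seed D i j \<omega>)\<bar>"
    by (intro AE_finite_allI[OF finite_atLeastAtMost] AEij)
  from holds_except_AE[OF this]
  have 1: "holds_except (Pr D) 0 (\<lambda>\<omega>. \<forall>i\<in>{1..n}. \<forall>j\<in>{1..p}. \<forall>\<eta>\<in>eta_ball m \<eta>0 (M * cnp D).
      \<bar>e \<eta> (seed D i j \<omega>) - e \<eta>0 (seed D i j \<omega>)\<bar> \<le> sqrt M * sqrt (cnp D) * \<bar>Z (seed D i j \<omega>)\<bar>)" .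
  have 2: "holds_except (Pr D) (real (card {1..p}) * tail x)
      (\<lambda>\<omega>. \<forall>j\<in>{1..p}. \<bar>(\<Sum>i=1..n. (Z (seed D i j \<omega>))\<^sup>2) - real n * z2\<bar> \<le> x * sqrt (real n))"
    using ZA.column_square_tail[of _ x] np by (intro holds_except_ball) (auto simp: tail_def z2_def)
  from holds_except_conj[OF 2 1] show ?thesis
  proof (rule holds_except_mono)
    fix \<omega>
    assume A: "(\<forall>j\<in>{1..p}. \<bar>(\<Sum>i=1..n. (Z (seed D i j \<omega>))\<^sup>2) - real n * z2\<bar> \<le> x * sqrt (real n)) \<and>
      (\<forall>i\<in>{1..n}. \<forall>j\<in>{1..p}. \<forall>\<eta>\<in>eta_ball m \<eta>0 (M * cnp D).
      \<bar>e \<eta> (seed D i j \<omega>) - e \<eta>0 (seed D i j \<omega>)\<bar> \<le> sqrt M * sqrt (cnp D) * \<bar>Z (seed D i j \<omega>)\<bar>)"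
    show "\<forall>\<eta>\<in>eta_ball m \<eta>0 (M * cnp D). \<forall>j\<in>{1..p}.
      (\<Sum>i=1..n. (e \<eta> (seed D i j \<omega>) - e \<eta>0 (seed D i j \<omega>))\<^sup>2) \<le> real n * (M * cnp D * (exp_bound / \<alpha> + 1))"
    proof (intro ballI)
      fix \<eta> j assume \<eta>: "\<eta> \<in> eta_ball m \<eta>0 (M * cnp D)" and j: "j \<in> {1..p}"
      have c0: "0 \<le> M * cnp D" using M1 cnp_nonneg by simp
      have "(\<Sum>i=1..n. (e \<eta> (seed D i j \<omega>) - e \<eta>0 (seed D i j \<omega>))\<^sup>2) \<le> (\<Sum>i=1..n. M * cnp D * (Z (seed D i j \<omega>))\<^sup>2)"
      proof (rule sum_mono)
        fix i assume i: "i \<in> {1..n}"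
        have "\<bar>e \<eta> (seed D i j \<omega>) - e \<eta>0 (seed D i j \<omega>)\<bar>\<^sup>2 \<le> (sqrt M * sqrt (cnp D) * \<bar>Z (seed D i j \<omega>)\<bar>)\<^sup>2"
          using A i j \<eta> by (intro power_mono) auto
        then show "(e \<eta> (seed D i j \<omega>) - e \<eta>0 (seed D i j \<omega>))\<^sup>2 \<le> M * cnp D * (Z (seed D i j \<omega>))\<^sup>2"
          using M1 cnp_nonneg by (simp add: power_mult_distrib)
      qed
      also have "\<dots> = M * cnp D * (\<Sum>i=1..n. (Z (seed D i j \<omega>))\<^sup>2)" by (simp add: sum_distrib_left)
      also have "\<dots> \<le> M * cnp D * (real n * (exp_bound / \<alpha> + 1))"
      proof (rule mult_left_mono[OF _ c0])
        have "x * sqrt (real n) \<le> real n" using mult_right_mono[OF x, of "sqrt (real n)"] by simp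
        moreover have "\<bar>(\<Sum>i=1..n. (Z (seed D i j \<omega>))\<^sup>2) - real n * z2\<bar> \<le> x * sqrt (real n)" using A j by blast
        moreover have "real n * z2 \<le> real n * (exp_bound / \<alpha>)" using z2 by (intro mult_left_mono) auto
        ultimately show "(\<Sum>i=1..n. (Z (seed D i j \<omega>))\<^sup>2) \<le> real n * (exp_bound / \<alpha> + 1)"
          unfolding distrib_left by linarith
      qed
      finally show "(\<Sum>i=1..n. (e \<eta> (seed D i j \<omega>) - e \<eta>0 (seed D i j \<omega>))\<^sup>2) \<le> real n * (M * cnp D * (exp_bound / \<alpha> + 1))"
        by (simp add: mult_ac)
    qed
  qed simp
qed

end

section \<open>A noise-free version of the truncation\<close>

lemma odd_power_measurable:
  assumes "\<And>i j. i \<in> {1..n} \<Longrightarrow> j \<in> {1..p} \<Longrightarrow> (\<lambda>\<omega>. X \<omega> i j) \<in> borel_measurable N"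
  shows "i \<in> {1..n} \<Longrightarrow> j \<in> {1..p} \<Longrightarrow> (\<lambda>\<omega>. odd_power n p (X \<omega>) k i j) \<in> borel_measurable N"
proof (induction k arbitrary: i)
  case 0 then show ?case using assms by simp
next
  case (Suc k)
  show ?case unfolding odd_power.simps
    by (intro borel_measurable_sum borel_measurable_times Suc.IH assms Suc.prems)
qed

context latent_model begin

lemma design_info:
  assumes "i \<in> {1..n}" "j \<in> {1..p}"
  shows "(\<lambda>\<omega>. design D \<omega> i j) \<in> borel_measurable (info {1,2,3})"
  unfolding design_def
  by (intro borel_measurable_add measurable_compose[OF factor_info inner_measurable] error_info) (use assms in auto)

text \<open>A version of the estimated signal matrix that is measurable with respect to the factors, the
  errors and the seeds alone; the selection \<open>Chat\<close> itself could depend on the noise where the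
  truncation is not unique.\<close>

lemma measurable_truncation:
  assumes ab: "0 \<le> lo" "lo < up" "up \<le> hi"
  obtains Ct where "\<And>i j. i \<in> {1..n} \<Longrightarrow> j \<in> {1..p} \<Longrightarrow> (\<lambda>\<omega>. Ct \<omega> i j) \<in> borel_measurable (info {1,2,3})"
    and "\<And>\<omega> U d V r i j. svd n p (design D \<omega>) U d V \<Longrightarrow> r \<le> min n p \<Longrightarrow>
      (\<And>k. k \<in> {1..r} \<Longrightarrow> up \<le> (d k)\<^sup>2 \<and> (d k)\<^sup>2 \<le> hi) \<Longrightarrow> (\<And>k. k \<in> {r+1..min n p} \<Longrightarrow> (d k)\<^sup>2 \<le> lo) \<Longrightarrow>
      i \<in> {1..n} \<Longrightarrow> j \<in> {1..p} \<Longrightarrow> thin_svd.trunc U d V r i j = Ct \<omega> i j"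
proof (rule step_polynomials[OF ab])
  fix c :: "nat \<Rightarrow> nat \<Rightarrow> real" and N :: "nat \<Rightarrow> nat"
  assume cN: "\<And>x. x \<in> {up..hi} \<Longrightarrow> (\<lambda>t. \<Sum>m\<le>N t. c t m * x ^ m) \<longlonglongrightarrow> 1"
    "\<And>x. x \<in> {0..lo} \<Longrightarrow> (\<lambda>t. \<Sum>m\<le>N t. c t m * x ^ m) \<longlonglongrightarrow> 0"
  define Ct where "Ct \<omega> i j = lim (\<lambda>t. \<Sum>m\<le>N t. c t m * odd_power n p (design D \<omega>) m i j)" for \<omega> i j
  show thesis
  proof (rule that[of Ct])
    show "(\<lambda>\<omega>. Ct \<omega> i j) \<in> borel_measurable (info {1,2,3})" if "i \<in> {1..n}" "j \<in> {1..p}" for i j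
      unfolding Ct_def
      by (intro borel_measurable_lim_metric borel_measurable_sum borel_measurable_times borel_measurable_const
          odd_power_measurable design_info that)
    fix \<omega> U d V and r i j :: nat
    assume svd: "svd n p (design D \<omega>) U d V" and r: "r \<le> min n p"
      and upper: "\<And>k. k \<in> {1..r} \<Longrightarrow> up \<le> (d k)\<^sup>2 \<and> (d k)\<^sup>2 \<le> hi"
      and lower: "\<And>k. k \<in> {r+1..min n p} \<Longrightarrow> (d k)\<^sup>2 \<le> lo" and ij: "i \<in> {1..n}" "j \<in> {1..p}"
    interpret T: thin_svd n p "design D \<omega>" U d V by unfold_locales (rule svd)
    have "(\<lambda>t. \<Sum>m\<le>N t. c t m * odd_power n p (design D \<omega>) m i j) \<longlonglongrightarrow> T.trunc r i j"
      by (rule T.spectral_polynomial_tendsto[OF r ij]) (use cN upper lower in auto)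
    then show "T.trunc r i j = Ct \<omega> i j" unfolding Ct_def by (simp add: limI)
  qed
qed

definition aug_design :: "('w \<Rightarrow> nat \<Rightarrow> nat \<Rightarrow> real) \<Rightarrow> 'w \<Rightarrow> nat \<Rightarrow> nat \<Rightarrow> real" where
  "aug_design Ct \<omega> = augment p (design D \<omega>) (knockoff e D (theta_hat m h D Ct \<omega>) \<omega>)"

context
  fixes Ct :: "'w \<Rightarrow> nat \<Rightarrow> nat \<Rightarrow> real"
  assumes Ct: "\<And>i j. i \<in> {1..n} \<Longrightarrow> j \<in> {1..p} \<Longrightarrow> (\<lambda>\<omega>. Ct \<omega> i j) \<in> borel_measurable (info {1,2,3})"
begin

lemma eta_hat_info: "(\<lambda>\<omega>. eta_hat m h n p (design D \<omega>) (Ct \<omega>)) \<in> measurable (info {1,2,3}) (Pi\<^sub>M {1..m} (\<lambda>_. borel))"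
  unfolding eta_hat_def
proof (rule measurable_restrict)
  fix l assume l: "l \<in> {1..m}"
  have "(\<lambda>\<omega>. \<lambda>k\<in>{1..m}. (\<Sum>i=1..n. \<Sum>j=1..p. (design D \<omega> i j - Ct \<omega> i j) ^ k) / (real n * real p))
      \<in> measurable (info {1,2,3}) (Pi\<^sub>M {1..m} (\<lambda>_. borel))"
    by (intro measurable_restrict borel_measurable_divide borel_measurable_sum borel_measurable_power
        borel_measurable_diff design_info Ct borel_measurable_const)
  then show "(\<lambda>\<omega>. h l (\<lambda>k\<in>{1..m}. (\<Sum>i=1..n. \<Sum>j=1..p. (design D \<omega> i j - Ct \<omega> i j) ^ k) / (real n * real p)))
      \<in> borel_measurable (info {1,2,3})"
    by (rule measurable_compose) (use family l in \<open>auto simp: error_family_def\<close>)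
qed

lemma aug_design_info:
  assumes i: "i \<in> {1..n}" and j: "j \<in> {1..2*p}"
  shows "(\<lambda>\<omega>. aug_design Ct \<omega> i j) \<in> borel_measurable (info {1,2,3})"
proof (cases "j \<le> p")
  case True
  then show ?thesis using design_info[OF i, of j] j by (simp add: aug_design_def augment_def)
next
  case False
  then have j': "j - p \<in> {1..p}" using j by auto
  have "(\<lambda>(\<eta>, b). e \<eta> b) \<in> borel_measurable (Pi\<^sub>M {1..m} (\<lambda>_. borel) \<Otimes>\<^sub>M Q)"
    using family by (simp add: error_family_def)
  from measurable_compose[OF measurable_Pair[OF eta_hat_info seed_info[OF _ _ i j']] this]
  have "(\<lambda>\<omega>. e (eta_hat m h n p (design D \<omega>) (Ct \<omega>)) (seed D i (j - p) \<omega>)) \<in> borel_measurable (info {1,2,3})" by simp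
  then show ?thesis
    using Ct[OF i j'] False by (simp add: aug_design_def augment_def knockoff_def theta_hat_def)
qed

text \<open>Built from the noise-free \<open>Ct\<close>, the augmented design depends on the sources
  1, 2, 3 only, so its columns are weights independent of the noise. Its first p columns are the
  design itself, which covers the plain Lasso too.\<close>

lemma noise_tail:
  assumes n: "n > 0" and V: "V > 0"
  shows "holds_except (Pr D) (real (2*p) * tail x) (\<lambda>\<omega>. \<forall>j\<in>{1..2*p}. (\<Sum>i=1..n. (aug_design Ct \<omega> i j)\<^sup>2) \<le> V \<longrightarrow>
    \<bar>\<Sum>i=1..n. aug_design Ct \<omega> i j * noise D i \<omega>\<bar> \<le> x * sqrt V)"
proof -
  obtain v where "noise_array (Pr D) (\<lambda>i j. noise D i) {1..n} {0::nat} \<alpha> exp_bound v"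
    using noise_row[OF n] by blast
  then interpret NA: noise_array "Pr D" "\<lambda>i j. noise D i" "{1..n}" "{0::nat}" \<alpha> exp_bound v .
  have "holds_except (Pr D) (real (card {1..2*p}) * tail x) (\<lambda>\<omega>. \<forall>j\<in>{1..2*p}. (\<Sum>i=1..n. (aug_design Ct \<omega> i j)\<^sup>2) \<le> V \<longrightarrow>
    \<bar>\<Sum>i=1..n. aug_design Ct \<omega> i j * noise D i \<omega>\<bar> \<le> x * sqrt V)"
  proof (rule holds_except_ball)
    fix j assume j: "j \<in> {1..2*p}"
    have a: "(\<lambda>\<omega>. \<lambda>i\<in>{1..n}. aug_design Ct \<omega> i j) \<in> measurable (info {1,2,3}) (Pi\<^sub>M {1..n} (\<lambda>_. borel))"
      by (intro measurable_restrict aug_design_info j)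
    have y: "(\<lambda>\<omega>. \<lambda>i\<in>{1..n}. noise D i \<omega>) \<in> measurable (info {0}) (Pi\<^sub>M {1..n} (\<lambda>_. borel))"
      by (intro measurable_restrict noise_info) auto
    have "indep_var (Pi\<^sub>M {1..n} (\<lambda>_. borel)) (\<lambda>\<omega>. \<lambda>i\<in>{1..n}. aug_design Ct \<omega> i j) (Pi\<^sub>M {1..n} (\<lambda>_. borel)) (\<lambda>\<omega>. \<lambda>i\<in>{1..n}. noise D i \<omega>)"
      by (rule indep_info[OF _ _ _ a y]) auto
    from NA.weighted_column_tail[OF _ V this, of 0 x]
    show "holds_except (Pr D) (tail x) (\<lambda>\<omega>. (\<Sum>i=1..n. (aug_design Ct \<omega> i j)\<^sup>2) \<le> V \<longrightarrow>
      \<bar>\<Sum>i=1..n. aug_design Ct \<omega> i j * noise D i \<omega>\<bar> \<le> x * sqrt V)"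
      by (simp add: tail_def)
  qed simp
  then show ?thesis by simp
qed

end

section \<open>Constants and the good event\<close>

definition "\<beta>1 = f0 * (1 / M)"
definition "vX = 2 * bd\<^sup>2 + 2 * (\<sigma>2 + 1)"
definition "K\<delta> = bd + real CARD('r) * (vX / sqrt (\<beta>1 / 2))"
definition "KZ = exp_bound / \<alpha> + 1"
text \<open>Bounds the mean square of an augmented column: a knockoff entry is truncation plus error
  plus perturbation, with (a + b + c)^2 \<le> 2 a^2 + 4 b^2 + 4 c^2, and c_np \<le> 1 enters in the
  last term.\<close>

definition "vA = 2 * vX + 4 * (\<sigma>2 + 1) + 4 * (M * KZ)"
text \<open>These are \<open>KR\<close>, \<open>KC\<close> and \<open>KA\<close> of
  \<open>factor_sample\<close> for the present parameters, written without reference to an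
  outcome.\<close>

definition "KR1 = 12 * (2 * bd + 1) * bd / \<beta>1\<^sup>2"
definition "KC1 = 16 * real CARD('r) / \<beta>1 * (1 + (\<sigma>2 + 2)\<^sup>2) + 2 * bd * KR1"
definition "KA1 = 2 * real CARD('r) * (4 / \<beta>1) * (2 * bd + 2 + \<sigma>2\<^sup>2) + 2 * bd * KR1"

lemma const_pos: "f0 > 0" "\<beta>1 > 0" "vX > 0" "KZ > 0" "vA > 0"
proof -
  show 1: "f0 > 0" using M1 by (simp add: f0_def)
  then show "\<beta>1 > 0" using M1 by (simp add: \<beta>1_def)
  show 2: "vX > 0" using \<sigma>2_pos by (simp add: vX_def add_nonneg_pos)
  show 3: "KZ > 0" using exp_bound_ge \<alpha>_pos by (simp add: KZ_def add_nonneg_pos)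
  have "0 \<le> M * KZ" using M1 3 by simp
  moreover have "0 < 2 * vX" "0 < 4 * (\<sigma>2 + 1)" using 2 \<sigma>2_pos by simp_all
  ultimately show "vA > 0" unfolding vA_def by (intro add_pos_nonneg add_pos_pos) auto
qed

text \<open>The deterministic requirements on n, p and s. The clause over k keeps the empirical
  moments within c_np of the true ones, hence the estimated \<eta> inside the ball; the factors 96
  and 128 are those of \<open>restricted_eigenvalue\<close>.\<close>

definition small_rates :: "real \<Rightarrow> real \<Rightarrow> bool" where
  "small_rates x H \<longleftrightarrow> 0 \<le> x \<and> 1 \<le> H \<and> CARD('r) \<le> min n p \<and> cnp D \<le> 1 \<and>
    real CARD('r) * x \<le> sqrt (real n) / (2 * M ^ 3) \<and>
    x * (\<sigma>2 + 1 + bd) \<le> sqrt (real n) \<and>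
    2 * (H / real n + \<sigma>2\<^sup>2 / real p) \<le> (\<beta>1 / 16)\<^sup>2 \<and> \<sigma>2 / real n \<le> \<beta>1 / 16 \<and>
    (\<forall>k\<in>{1..m}. sqrt (H / (real n * real p)) + real k * 2 ^ k * (sqrt H + K\<delta> ^ (k - 1))
        * sqrt (KA1 * H * (1 / real n + 1 / real p)) \<le> cnp D) \<and>
    96 * real (sparsity D) * (x * (\<sigma>2 + 1 + bd) / sqrt (real n)) \<le> \<sigma>2 \<and>
    128 * real (sparsity D) * (2 * (KC1 * ((x * (\<sigma>2 + 1 + bd))\<^sup>2 / real n + H / real p)) + 2 * (M * cnp D * KZ)) \<le> \<sigma>2"

text \<open>The noise clause remains an implication: its premise on the column lengths follows from
  the other clauses once \<open>Ct\<close> is known to be the truncation.\<close>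

definition good_event :: "('w \<Rightarrow> nat \<Rightarrow> nat \<Rightarrow> real) \<Rightarrow> real \<Rightarrow> real \<Rightarrow> 'w \<Rightarrow> bool" where
  "good_event Ct x H \<omega> \<longleftrightarrow>
    (\<forall>i\<in>{1..n}. \<forall>a. \<bar>factor D i \<omega> $ a\<bar> \<le> M) \<and>
    (\<forall>y. f0 * real n * (norm y)\<^sup>2 \<le> (\<Sum>i=1..n. (factor D i \<omega> \<bullet> y)\<^sup>2)) \<and>
    (\<forall>j\<in>{1..2*p}. \<forall>l\<in>{1..2*p}. \<bar>(\<Sum>i=1..n. Eb i j \<omega> * Eb i l \<omega>) - (if j = l then real n * \<sigma>2 else 0)\<bar>
      \<le> x * (\<sigma>2 + 1) * sqrt (real n)) \<and>
    (\<forall>j\<in>{1..p}. \<forall>l\<in>{1..2*p}. \<bar>\<Sum>i=1..n. (factor D i \<omega> \<bullet> loading D j) * Eb i l \<omega>\<bar> \<le> x * bd * sqrt (real n)) \<and>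
    (\<forall>i\<in>{1..n}. (\<Sum>j=1..p. (error D i j \<omega>)\<^sup>2) \<le> real p * (\<sigma>2 + 1)) \<and>
    (\<Sum>j=1..p. \<Sum>l=1..p. ((\<Sum>i=1..n. error D i j \<omega> * error D i l \<omega>) - (if j = l then real n * \<sigma>2 else 0))\<^sup>2)
      \<le> H * (real n * (real p)\<^sup>2) \<and>
    (\<Sum>i=1..n. \<Sum>l=1..n. ((\<Sum>j=1..p. error D i j \<omega> * error D l j \<omega>) - (if i = l then real p * \<sigma>2 else 0))\<^sup>2)
      \<le> H * (real p * (real n)\<^sup>2) \<and>
    (\<Sum>i=1..n. (norm (\<Sum>j=1..p. error D i j \<omega> *\<^sub>R loading D j))\<^sup>2) \<le> H * (real n * real p) \<and>
    (\<Sum>j=1..p. (norm (\<Sum>i=1..n. error D i j \<omega> *\<^sub>R factor D i \<omega>))\<^sup>2) \<le> H * (real n * real p) \<and>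
    (\<forall>k\<in>{1..m}. (\<Sum>i=1..n. \<Sum>j=1..p. error D i j \<omega> ^ k - moments m Q (e \<eta>0) k)\<^sup>2 \<le> H * (real n * real p)) \<and>
    (\<forall>k\<in>{1..m}. (\<Sum>i=1..n. \<Sum>j=1..p. (error D i j \<omega> ^ (k - 1))\<^sup>2) \<le> H * (real n * real p)) \<and>
    (\<forall>\<eta>\<in>eta_ball m \<eta>0 (M * cnp D). \<forall>j\<in>{1..p}.
      (\<Sum>i=1..n. (e \<eta> (seed D i j \<omega>) - e \<eta>0 (seed D i j \<omega>))\<^sup>2) \<le> real n * (M * cnp D * KZ)) \<and>
    (\<forall>j\<in>{1..2*p}. (\<Sum>i=1..n. (aug_design Ct \<omega> i j)\<^sup>2) \<le> real n * vA \<longrightarrow>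
      \<bar>\<Sum>i=1..n. aug_design Ct \<omega> i j * noise D i \<omega>\<bar> \<le> x * sqrt (real n * vA))"

text \<open>Counting the union bounds: 2p + 4p^2 for the Gram matrix, 2p^2 for the cross terms, p
  for the perturbation and 2p for the noise. Four Frobenius bounds and two families of m moment
  bounds cost \<delta> each.\<close>

lemma good_event_prob:
  assumes Ct: "\<And>i j. i \<in> {1..n} \<Longrightarrow> j \<in> {1..p} \<Longrightarrow> (\<lambda>\<omega>. Ct \<omega> i j) \<in> borel_measurable (info {1,2,3})"
    and small: "small_rates x H" and \<delta>: "\<delta> > 0" "KM \<le> \<delta> * H"
  shows "holds_except (Pr D)
    ((real CARD('r))\<^sup>2 * (2 * exp (2 * exp (2 * M\<^sup>2)) * exp (- (1 / 2 * x)))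
      + (5 * real p + 6 * (real p)\<^sup>2) * tail x + real n * tail (sqrt (real p)) + (4 + 2 * real m) * \<delta>)
    (good_event Ct x H)"
proof -
  have "CARD('r) \<le> min n p" using small by (simp add: small_rates_def)
  then have "0 < min n p" by (rule order.strict_trans2[OF zero_less_card_finite])
  then have np: "n > 0" "p > 0" by auto
  have x: "0 \<le> x" "x \<le> sqrt (real n)"
  proof -
    show x0: "0 \<le> x" using small by (simp add: small_rates_def)
    have "x * 1 \<le> x * (\<sigma>2 + 1 + bd)" using x0 \<sigma>2_pos bd_pos by (intro mult_left_mono) auto
    then show "x \<le> sqrt (real n)" using small unfolding small_rates_def by linarith
  qed
  have H: "H > 0" "KM \<le> \<delta> * H" using small \<delta> by (auto simp: small_rates_def)
  have rx: "real CARD('r) * x \<le> sqrt (real n) / (2 * M ^ 3)" using small by (simp add: small_rates_def)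
  have mom: "holds_except (Pr D) (real (card {1..m}) * \<delta>)
      (\<lambda>\<omega>. \<forall>k\<in>{1..m}. (\<Sum>i=1..n. \<Sum>j=1..p. error D i j \<omega> ^ k - moments m Q (e \<eta>0) k)\<^sup>2 \<le> H * (real n * real p))"
    by (intro holds_except_ball error_moment_Markov np \<delta>(1) H) auto
  have pow: "holds_except (Pr D) (real (card {1..m}) * \<delta>)
      (\<lambda>\<omega>. \<forall>k\<in>{1..m}. (\<Sum>i=1..n. \<Sum>j=1..p. (error D i j \<omega> ^ (k - 1))\<^sup>2) \<le> H * (real n * real p))"
    by (intro holds_except_ball error_power_Markov np \<delta>(1) H) auto
  have V: "real n * vA > 0" using np const_pos by simp
  have noise: "holds_except (Pr D) (real (2*p) * tail x) (\<lambda>\<omega>. \<forall>j\<in>{1..2*p}. (\<Sum>i=1..n. (aug_design Ct \<omega> i j)\<^sup>2) \<le> real n * vA \<longrightarrow>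
      \<bar>\<Sum>i=1..n. aug_design Ct \<omega> i j * noise D i \<omega>\<bar> \<le> x * sqrt (real n * vA))"
    by (rule noise_tail[OF Ct np(1) V])
  note all = holds_except_conj[OF holds_except_AE[OF factor_bounded]
    holds_except_conj[OF factor_gram_lower[OF np(1) rx]
    holds_except_conj[OF Eb_gram[OF np(1) x]
    holds_except_conj[OF Eb_cross[OF np(1), of x]
    holds_except_conj[OF error_rows[OF np(2)]
    holds_except_conj[OF error_gram_Markov[OF np \<delta>(1) H]
    holds_except_conj[OF error_gram_Markov'[OF np \<delta>(1) H]
    holds_except_conj[OF error_loading_Markov[OF np \<delta>(1) H]
    holds_except_conj[OF error_factor_Markov[OF np \<delta>(1) H]
    holds_except_conj[OF mom
    holds_except_conj[OF pow
    holds_except_conj[OF knockoff_perturbation[OF np x(2)]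
      noise]]]]]]]]]]]]
  show ?thesis
  proof (rule holds_except_mono[OF all], goal_cases)
    case 1
    show ?case by (simp add: power2_eq_square algebra_simps)
  next
    case (2 \<omega>)
    from 2(2) show ?case unfolding good_event_def KZ_def .
  qed
qed


text \<open>No probability is left: on the good event the spectral gap holds for every decomposition
  of the design, so any admissible \<open>Chat\<close> equals the noise-free \<open>Ct\<close>, and
  the noise bound proved for \<open>Ct\<close> applies to the actual knockoffs.\<close>

lemma good_outcome:
  fixes Ct Chat :: "'w \<Rightarrow> nat \<Rightarrow> nat \<Rightarrow> real" and C0 \<omega>
  defines "lam \<equiv> lasso_lambda C0 D" and "s \<equiv> real (sparsity D)"
  assumes \<omega>: "\<omega> \<in> space (Pr D)" and small: "small_rates x H" and good: "good_event Ct x H \<omega>"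
    and Chat: "c_hat_fit D Chat"
    and Ct: "\<And>U d V i j. svd n p (design D \<omega>) U d V \<Longrightarrow>
      (\<And>k. k \<in> {1..CARD('r)} \<Longrightarrow> real n * real p * (\<beta>1 / 2) \<le> (d k)\<^sup>2 \<and> (d k)\<^sup>2 \<le> real n * real p * (vX + \<beta>1)) \<Longrightarrow>
      (\<And>k. k \<in> {CARD('r)+1..min n p} \<Longrightarrow> (d k)\<^sup>2 \<le> real n * real p * (\<beta>1 / 16)) \<Longrightarrow>
      i \<in> {1..n} \<Longrightarrow> j \<in> {1..p} \<Longrightarrow> thin_svd.trunc U d V CARD('r) i j = Ct \<omega> i j"
    and lam: "lam > 0" "4 * x * sqrt vA \<le> lam * sqrt (real n)"
  shows "is_lasso n p lam (response D \<omega>) (design D \<omega>) bl \<Longrightarrow>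
      (\<Sum>j=1..p. \<bar>bl j - coef D j\<bar>) \<le> 48 * lam * s / \<sigma>2"
    and "is_lasso n (2 * p) lam (response D \<omega>) (augment p (design D \<omega>) (knockoff e D (theta_hat m h D Chat \<omega>) \<omega>)) ba \<Longrightarrow>
      (\<Sum>j=1..2*p. \<bar>ba j - (if j \<le> p then coef D j else 0)\<bar>) \<le> 48 * lam * s / \<sigma>2 \<and>
      (\<Sum>j=1..2*p. (ba j - (if j \<le> p then coef D j else 0))\<^sup>2) \<le> (12 * lam / \<sigma>2)\<^sup>2 * s"
proof -
  define t where "t = x * (\<sigma>2 + 1 + bd)"
  note sm = small[unfolded small_rates_def]
  note ge = good[unfolded good_event_def]
  have rmn: "CARD('r) \<le> min n p" using sm by blast
  then have "0 < min n p" by (rule order.strict_trans2[OF zero_less_card_finite])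
  then have np: "n > 0" "p > 0" by auto
  have x0: "0 \<le> x" and H1: "1 \<le> H" and cnp1: "cnp D \<le> 1" using sm by blast+
  have t0: "0 \<le> t" using x0 \<sigma>2_pos bd_pos by (simp add: t_def)
  have tn: "t \<le> sqrt (real n)" using sm unfolding t_def by blast
  have xt1: "x * (\<sigma>2 + 1) * sqrt (real n) \<le> t * sqrt (real n)" "x * bd * sqrt (real n) \<le> t * sqrt (real n)"
    unfolding t_def using x0 \<sigma>2_pos bd_pos by (auto intro!: mult_right_mono mult_left_mono)
  have fbound: "\<And>i a. i \<in> {1..n} \<Longrightarrow> \<bar>factor D i \<omega> $ a\<bar> \<le> M" using ge by blast
  have Eb_left: "Eb i j \<omega> = error D i j \<omega>" if "j \<in> {1..p}" for i j using that by (simp add: Eb_def)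
  have gram: "\<bar>(\<Sum>i=1..n. Eb i j \<omega> * Eb i l \<omega>) - (if j = l then real n * \<sigma>2 else 0)\<bar> \<le> t * sqrt (real n)"
    if "j \<in> {1..2*p}" "l \<in> {1..2*p}" for j l
    using order.trans[OF _ xt1(1)] ge that by blast
  have cross: "\<bar>\<Sum>i=1..n. (factor D i \<omega> \<bullet> loading D j) * Eb i l \<omega>\<bar> \<le> t * sqrt (real n)"
    if "j \<in> {1..p}" "l \<in> {1..2*p}" for j l
    using order.trans[OF _ xt1(2)] ge that by blast
  have "svd_truncation CARD('r) n p (design D \<omega>) (Chat \<omega>)" using Chat \<omega> by (simp add: c_hat_fit_def)
  then obtain U d V where svd: "svd n p (design D \<omega>) U d V"
    and trunc: "\<And>i j. i \<in> {1..n} \<Longrightarrow> j \<in> {1..p} \<Longrightarrow> Chat \<omega> i j = (\<Sum>k=1..min CARD('r) (min n p). U i k * d k * V j k)"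
    unfolding svd_truncation_def by blast
  interpret FS: factor_sample n p "design D \<omega>" U d V "\<lambda>i. factor D i \<omega>" "loading D" "\<lambda>i j. error D i j \<omega>"
    "CARD('r)" bd f0 "1 / M" \<beta>1 \<sigma>2 H t
  proof
    show "svd n p (design D \<omega>) U d V" by (rule svd)
    show "(norm (factor D i \<omega>))\<^sup>2 \<le> bd" if "i \<in> {1..n}" for i using norm_square_le_b fbound[OF that] by blast
    show "(norm (loading D j))\<^sup>2 \<le> bd" if "j \<in> {1..p}" for j by (rule loading_bounded[OF that])
    show "f0 * real n * (norm y)\<^sup>2 \<le> (\<Sum>i=1..n. (factor D i \<omega> \<bullet> y)\<^sup>2)" for y using ge by blast
    show "1 / M * real p * norm c \<le> norm (\<Sum>j=1..p. (loading D j \<bullet> c) *\<^sub>R loading D j)" for c by (rule loading_lower[OF np(2)])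
    show "\<bar>(\<Sum>i=1..n. error D i j \<omega> * error D i l \<omega>) - (if j = l then real n * \<sigma>2 else 0)\<bar> \<le> t * sqrt (real n)"
      if "j \<in> {1..p}" "l \<in> {1..p}" for j l using gram[of j l] that by (simp add: Eb_left)
    show "\<bar>\<Sum>i=1..n. (factor D i \<omega> \<bullet> loading D j) * error D i l \<omega>\<bar> \<le> t * sqrt (real n)"
      if "j \<in> {1..p}" "l \<in> {1..p}" for j l using cross[of j l] that by (simp add: Eb_left)
    show "(\<Sum>j=1..p. (error D i j \<omega>)\<^sup>2) \<le> real p * (\<sigma>2 + 1)" if "i \<in> {1..n}" for i using ge that by blast
    show "(\<Sum>j=1..p. \<Sum>l=1..p. ((\<Sum>i=1..n. error D i j \<omega> * error D i l \<omega>) - (if j = l then real n * \<sigma>2 else 0))\<^sup>2)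
      \<le> H * real n * (real p)\<^sup>2" unfolding mult.assoc using ge by blast
    show "(\<Sum>i=1..n. \<Sum>l=1..n. ((\<Sum>j=1..p. error D i j \<omega> * error D l j \<omega>) - (if i = l then real p * \<sigma>2 else 0))\<^sup>2)
      \<le> H * real p * (real n)\<^sup>2" unfolding mult.assoc using ge by blast
    show "(\<Sum>i=1..n. (norm (\<Sum>j=1..p. error D i j \<omega> *\<^sub>R loading D j))\<^sup>2) \<le> H * real n * real p" unfolding mult.assoc using ge by blast
    show "(\<Sum>j=1..p. (norm (\<Sum>i=1..n. error D i j \<omega> *\<^sub>R factor D i \<omega>))\<^sup>2) \<le> H * real n * real p" unfolding mult.assoc using ge by blast
    show "2 * (H / real n + \<sigma>2\<^sup>2 / real p) \<le> (\<beta>1 / 16)\<^sup>2" "\<sigma>2 / real n \<le> \<beta>1 / 16" using sm by blast+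
  qed (use rmn const_pos M1 \<sigma>2_pos H1 t0 tn in \<open>auto simp: design_def \<beta>1_def\<close>)
  have const_eqs: "FS.v = vX" "FS.KC = KC1" "FS.KA = KA1"
    by (simp_all add: FS.v_def vX_def FS.KC_def KC1_def FS.KA_def KA1_def FS.KR_def KR1_def)
  have tr: "Chat \<omega> i j = Ct \<omega> i j" "FS.trunc CARD('r) i j = Ct \<omega> i j" if "i \<in> {1..n}" "j \<in> {1..p}" for i j
  proof -
    show *: "FS.trunc CARD('r) i j = Ct \<omega> i j"
    proof (rule Ct[OF svd _ _ that])
      fix k assume k: "k \<in> {1..CARD('r)}"
      then have "k \<in> {1..min n p}" using rmn by auto
      then have "(d k)\<^sup>2 \<le> real n * real p * vX" using FS.singular_value_square_bound const_eqs by simp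
      also have "\<dots> \<le> real n * real p * (vX + \<beta>1)" using const_pos by (intro mult_left_mono) auto
      finally show "real n * real p * (\<beta>1 / 2) \<le> (d k)\<^sup>2 \<and> (d k)\<^sup>2 \<le> real n * real p * (vX + \<beta>1)"
        using FS.spectral_gap(1)[OF k] by simp
    qed (use FS.spectral_gap(2) in auto)
    have "min CARD('r) (min n p) = CARD('r)" using rmn by simp
    then show "Chat \<omega> i j = Ct \<omega> i j" using trunc[OF that] * by (simp add: FS.trunc_def)
  qed
  define dl where "dl i j = Ct \<omega> i j - factor D i \<omega> \<bullet> loading D j" for i j
  have dl_le: "\<bar>dl i j\<bar> \<le> K\<delta>" if "i \<in> {1..n}" "j \<in> {1..p}" for i j
    using FS.trunc_bounded[OF that] FS.C_entry(1)[OF that] tr(2)[OF that] const_eqs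
    unfolding dl_def K\<delta>_def by (simp only:)
  have dl_total: "(\<Sum>i=1..n. \<Sum>j=1..p. (dl i j)\<^sup>2) \<le> real n * real p * (KA1 * H * (1 / real n + 1 / real p))"
  proof -
    have "(\<Sum>i=1..n. \<Sum>j=1..p. (dl i j)\<^sup>2) = (\<Sum>i=1..n. \<Sum>j=1..p. (FS.trunc CARD('r) i j - factor D i \<omega> \<bullet> loading D j)\<^sup>2)"
      by (intro sum.cong refl) (simp add: dl_def tr)
    also have "\<dots> \<le> real n * real p * (KA1 * H * (1 / real n + 1 / real p))" using FS.trunc_total_error_bound const_eqs by simp
    finally show ?thesis .
  qed
  have dl_col: "(\<Sum>i=1..n. (dl i j)\<^sup>2) \<le> real n * (KC1 * (t\<^sup>2 / real n + H / real p))" if "j \<in> {1..p}" for j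
  proof -
    have "(\<Sum>i=1..n. (dl i j)\<^sup>2) = (\<Sum>i=1..n. (FS.trunc CARD('r) i j - factor D i \<omega> \<bullet> loading D j)\<^sup>2)"
      using that by (intro sum.cong refl) (simp add: dl_def tr)
    also have "\<dots> \<le> real n * (KC1 * (t\<^sup>2 / real n + H / real p))" using FS.trunc_column_error_bound[OF that] const_eqs by simp
    finally show ?thesis .
  qed
  \<comment> \<open>The residuals are X - Ct = E - dl, so these are empirical moments of the errors
    perturbed by \<open>dl\<close>.\<close>
  define \<tau> where "\<tau> = (\<lambda>k\<in>{1..m}. (\<Sum>i=1..n. \<Sum>j=1..p. (design D \<omega> i j - Ct \<omega> i j) ^ k) / (real n * real p))"
  define \<eta> where "\<eta> = eta_hat m h n p (design D \<omega>) (Ct \<omega>)"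
  define mu where "mu = moments m Q (e \<eta>0)"
  have \<tau>_close: "\<bar>\<tau> k - mu k\<bar> \<le> cnp D" if k: "k \<in> {1..m}" for k
  proof -
    let ?A = "{1..n} \<times> {1..p}"
    have cA: "real (card ?A) = real n * real p" by simp
    have "\<bar>(\<Sum>z\<in>?A. ((\<lambda>(i, j). error D i j \<omega>) z - (\<lambda>(i, j). dl i j) z) ^ k) / real (card ?A) - mu k\<bar>
        \<le> sqrt (H / real (card ?A)) + real k * 2 ^ k * (sqrt H + K\<delta> ^ (k - 1)) * sqrt (KA1 * H * (1 / real n + 1 / real p))"
    proof (rule empirical_moment_error)
      show "\<bar>case z of (i, j) \<Rightarrow> dl i j\<bar> \<le> K\<delta>" if "z \<in> ?A" for z using that dl_le by auto
      show "(\<Sum>z\<in>?A. (case z of (i, j) \<Rightarrow> dl i j)\<^sup>2) \<le> real (card ?A) * (KA1 * H * (1 / real n + 1 / real p))"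
        unfolding cA using dl_total by (simp add: sum.cartesian_product case_prod_unfold)
      have "(\<Sum>i=1..n. \<Sum>j=1..p. error D i j \<omega> ^ k - mu k)\<^sup>2 \<le> H * (real n * real p)" using ge k unfolding mu_def by blast
      then show "(\<Sum>z\<in>?A. (case z of (i, j) \<Rightarrow> error D i j \<omega>) ^ k - mu k)\<^sup>2 \<le> H * real (card ?A)"
        unfolding cA by (simp add: sum.cartesian_product case_prod_unfold)
      have "(\<Sum>i=1..n. \<Sum>j=1..p. (error D i j \<omega> ^ (k - 1))\<^sup>2) \<le> H * (real n * real p)" using ge k by blast
      then show "(\<Sum>z\<in>?A. ((case z of (i, j) \<Rightarrow> error D i j \<omega>) ^ (k - 1))\<^sup>2) \<le> H * real (card ?A)"
        unfolding cA by (simp add: sum.cartesian_product case_prod_unfold)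
    qed (use k np in auto)
    also have "\<dots> \<le> cnp D" unfolding cA using sm k by blast
    also have "(\<Sum>z\<in>?A. ((\<lambda>(i, j). error D i j \<omega>) z - (\<lambda>(i, j). dl i j) z) ^ k) / real (card ?A) = \<tau> k"
    proof -
      have "(\<Sum>z\<in>?A. ((\<lambda>(i, j). error D i j \<omega>) z - (\<lambda>(i, j). dl i j) z) ^ k)
          = (\<Sum>i=1..n. \<Sum>j=1..p. (error D i j \<omega> - dl i j) ^ k)"
        by (simp add: sum.cartesian_product case_prod_unfold)
      also have "\<dots> = (\<Sum>i=1..n. \<Sum>j=1..p. (design D \<omega> i j - Ct \<omega> i j) ^ k)"
        by (simp add: dl_def design_def algebra_simps)
      finally show ?thesis using k by (simp add: \<tau>_def cA)
    qed
    finally show ?thesis .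
  qed
  have \<eta>_ball: "\<eta> \<in> eta_ball m \<eta>0 (M * cnp D)"
    unfolding eta_ball_def
  proof (intro CollectI conjI ballI)
    show "\<eta> \<in> Rvec m" by (simp add: \<eta>_def eta_hat_def)
    fix l assume l: "l \<in> {1..m}"
    \<comment> \<open>As M > 1, moments within c_np lie in the region where \<open>h\<close> is
      Lipschitz; the conclusion, M times the moment error, is at most M c_np, the radius on which
      the process is controlled.\<close>
    have "cnp D * 1 \<le> cnp D * M" using M1 cnp_nonneg by (intro mult_left_mono) auto
    then have "\<tau> \<in> eta_ball m mu (M * cnp D)"
      using \<tau>_close by (force simp: eta_ball_def \<tau>_def mult.commute)
    then have "\<bar>h l \<tau> - h l mu\<bar> \<le> M * Max ((\<lambda>k. \<bar>\<tau> k - mu k\<bar>) ` {1..m})"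
      using error_cond l unfolding error_condition_def mu_def by blast
    also have "\<dots> \<le> M * cnp D"
      using M1 \<tau>_close m1 by (intro mult_left_mono) (auto simp: Max_le_iff)
    also have "h l \<tau> = \<eta> l" using l by (simp add: \<eta>_def eta_hat_def \<tau>_def)
    also have "h l mu = \<eta>0 l" using family l unfolding error_family_def mu_def by auto
    finally show "\<bar>\<eta> l - \<eta>0 l\<bar> \<le> M * cnp D" .
  qed
  define zt where "zt i j = e \<eta> (seed D i j \<omega>) - e \<eta>0 (seed D i j \<omega>)" for i j
  have zt: "(\<Sum>i=1..n. (zt i j)\<^sup>2) \<le> real n * (M * cnp D * KZ)" if "j \<in> {1..p}" for j
    unfolding zt_def using ge \<eta>_ball that by blast
  define A where "A = aug_design Ct \<omega>"
  have A_left: "A i j = design D \<omega> i j" if "j \<in> {1..p}" for i j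
    using that by (simp add: A_def aug_design_def augment_def)
  have A_right: "A i j = Ct \<omega> i (j - p) + e \<eta> (seed D i (j - p) \<omega>)" if "\<not> j \<le> p" for i j
    using that by (simp add: A_def aug_design_def augment_def knockoff_def theta_hat_def \<eta>_def)
  have A_Chat: "augment p (design D \<omega>) (knockoff e D (theta_hat m h D Chat \<omega>) \<omega>) i j = A i j"
    if "i \<in> {1..n}" "j \<in> {1..2*p}" for i j
  proof (cases "j \<le> p")
    case False
    then have j': "j - p \<in> {1..p}" using that(2) unfolding atLeastAtMost_iff by linarith
    have "eta_hat m h n p (design D \<omega>) (Chat \<omega>) = \<eta>"
      unfolding \<eta>_def eta_hat_def using tr(1) by (intro restrict_ext arg_cong[where f = "h _"] arg_cong2[where f = "(/)"] sum.cong refl) auto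
    then show ?thesis
      using False tr(1)[OF that(1) j'] A_right[OF False, of i] by (simp add: augment_def knockoff_def theta_hat_def)
  qed (use that in \<open>simp add: A_left augment_def\<close>)
  have KZM: "M * cnp D * KZ \<le> M * KZ"
    using M1 cnp1 const_pos(4) by (intro mult_right_mono mult_left_le) auto
  have A_col: "(\<Sum>i=1..n. (A i j)\<^sup>2) \<le> real n * vA" if j: "j \<in> {1..2*p}" for j
  proof (cases "j \<le> p")
    case True
    then have j': "j \<in> {1..p}" using j by auto
    have "(\<Sum>i=1..n. (A i j)\<^sup>2) \<le> real n * vX" using FS.X_column_le[OF j'] const_eqs A_left[OF j'] by simp
    also have "\<dots> \<le> real n * vA"
    proof (rule mult_left_mono)
      have "0 \<le> M * KZ" using M1 const_pos by simp
      then show "vX \<le> vA" using const_pos(3) \<sigma>2_pos unfolding vA_def by (intro order.trans[OF _ add_increasing2[of "4 * (M * KZ)"]]) auto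
    qed simp
    finally show ?thesis .
  next
    case False
    then have j': "j - p \<in> {1..p}" using j unfolding atLeastAtMost_iff by linarith
    have "(\<Sum>i=1..n. (A i j)\<^sup>2) \<le> (\<Sum>i=1..n. 2 * (Ct \<omega> i (j - p))\<^sup>2 + (4 * (Eb i j \<omega>)\<^sup>2 + 4 * (zt i (j - p))\<^sup>2))"
    proof (rule sum_mono)
      fix i
      have "A i j = Ct \<omega> i (j - p) + (Eb i j \<omega> + zt i (j - p))" using False by (simp add: A_right Eb_def zt_def)
      then show "(A i j)\<^sup>2 \<le> 2 * (Ct \<omega> i (j - p))\<^sup>2 + (4 * (Eb i j \<omega>)\<^sup>2 + 4 * (zt i (j - p))\<^sup>2)"
        using power2_sum_le[of "Ct \<omega> i (j - p)" "Eb i j \<omega> + zt i (j - p)"] power2_sum_le[of "Eb i j \<omega>" "zt i (j - p)"] by simp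
    qed
    also have "\<dots> = 2 * (\<Sum>i=1..n. (Ct \<omega> i (j - p))\<^sup>2) + (4 * (\<Sum>i=1..n. (Eb i j \<omega>)\<^sup>2) + 4 * (\<Sum>i=1..n. (zt i (j - p))\<^sup>2))"
      by (simp add: sum.distrib sum_distrib_left)
    also have "\<dots> \<le> 2 * (real n * vX) + (4 * (real n * (\<sigma>2 + 1)) + 4 * (real n * (M * KZ)))"
    proof (intro add_mono mult_left_mono)
      have "(\<Sum>i=1..n. (Ct \<omega> i (j - p))\<^sup>2) = (\<Sum>i=1..n. (FS.trunc CARD('r) i (j - p))\<^sup>2)"
        using j' by (intro sum.cong refl) (simp add: tr)
      also have "\<dots> \<le> real n * vX"
        using FS.trunc_column_le[OF rmn j'] FS.X_column_le[OF j'] const_eqs by simp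
      finally show "(\<Sum>i=1..n. (Ct \<omega> i (j - p))\<^sup>2) \<le> real n * vX" .
      have "\<bar>(\<Sum>i=1..n. (Eb i j \<omega>)\<^sup>2) - real n * \<sigma>2\<bar> \<le> t * sqrt (real n)" using gram[OF j j] by (simp add: power2_eq_square)
      moreover have "t * sqrt (real n) \<le> real n" by (rule FS.t_sqrt)
      ultimately show "(\<Sum>i=1..n. (Eb i j \<omega>)\<^sup>2) \<le> real n * (\<sigma>2 + 1)" unfolding distrib_left by linarith
      show "(\<Sum>i=1..n. (zt i (j - p))\<^sup>2) \<le> real n * (M * KZ)"
        using zt[OF j'] mult_left_mono[OF KZM, of "real n"] by simp
    qed auto
    also have "\<dots> = real n * vA" by (simp add: vA_def algebra_simps)
    finally show ?thesis .
  qed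
  have noise: "\<bar>\<Sum>i=1..n. A i j * noise D i \<omega>\<bar> \<le> real n * (lam / 4)" if j: "j \<in> {1..2*p}" for j
  proof -
    have "\<bar>\<Sum>i=1..n. A i j * noise D i \<omega>\<bar> \<le> x * sqrt (real n * vA)"
      using ge A_col[OF j] j unfolding A_def by blast
    also have "\<dots> = (4 * x * sqrt vA) * sqrt (real n) / 4" by (simp add: real_sqrt_mult)
    also have "\<dots> \<le> (lam * sqrt (real n)) * sqrt (real n) / 4"
      by (intro divide_right_mono mult_right_mono lam(2)) auto
    also have "\<dots> = real n * (lam / 4)" by simp
    finally show ?thesis .
  qed
  \<comment> \<open>A knockoff column shares the signal part of its original; only the error part is
    fresh, and the remainder vanishes on the original columns.\<close>
  define Bm where "Bm i j = factor D i \<omega> \<bullet> loading D (if j \<le> p then j else j - p)" for i j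
  define Rm where "Rm i j = (if j \<le> p then 0 else dl i (j - p) + zt i (j - p))" for i j
  define k1 where "k1 = t / sqrt (real n)"
  define r2 where "r2 = 2 * (KC1 * (t\<^sup>2 / real n + H / real p)) + 2 * (M * cnp D * KZ)"
  have k1: "k1 \<ge> 0" "t * sqrt (real n) = real n * k1" "96 * s * k1 \<le> \<sigma>2"
  proof -
    show "k1 \<ge> 0" using t0 by (simp add: k1_def)
    have "real n = sqrt (real n) * sqrt (real n)" by simp
    then show "t * sqrt (real n) = real n * k1" using np by (simp add: k1_def) (simp add: field_simps)
    show "96 * s * k1 \<le> \<sigma>2" using sm unfolding s_def k1_def t_def by blast
  qed
  have r2: "r2 \<ge> 0" "128 * s * r2 \<le> \<sigma>2"
  proof -
    have "KC1 \<ge> 0" using FS.KC_nonneg const_eqs by simp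
    then show "r2 \<ge> 0" using H1 M1 cnp_nonneg const_pos(4) unfolding r2_def by (intro add_nonneg_nonneg mult_nonneg_nonneg) auto
    show "128 * s * r2 \<le> \<sigma>2" using sm unfolding s_def r2_def t_def by blast
  qed
  have BE: "\<bar>\<Sum>i=1..n. Bm i j * Eb i l \<omega>\<bar> \<le> real n * k1" if "j \<in> {1..2*p}" "l \<in> {1..2*p}" for j l
  proof -
    have "(if j \<le> p then j else j - p) \<in> {1..p}" using that(1) unfolding atLeastAtMost_iff by (cases "j \<le> p"; simp; linarith)
    from cross[OF this that(2)] show ?thesis by (simp add: Bm_def k1(2))
  qed
  have EE: "\<bar>(\<Sum>i=1..n. Eb i j \<omega> * Eb i l \<omega>) - (if j = l then real n * \<sigma>2 else 0)\<bar> \<le> real n * k1"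
    if "j \<in> {1..2*p}" "l \<in> {1..2*p}" for j l
    using gram[OF that] by (simp only: k1(2))
  have RR: "(\<Sum>i=1..n. (Rm i j)\<^sup>2) \<le> real n * r2" if j: "j \<in> {1..2*p}" for j
  proof (cases "j \<le> p")
    case True
    then show ?thesis using r2 by (simp add: Rm_def)
  next
    case False
    then have j': "j - p \<in> {1..p}" using j unfolding atLeastAtMost_iff by linarith
    have "(\<Sum>i=1..n. (Rm i j)\<^sup>2) \<le> (\<Sum>i=1..n. 2 * (dl i (j - p))\<^sup>2 + 2 * (zt i (j - p))\<^sup>2)"
      using False by (intro sum_mono) (simp add: Rm_def power2_sum_le)
    also have "\<dots> = 2 * (\<Sum>i=1..n. (dl i (j - p))\<^sup>2) + 2 * (\<Sum>i=1..n. (zt i (j - p))\<^sup>2)"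
      by (simp add: sum.distrib sum_distrib_left)
    also have "\<dots> \<le> 2 * (real n * (KC1 * (t\<^sup>2 / real n + H / real p))) + 2 * (real n * (M * cnp D * KZ))"
      by (intro add_mono mult_left_mono dl_col zt j') auto
    also have "\<dots> = real n * r2" by (simp add: r2_def algebra_simps)
    finally show ?thesis .
  qed
  have A_dec: "A i j = Bm i j + Eb i j \<omega> + Rm i j" if "j \<in> {1..2*p}" for i j
    using that A_left[of j i] A_right[of j i]
    by (cases "j \<le> p") (auto simp: Bm_def Eb_def Rm_def dl_def zt_def design_def)
  have S: "signals D \<subseteq> {1..p}" by (auto simp: signals_def)
  have scard: "s = real (card (signals D))" by (simp add: s_def sparsity_def)
  \<comment> \<open>The eigenvalue \<sigma>2/8 turns the factors 6 and 3/2 of the oracle inequality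
    into 48 and 12.\<close>
  have kap: "\<sigma>2 / 8 > 0" using \<sigma>2_pos by simp
  show "(\<Sum>j=1..p. \<bar>bl j - coef D j\<bar>) \<le> 48 * lam * s / \<sigma>2"
    if bl: "is_lasso n p lam (response D \<omega>) (design D \<omega>) bl"
  proof -
    have "(\<Sum>j=1..p. \<bar>bl j - coef D j\<bar>) \<le> 6 * lam * real (card (signals D)) / (\<sigma>2 / 8)"
    proof (rule lasso_error_bound(2)[OF np(1) lam(1) kap S bl, of "coef D" "\<lambda>i. noise D i \<omega>"])
      show "response D \<omega> i = (\<Sum>j=1..p. design D \<omega> i j * coef D j) + noise D i \<omega>" for i by (simp add: response_def)
      show "coef D j = 0" if "j \<in> {1..p} - signals D" for j using that by (auto simp: signals_def)
      show "\<bar>\<Sum>i=1..n. design D \<omega> i j * noise D i \<omega>\<bar> \<le> real n * (lam / 4)" if "j \<in> {1..p}" for j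
        using noise[of j] that A_left[OF that] by auto
      fix y :: "nat \<Rightarrow> real"
      assume y: "(\<Sum>j=1..p. \<bar>y j\<bar>)\<^sup>2 \<le> 16 * real (card (signals D)) * (\<Sum>j=1..p. (y j)\<^sup>2)"
      show "\<sigma>2 / 8 * (\<Sum>j=1..p. (y j)\<^sup>2) \<le> (\<Sum>i=1..n. (\<Sum>j=1..p. design D \<omega> i j * y j)\<^sup>2) / real n"
      proof (rule restricted_eigenvalue[where B = Bm and E = "\<lambda>i j. Eb i j \<omega>" and R = Rm and s = s, OF np(1) _ _ _ _ k1(3,1) r2(2,1)])
        show "design D \<omega> i j = Bm i j + Eb i j \<omega> + Rm i j" if "j \<in> {1..p}" for i j
          using A_dec[of j i] A_left[OF that] that by auto
        show "\<bar>\<Sum>i=1..n. Bm i j * Eb i l \<omega>\<bar> \<le> real n * k1" if "j \<in> {1..p}" "l \<in> {1..p}" for j l using BE[of j l] that by auto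
        show "\<bar>(\<Sum>i=1..n. Eb i j \<omega> * Eb i l \<omega>) - (if j = l then real n * \<sigma>2 else 0)\<bar> \<le> real n * k1" if "j \<in> {1..p}" "l \<in> {1..p}" for j l
          using EE[of j l] that by auto
        show "(\<Sum>i=1..n. (Rm i j)\<^sup>2) \<le> real n * r2" if "j \<in> {1..p}" for j using RR[of j] that by auto
      qed (use y scard in simp)
    qed
    then show ?thesis by (simp add: scard)
  qed
  show "(\<Sum>j=1..2*p. \<bar>ba j - (if j \<le> p then coef D j else 0)\<bar>) \<le> 48 * lam * s / \<sigma>2 \<and>
      (\<Sum>j=1..2*p. (ba j - (if j \<le> p then coef D j else 0))\<^sup>2) \<le> (12 * lam / \<sigma>2)\<^sup>2 * s"
    if ba: "is_lasso n (2 * p) lam (response D \<omega>) (augment p (design D \<omega>) (knockoff e D (theta_hat m h D Chat \<omega>) \<omega>)) ba"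
  proof -
    define A' where "A' = augment p (design D \<omega>) (knockoff e D (theta_hat m h D Chat \<omega>) \<omega>)"
    have A'A: "A' i j = A i j" if "i \<in> {1..n}" "j \<in> {1..2*p}" for i j
      unfolding A'_def by (rule A_Chat[OF that])
    have S2: "signals D \<subseteq> {1..2*p}" using S by force
    have ba': "is_lasso n (2*p) lam (response D \<omega>) A' ba" using ba unfolding A'_def .
    \<comment> \<open>The response does not involve the knockoffs, so in the augmented regression
      the true coefficient is padded by zeros.\<close>
    have y: "response D \<omega> i = (\<Sum>j=1..2*p. A' i j * (if j \<le> p then coef D j else 0)) + noise D i \<omega>" if "i \<in> {1..n}" for i
    proof -
      have "(\<Sum>j=1..2*p. A' i j * (if j \<le> p then coef D j else 0)) = (\<Sum>j=1..p. design D \<omega> i j * coef D j)"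
        by (rule sum.mono_neutral_cong_right) (use that A'A A_left in auto)
      then show ?thesis by (simp add: response_def)
    qed
    have z: "(if j \<le> p then coef D j else 0) = 0" if "j \<in> {1..2*p} - signals D" for j using that by (auto simp: signals_def)
    have nz: "\<bar>\<Sum>i=1..n. A' i j * noise D i \<omega>\<bar> \<le> real n * (lam / 4)" if "j \<in> {1..2*p}" for j
      using noise[OF that] A'A that by simp
    have re: "\<sigma>2 / 8 * (\<Sum>j=1..2*p. (y j)\<^sup>2) \<le> (\<Sum>i=1..n. (\<Sum>j=1..2*p. A' i j * y j)\<^sup>2) / real n"
      if "(\<Sum>j=1..2*p. \<bar>y j\<bar>)\<^sup>2 \<le> 16 * real (card (signals D)) * (\<Sum>j=1..2*p. (y j)\<^sup>2)" for y
      by (rule restricted_eigenvalue[where B = Bm and E = "\<lambda>i j. Eb i j \<omega>" and R = Rm and s = s, OF np(1) _ BE EE RR k1(3,1) r2(2,1)])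
        (use that scard A'A A_dec in auto)
    have l2: "(\<Sum>j=1..2*p. (ba j - (if j \<le> p then coef D j else 0))\<^sup>2) \<le> (3 * lam / (2 * (\<sigma>2 / 8)))\<^sup>2 * real (card (signals D))"
      by (rule lasso_error_bound(1)[OF np(1) lam(1) kap S2 ba' y z nz re])
    have l1: "(\<Sum>j=1..2*p. \<bar>ba j - (if j \<le> p then coef D j else 0)\<bar>) \<le> 6 * lam * real (card (signals D)) / (\<sigma>2 / 8)"
      by (rule lasso_error_bound(2)[OF np(1) lam(1) kap S2 ba' y z nz re])
    show ?thesis using l1 l2 by (simp add: scard)
  qed
qed

end

section \<open>Growth rates and power\<close>

lemma ln_ge_one: "3 \<le> n \<Longrightarrow> 1 \<le> ln (real n)"
  using exp_le by (subst ln_ge_iff) auto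

lemma eventually_le_of_tendsto_0:
  fixes f :: "nat \<Rightarrow> real"
  assumes "f \<longlonglongrightarrow> 0" "c > 0"
  shows "\<forall>\<^sub>F t in sequentially. f t \<le> c"
  using order_tendstoD(2)[OF assms] by (rule eventually_mono) simp

text \<open>The positive part of the deficit serves all t at once, including the early ones about
  which nothing is known.\<close>

lemma tendsto_0_deficit:
  fixes f :: "nat \<Rightarrow> real"
  assumes "\<And>\<epsilon>. \<epsilon> > 0 \<Longrightarrow> \<forall>\<^sub>F t in sequentially. f t \<ge> \<gamma> - \<epsilon>"
  shows "\<exists>\<delta>. \<delta> \<longlonglongrightarrow> 0 \<and> (\<forall>t. f t \<ge> \<gamma> - \<delta> t)"
proof (intro exI[of _ "\<lambda>t. max 0 (\<gamma> - f t)"] conjI allI)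
  show "(\<lambda>t. max 0 (\<gamma> - f t)) \<longlonglongrightarrow> 0"
  proof (rule tendstoI)
    fix \<epsilon> :: real assume \<epsilon>: "\<epsilon> > 0"
    from assms[of "\<epsilon> / 2"] \<epsilon> have "\<forall>\<^sub>F t in sequentially. f t \<ge> \<gamma> - \<epsilon> / 2" by simp
    then show "\<forall>\<^sub>F t in sequentially. dist (max 0 (\<gamma> - f t)) 0 < \<epsilon>"
      by (rule eventually_mono) (use \<epsilon> in \<open>simp add: dist_real_def\<close>)
  qed
  show "f t \<ge> \<gamma> - max 0 (\<gamma> - f t)" for t by simp
qed

section \<open>Consequences of the growth condition\<close>

locale growth_rates =
  fixes n p s k :: "nat \<Rightarrow> nat"
  assumes lim: "filterlim (\<lambda>t. min (n t) (p t)) at_top sequentially"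
    and s_pos: "\<And>t. s t > 0" and k: "\<And>t. 2 * s t \<le> k t"
    and rate: "(\<lambda>t. real (s t) * sqrt (real (k t)) * c_rate_log (n t) (p t)) \<longlonglongrightarrow> 0"
begin

lemma n_lim: "filterlim (\<lambda>t. real (n t)) at_top sequentially"
  by (rule filterlim_compose[OF filterlim_real_sequentially])
    (rule filterlim_at_top_mono[OF lim], simp)

lemma p_lim: "filterlim (\<lambda>t. real (p t)) at_top sequentially"
  by (rule filterlim_compose[OF filterlim_real_sequentially])
    (rule filterlim_at_top_mono[OF lim], simp)

lemma eventually_min_ge: "\<forall>\<^sub>F t in sequentially. N \<le> min (n t) (p t)"
  using lim unfolding filterlim_at_top by blast

text \<open>From 3 on the logarithms are at least 1, so their square roots are at most themselves
  and \<open>c_rate\<close> is dominated by \<open>c_rate_log\<close>.\<close>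

lemma large: "\<forall>\<^sub>F t in sequentially. 3 \<le> n t \<and> 3 \<le> p t"
  using eventually_min_ge[of 3] by (rule eventually_mono) simp

lemma ln_p_lim: "filterlim (\<lambda>t. ln (real (p t))) at_top sequentially"
  by (rule filterlim_compose[OF ln_at_top p_lim])

lemma ln_n_lim: "filterlim (\<lambda>t. ln (real (n t))) at_top sequentially"
  by (rule filterlim_compose[OF ln_at_top n_lim])

lemma s_ge_1: "real (s t) \<ge> 1" using s_pos[of t] by simp

lemma s_rate_log: "(\<lambda>t. real (s t) * c_rate_log (n t) (p t)) \<longlonglongrightarrow> 0"
proof (rule tendsto_sandwich[OF _ _ tendsto_const rate])
  show "\<forall>\<^sub>F t in sequentially. 0 \<le> real (s t) * c_rate_log (n t) (p t)"
    using large by (rule eventually_mono) (auto simp: c_rate_log_def)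
  show "\<forall>\<^sub>F t in sequentially. real (s t) * c_rate_log (n t) (p t) \<le> real (s t) * sqrt (real (k t)) * c_rate_log (n t) (p t)"
    using large
  proof (rule eventually_mono)
    fix t assume t: "3 \<le> n t \<and> 3 \<le> p t"
    have "1 \<le> k t" using k[of t] s_pos[of t] by linarith
    then have "1 \<le> sqrt (real (k t))" by simp
    then have "real (s t) * 1 \<le> real (s t) * sqrt (real (k t))" by (intro mult_left_mono) auto
    moreover have "0 \<le> c_rate_log (n t) (p t)" using t by (auto simp: c_rate_log_def)
    ultimately show "real (s t) * c_rate_log (n t) (p t) \<le> real (s t) * sqrt (real (k t)) * c_rate_log (n t) (p t)"
      by (intro mult_right_mono) auto
  qed
qed

lemma sandwich_s_rate:
  assumes "\<And>t. 3 \<le> n t \<Longrightarrow> 3 \<le> p t \<Longrightarrow> 0 \<le> f t \<and> f t \<le> real (s t) * c_rate_log (n t) (p t)"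
  shows "f \<longlonglongrightarrow> 0"
proof (rule tendsto_sandwich[OF _ _ tendsto_const s_rate_log])
  show "\<forall>\<^sub>F t in sequentially. 0 \<le> f t" "\<forall>\<^sub>F t in sequentially. f t \<le> real (s t) * c_rate_log (n t) (p t)"
    using large by (auto elim!: eventually_mono dest!: assms)
qed

lemma s_ln_p: "(\<lambda>t. real (s t) * (ln (real (p t)) / sqrt (real (n t)))) \<longlonglongrightarrow> 0"
  and s_ln_n: "(\<lambda>t. real (s t) * (ln (real (n t)) / sqrt (real (p t)))) \<longlonglongrightarrow> 0"
  by (rule sandwich_s_rate; auto simp: c_rate_log_def simp del: times_divide_eq_right intro!: mult_left_mono)+

lemma ln_p_sqrt_n: "(\<lambda>t. ln (real (p t)) / sqrt (real (n t))) \<longlonglongrightarrow> 0"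
  and ln_n_sqrt_p: "(\<lambda>t. ln (real (n t)) / sqrt (real (p t))) \<longlonglongrightarrow> 0"
proof -
  have *: "x \<le> real (s t) * x" if "0 \<le> x" for x t
    using mult_right_mono[OF s_ge_1 that] by simp
  show "(\<lambda>t. ln (real (p t)) / sqrt (real (n t))) \<longlonglongrightarrow> 0"
    by (rule tendsto_sandwich[OF _ _ tendsto_const s_ln_p])
      (use large in \<open>auto elim!: eventually_mono intro!: * simp del: times_divide_eq_right\<close>)
  show "(\<lambda>t. ln (real (n t)) / sqrt (real (p t))) \<longlonglongrightarrow> 0"
    by (rule tendsto_sandwich[OF _ _ tendsto_const s_ln_n])
      (use large in \<open>auto elim!: eventually_mono intro!: * simp del: times_divide_eq_right\<close>)
qed

lemma s_rate: "(\<lambda>t. real (s t) * c_rate (n t) (p t)) \<longlonglongrightarrow> 0"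
proof (rule sandwich_s_rate)
  fix t assume t: "3 \<le> n t" "3 \<le> p t"
  have *: "sqrt x \<le> x" if "1 \<le> x" for x :: real
    using that by (intro real_le_lsqrt) (auto simp: power2_eq_square)
  have "c_rate (n t) (p t) \<le> c_rate_log (n t) (p t)"
    using t unfolding c_rate_def c_rate_log_def real_sqrt_divide
    by (intro add_mono divide_right_mono * ln_ge_one) auto
  moreover have "0 \<le> c_rate (n t) (p t)" using t by (auto simp: c_rate_def)
  ultimately show "0 \<le> real (s t) * c_rate (n t) (p t) \<and> real (s t) * c_rate (n t) (p t) \<le> real (s t) * c_rate_log (n t) (p t)"
    by (auto intro: mult_left_mono)
qed

lemma c_rate_lim: "(\<lambda>t. c_rate (n t) (p t)) \<longlonglongrightarrow> 0"
proof (rule tendsto_sandwich[OF _ _ tendsto_const s_rate])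
  have "0 \<le> c_rate (n t) (p t)" if "3 \<le> n t \<and> 3 \<le> p t" for t using that by (auto simp: c_rate_def)
  then show "\<forall>\<^sub>F t in sequentially. 0 \<le> c_rate (n t) (p t)"
    "\<forall>\<^sub>F t in sequentially. c_rate (n t) (p t) \<le> real (s t) * c_rate (n t) (p t)"
    using large mult_right_mono[OF s_ge_1] by (auto elim!: eventually_mono)
qed

lemma s_ln_p_square: "(\<lambda>t. real (s t) * ((ln (real (p t)))\<^sup>2 / real (n t))) \<longlonglongrightarrow> 0"
proof -
  have "(\<lambda>t. real (s t) * (ln (real (p t)) / sqrt (real (n t))) * (ln (real (p t)) / sqrt (real (n t)))) \<longlonglongrightarrow> 0 * 0"
    by (intro tendsto_mult s_ln_p ln_p_sqrt_n)
  then show ?thesis by (simp add: power2_eq_square mult.assoc)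
qed

lemma s_div_p: "(\<lambda>t. real (s t) / real (p t)) \<longlonglongrightarrow> 0"
proof (rule tendsto_sandwich[OF _ _ tendsto_const])
  show "(\<lambda>t. (real (s t) * (ln (real (n t)) / sqrt (real (p t))))\<^sup>2) \<longlonglongrightarrow> 0"
    using tendsto_power[OF s_ln_n, of 2] by simp
  show "\<forall>\<^sub>F t in sequentially. real (s t) / real (p t) \<le> (real (s t) * (ln (real (n t)) / sqrt (real (p t))))\<^sup>2"
    using large
  proof (rule eventually_mono)
    fix t assume t: "3 \<le> n t \<and> 3 \<le> p t"
    then have "1 \<le> ln (real (n t))" by (intro ln_ge_one) simp
    then have "1 * 1 \<le> real (s t) * (ln (real (n t)))\<^sup>2" using s_ge_1[of t] by (intro mult_mono) auto
    then have "real (s t) * 1 \<le> real (s t) * (real (s t) * (ln (real (n t)))\<^sup>2)" by (intro mult_left_mono) auto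
    then have "real (s t) / real (p t) \<le> real (s t) * (real (s t) * (ln (real (n t)))\<^sup>2) / real (p t)"
      by (intro divide_right_mono) auto
    then show "real (s t) / real (p t) \<le> (real (s t) * (ln (real (n t)) / sqrt (real (p t))))\<^sup>2"
      by (simp add: power_mult_distrib power_divide power2_eq_square mult_ac)
  qed
qed simp

lemma inverse_p: "(\<lambda>t. 1 / real (p t)) \<longlonglongrightarrow> 0"
  and inverse_n: "(\<lambda>t. 1 / real (n t)) \<longlonglongrightarrow> 0"
  using tendsto_inverse_0_at_top[OF p_lim] tendsto_inverse_0_at_top[OF n_lim] by (simp_all add: inverse_eq_divide)

text \<open>The rate c_np exceeds the logarithm-free error by the factors sqrt (ln n) and sqrt (ln
  p), which absorb any fixed constant. This brings the estimated moments into the region where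
  \<open>h\<close> is Lipschitz.\<close>

lemma dominated_by_c_rate:
  "\<forall>\<^sub>F t in sequentially. K * sqrt (1 / real (n t) + 1 / real (p t)) \<le> c_rate (n t) (p t)"
proof -
  have sq: "filterlim (\<lambda>t. sqrt (ln (real (p t)))) at_top sequentially" "filterlim (\<lambda>t. sqrt (ln (real (n t)))) at_top sequentially"
    by (rule filterlim_compose[OF sqrt_at_top ln_p_lim], rule filterlim_compose[OF sqrt_at_top ln_n_lim])
  have "\<forall>\<^sub>F t in sequentially. \<bar>K\<bar> \<le> sqrt (ln (real (p t)))" "\<forall>\<^sub>F t in sequentially. \<bar>K\<bar> \<le> sqrt (ln (real (n t)))"
    using sq unfolding filterlim_at_top by blast+
  then show ?thesis using large
  proof eventually_elim
    case (elim t)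
    have "K * sqrt (1 / real (n t) + 1 / real (p t)) \<le> \<bar>K\<bar> * (sqrt (1 / real (n t)) + sqrt (1 / real (p t)))"
      by (intro mult_mono sqrt_add_le_add_sqrt) auto
    also have "\<dots> = \<bar>K\<bar> / sqrt (real (p t)) + \<bar>K\<bar> / sqrt (real (n t))"
      by (simp add: real_sqrt_divide distrib_left)
    also have "\<dots> \<le> c_rate (n t) (p t)"
      unfolding c_rate_def real_sqrt_divide by (intro add_mono divide_right_mono elim) auto
    finally show ?case .
  qed
qed

text \<open>As ln n / sqrt p tends to 0, eventually n \<le> exp ((a / 2) sqrt p), which costs half
  of the exponent.\<close>

lemma n_exp_sqrt_p:
  assumes "a > 0"
  shows "(\<lambda>t. real (n t) * exp (- (a * sqrt (real (p t))))) \<longlonglongrightarrow> 0"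
proof (rule tendsto_sandwich[OF _ _ tendsto_const])
  have "filterlim (\<lambda>t. sqrt (real (p t))) at_top sequentially" by (rule filterlim_compose[OF sqrt_at_top p_lim])
  then have "filterlim (\<lambda>t. a / 2 * sqrt (real (p t))) at_top sequentially"
    by (rule filterlim_tendsto_pos_mult_at_top[OF tendsto_const, rotated]) (use assms in simp)
  then have "filterlim (\<lambda>t. - (a / 2 * sqrt (real (p t)))) at_bot sequentially"
    by (simp add: filterlim_uminus_at_bot)
  then show "(\<lambda>t. exp (- (a / 2 * sqrt (real (p t))))) \<longlonglongrightarrow> 0"
    by (rule filterlim_compose[OF exp_at_bot])
  have "\<forall>\<^sub>F t in sequentially. ln (real (n t)) / sqrt (real (p t)) \<le> a / 2"
    by (rule eventually_le_of_tendsto_0[OF ln_n_sqrt_p]) (use assms in simp)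
  then show "\<forall>\<^sub>F t in sequentially. real (n t) * exp (- (a * sqrt (real (p t)))) \<le> exp (- (a / 2 * sqrt (real (p t))))"
    using large
  proof eventually_elim
    case (elim t)
    then have "ln (real (n t)) \<le> a / 2 * sqrt (real (p t))" by (simp add: divide_le_eq)
    moreover have "real (n t) = exp (ln (real (n t)))" using elim by simp
    ultimately show ?case by (metis (no_types, lifting) exp_add exp_le_cancel_iff add_le_cancel_right
      add.commute diff_add_cancel field_sum_of_halves minus_diff_eq uminus_add_conv_diff distrib_right)
  qed
qed simp

text \<open>The factor 6 / a makes the exponent 3 ln p, and p^(-3) beats a union over order p^2
  pairs.\<close>

lemma p_square_exp:
  assumes "a > 0" "K \<ge> 0"
  shows "(\<lambda>t. (5 * real (p t) + 6 * (real (p t))\<^sup>2) * (K * exp (- (a / 2 * (6 / a * ln (real (p t))))))) \<longlonglongrightarrow> 0"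
proof (rule tendsto_sandwich[OF _ _ tendsto_const])
  show "(\<lambda>t. 11 * K * (1 / real (p t))) \<longlonglongrightarrow> 0"
    using tendsto_mult[OF tendsto_const inverse_p, of "11 * K"] by simp
  show "\<forall>\<^sub>F t in sequentially. (5 * real (p t) + 6 * (real (p t))\<^sup>2) * (K * exp (- (a / 2 * (6 / a * ln (real (p t)))))) \<le> 11 * K * (1 / real (p t))"
    using large
  proof eventually_elim
    case (elim t)
    have "exp (- (a / 2 * (6 / a * ln (real (p t))))) = exp (- (3 * ln (real (p t))))" using assms by simp
    also have "\<dots> = inverse (real (p t) ^ 3)"
      using elim by (simp add: exp_minus exp_of_nat_mult[of 3, simplified])
    finally have e: "exp (- (a / 2 * (6 / a * ln (real (p t))))) = inverse (real (p t) ^ 3)" .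
    have "5 * real (p t) * 1 \<le> 5 * real (p t) * real (p t)" using elim by (intro mult_left_mono) auto
    then have "5 * real (p t) + 6 * (real (p t))\<^sup>2 \<le> 11 * (real (p t))\<^sup>2" by (simp add: power2_eq_square)
    then have "(5 * real (p t) + 6 * (real (p t))\<^sup>2) * (K * inverse (real (p t) ^ 3)) \<le> 11 * (real (p t))\<^sup>2 * (K * inverse (real (p t) ^ 3))"
      using assms by (intro mult_right_mono) auto
    also have "\<dots> = 11 * K * (1 / real (p t))" using elim by (simp add: power2_eq_square power3_eq_cube field_simps)
    finally show ?case unfolding e .
  qed
qed (use assms in auto)

lemma exp_ln_p:
  assumes "a > 0"
  shows "(\<lambda>t. exp (- (1 / 2 * (a * ln (real (p t)))))) \<longlonglongrightarrow> 0"
proof -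
  have "filterlim (\<lambda>t. a / 2 * ln (real (p t))) at_top sequentially"
    by (rule filterlim_tendsto_pos_mult_at_top[OF tendsto_const _ ln_p_lim]) (use assms in simp)
  then have "filterlim (\<lambda>t. - (a / 2 * ln (real (p t)))) at_bot sequentially"
    by (simp add: filterlim_uminus_at_bot)
  from filterlim_compose[OF exp_at_bot this] show ?thesis by (simp add: mult.commute mult.left_commute)
qed

end

section \<open>Power and measurability of the selections\<close>

lemma (in prob_space) sel_power_ge:
  assumes f: "\<And>\<omega>. f \<omega> = real (card (S \<omega> \<inter> signals D)) / real (sparsity D)" and P: "Pr D = M"
    and meas: "\<And>j. j \<in> {1..nvar D} \<Longrightarrow> {\<omega> \<in> space M. j \<in> S \<omega>} \<in> sets M"
    and ev: "holds_except M \<delta> (\<lambda>\<omega>. \<gamma> \<le> f \<omega>)" and \<gamma>: "0 \<le> \<gamma>" "\<gamma> \<le> 1"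
  shows "sel_power D S \<ge> \<gamma> - \<delta>"
proof -
  have fin: "finite (signals D)" by (simp add: signals_def)
  have "real (card (S \<omega> \<inter> signals D)) = (\<Sum>j\<in>signals D. indicator {\<omega>. j \<in> S \<omega>} \<omega>)" for \<omega>
  proof -
    have "S \<omega> \<inter> signals D = {j \<in> signals D. j \<in> S \<omega>}" by auto
    then show ?thesis using fin by (simp add: indicator_def of_bool_def sum.If_cases Int_def cong: if_cong)
  qed
  then have f': "f \<omega> = (\<Sum>j\<in>signals D. indicator {\<omega> \<in> space M. j \<in> S \<omega>} \<omega>) / real (sparsity D)"
    if "\<omega> \<in> space M" for \<omega> unfolding f using that by (simp add: indicator_def)
  have "(\<lambda>\<omega>. (\<Sum>j\<in>signals D. indicator {\<omega> \<in> space M. j \<in> S \<omega>} \<omega>) / real (sparsity D)) \<in> borel_measurable M"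
    by (intro borel_measurable_divide borel_measurable_sum borel_measurable_indicator meas borel_measurable_const)
      (auto simp: signals_def)
  then have "f \<in> borel_measurable M"
    by (rule measurable_cong[THEN iffD1, rotated]) (simp add: f')
  moreover have "f \<omega> \<le> 1" for \<omega>
  proof -
    have "card (S \<omega> \<inter> signals D) \<le> card (signals D)" using fin by (intro card_mono) auto
    then show ?thesis unfolding f sparsity_def by (simp add: divide_le_eq)
  qed
  moreover have "0 \<le> f \<omega>" for \<omega> by (simp add: f)
  ultimately have "expectation f \<ge> \<gamma> - \<delta>"
    using \<gamma> by (intro expectation_ge_of_holds_except[OF ev])
  then show ?thesis unfolding sel_power_def P f[symmetric] .
qed

lemma sel_power_le_1: "prob_space (Pr D) \<Longrightarrow> sel_power D S \<le> 1"
proof -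
  assume "prob_space (Pr D)"
  then interpret prob_space "Pr D" .
  have *: "real (card (S \<omega> \<inter> signals D)) / real (sparsity D) \<le> 1" for \<omega>
  proof -
    have "card (S \<omega> \<inter> signals D) \<le> card (signals D)" by (intro card_mono) (auto simp: signals_def)
    then show ?thesis by (simp add: sparsity_def divide_le_eq)
  qed
  show ?thesis
  proof (cases "integrable (Pr D) (\<lambda>\<omega>. real (card (S \<omega> \<inter> signals D)) / real (sparsity D))")
    case True
    then have "expectation (\<lambda>\<omega>. real (card (S \<omega> \<inter> signals D)) / real (sparsity D)) \<le> expectation (\<lambda>_. 1)"
      by (intro integral_mono) (auto simp: *)
    then show ?thesis by (simp add: sel_power_def prob_space)
  next
    \<comment> \<open>A non-integrable function has integral 0 by convention, so the bound persists
      for an arbitrary selection.\<close>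
    case False
    then show ?thesis unfolding sel_power_def by (subst not_integrable_integral_eq) auto
  qed
qed

lemma support_measurable:
  assumes "(\<lambda>\<omega>. b \<omega> j) \<in> borel_measurable P"
  shows "{\<omega> \<in> space P. j \<in> support p (b \<omega>)} \<in> sets P"
proof -
  have "{\<omega> \<in> space P. j \<in> support p (b \<omega>)} = {\<omega> \<in> space P. j \<in> {1..p} \<and> b \<omega> j \<noteq> 0}" by (auto simp: support_def)
  also have "\<dots> \<in> sets P" using assms by measurable
  finally show ?thesis .
qed

text \<open>The threshold is data-dependent, but its candidates are the values \<bar>W i\<bar>;
  fixing the index i turns the event into a finite union of events about counts.\<close>

lemma knockoff_select_measurable:
  assumes W: "\<And>j. j \<in> {1..p} \<Longrightarrow> (\<lambda>\<omega>. W \<omega> j) \<in> borel_measurable P" and j: "j \<in> {1..p}"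
  shows "{\<omega> \<in> space P. j \<in> knockoff_select a q p (W \<omega>)} \<in> sets P"
proof -
  have cnt: "(\<lambda>\<omega>. real (card {l \<in> {1..p}. R l \<omega>})) \<in> borel_measurable P"
    if R: "\<And>l. l \<in> {1..p} \<Longrightarrow> {\<omega> \<in> space P. R l \<omega>} \<in> sets P" for R
  proof -
    have "(\<lambda>\<omega>. \<Sum>l=1..p. indicator {\<omega> \<in> space P. R l \<omega>} \<omega> :: real) \<in> borel_measurable P"
      by (intro borel_measurable_sum borel_measurable_indicator R)
    moreover have "(\<Sum>l=1..p. indicator {\<omega> \<in> space P. R l \<omega>} \<omega>) = real (card {l \<in> {1..p}. R l \<omega>})"
      if "\<omega> \<in> space P" for \<omega>
    proof -
      have "(\<Sum>l=1..p. indicator {\<omega> \<in> space P. R l \<omega>} \<omega> :: real) = (\<Sum>l=1..p. if R l \<omega> then 1 else 0)"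
        using that by (intro sum.cong refl) (simp add: indicator_def)
      also have "\<dots> = real (card {l \<in> {1..p}. R l \<omega>})"
        by (simp add: sum.If_cases Int_def)
      finally show ?thesis .
    qed
    ultimately show ?thesis by (rule measurable_cong[THEN iffD1, rotated]) simp
  qed
  have num: "(\<lambda>\<omega>. real (card {l \<in> {1..p}. W \<omega> l \<le> - \<bar>W \<omega> i\<bar>})) \<in> borel_measurable P"
    and den: "(\<lambda>\<omega>. real (card {l \<in> {1..p}. W \<omega> l \<ge> \<bar>W \<omega> i\<bar>})) \<in> borel_measurable P" if i: "i \<in> {1..p}" for i
  proof -
    show "(\<lambda>\<omega>. real (card {l \<in> {1..p}. W \<omega> l \<le> - \<bar>W \<omega> i\<bar>})) \<in> borel_measurable P"
    proof (rule cnt)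
      fix l assume "l \<in> {1..p}"
      note [measurable] = W[OF this] W[OF i]
      show "{\<omega> \<in> space P. W \<omega> l \<le> - \<bar>W \<omega> i\<bar>} \<in> sets P" by measurable
    qed
    show "(\<lambda>\<omega>. real (card {l \<in> {1..p}. W \<omega> l \<ge> \<bar>W \<omega> i\<bar>})) \<in> borel_measurable P"
    proof (rule cnt)
      fix l assume "l \<in> {1..p}"
      note [measurable] = W[OF this] W[OF i]
      show "{\<omega> \<in> space P. W \<omega> l \<ge> \<bar>W \<omega> i\<bar>} \<in> sets P" by measurable
    qed
  qed
  have "{\<omega> \<in> space P. j \<in> knockoff_select a q p (W \<omega>)} =
    (\<Union>i\<in>{1..p}. {\<omega> \<in> space P. \<bar>W \<omega> i\<bar> \<noteq> 0 \<and>
      (real a - 1 + real (card {l \<in> {1..p}. W \<omega> l \<le> - \<bar>W \<omega> i\<bar>})) / max (real (card {l \<in> {1..p}. W \<omega> l \<ge> \<bar>W \<omega> i\<bar>})) 1 \<le> q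
      \<and> \<bar>W \<omega> i\<bar> \<le> W \<omega> j})"
    unfolding knockoff_select_iff threshold_candidates_def using j by auto
  also have "\<dots> \<in> sets P"
  proof (intro sets.finite_UN)
    fix i assume i: "i \<in> {1..p}"
    note [measurable] = num[OF i] den[OF i] W[OF i] W[OF j]
    show "{\<omega> \<in> space P. \<bar>W \<omega> i\<bar> \<noteq> 0 \<and>
      (real a - 1 + real (card {l \<in> {1..p}. W \<omega> l \<le> - \<bar>W \<omega> i\<bar>})) / max (real (card {l \<in> {1..p}. W \<omega> l \<ge> \<bar>W \<omega> i\<bar>})) 1 \<le> q
      \<and> \<bar>W \<omega> i\<bar> \<le> W \<omega> j} \<in> sets P" by measurable
  qed simp
  finally show ?thesis .
qed

lemma (in latent_model) estimation_errors:
  assumes small: "small_rates x H" and \<delta>: "\<delta> > 0" "KM \<le> \<delta> * H"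
    and Chat: "c_hat_fit D Chat" and bhat: "lasso_fit C0 D bhat"
    and baug: "aug_fit C0 e D (theta_hat m h D Chat) baug"
    and lam: "lasso_lambda C0 D > 0" "4 * x * sqrt vA \<le> lasso_lambda C0 D * sqrt (real n)"
  shows "holds_except (Pr D)
    ((real CARD('r))\<^sup>2 * (2 * exp (2 * exp (2 * M\<^sup>2)) * exp (- (1 / 2 * x)))
      + (5 * real p + 6 * (real p)\<^sup>2) * tail x + real n * tail (sqrt (real p)) + (4 + 2 * real m) * \<delta>)
    (\<lambda>\<omega>. (\<Sum>j=1..p. \<bar>bhat \<omega> j - coef D j\<bar>) \<le> 48 * lasso_lambda C0 D * real (sparsity D) / \<sigma>2 \<and>
      (\<Sum>j=1..2*p. \<bar>baug \<omega> j - (if j \<le> p then coef D j else 0)\<bar>) \<le> 48 * lasso_lambda C0 D * real (sparsity D) / \<sigma>2 \<and>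
      (\<Sum>j=1..2*p. (baug \<omega> j - (if j \<le> p then coef D j else 0))\<^sup>2) \<le> (12 * lasso_lambda C0 D / \<sigma>2)\<^sup>2 * real (sparsity D))"
proof -
  define np where "np = real n * real p"
  have r: "CARD('r) \<le> min n p" using small by (simp add: small_rates_def)
  then have "0 < min n p" by (rule order.strict_trans2[OF zero_less_card_finite])
  then have np: "np > 0" by (simp add: np_def)
  \<comment> \<open>The levels of the cutoff polynomials come from the spectral gap. Adding \<beta>1
    to the top one guarantees that it exceeds \<beta>1 / 2 whatever \<open>vX\<close> is.\<close>
  have b: "0 \<le> np * (\<beta>1 / 16)" "np * (\<beta>1 / 16) < np * (\<beta>1 / 2)" "np * (\<beta>1 / 2) \<le> np * (vX + \<beta>1)"
    using np const_pos by (auto intro!: mult_strict_left_mono mult_left_mono)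
  show ?thesis
  proof (rule measurable_truncation[OF b])
    fix Ct
    assume Ct: "\<And>i j. i \<in> {1..n} \<Longrightarrow> j \<in> {1..p} \<Longrightarrow> (\<lambda>\<omega>. Ct \<omega> i j) \<in> borel_measurable (info {1,2,3})"
      and eq: "\<And>\<omega> U d V r i j. svd n p (design D \<omega>) U d V \<Longrightarrow> r \<le> min n p \<Longrightarrow>
        (\<And>k. k \<in> {1..r} \<Longrightarrow> np * (\<beta>1 / 2) \<le> (d k)\<^sup>2 \<and> (d k)\<^sup>2 \<le> np * (vX + \<beta>1)) \<Longrightarrow>
        (\<And>k. k \<in> {r+1..min n p} \<Longrightarrow> (d k)\<^sup>2 \<le> np * (\<beta>1 / 16)) \<Longrightarrow>
        i \<in> {1..n} \<Longrightarrow> j \<in> {1..p} \<Longrightarrow> thin_svd.trunc U d V r i j = Ct \<omega> i j"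
    show ?thesis
    proof (rule holds_except_mono[OF good_event_prob[OF Ct small \<delta>] order.refl])
      fix \<omega> assume \<omega>: "\<omega> \<in> space (Pr D)" and good: "good_event Ct x H \<omega>"
      note go = good_outcome[OF \<omega> small good Chat eq[unfolded np_def, OF _ r] lam]
      have "is_lasso n p (lasso_lambda C0 D) (response D \<omega>) (design D \<omega>) (bhat \<omega>)"
        using bhat \<omega> by (simp add: lasso_fit_def)
      note l = go(1)[OF _ _ _ _ _ this]
      have "is_lasso n (2 * p) (lasso_lambda C0 D) (response D \<omega>) (augment p (design D \<omega>) (knockoff e D (theta_hat m h D Chat \<omega>) \<omega>)) (baug \<omega>)"
        using baug \<omega> by (simp add: aug_fit_def)
      note a = go(2)[OF _ _ _ _ _ this]
      show "(\<Sum>j=1..p. \<bar>bhat \<omega> j - coef D j\<bar>) \<le> 48 * lasso_lambda C0 D * real (sparsity D) / \<sigma>2 \<and>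
        (\<Sum>j=1..2*p. \<bar>baug \<omega> j - (if j \<le> p then coef D j else 0)\<bar>) \<le> 48 * lasso_lambda C0 D * real (sparsity D) / \<sigma>2 \<and>
        (\<Sum>j=1..2*p. (baug \<omega> j - (if j \<le> p then coef D j else 0))\<^sup>2) \<le> (12 * lasso_lambda C0 D / \<sigma>2)\<^sup>2 * real (sparsity D)"
        using l a by blast
    qed
  qed
qed

section \<open>The sequence of models\<close>

locale model_sequence =
  fixes M C\<epsilon> Ce ce :: real and m :: nat
    and G :: "(nat \<Rightarrow> real) \<Rightarrow> real \<Rightarrow> real" and \<eta>0 :: "nat \<Rightarrow> real"
    and h :: "nat \<Rightarrow> (nat \<Rightarrow> real) \<Rightarrow> real"
    and Q :: "'b measure" and e :: "(nat \<Rightarrow> real) \<Rightarrow> 'b \<Rightarrow> real"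
    and D :: "nat \<Rightarrow> ('w, 'b, 'r::finite) factor_model" and k :: "nat \<Rightarrow> nat"
  assumes model: "\<And>t. latent_model M C\<epsilon> Ce ce m G \<eta>0 h Q e (D t)"
    and lim: "filterlim (\<lambda>t. min (nobs (D t)) (nvar (D t))) at_top sequentially"
    and s_pos: "\<And>t. sparsity (D t) > 0" and k: "\<And>t. 2 * sparsity (D t) \<le> k t"
    and rate: "(\<lambda>t. real (sparsity (D t)) * sqrt (real (k t)) * c_rate_log (nobs (D t)) (nvar (D t))) \<longlonglongrightarrow> 0"
begin

sublocale growth_rates "\<lambda>t. nobs (D t)" "\<lambda>t. nvar (D t)" "\<lambda>t. sparsity (D t)" k
  by unfold_locales (rule lim s_pos k rate)+

text \<open>Index 0 merely provides names for the constants; as these do not involve the model,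
  \<open>L.\<sigma>2\<close>, \<open>L.vA\<close> and so on are those of every
  \<open>D t\<close>.\<close>

sublocale L: latent_model M C\<epsilon> Ce ce m G \<eta>0 h Q e "D 0"
  by (rule model)

abbreviation "x t \<equiv> 6 / L.\<alpha> * ln (real (nvar (D t)))"

lemma cnp_lim: "(\<lambda>t. cnp (D t)) \<longlonglongrightarrow> 0"
  using c_rate_lim by (simp add: cnp_def)

lemma x_sqrt_n: "(\<lambda>t. K * (x t / sqrt (real (nobs (D t))))) \<longlonglongrightarrow> 0"
  using tendsto_mult[OF tendsto_const[of "K * (6 / L.\<alpha>)"] ln_p_sqrt_n] by (simp add: mult.assoc)

text \<open>With x of order ln p the clauses reduce to limits of \<open>growth_rates\<close>: the
  Gram error to s ln p / sqrt n, the remainder to s (ln p)^2 / n, s / p and s c_np, the moment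
  clause to \<open>dominated_by_c_rate\<close>.\<close>

lemma eventually_small_rates:
  assumes H: "1 \<le> H"
  shows "\<forall>\<^sub>F t in sequentially. latent_model.small_rates M C\<epsilon> Ce ce m \<eta>0 Q e (D t) (x t) H"
proof -
  note ev = eventually_le_of_tendsto_0
  let ?n = "\<lambda>t. real (nobs (D t))" and ?p = "\<lambda>t. real (nvar (D t))" and ?s = "\<lambda>t. real (sparsity (D t))"
  let ?c = "6 / L.\<alpha> * (L.\<sigma>2 + 1 + L.bd)"
  have \<beta>: "L.\<beta>1 / 16 > 0" using L.const_pos by simp
  have "\<forall>\<^sub>F t in sequentially. real CARD('r) * (x t / sqrt (?n t)) \<le> 1 / (2 * M ^ 3)"
    by (rule ev[OF x_sqrt_n]) (use L.M1 in simp)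
  moreover have "\<forall>\<^sub>F t in sequentially. (L.\<sigma>2 + 1 + L.bd) * (x t / sqrt (?n t)) \<le> 1"
    by (rule ev[OF x_sqrt_n]) simp
  moreover have "\<forall>\<^sub>F t in sequentially. 2 * (H * (1 / ?n t) + L.\<sigma>2\<^sup>2 * (1 / ?p t)) \<le> (L.\<beta>1 / 16)\<^sup>2"
  proof (rule ev)
    have "(\<lambda>t. 2 * (H * (1 / ?n t) + L.\<sigma>2\<^sup>2 * (1 / ?p t))) \<longlonglongrightarrow> 2 * (H * 0 + L.\<sigma>2\<^sup>2 * 0)"
      by (intro tendsto_intros inverse_n inverse_p)
    then show "(\<lambda>t. 2 * (H * (1 / ?n t) + L.\<sigma>2\<^sup>2 * (1 / ?p t))) \<longlonglongrightarrow> 0" by simp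
  qed (use \<beta> in simp)
  moreover have "\<forall>\<^sub>F t in sequentially. L.\<sigma>2 * (1 / ?n t) \<le> L.\<beta>1 / 16"
    by (rule ev[OF _ \<beta>]) (use tendsto_mult[OF tendsto_const inverse_n, of L.\<sigma>2] in simp)
  moreover have "\<forall>\<^sub>F t in sequentially. \<forall>k\<in>{1..m}. sqrt (H / (?n t * ?p t)) + real k * 2 ^ k * (sqrt H + L.K\<delta> ^ (k - 1))
      * sqrt (L.KA1 * H * (1 / ?n t + 1 / ?p t)) \<le> cnp (D t)"
  proof (intro eventually_ball_finite ballI)
    fix k assume "k \<in> {1..m}"
    let ?K = "sqrt H + real k * 2 ^ k * (sqrt H + L.K\<delta> ^ (k - 1)) * sqrt (L.KA1 * H)"
    show "\<forall>\<^sub>F t in sequentially. sqrt (H / (?n t * ?p t)) + real k * 2 ^ k * (sqrt H + L.K\<delta> ^ (k - 1))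
      * sqrt (L.KA1 * H * (1 / ?n t + 1 / ?p t)) \<le> cnp (D t)"
      using dominated_by_c_rate[of ?K] large
    proof eventually_elim
      case (elim t)
      have "1 / (?n t * ?p t) \<le> 1 / ?n t" using elim by (intro divide_left_mono) auto
      then have "1 / (?n t * ?p t) \<le> 1 / ?n t + 1 / ?p t" by (rule add_increasing2[rotated]) simp
      then have "sqrt (H * (1 / (?n t * ?p t))) \<le> sqrt (H * (1 / ?n t + 1 / ?p t))"
        using H by (intro real_sqrt_le_mono mult_left_mono) auto
      then have "sqrt (H / (?n t * ?p t)) \<le> sqrt H * sqrt (1 / ?n t + 1 / ?p t)"
        unfolding real_sqrt_mult[symmetric] by simp
      then have "sqrt (H / (?n t * ?p t)) + real k * 2 ^ k * (sqrt H + L.K\<delta> ^ (k - 1))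
          * sqrt (L.KA1 * H * (1 / ?n t + 1 / ?p t)) \<le> ?K * sqrt (1 / ?n t + 1 / ?p t)"
        unfolding real_sqrt_mult[of "L.KA1 * H"] distrib_right by (simp only: mult.assoc add_le_cancel_right)
      then show ?case using elim unfolding cnp_def by linarith
    qed
  qed simp
  moreover have "\<forall>\<^sub>F t in sequentially. 96 * ?c * (?s t * (ln (?p t) / sqrt (?n t))) \<le> L.\<sigma>2"
    by (rule ev[OF _ L.\<sigma>2_pos]) (use tendsto_mult[OF tendsto_const s_ln_p, of "96 * ?c"] in simp)
  moreover have "\<forall>\<^sub>F t in sequentially. 256 * L.KC1 * ?c\<^sup>2 * (?s t * ((ln (?p t))\<^sup>2 / ?n t)) + 256 * L.KC1 * H * (?s t / ?p t)
      + 256 * M * L.KZ * (?s t * c_rate (nobs (D t)) (nvar (D t))) \<le> L.\<sigma>2"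
  proof (rule ev[OF _ L.\<sigma>2_pos])
    have "(\<lambda>t. 256 * L.KC1 * ?c\<^sup>2 * (?s t * ((ln (?p t))\<^sup>2 / ?n t)) + 256 * L.KC1 * H * (?s t / ?p t)
        + 256 * M * L.KZ * (?s t * c_rate (nobs (D t)) (nvar (D t)))) \<longlonglongrightarrow>
      256 * L.KC1 * ?c\<^sup>2 * 0 + 256 * L.KC1 * H * 0 + 256 * M * L.KZ * 0"
      by (intro tendsto_add tendsto_mult[OF tendsto_const] s_ln_p_square s_div_p s_rate)
    then show "(\<lambda>t. 256 * L.KC1 * ?c\<^sup>2 * (?s t * ((ln (?p t))\<^sup>2 / ?n t)) + 256 * L.KC1 * H * (?s t / ?p t)
        + 256 * M * L.KZ * (?s t * c_rate (nobs (D t)) (nvar (D t)))) \<longlonglongrightarrow> 0" by simp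
  qed
  moreover note large eventually_min_ge[of "CARD('r)"] ev[OF cnp_lim zero_less_one]
  ultimately show ?thesis
  proof eventually_elim
    case (elim t)
    interpret N: latent_model M C\<epsilon> Ce ce m G \<eta>0 h Q e "D t" by (rule model)
    have n: "sqrt (?n t) > 0" using elim(8) by simp
    have x: "x t \<ge> 0" using elim(8) L.\<alpha>_pos by simp
    have *: "a * y \<le> b * sqrt (?n t)" if "a * (y / sqrt (?n t)) \<le> b" for a b y :: real
      using that n by (simp add: divide_le_eq)
    have eq: "96 * s * (A * l * c / q) = 96 * (A * c) * (s * (l / q))"
      "128 * s * (2 * (K * ((A * l * c)\<^sup>2 / q + H / b)) + 2 * (M * d * Z))
        = 256 * K * (A * c)\<^sup>2 * (s * (l\<^sup>2 / q)) + 256 * K * H * (s / b) + 256 * M * Z * (s * d)"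
      for s A l c q K b d Z :: real
      by (simp_all add: power_mult_distrib distrib_left mult_ac)
    show ?case unfolding N.small_rates_def
    proof (intro conjI)
      show "real CARD('r) * x t \<le> sqrt (?n t) / (2 * M ^ 3)" using *[OF elim(1)] by simp
      show "x t * (L.\<sigma>2 + 1 + L.bd) \<le> sqrt (?n t)" using *[OF elim(2)] by (simp only: mult.commute mult_1)
      show "2 * (H / ?n t + L.\<sigma>2\<^sup>2 / ?p t) \<le> (L.\<beta>1 / 16)\<^sup>2" "L.\<sigma>2 / ?n t \<le> L.\<beta>1 / 16" using elim(3,4) by simp_all
      show "96 * ?s t * (x t * (L.\<sigma>2 + 1 + L.bd) / sqrt (?n t)) \<le> L.\<sigma>2" using elim(6) unfolding eq(1) .
      show "128 * ?s t * (2 * (L.KC1 * ((x t * (L.\<sigma>2 + 1 + L.bd))\<^sup>2 / ?n t + H / ?p t)) + 2 * (M * cnp (D t) * L.KZ)) \<le> L.\<sigma>2"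
        using elim(7) unfolding eq(2) cnp_def .
    qed (use elim x H in auto)
  qed
qed

text \<open>For x = (6 / \<alpha>) ln p the requirement 4 x sqrt vA \<le> lam sqrt n reads (24 /
  \<alpha>) sqrt vA \<le> C0, which is the origin of the lower bound on \<open>C0\<close>. Half of
  \<epsilon> goes to the Markov bounds through \<delta>, the other half dominates the vanishing
  tails.\<close>

lemma eventually_estimation_errors:
  assumes C0: "24 / L.\<alpha> * sqrt L.vA \<le> C0" and \<epsilon>: "\<epsilon> > 0"
    and fits: "\<And>t. lasso_fit C0 (D t) (bhat t)" "\<And>t. c_hat_fit (D t) (Chat t)"
      "\<And>t. aug_fit C0 e (D t) (theta_hat m h (D t) (Chat t)) (baug t)"
  shows "\<forall>\<^sub>F t in sequentially. holds_except (Pr (D t)) \<epsilon>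
    (\<lambda>\<omega>. (\<Sum>j=1..nvar (D t). \<bar>bhat t \<omega> j - coef (D t) j\<bar>) \<le> 48 * lasso_lambda C0 (D t) * real (sparsity (D t)) / L.\<sigma>2 \<and>
      (\<Sum>j=1..2*nvar (D t). \<bar>baug t \<omega> j - (if j \<le> nvar (D t) then coef (D t) j else 0)\<bar>)
        \<le> 48 * lasso_lambda C0 (D t) * real (sparsity (D t)) / L.\<sigma>2 \<and>
      (\<Sum>j=1..2*nvar (D t). (baug t \<omega> j - (if j \<le> nvar (D t) then coef (D t) j else 0))\<^sup>2)
        \<le> (12 * lasso_lambda C0 (D t) / L.\<sigma>2)\<^sup>2 * real (sparsity (D t)))"
proof -
  let ?n = "\<lambda>t. real (nobs (D t))" and ?p = "\<lambda>t. real (nvar (D t))"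
  define \<delta> where "\<delta> = \<epsilon> / (2 * (4 + 2 * real m))"
  have \<delta>: "\<delta> > 0" "(4 + 2 * real m) * \<delta> = \<epsilon> / 2" using \<epsilon> by (simp_all add: \<delta>_def field_simps)
  define H where "H = max 1 (L.KM / \<delta>)"
  have H: "1 \<le> H" "L.KM \<le> \<delta> * H"
    using \<delta>(1) by (simp_all add: H_def max_def field_simps)
  let ?T = "2 * exp (2 * noise_array.D L.\<alpha> exp_bound)"
  have tail: "L.tail y = ?T * exp (- (L.\<alpha> / 2 * y))" for y by (simp add: L.tail_def)
  have "(\<lambda>t. (real CARD('r))\<^sup>2 * (2 * exp (2 * exp (2 * M\<^sup>2)) * exp (- (1 / 2 * x t)))
      + (5 * ?p t + 6 * (?p t)\<^sup>2) * L.tail (x t) + ?n t * L.tail (sqrt (?p t)))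
    \<longlonglongrightarrow> (real CARD('r))\<^sup>2 * (2 * exp (2 * exp (2 * M\<^sup>2)) * 0) + 0 + ?T * 0"
  proof (intro tendsto_add tendsto_mult[OF tendsto_const])
    show "(\<lambda>t. exp (- (1 / 2 * x t))) \<longlonglongrightarrow> 0" by (rule exp_ln_p) (use L.\<alpha>_pos in simp)
    show "(\<lambda>t. (5 * ?p t + 6 * (?p t)\<^sup>2) * L.tail (x t)) \<longlonglongrightarrow> 0"
      unfolding tail by (rule p_square_exp) (use L.\<alpha>_pos in auto)
    have "(\<lambda>t. ?T * (?n t * exp (- (L.\<alpha> / 2 * sqrt (?p t))))) \<longlonglongrightarrow> ?T * 0"
      by (intro tendsto_mult tendsto_const n_exp_sqrt_p) (use L.\<alpha>_pos in simp)
    then show "(\<lambda>t. ?n t * L.tail (sqrt (?p t))) \<longlonglongrightarrow> ?T * 0" unfolding tail by (simp add: mult_ac)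
  qed
  then have "(\<lambda>t. (real CARD('r))\<^sup>2 * (2 * exp (2 * exp (2 * M\<^sup>2)) * exp (- (1 / 2 * x t)))
      + (5 * ?p t + 6 * (?p t)\<^sup>2) * L.tail (x t) + ?n t * L.tail (sqrt (?p t))) \<longlonglongrightarrow> 0" by simp
  from eventually_le_of_tendsto_0[OF this, of "\<epsilon> / 2"] \<epsilon>
  have "\<forall>\<^sub>F t in sequentially. (real CARD('r))\<^sup>2 * (2 * exp (2 * exp (2 * M\<^sup>2)) * exp (- (1 / 2 * x t)))
      + (5 * ?p t + 6 * (?p t)\<^sup>2) * L.tail (x t) + ?n t * L.tail (sqrt (?p t)) \<le> \<epsilon> / 2" by simp
  with eventually_small_rates[OF H(1)] large show ?thesis
  proof eventually_elim
    case (elim t)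
    interpret N: latent_model M C\<epsilon> Ce ce m G \<eta>0 h Q e "D t" by (rule model)
    have "ln (?p t) > 0" using elim(2) by simp
    have c: "0 < 24 / L.\<alpha> * sqrt L.vA" using L.\<alpha>_pos L.const_pos by simp
    have lam: "lasso_lambda C0 (D t) * sqrt (?n t) = C0 * ln (?p t)" "lasso_lambda C0 (D t) > 0"
      using elim(2) c C0 \<open>ln (?p t) > 0\<close> by (simp_all add: lasso_lambda_def)
    have "4 * x t * sqrt L.vA = 24 / L.\<alpha> * sqrt L.vA * ln (?p t)" by simp
    also have "\<dots> \<le> lasso_lambda C0 (D t) * sqrt (?n t)"
      unfolding lam(1) using \<open>ln (?p t) > 0\<close> by (intro mult_right_mono C0) auto
    finally have l: "4 * x t * sqrt L.vA \<le> lasso_lambda C0 (D t) * sqrt (?n t)" .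
    show ?case
      by (rule holds_except_mono[OF N.estimation_errors[OF elim(1) \<delta>(1) H(2) fits(2,1,3) lam(2) l]])
        (use elim(3) \<delta>(2) in auto)
  qed
qed


lemma power_bounds:
  assumes C0: "24 / L.\<alpha> * sqrt L.vA \<le> C0"
    and I: "signal_strength_I \<gamma> D" and II: "signal_strength_II q C2 D"
    and q: "0 < q" and \<gamma>: "0 < \<gamma>" "\<gamma> \<le> 1"
    and fits: "\<And>t. lasso_fit C0 (D t) (bhat t)" "\<And>t. c_hat_fit (D t) (Chat t)"
      "\<And>t. aug_fit C0 e (D t) (theta_hat m h (D t) (Chat t)) (baug t)"
  shows "\<exists>\<delta>. \<delta> \<longlonglongrightarrow> 0 \<and> (\<forall>t. lasso_power (D t) (bhat t) \<ge> \<gamma> - \<delta> t)"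
    and "a \<in> {1,2} \<Longrightarrow> \<exists>\<delta>. \<delta> \<longlonglongrightarrow> 0 \<and> (\<forall>t. ipad_power a q (D t) (baug t) \<ge> \<gamma> - \<delta> t)"
proof -
  let ?n = "\<lambda>t. real (nobs (D t))" and ?p = "\<lambda>t. real (nvar (D t))" and ?s = "\<lambda>t. real (sparsity (D t))"
  define l where "l t = ln (?p t) / sqrt (?n t)" for t
  from I obtain b where b: "filterlim b at_top sequentially"
    "\<And>t A. A \<subseteq> signals (D t) \<Longrightarrow> real (card A) / ?s t > 1 - \<gamma> \<Longrightarrow>
       (\<Sum>j\<in>A. \<bar>coef (D t) j\<bar>) > b t * ?s t * ln (?p t) / sqrt (?n t)"
    unfolding signal_strength_I_def by blast
  from II obtain u where u: "filterlim u at_top sequentially"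
    "\<And>t. real (card {j \<in> {1..nvar (D t)}. \<bar>coef (D t) j\<bar> \<ge> u t * (sqrt (?s t / ?n t) * ln (?p t))}) \<ge> C2 * ?s t"
    and C2: "\<And>t. 2 / (q * ?s t) < C2"
    unfolding signal_strength_II_def by blast
  have "0 < 2 / (q * ?s 0)" using q s_pos[of 0] by simp
  then have C2_pos: "C2 > 0" using C2[of 0] by linarith
  define K1 where "K1 = 48 * C0 / L.\<sigma>2"
  \<comment> \<open>Chosen so that at t0 = K2 l, with l = ln p / sqrt n, the count e1 / t0 = K1 s /
    K2 is exactly q C2 s / 2.\<close>
  define K2 where "K2 = 2 * K1 / (q * C2)"
  have "0 < 24 / L.\<alpha> * sqrt L.vA" using L.\<alpha>_pos L.const_pos by simp
  then have C0_pos: "C0 > 0" using C0 by linarith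
  then have K: "K1 > 0" "K2 > 0" using L.\<sigma>2_pos q C2_pos by (simp_all add: K1_def K2_def)
  have lam: "48 * lasso_lambda C0 (D t) * ?s t / L.\<sigma>2 = K1 * ?s t * l t" for t
    by (simp add: lasso_lambda_def K1_def l_def mult_ac)
  define e2 where "e2 t = 12 * C0 / L.\<sigma>2 * sqrt (?s t) * l t" for t
  have e2: "(12 * lasso_lambda C0 (D t) / L.\<sigma>2)\<^sup>2 * ?s t = (e2 t)\<^sup>2" for t
    by (simp add: lasso_lambda_def l_def e2_def power_mult_distrib power_divide mult_ac)
  define ok where "ok t \<omega> \<longleftrightarrow>
      (\<Sum>j=1..nvar (D t). \<bar>bhat t \<omega> j - coef (D t) j\<bar>) \<le> K1 * ?s t * l t \<and>
      (\<Sum>j=1..2*nvar (D t). \<bar>baug t \<omega> j - (if j \<le> nvar (D t) then coef (D t) j else 0)\<bar>) \<le> K1 * ?s t * l t \<and>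
      (\<Sum>j=1..2*nvar (D t). (baug t \<omega> j - (if j \<le> nvar (D t) then coef (D t) j else 0))\<^sup>2) \<le> (e2 t)\<^sup>2" for t \<omega>
  have ok: "\<forall>\<^sub>F t in sequentially. holds_except (Pr (D t)) \<epsilon> (ok t)" if "\<epsilon> > 0" for \<epsilon>
    using eventually_estimation_errors[OF C0 that fits] unfolding lam e2 ok_def .
  \<comment> \<open>(K1 + K2) s l bounds the mass of the missed signals; with s \<ge> 1, the second
    level keeps every strong signal above t0 plus twice the coordinate error
    \<open>e2\<close>.\<close>
  have bev: "\<forall>\<^sub>F t in sequentially. K1 + K2 \<le> b t" and uev: "\<forall>\<^sub>F t in sequentially. K2 + 24 * C0 / L.\<sigma>2 \<le> u t"
    using b(1) u(1) unfolding filterlim_at_top by blast+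
  have frac: "\<gamma> \<le> real (card (T \<inter> signals (D t))) / ?s t"
    if "(\<Sum>j\<in>signals (D t) - T. \<bar>coef (D t) j\<bar>) \<le> (K1 + K2) * ?s t * l t" "K1 + K2 \<le> b t" "3 \<le> nobs (D t) \<and> 3 \<le> nvar (D t)" for t T
    unfolding sparsity_def
  proof (rule selected_fraction_ge)
    show "finite (signals (D t))" by (simp add: signals_def)
    show "card (signals (D t)) > 0" using s_pos[of t] by (simp add: sparsity_def)
    show "(\<Sum>j\<in>A. \<bar>coef (D t) j\<bar>) > b t * ?s t * l t"
      if "A \<subseteq> signals (D t)" "real (card A) / real (card (signals (D t))) > 1 - \<gamma>" for A
      using b(2)[OF that(1)] that(2) by (simp add: l_def sparsity_def)
    have "0 \<le> l t" using that(3) by (simp add: l_def)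
    then have "(K1 + K2) * (?s t * l t) \<le> b t * (?s t * l t)" using that(2) by (intro mult_right_mono) auto
    then show "(\<Sum>j\<in>signals (D t) - T. \<bar>coef (D t) j\<bar>) \<le> b t * ?s t * l t" using that(1) by (simp only: mult.assoc)
  qed
  have lasso: "\<gamma> \<le> real (card (support (nvar (D t)) (bhat t \<omega>) \<inter> signals (D t))) / ?s t"
    if "ok t \<omega>" "K1 + K2 \<le> b t" "3 \<le> nobs (D t) \<and> 3 \<le> nvar (D t)" for t \<omega>
  proof (rule frac[OF _ that(2,3)])
    have "0 \<le> l t" using that(3) by (simp add: l_def)
    then have "K1 * (?s t * l t) \<le> (K1 + K2) * (?s t * l t)" using K by (intro mult_right_mono) auto
    moreover have "(\<Sum>j\<in>signals (D t) - support (nvar (D t)) (bhat t \<omega>). \<bar>coef (D t) j\<bar>) \<le> K1 * ?s t * l t"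
      by (rule lasso_missed_le) (use that(1) in \<open>auto simp: signals_def ok_def\<close>)
    ultimately show "(\<Sum>j\<in>signals (D t) - support (nvar (D t)) (bhat t \<omega>). \<bar>coef (D t) j\<bar>) \<le> (K1 + K2) * ?s t * l t"
      by (simp only: mult.assoc)
  qed
  have ipad: "\<gamma> \<le> real (card (knockoff_select a q (nvar (D t)) (lcd (nvar (D t)) (baug t \<omega>)) \<inter> signals (D t))) / ?s t"
    if "ok t \<omega>" "K1 + K2 \<le> b t" "K2 + 24 * C0 / L.\<sigma>2 \<le> u t" "3 \<le> nobs (D t) \<and> 3 \<le> nvar (D t)" "a \<in> {1,2}" for t \<omega> a
  proof (rule frac[OF _ that(2,4)])
    have l: "0 < l t" using that(4) by (simp add: l_def)
    define S2 where "S2 = {j \<in> {1..nvar (D t)}. \<bar>coef (D t) j\<bar> \<ge> u t * (sqrt (?s t / ?n t) * ln (?p t))}"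
    have r: "sqrt (?s t / ?n t) * ln (?p t) = sqrt (?s t) * l t" by (simp add: l_def real_sqrt_divide)
    have "(\<Sum>j\<in>signals (D t) - knockoff_select a q (nvar (D t)) (lcd (nvar (D t)) (baug t \<omega>)). \<bar>coef (D t) j\<bar>)
        \<le> K1 * ?s t * l t + real (card (signals (D t))) * (K2 * l t)"
    proof (rule knockoff_missed_le[where ?e2.0 = "e2 t" and ?S2.0 = S2 and ?C2.0 = C2 and s = "?s t"])
      show "e2 t \<ge> 0" using l C0_pos L.\<sigma>2_pos by (simp add: e2_def)
      show "K2 * l t > 0" using K l by simp
      show "real (card S2) \<ge> C2 * ?s t" unfolding S2_def by (rule u(2))
      show "\<bar>coef (D t) j\<bar> \<ge> K2 * l t + 2 * e2 t" if j: "j \<in> S2" for j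
      proof -
        have "1 \<le> sqrt (?s t)" using s_ge_1[of t] by simp
        then have "K2 * 1 \<le> K2 * sqrt (?s t)" using K by (intro mult_left_mono) auto
        then have "K2 * l t \<le> K2 * sqrt (?s t) * l t" using l by (intro mult_right_mono) auto
        then have "K2 * l t + 2 * e2 t \<le> (K2 + 24 * C0 / L.\<sigma>2) * (sqrt (?s t) * l t)"
          by (simp add: e2_def distrib_right mult.assoc)
        also have "\<dots> \<le> u t * (sqrt (?s t) * l t)" using \<open>K2 + 24 * C0 / L.\<sigma>2 \<le> u t\<close> l by (intro mult_right_mono) auto
        also have "\<dots> \<le> \<bar>coef (D t) j\<bar>" using j unfolding S2_def r by simp
        finally show ?thesis .
      qed
      show "2 / (q * ?s t) < C2" by (rule C2)
      show "K1 * ?s t * l t / (K2 * l t) \<le> q * C2 * ?s t / 2" using l K q C2_pos by (simp add: K2_def)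
    qed (use that s_pos[of t] q in \<open>auto simp: signals_def ok_def S2_def\<close>)
    then show "(\<Sum>j\<in>signals (D t) - knockoff_select a q (nvar (D t)) (lcd (nvar (D t)) (baug t \<omega>)). \<bar>coef (D t) j\<bar>)
        \<le> (K1 + K2) * ?s t * l t"
      by (simp add: sparsity_def[symmetric] algebra_simps)
  qed
  show "\<exists>\<delta>. \<delta> \<longlonglongrightarrow> 0 \<and> (\<forall>t. lasso_power (D t) (bhat t) \<ge> \<gamma> - \<delta> t)"
  proof (rule tendsto_0_deficit)
    fix \<epsilon> :: real assume "\<epsilon> > 0"
    from ok[OF this] bev large show "\<forall>\<^sub>F t in sequentially. lasso_power (D t) (bhat t) \<ge> \<gamma> - \<epsilon>"
    proof eventually_elim
      case (elim t)
      interpret N: latent_model M C\<epsilon> Ce ce m G \<eta>0 h Q e "D t" by (rule model)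
      show ?case unfolding lasso_power_def
      proof (rule N.sel_power_ge[OF refl refl support_measurable holds_except_mono[OF elim(1) order.refl lasso[OF _ elim(2,3)]]])
        show "(\<lambda>\<omega>. bhat t \<omega> j) \<in> borel_measurable (Pr (D t))" if "j \<in> {1..nvar (D t)}" for j
          using fits(1)[of t] that by (simp add: lasso_fit_def)
      qed (use \<gamma> in auto)
    qed
  qed
  show "\<exists>\<delta>. \<delta> \<longlonglongrightarrow> 0 \<and> (\<forall>t. ipad_power a q (D t) (baug t) \<ge> \<gamma> - \<delta> t)" if a: "a \<in> {1,2}"
  proof (rule tendsto_0_deficit)
    fix \<epsilon> :: real assume "\<epsilon> > 0"
    from ok[OF this] bev uev large show "\<forall>\<^sub>F t in sequentially. ipad_power a q (D t) (baug t) \<ge> \<gamma> - \<epsilon>"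
    proof eventually_elim
      case (elim t)
      interpret N: latent_model M C\<epsilon> Ce ce m G \<eta>0 h Q e "D t" by (rule model)
      show ?case unfolding ipad_power_def
      proof (rule N.sel_power_ge[OF refl refl knockoff_select_measurable holds_except_mono[OF elim(1) order.refl ipad[OF _ elim(2-4) a]]])
        fix j assume "j \<in> {1..nvar (D t)}"
        then have "j \<in> {1..2 * nvar (D t)}" "nvar (D t) + j \<in> {1..2 * nvar (D t)}" by auto
        then have "(\<lambda>\<omega>. baug t \<omega> j) \<in> borel_measurable (Pr (D t))" "(\<lambda>\<omega>. baug t \<omega> (nvar (D t) + j)) \<in> borel_measurable (Pr (D t))"
          using fits(3)[of t] by (auto simp: aug_fit_def)
        then show "(\<lambda>\<omega>. lcd (nvar (D t)) (baug t \<omega>) j) \<in> borel_measurable (Pr (D t))"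
          unfolding lcd_def by measurable
      qed (use \<gamma> in auto)
    qed
  qed
qed

end

theorem theorem2:
  fixes M C\<epsilon> Ce ce c C \<nu> q \<gamma> C2 :: real
    and m :: nat
    and G :: "(nat \<Rightarrow> real) \<Rightarrow> real \<Rightarrow> real"
    and \<eta>0 :: "nat \<Rightarrow> real"
    and h :: "nat \<Rightarrow> (nat \<Rightarrow> real) \<Rightarrow> real"
    and Q :: "'b measure"
    and e :: "(nat \<Rightarrow> real) \<Rightarrow> 'b \<Rightarrow> real"
  assumes "M > 1" "C\<epsilon> > 0" "Ce > 0" "ce > 0" "c > 0" "C > 0" "\<nu> > 0"
    and "0 < q" "q < 1" and "0 < \<gamma>" "\<gamma> \<le> 1" and "m \<ge> 1"
    and "error_family Ce m G \<eta>0 h Q e"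
  shows "\<exists>Cmin>0. \<forall>C0\<ge>Cmin.
    \<forall>(D :: nat \<Rightarrow> ('w, 'b, 'r::finite) factor_model) (k :: nat \<Rightarrow> nat) bhat Chat baug.
      (\<forall>t. prob_space (Pr (D t)) \<and> independent_sources Q (D t) \<and>
           noise_condition C\<epsilon> (D t) \<and> factor_condition M (D t) \<and> loading_condition M (D t) \<and>
           error_condition M ce m G \<eta>0 h Q e (D t) \<and> eigenvalue_condition (D t) \<and>
           tail_constants c C (D t)) \<longrightarrow>
      filterlim (\<lambda>t. min (nobs (D t)) (nvar (D t))) at_top sequentially \<longrightarrow>
      (\<lambda>t. real (sparsity (D t)) / real (nobs (D t))) \<longlonglongrightarrow> 0 \<longrightarrow>
      signal_strength_I \<gamma> D \<longrightarrow>
      signal_strength_II q C2 D \<longrightarrow>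
      (\<forall>t. 2 * sparsity (D t) \<le> k t \<and> k t \<le> min (nobs (D t)) (nvar (D t))) \<longrightarrow>
      (\<forall>t. cnp (D t) \<le> c / sqrt ((real CARD('r))\<^sup>2 * M\<^sup>2 * C * (\<nu> + 2))) \<longrightarrow>
      (\<lambda>t. real (sparsity (D t)) * sqrt (real (k t)) * c_rate_log (nobs (D t)) (nvar (D t)))
        \<longlonglongrightarrow> 0 \<longrightarrow>
      (\<forall>t. lasso_fit C0 (D t) (bhat t) \<and> c_hat_fit (D t) (Chat t) \<and>
           aug_fit C0 e (D t) (theta_hat m h (D t) (Chat t)) (baug t) \<and>
           (AE \<omega> in Pr (D t).
              real (card (support (2 * nvar (D t)) (baug t \<omega>))) \<le> real (k t) / 2)) \<longrightarrow>
      (\<exists>\<delta>. \<delta> \<longlonglongrightarrow> 0 \<and> (\<forall>t. lasso_power (D t) (bhat t) \<ge> \<gamma> - \<delta> t)) \<and>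
      (\<forall>a\<in>{1, 2}.
         (\<exists>\<delta>. \<delta> \<longlonglongrightarrow> 0 \<and> (\<forall>t. ipad_power a q (D t) (baug t) \<ge> \<gamma> - \<delta> t)) \<and>
         (\<gamma> = 1 \<longrightarrow>
            (\<exists>\<delta>. \<delta> \<longlonglongrightarrow> 0 \<and>
               (\<forall>t. ipad_power a q (D t) (baug t) \<ge> lasso_power (D t) (bhat t) - \<delta> t))))"
proof -
  \<comment> \<open>The constants are taken from the locale without an interpretation, as no model
    is at hand yet; the type argument is there because \<open>vA\<close> involves the number of
    factors.\<close>
  define Cmin where "Cmin = 24 / latent_model.\<alpha> C\<epsilon> Ce ce * sqrt (latent_model.vA TYPE('r) M C\<epsilon> Ce ce \<eta>0 Q e)"
  show ?thesis
  \<comment> \<open>The maximum with 1 makes the witness positive before any model is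
    available.\<close>
  proof (intro exI[of _ "max 1 Cmin"] conjI allI impI)
    fix C0 and D :: "nat \<Rightarrow> ('w, 'b, 'r) factor_model" and k bhat Chat baug
    assume C0: "max 1 Cmin \<le> C0"
      and model: "\<forall>t. prob_space (Pr (D t)) \<and> independent_sources Q (D t) \<and>
           noise_condition C\<epsilon> (D t) \<and> factor_condition M (D t) \<and> loading_condition M (D t) \<and>
           error_condition M ce m G \<eta>0 h Q e (D t) \<and> eigenvalue_condition (D t) \<and>
           tail_constants c C (D t)"
      and lim: "filterlim (\<lambda>t. min (nobs (D t)) (nvar (D t))) at_top sequentially"
      and I: "signal_strength_I \<gamma> D" and II: "signal_strength_II q C2 D"
      and k: "\<forall>t. 2 * sparsity (D t) \<le> k t \<and> k t \<le> min (nobs (D t)) (nvar (D t))"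
      and rate: "(\<lambda>t. real (sparsity (D t)) * sqrt (real (k t)) * c_rate_log (nobs (D t)) (nvar (D t))) \<longlonglongrightarrow> 0"
      and fits: "\<forall>t. lasso_fit C0 (D t) (bhat t) \<and> c_hat_fit (D t) (Chat t) \<and>
           aug_fit C0 e (D t) (theta_hat m h (D t) (Chat t)) (baug t) \<and>
           (AE \<omega> in Pr (D t). real (card (support (2 * nvar (D t)) (baug t \<omega>))) \<le> real (k t) / 2)"
    have s_pos: "sparsity (D t) > 0" for t using II unfolding signal_strength_II_def by blast
    interpret model_sequence M C\<epsilon> Ce ce m G \<eta>0 h Q e D k
    proof (rule model_sequence.intro[OF _ lim s_pos _ rate])
      show "latent_model M C\<epsilon> Ce ce m G \<eta>0 h Q e (D t)" for t
        by (rule latent_model.intro) (use assms model in blast)+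
      show "2 * sparsity (D t) \<le> k t" for t using k by blast
    qed
    have "24 / L.\<alpha> * sqrt L.vA \<le> C0" using C0 unfolding Cmin_def by simp
    note bounds = power_bounds[OF this I II \<open>0 < q\<close> \<open>0 < \<gamma>\<close> \<open>\<gamma> \<le> 1\<close>, of bhat Chat baug]
    show "\<exists>\<delta>. \<delta> \<longlonglongrightarrow> 0 \<and> (\<forall>t. lasso_power (D t) (bhat t) \<ge> \<gamma> - \<delta> t)"
      by (rule bounds(1)) (use fits in auto)
    show "\<forall>a\<in>{1, 2}.
         (\<exists>\<delta>. \<delta> \<longlonglongrightarrow> 0 \<and> (\<forall>t. ipad_power a q (D t) (baug t) \<ge> \<gamma> - \<delta> t)) \<and>
         (\<gamma> = 1 \<longrightarrow>
            (\<exists>\<delta>. \<delta> \<longlonglongrightarrow> 0 \<and>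
               (\<forall>t. ipad_power a q (D t) (baug t) \<ge> lasso_power (D t) (bhat t) - \<delta> t)))"
    proof (intro ballI conjI impI)
      fix a :: nat assume a: "a \<in> {1, 2}"
      show ipad: "\<exists>\<delta>. \<delta> \<longlonglongrightarrow> 0 \<and> (\<forall>t. ipad_power a q (D t) (baug t) \<ge> \<gamma> - \<delta> t)"
        by (rule bounds(2)) (use fits a in auto)
      assume "\<gamma> = 1"
      with ipad obtain \<delta> where \<delta>: "\<delta> \<longlonglongrightarrow> 0" "\<And>t. ipad_power a q (D t) (baug t) \<ge> 1 - \<delta> t" by auto
      \<comment> \<open>A power never exceeds 1, so for \<gamma> = 1 the lower bound for IPAD is
        already a comparison with the Lasso.\<close>
      have "lasso_power (D t) (bhat t) \<le> 1" for t
        unfolding lasso_power_def by (rule sel_power_le_1[OF latent_model.prob_P[OF model]])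
      then have "ipad_power a q (D t) (baug t) \<ge> lasso_power (D t) (bhat t) - \<delta> t" for t
        using \<delta>(2)[of t] by (smt (verit))
      with \<delta>(1) show "\<exists>\<delta>. \<delta> \<longlonglongrightarrow> 0 \<and>
          (\<forall>t. ipad_power a q (D t) (baug t) \<ge> lasso_power (D t) (bhat t) - \<delta> t)" by blast
    qed
  qed (simp add: less_max_iff_disj)
qed

end
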